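(* Let $d\in\{2,3\}$, let $\Omega\subset\mathbb{R}^d$ be a bounded domain that is convex or has $C^2$ boundary, let $\Gamma=\partial\Omega$, $\nu>0$ and $T>0$. Let $f\in L^2(0,T;L^2(\Omega))$ and $u_0\in H^1_0(\Omega)$, and let $u$ be the strong solution of $$\frac{\partial u}{\partial t}-\nu\Delta u+\sum_{i=1}^d u\frac{\partial u}{\partial x_i}=f\ \text{ in }\Omega\times(0,T),\qquad u=0\ \text{ on }\Gamma\times(0,T),\qquad u(\cdot,0)=u_0\ \text{ in }\Omega.$$ Then for a given $\varepsilon>0$ there exists (for a suitable $N$) $u_N\in\mathcal{F}_N$ such that $$\bigg\|\frac{\partial u_N}{\partial t}-\nu\Delta u_N+\sum_{i=1}^d u_N\frac{\partial u_N}{\partial x_i}-f\bigg\|_{L^2(0,T;L^2(\Omega))}^2+\big\|u_N|_\Gamma\big\|_{L^2(0,T;H^{1/2}(\Gamma))}^2+\|u(\cdot,0)-u_N(\cdot,0)\|^2\le C\varepsilon^2,$$ for some $C=C(\nu,T,\|\nabla u_0\|,\|f\|_{L^2(0,T;L^2(\Omega))},C_a,C_s)>0$.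
   Context: $\|\cdot\|$ is the $L^2(\Omega)$ norm; $H^{1/2}(\Gamma)$ is the trace space of $H^1(\Omega)$. $C_a$ and $C_s$ are constants depending on $\Omega$, from Agmon's inequality ($\|h\|_{L^\infty(\Omega)}\le C_a\|h\|_{H^{s_1}(\Omega)}^\theta\|h\|_{H^{s_2}(\Omega)}^{1-\theta}$ with $s_1<\frac d2<s_2$, $\frac d2=\theta s_1+(1-\theta)s_2$, $0<\theta<1$) and from the Sobolev embedding $H^1(\Omega)\hookrightarrow L^q(\Omega)$ respectively. A strong solution is $u\in C([0,T];H^1_0(\Omega))\cap L^2(0,T;H^2(\Omega))$ with $\partial_tu\in L^2(0,T;L^2(\Omega))$ satisfying the equation in $L^2(\Omega)$ for a.e. $t\in[0,T]$ and the initial condition. $\mathcal{F}_N$ is the class of functions of $(x,t)$ on $\Omega\times(0,T)$ representable by a deep neural network of complexity (size) $N$, i.e. compositions of layers $y\mapsto\sigma(Wy+b)$ with weight matrices $W$, bias vectors $b$ and a smooth non-polynomial activation $\sigma\in C^\infty(\mathbb{R})$ applied componentwise (e.g. the sigmoid or $\tanh$), followed by an affine scalar output layer; $N$ may depend on $\varepsilon$. Constants may also depend on the domain. *)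

theory Defs
  imports "HOL-Analysis.Analysis" "HOL-Computational_Algebra.Polynomial"
begin

section \<open>Classical derivatives and smoothness\<close>

definition dirder :: "'a::euclidean_space \<Rightarrow> ('a \<Rightarrow> real) \<Rightarrow> 'a \<Rightarrow> real" where
  "dirder v f x = frechet_derivative f (at x) v"

primrec Ck :: "nat \<Rightarrow> ('a::euclidean_space \<Rightarrow> real) \<Rightarrow> bool" where
  "Ck 0 f \<longleftrightarrow> continuous_on UNIV f"
| "Ck (Suc k) f \<longleftrightarrow> (\<forall>x. f differentiable (at x)) \<and> (\<forall>v. Ck k (dirder v f))"

definition smooth :: "('a::euclidean_space \<Rightarrow> real) \<Rightarrow> bool" where
  "smooth f \<longleftrightarrow> (\<forall>k. Ck k f)"

definition test_function :: "'a::euclidean_space set \<Rightarrow> ('a \<Rightarrow> real) \<Rightarrow> bool" where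
  "test_function \<Omega> \<phi> \<longleftrightarrow>
     smooth \<phi> \<and> (\<exists>K. compact K \<and> K \<subseteq> \<Omega> \<and> (\<forall>x. x \<notin> K \<longrightarrow> \<phi> x = 0))"

text \<open>
  Near each boundary point, after a rigid motion, the set is the region strictly above the graph
  of a twice continuously differentiable function.  The unit vector \<open>e\<close> is the vertical direction
  and \<open>\<gamma>\<close> is only evaluated on the hyperplane orthogonal to \<open>e\<close>.
\<close>

definition C2_boundary :: "'a::euclidean_space set \<Rightarrow> bool" where
  "C2_boundary \<Omega> \<longleftrightarrow>
     (\<forall>p \<in> frontier \<Omega>. \<exists>r>0. \<exists>e. norm e = 1 \<and>
        (\<exists>\<gamma>. Ck 2 \<gamma> \<and>
           \<Omega> \<inter> ball p r = {x \<in> ball p r. \<gamma> (x - (x \<bullet> e) *\<^sub>R e) < x \<bullet> e}))"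


section \<open>Lebesgue and Sobolev spaces\<close>

text \<open>
  Elements of these spaces are represented by functions, not by classes of functions modulo null
  sets; the notions of this section are invariant under changes on null sets.
\<close>

definition L2sq :: "'a measure \<Rightarrow> ('a \<Rightarrow> real) \<Rightarrow> ennreal" where
  "L2sq M f = (\<integral>\<^sup>+ x. ennreal ((f x)\<^sup>2) \<partial>M)"

definition L2 :: "'a measure \<Rightarrow> ('a \<Rightarrow> real) set" where
  "L2 M = {f \<in> borel_measurable M. L2sq M f < \<infinity>}"

definition L2norm :: "'a measure \<Rightarrow> ('a \<Rightarrow> real) \<Rightarrow> real" where
  "L2norm M f = sqrt (enn2real (L2sq M f))"

definition has_wderiv ::
  "'a::euclidean_space set \<Rightarrow> 'a \<Rightarrow> ('a \<Rightarrow> real) \<Rightarrow> ('a \<Rightarrow> real) \<Rightarrow> bool" where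
  "has_wderiv \<Omega> e v g \<longleftrightarrow>
     v \<in> L2 (lebesgue_on \<Omega>) \<and> g \<in> L2 (lebesgue_on \<Omega>) \<and>
     (\<forall>\<phi>. test_function \<Omega> \<phi> \<longrightarrow>
        (\<integral>x. v x * dirder e \<phi> x \<partial>lebesgue_on \<Omega>) = - (\<integral>x. g x * \<phi> x \<partial>lebesgue_on \<Omega>))"

definition wderiv :: "'a::euclidean_space set \<Rightarrow> 'a \<Rightarrow> ('a \<Rightarrow> real) \<Rightarrow> 'a \<Rightarrow> real" where
  "wderiv \<Omega> e v = (SOME g. has_wderiv \<Omega> e v g)"

primrec H :: "nat \<Rightarrow> 'a::euclidean_space set \<Rightarrow> ('a \<Rightarrow> real) set" where
  "H 0 \<Omega> = L2 (lebesgue_on \<Omega>)"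
| "H (Suc k) \<Omega> = {v \<in> L2 (lebesgue_on \<Omega>). \<forall>e\<in>Basis. \<exists>g \<in> H k \<Omega>. has_wderiv \<Omega> e v g}"

definition grad_norm :: "'a::euclidean_space set \<Rightarrow> ('a \<Rightarrow> real) \<Rightarrow> real" where
  "grad_norm \<Omega> v = sqrt (\<Sum>e\<in>Basis. (L2norm (lebesgue_on \<Omega>) (wderiv \<Omega> e v))\<^sup>2)"

definition H1norm :: "'a::euclidean_space set \<Rightarrow> ('a \<Rightarrow> real) \<Rightarrow> real" where
  "H1norm \<Omega> v = sqrt ((L2norm (lebesgue_on \<Omega>) v)\<^sup>2 + (grad_norm \<Omega> v)\<^sup>2)"

definition H10 :: "'a::euclidean_space set \<Rightarrow> ('a \<Rightarrow> real) set" where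
  "H10 \<Omega> = {v \<in> H 1 \<Omega>. \<exists>\<phi>. (\<forall>k::nat. test_function \<Omega> (\<phi> k)) \<and>
     (\<lambda>k. H1norm \<Omega> (\<lambda>x. v x - \<phi> k x)) \<longlonglongrightarrow> 0}"


section \<open>Traces\<close>

text \<open>
  Surface measure is the Hausdorff measure of codimension one, normalised by the volume of the
  unit ball in that dimension.  The \<open>m\<close>-dimensional measure is intended for \<open>m \<ge> 1\<close> only: empty
  sets in a cover have diameter \<open>0\<close>, hence contribute nothing when \<open>m \<ge> 1\<close>.
\<close>

definition hausdorff_content :: "nat \<Rightarrow> real \<Rightarrow> 'a::euclidean_space set \<Rightarrow> ennreal" where
  "hausdorff_content m \<delta> A =
     (INF E \<in> {E :: nat \<Rightarrow> 'a set. A \<subseteq> (\<Union>n. E n) \<and> (\<forall>n. bounded (E n) \<and> diameter (E n) \<le> \<delta>)}.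
        (\<Sum>n. ennreal (unit_ball_vol (real m) * (diameter (E n) / 2) ^ m)))"

definition hausdorff_measure :: "nat \<Rightarrow> 'a::euclidean_space measure" where
  "hausdorff_measure m =
     measure_of UNIV (sets borel) (\<lambda>A. SUP \<delta> \<in> {0<..}. hausdorff_content m \<delta> A)"

definition surface_measure :: "'a::euclidean_space set \<Rightarrow> 'a measure" where
  "surface_measure \<Omega> = restrict_space (hausdorff_measure (DIM('a) - 1)) (frontier \<Omega>)"

text \<open>
  The trace operator is the continuous extension to \<open>H 1 \<Omega>\<close> of the restriction to the boundary of
  functions smooth up to the boundary.  Only the values of \<open>g\<close> on the boundary matter; its square
  integrability follows from the approximation.
\<close>

definition has_trace ::
  "'a::euclidean_space set \<Rightarrow> ('a \<Rightarrow> real) \<Rightarrow> ('a \<Rightarrow> real) \<Rightarrow> bool" where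
  "has_trace \<Omega> v g \<longleftrightarrow>
     v \<in> H 1 \<Omega> \<and> g \<in> borel_measurable (surface_measure \<Omega>) \<and>
     (\<exists>\<phi>. (\<forall>k::nat. smooth (\<phi> k)) \<and>
        (\<lambda>k. H1norm \<Omega> (\<lambda>x. v x - \<phi> k x)) \<longlonglongrightarrow> 0 \<and>
        (\<lambda>k. L2sq (surface_measure \<Omega>) (\<lambda>x. \<phi> k x - g x)) \<longlonglongrightarrow> 0)"

text \<open>
  Quotient norm of the trace space of \<open>H 1 \<Omega>\<close>; it is \<open>\<infinity>\<close> if \<open>g\<close> is not a trace.
\<close>

definition Hhalf_norm :: "'a::euclidean_space set \<Rightarrow> ('a \<Rightarrow> real) \<Rightarrow> ennreal" where
  "Hhalf_norm \<Omega> g = (INF v \<in> {v. has_trace \<Omega> v g}. ennreal (H1norm \<Omega> v))"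


section \<open>Functions of space and time\<close>

text \<open>
  Functions of time with values in \<open>L\<^sup>2\<close> are identified with functions of \<open>(x, t)\<close> on the
  space-time cylinder, so that \<open>L\<^sup>2(0,T;L\<^sup>2(\<Omega>))\<close> is \<open>L\<^sup>2\<close> of the cylinder.
\<close>

definition cylinder :: "'a::euclidean_space set \<Rightarrow> real \<Rightarrow> ('a \<times> real) set" where
  "cylinder \<Omega> T = \<Omega> \<times> {0<..<T}"

definition slice :: "('a \<times> real \<Rightarrow> real) \<Rightarrow> real \<Rightarrow> 'a \<Rightarrow> real" where
  "slice u t = (\<lambda>x. u (x, t))"

text \<open>
  \<open>L2H k \<Omega> T\<close> is \<open>L\<^sup>2(0,T;H\<^sup>k(\<Omega>))\<close>.  As \<open>v \<mapsto> (\<partial>\<^sup>\<alpha>v)\<^sub>\<alpha>\<close> embeds \<open>H\<^sup>k(\<Omega>)\<close> isometrically into a finite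
  power of \<open>L\<^sup>2(\<Omega>)\<close>, a function is in this space iff its spatial weak derivatives at almost
  every time, up to order \<open>k\<close>, are the slices of square integrable functions on the cylinder.
\<close>

primrec L2H :: "nat \<Rightarrow> 'a::euclidean_space set \<Rightarrow> real \<Rightarrow> ('a \<times> real \<Rightarrow> real) set" where
  "L2H 0 \<Omega> T = L2 (lebesgue_on (cylinder \<Omega> T))"
| "L2H (Suc k) \<Omega> T = {u \<in> L2 (lebesgue_on (cylinder \<Omega> T)). \<forall>e\<in>Basis. \<exists>g \<in> L2H k \<Omega> T.
     AE t in lebesgue_on {0<..<T}. has_wderiv \<Omega> e (slice u t) (slice g t)}"

definition C_H10 :: "'a::euclidean_space set \<Rightarrow> real \<Rightarrow> ('a \<times> real \<Rightarrow> real) set" where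
  "C_H10 \<Omega> T = {u. (\<forall>t\<in>{0..T}. slice u t \<in> H10 \<Omega>) \<and>
     (\<forall>t\<in>{0..T}. ((\<lambda>s. H1norm \<Omega> (\<lambda>x. u (x, s) - u (x, t))) \<longlongrightarrow> 0) (at t within {0..T}))}"

text \<open>
  The time derivative \<open>u'\<close> is the weak derivative on the cylinder in the direction \<open>(0, 1)\<close>;
  \<open>has_wderiv\<close> includes its square integrability.
\<close>

definition strong_solution ::
  "'a::euclidean_space set \<Rightarrow> real \<Rightarrow> real \<Rightarrow> ('a \<times> real \<Rightarrow> real) \<Rightarrow> ('a \<Rightarrow> real) \<Rightarrow>
   ('a \<times> real \<Rightarrow> real) \<Rightarrow> bool" where
  "strong_solution \<Omega> T \<nu> f u0 u \<longleftrightarrow>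
     u \<in> C_H10 \<Omega> T \<and> u \<in> L2H 2 \<Omega> T \<and>
     (\<exists>u'. has_wderiv (cylinder \<Omega> T) (0, 1) u u' \<and>
        (AE t in lebesgue_on {0<..<T}. AE x in lebesgue_on \<Omega>.
           u' (x, t)
             - \<nu> * (\<Sum>e\<in>Basis. wderiv \<Omega> e (wderiv \<Omega> e (slice u t)) x)
             + (\<Sum>e\<in>Basis. u (x, t) * wderiv \<Omega> e (slice u t) x)
           = f (x, t))) \<and>
     (AE x in lebesgue_on \<Omega>. u (x, 0) = u0 x)"

definition burgers_op ::
  "real \<Rightarrow> ('a::euclidean_space \<times> real \<Rightarrow> real) \<Rightarrow> 'a \<times> real \<Rightarrow> real" where
  "burgers_op \<nu> w z =
     dirder (0, 1) w z
       - \<nu> * (\<Sum>e\<in>Basis. dirder (e, 0) (dirder (e, 0) w) z)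
       + (\<Sum>e\<in>Basis. w z * dirder (e, 0) w z)"


section \<open>Neural networks\<close>

text \<open>
  A layer is a list of neurons, each consisting of a row of the weight matrix and the corresponding
  entry of the bias vector.  The rows of the first weight matrix are elements of the input space,
  those of the later ones are lists.  A network consists of the first hidden layer, the further
  hidden layers, and the scalar affine output layer.
\<close>

type_synonym 'a network = "('a \<times> real) list \<times> (real list \<times> real) list list \<times> (real list \<times> real)"

definition affine_list :: "real list \<times> real \<Rightarrow> real list \<Rightarrow> real" where
  "affine_list n y = (\<Sum>i<length y. fst n ! i * y ! i) + snd n"

fun net_eval :: "(real \<Rightarrow> real) \<Rightarrow> 'a::euclidean_space network \<Rightarrow> 'a \<Rightarrow> real" where
  "net_eval \<sigma> (L, Ls, out) z =
     affine_list out
       (fold (\<lambda>l y. map (\<lambda>n. \<sigma> (affine_list n y)) l) Ls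
          (map (\<lambda>(w, b). \<sigma> (w \<bullet> z + b)) L))"

fun compatible :: "nat \<Rightarrow> (real list \<times> real) list list \<Rightarrow> real list \<times> real \<Rightarrow> bool" where
  "compatible m [] out \<longleftrightarrow> length (fst out) = m"
| "compatible m (l # ls) out \<longleftrightarrow> (\<forall>n\<in>set l. length (fst n) = m) \<and> compatible (length l) ls out"

fun net_wf :: "'a network \<Rightarrow> bool" where
  "net_wf (L, Ls, out) \<longleftrightarrow> compatible (length L) Ls out"

text \<open>The size is the total number of entries of the weight matrices and bias vectors.\<close>

fun net_size :: "'a::euclidean_space network \<Rightarrow> nat" where
  "net_size (L, Ls, out) =
     length L * (DIM('a) + 1)
       + (\<Sum>l\<leftarrow>Ls. \<Sum>n\<leftarrow>l. length (fst n) + 1)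
       + (length (fst out) + 1)"

definition network_class :: "(real \<Rightarrow> real) \<Rightarrow> nat \<Rightarrow> ('a::euclidean_space \<Rightarrow> real) set" where
  "network_class \<sigma> N = {net_eval \<sigma> n | n. net_wf n \<and> net_size n = N}"

definition polynomial_fun :: "(real \<Rightarrow> real) \<Rightarrow> bool" where
  "polynomial_fun \<sigma> \<longleftrightarrow> (\<exists>p :: real poly. \<forall>x. \<sigma> x = poly p x)"

end

theory Submission
  imports Defs
begin

text \<open>
  The bound holds with \<open>C = 1\<close>, because the squared residual, trace and initial errors of \<open>w\<close> are
  continuous at \<open>u\<close> along a suitable sequence of smooth \<open>w\<close>.  A convex or \<open>C\<^sup>2\<close> domain admits at each
  point a cone pointing into it; mollifying with kernels supported in these cones and patching with
  cutoffs gives compactly supported smooth functions that converge to \<open>u\<close> together with all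
  derivatives occurring in the equation, and whose \<open>H\<^sup>1(\<Omega>)\<close> norms are bounded uniformly in time.
  Averaging Taylor's formula over the cones bounds the supremum by the \<open>H\<^sup>2\<close> norm (as \<open>d \<le> 3\<close>), so the
  nonlinear terms converge as well.  The trace error of \<open>w\<close> is at most the \<open>H\<^sup>1\<close> norm of \<open>w - u\<close> at each
  time, since \<open>u\<close> has zero trace.  Finally, test functions are \<open>C\<^sup>2\<close> limits of polynomials by
  convolution with Landau kernels, and polynomials are \<open>C\<^sup>2\<close> limits of shallow networks, by taking
  difference quotients of \<open>\<sigma>(c \<bullet> z + b)\<close> in \<open>c\<close> at a \<open>b\<close> where the relevant derivative of \<open>\<sigma>\<close> does
  not vanish.
\<close>

section \<open>Smooth functions\<close>

text \<open>The statement asks for no rate: the size of the network may depend on all the data, so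
  density in the right topologies suffices. The obstacle is the quadratic term, since closeness in
  the mean square on the cylinder does not control a product. Of its two factors, the function is
  measured by its supremum over \<Omega>, square integrable in time, and the gradient by its mean
  square over \<Omega>, uniformly in time. Convergence on the cylinder does not imply the second
  kind of control, so a bound on every time slice accompanies the approximations through
  mollification and patching; its source is the continuity of u in time with values in
  \<open>H10\<close>. Space and time are mollified together, with the times 0 and T treated as
  boundary points of the cylinder, and cones replace an extension operator. The square integrable
  time derivative then carries the convergence over to the initial face. The network comes last:
  once a smooth approximation is fixed, it is bounded with its derivatives, and a perturbation small
  in C2 on a bounded set changes every term by little.\<close>

lemma dirder_eqI: "(f has_derivative f') (at x) \<Longrightarrow> dirder v f x = f' v"
  unfolding dirder_def by (metis frechet_derivative_at)

lemma has_derivative_dirder: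
  "f differentiable (at x) \<Longrightarrow> (f has_derivative (\<lambda>v. dirder v f x)) (at x)"
  unfolding dirder_def by (simp add: frechet_derivative_works)

lemma dirder_linear: "f differentiable (at x) \<Longrightarrow> linear (\<lambda>v. dirder v f x)"
  using has_derivative_dirder has_derivative_linear by blast

lemma dirder_Basis_sum:
  fixes f :: "'a::euclidean_space \<Rightarrow> real"
  assumes "f differentiable (at x)"
  shows "dirder v f x = (\<Sum>e\<in>Basis. (v \<bullet> e) * dirder e f x)"
proof -
  interpret linear "\<lambda>v. dirder v f x" by (rule dirder_linear[OF assms])
  have "dirder v f x = dirder (\<Sum>e\<in>Basis. (v \<bullet> e) *\<^sub>R e) f x" by (simp add: euclidean_representation)
  also have "\<dots> = (\<Sum>e\<in>Basis. (v \<bullet> e) * dirder e f x)"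
    by (simp add: sum scale)
  finally show ?thesis .
qed

lemma Ck_imp_continuous: "Ck k f \<Longrightarrow> continuous_on UNIV f"
  by (cases k)
    (auto intro!: differentiable_imp_continuous_on simp: differentiable_on_def differentiable_at_withinI)

lemma Ck_SucD: "Ck (Suc k) f \<Longrightarrow> Ck k f"
proof (induction k arbitrary: f)
  case 0
  then show ?case using Ck_imp_continuous by fastforce
next
  case (Suc k)
  then show ?case by (metis Ck.simps(2))
qed

lemma Ck_differentiable: "Ck (Suc k) f \<Longrightarrow> f differentiable (at x)" by simp

lemma Ck_dirder: "Ck (Suc k) f \<Longrightarrow> Ck k (dirder v f)" by simp

lemma smooth_differentiable: "smooth f \<Longrightarrow> f differentiable (at x)"
  unfolding smooth_def using Ck_differentiable by blast

lemma smooth_dirder: "smooth f \<Longrightarrow> smooth (dirder v f)"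
  unfolding smooth_def using Ck_dirder by blast

lemma smooth_continuous: "smooth f \<Longrightarrow> continuous_on S f"
  unfolding smooth_def using Ck_imp_continuous continuous_on_subset by blast

lemma smooth_has_derivative: "smooth f \<Longrightarrow> (f has_derivative (\<lambda>v. dirder v f x)) (at x)"
  by (simp add: has_derivative_dirder smooth_differentiable)

text \<open>Smooth functions form the greatest family of differentiable functions closed under
  directional derivatives. This suits convolutions with a fixed second factor, whose derivatives are
  again such convolutions.\<close>

lemma smooth_coinduct:
  assumes "\<And>f. f \<in> S \<Longrightarrow> (\<forall>x. f differentiable (at x)) \<and> (\<forall>v. dirder v f \<in> S)" and "f \<in> S"
  shows "smooth f"
  unfolding smooth_def
proof
  fix k show "Ck k f" using assms(2)
  proof (induction k arbitrary: f)
    case 0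
    then have "Ck 1 f \<longrightarrow> continuous_on UNIV f" using Ck_imp_continuous by blast
    moreover have "f differentiable_on UNIV"
      using assms(1)[OF 0] by (simp add: differentiable_on_def)
    ultimately show ?case by (simp add: differentiable_imp_continuous_on)
  next
    case (Suc k)
    then show ?case using assms(1)[OF Suc.prems] by simp
  qed
qed

section \<open>Calculus rules for directional derivatives\<close>

lemma dirder_const [simp]: "dirder v (\<lambda>x. c) = (\<lambda>x. 0)"
  by (rule ext, rule dirder_eqI) (rule has_derivative_const)

lemma dirder_add:
  "f differentiable (at x) \<Longrightarrow> g differentiable (at x) \<Longrightarrow>
    dirder v (\<lambda>x. f x + g x) x = dirder v f x + dirder v g x"
  by (rule dirder_eqI, rule has_derivative_add[OF has_derivative_dirder has_derivative_dirder])

lemma dirder_diff: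
  "f differentiable (at x) \<Longrightarrow> g differentiable (at x) \<Longrightarrow>
    dirder v (\<lambda>x. f x - g x) x = dirder v f x - dirder v g x"
  by (rule dirder_eqI, rule has_derivative_diff[OF has_derivative_dirder has_derivative_dirder])

lemma dirder_mult:
  "f differentiable (at x) \<Longrightarrow> g differentiable (at x) \<Longrightarrow>
    dirder v (\<lambda>x. f x * g x) x = f x * dirder v g x + dirder v f x * g x"
  by (rule dirder_eqI, rule has_derivative_mult[OF has_derivative_dirder has_derivative_dirder])

lemma dirder_cmult:
  "f differentiable (at x) \<Longrightarrow> dirder v (\<lambda>x. c * f x) x = c * dirder v f x"
  by (rule dirder_eqI, rule has_derivative_mult_right[OF has_derivative_dirder])

lemma dirder_inner [simp]: "dirder v (\<lambda>x. a \<bullet> x) = (\<lambda>x. a \<bullet> v)"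
  by (rule ext, rule dirder_eqI) (rule has_derivative_inner_right, rule has_derivative_ident)

lemma dirder_comp_affine:
  fixes A :: "'a::euclidean_space \<Rightarrow> 'b::euclidean_space"
  assumes "linear A" "f differentiable (at (A x + b))"
  shows "dirder v (\<lambda>x. f (A x + b)) x = dirder (A v) f (A x + b)"
    and "(\<lambda>x. f (A x + b)) differentiable (at x)"
proof -
  have 1: "((\<lambda>x. A x + b) has_derivative A) (at x)"
    using has_derivative_add[OF linear_imp_has_derivative[OF assms(1)] has_derivative_const] by simp
  have "((\<lambda>x. f (A x + b)) has_derivative (\<lambda>v. dirder (A v) f (A x + b))) (at x)"
    using has_derivative_compose[OF 1 has_derivative_dirder[OF assms(2)]] .
  then show "dirder v (\<lambda>x. f (A x + b)) x = dirder (A v) f (A x + b)"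
    and "(\<lambda>x. f (A x + b)) differentiable (at x)"
    by (auto intro: dirder_eqI differentiableI)
qed

lemma Ck_const [simp]: "Ck k (\<lambda>x. c)"
  by (induction k arbitrary: c) auto

lemma Ck_add: "Ck k f \<Longrightarrow> Ck k g \<Longrightarrow> Ck k (\<lambda>x. f x + g x)"
proof (induction k arbitrary: f g)
  case 0 then show ?case by (simp add: continuous_on_add)
next
  case (Suc k)
  have "dirder v (\<lambda>x. f x + g x) = (\<lambda>x. dirder v f x + dirder v g x)" for v
    using Suc.prems by (auto simp: dirder_add)
  then show ?case using Suc by (auto intro!: derivative_intros)
qed

lemma Ck_mult: "Ck k f \<Longrightarrow> Ck k g \<Longrightarrow> Ck k (\<lambda>x. f x * g x)"
proof (induction k arbitrary: f g)
  case 0 then show ?case by (simp add: continuous_on_mult)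
next
  case (Suc k)
  have "dirder v (\<lambda>x. f x * g x) = (\<lambda>x. f x * dirder v g x + dirder v f x * g x)" for v
    using Suc.prems by (auto simp: dirder_mult)
  then show ?case using Suc Ck_SucD[OF Suc.prems(1)] Ck_SucD[OF Suc.prems(2)]
    by (auto intro!: derivative_intros Ck_add)
qed

lemma smooth_const [simp]: "smooth (\<lambda>x. c)"
  and smooth_add: "smooth f \<Longrightarrow> smooth g \<Longrightarrow> smooth (\<lambda>x. f x + g x)"
  and smooth_mult: "smooth f \<Longrightarrow> smooth g \<Longrightarrow> smooth (\<lambda>x. f x * g x)"
  unfolding smooth_def by (auto simp: Ck_add Ck_mult)

lemma smooth_cmult: "smooth f \<Longrightarrow> smooth (\<lambda>x. c * f x)"
  by (intro smooth_mult smooth_const)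

lemma smooth_minus: "smooth f \<Longrightarrow> smooth (\<lambda>x. - f x)"
  using smooth_cmult[of f "-1"] by simp

lemma smooth_diff: "smooth f \<Longrightarrow> smooth g \<Longrightarrow> smooth (\<lambda>x. f x - g x)"
  using smooth_add[of f "\<lambda>x. - g x"] smooth_minus by fastforce

lemma smooth_sum: "(\<And>i. i \<in> I \<Longrightarrow> smooth (f i)) \<Longrightarrow> smooth (\<lambda>x. \<Sum>i\<in>I. f i x)"
  by (induction I rule: infinite_finite_induct) (auto intro: smooth_add)

lemma smooth_inner: "smooth (\<lambda>x. a \<bullet> x)"
proof -
  have "Ck k (\<lambda>x. a \<bullet> x)" for k
    by (cases k) (auto intro!: continuous_intros derivative_intros)
  then show ?thesis by (simp add: smooth_def)
qed

lemma Ck_comp_affine: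
  fixes A :: "'a::euclidean_space \<Rightarrow> 'b::euclidean_space"
  assumes "linear A"
  shows "Ck k f \<Longrightarrow> Ck k (\<lambda>x. f (A x + b))"
proof (induction k arbitrary: f)
  case 0
  have "continuous_on UNIV (\<lambda>x. A x + b)"
    using assms by (intro continuous_on_add continuous_on_const linear_continuous_on)
      (simp add: linear_conv_bounded_linear)
  then show ?case using 0 by (auto intro: continuous_on_compose2)
next
  case (Suc k)
  have "dirder v (\<lambda>x. f (A x + b)) = (\<lambda>x. dirder (A v) f (A x + b))" for v
    using Suc.prems assms by (auto simp: dirder_comp_affine)
  then show ?case using Suc assms by (auto intro!: dirder_comp_affine)
qed

lemma smooth_comp_affine:
  fixes A :: "'a::euclidean_space \<Rightarrow> 'b::euclidean_space"
  shows "linear A \<Longrightarrow> smooth f \<Longrightarrow> smooth (\<lambda>x. f (A x + b))"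
  unfolding smooth_def by (auto intro: Ck_comp_affine)

lemma dirder_comp_real:
  fixes \<tau> :: "real \<Rightarrow> real"
  assumes "\<tau> differentiable (at (f x))" "f differentiable (at x)"
  shows "dirder v (\<lambda>x. \<tau> (f x)) x = dirder 1 \<tau> (f x) * dirder v f x"
    and "(\<lambda>x. \<tau> (f x)) differentiable (at x)"
proof -
  have "((\<lambda>x. \<tau> (f x)) has_derivative (\<lambda>v. dirder (dirder v f x) \<tau> (f x))) (at x)"
    using has_derivative_compose[OF has_derivative_dirder[OF assms(2)] has_derivative_dirder[OF assms(1)]] .
  moreover have "dirder (dirder v f x) \<tau> (f x) = dirder 1 \<tau> (f x) * dirder v f x" for v
    using dirder_Basis_sum[OF assms(1), of "dirder v f x"] by simp
  ultimately show "dirder v (\<lambda>x. \<tau> (f x)) x = dirder 1 \<tau> (f x) * dirder v f x"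
    and "(\<lambda>x. \<tau> (f x)) differentiable (at x)"
    by (auto intro: dirder_eqI[THEN trans] differentiableI)
qed

lemma smooth_comp_real:
  fixes \<tau> :: "real \<Rightarrow> real"
  assumes "smooth \<tau>" "smooth f"
  shows "smooth (\<lambda>x. \<tau> (f x))"
proof -
  have "Ck k (\<lambda>x. \<tau> (f x))" for k using assms
  proof (induction k arbitrary: \<tau>)
    case 0
    then show ?case
      using continuous_on_compose2[OF smooth_continuous[of \<tau> UNIV] smooth_continuous[of f UNIV]] by simp
  next
    case (Suc k)
    have "dirder v (\<lambda>x. \<tau> (f x)) = (\<lambda>x. dirder 1 \<tau> (f x) * dirder v f x)" for v
      by (rule ext, rule dirder_comp_real(1)) (simp_all add: smooth_differentiable Suc.prems)
    moreover have "Ck k (\<lambda>x. dirder 1 \<tau> (f x) * dirder v f x)" for v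
    proof (rule Ck_mult)
      show "Ck k (\<lambda>x. dirder 1 \<tau> (f x))"
        using Suc.prems by (intro Suc.IH smooth_dirder)
      show "Ck k (dirder v f)"
        using smooth_dirder[OF Suc.prems(2)] by (simp add: smooth_def)
    qed
    moreover have "(\<lambda>x. \<tau> (f x)) differentiable (at x)" for x
      by (rule dirder_comp_real(2)) (simp_all add: smooth_differentiable Suc.prems)
    ultimately show ?case by (simp only: Ck.simps simp_thms)
  qed
  then show ?thesis by (simp add: smooth_def)
qed

lemma real_has_derivative_dirder:
  fixes \<tau> :: "real \<Rightarrow> real"
  assumes "\<tau> differentiable (at x)"
  shows "(\<tau> has_real_derivative dirder 1 \<tau> x) (at x)"
proof -
  have "(\<tau> has_derivative (\<lambda>v. dirder v \<tau> x)) (at x)" by (rule has_derivative_dirder[OF assms])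
  moreover have "(\<lambda>v. dirder v \<tau> x) = (*) (dirder 1 \<tau> x)"
    by (rule ext, subst dirder_Basis_sum[OF assms]) simp
  ultimately show ?thesis by (metis has_field_derivative_def)
qed

lemma real_dirderI:
  fixes \<tau> :: "real \<Rightarrow> real"
  assumes "(\<tau> has_real_derivative d) (at x)"
  shows "dirder v \<tau> x = v * d" "\<tau> differentiable (at x)"
  using assms dirder_eqI[of \<tau> "(*) d" x v]
  by (auto simp: has_field_derivative_def differentiable_def)

text \<open>\<open>frechet_derivative\<close> chooses some derivative, an arbitrary map where none
  exists. Both sides choose from the same predicate, so locality holds without any
  differentiability.\<close>

lemma dirder_cong_open:
  assumes "open S" "\<And>x. x \<in> S \<Longrightarrow> f x = g x" "x \<in> S"
  shows "dirder v f x = dirder v g x"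
proof -
  have "(f has_derivative f') (at x) \<longleftrightarrow> (g has_derivative f') (at x)" for f'
    using has_derivative_transform_within_open[OF _ assms(1,3)] assms(2) by metis
  then show ?thesis by (simp add: dirder_def frechet_derivative_def)
qed

lemma dirder_eq_0_open:
  assumes "open S" "\<And>x. x \<in> S \<Longrightarrow> f x = c" "x \<in> S"
  shows "dirder v f x = 0"
  using dirder_cong_open[OF assms(1), of f "\<lambda>_. c" x v] assms by simp

lemma dirder_support:
  assumes "closed K" "\<And>x. x \<notin> K \<Longrightarrow> f x = 0" "x \<notin> K"
  shows "dirder v f x = 0"
  by (rule dirder_eq_0_open[of "- K"]) (use assms in auto)

lemma smooth_dirder_sum:
  assumes "\<And>i. i \<in> I \<Longrightarrow> smooth (f i)"
  shows "dirder v (\<lambda>x. \<Sum>i\<in>I. f i x) x = (\<Sum>i\<in>I. dirder v (f i) x)"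
  using assms
  by (induction I rule: infinite_finite_induct)
    (auto simp: dirder_add smooth_differentiable smooth_sum)

text \<open>The powers of the inverse make the family closed under differentiation up to linear combinations.\<close>

definition flat :: "nat \<Rightarrow> real \<Rightarrow> real" where
  "flat m x = (if x > 0 then inverse x ^ m * exp (- inverse x) else 0)"

text \<open>With y = 1/x the right-hand limit is the decay of y^m / exp y at infinity.\<close>

lemma flat_limit: "(flat m \<longlongrightarrow> 0) (at 0)"
proof -
  have "((\<lambda>x. x ^ m / exp x) \<longlongrightarrow> 0) (at_top :: real filter)"
    by (rule tendsto_power_div_exp_0)
  then have "((\<lambda>x. inverse x ^ m / exp (inverse x)) \<longlongrightarrow> 0) (at_right (0::real))"
    by (rule filterlim_compose) (rule filterlim_inverse_at_top_right)
  then have "(flat m \<longlongrightarrow> 0) (at_right 0)"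
    by (rule tendsto_cong[THEN iffD1, rotated])
      (auto simp: eventually_at_filter flat_def exp_minus divide_inverse)
  moreover have "(flat m \<longlongrightarrow> 0) (at_left 0)"
    by (rule tendsto_cong[THEN iffD1, rotated, OF tendsto_const])
      (auto simp: eventually_at_filter flat_def)
  ultimately show ?thesis using filterlim_split_at by blast
qed

lemma flat_deriv:
  "(flat m has_real_derivative flat (m + 2) x - m * flat (m + 1) x) (at x)"
proof (cases x "0::real" rule: linorder_cases)
  case less
  have "((\<lambda>_. 0) has_real_derivative 0) (at x)" by simp
  then have "(flat m has_real_derivative 0) (at x)"
    by (rule DERIV_cong_ev[THEN iffD1, rotated 3])
      (use less in \<open>auto simp: flat_def intro!: eventually_mono[OF eventually_nhds_in_open[of "{..<0}"]]\<close>)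
  then show ?thesis using less by (simp add: flat_def)
next
  case equal
  \<comment> \<open>The difference quotient at 0 is \<open>flat (Suc m)\<close> itself, because
    dividing by h raises the power of the inverse by one.\<close>
  have "((\<lambda>h. flat m h / h) \<longlongrightarrow> 0) (at 0)"
    using flat_limit[of "Suc m"]
    by (rule tendsto_cong[THEN iffD1, rotated])
      (auto simp: eventually_at_filter flat_def field_simps)
  then show ?thesis unfolding equal DERIV_def by (simp add: flat_def)
next
  case greater
  have "((\<lambda>x. inverse x ^ m * exp (- inverse x)) has_real_derivative
      flat (m + 2) x - m * flat (m + 1) x) (at x)"
  proof (cases m)
    case 0
    then show ?thesis using greater
      by (auto intro!: derivative_eq_intros simp: flat_def field_simps power2_eq_square)
  next
    case (Suc n)
    have "((\<lambda>x. inverse x ^ m * exp (- inverse x)) has_real_derivative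
        m * inverse x ^ n * (- (inverse x * inverse x)) * exp (- inverse x)
         + inverse x ^ m * (exp (- inverse x) * (inverse x * inverse x))) (at x)"
      unfolding Suc
      by (rule DERIV_cong, rule DERIV_mult, rule DERIV_power_Suc, rule DERIV_inverse)
        (use greater in \<open>auto intro!: derivative_eq_intros simp: algebra_simps\<close>)
    then show ?thesis using greater Suc by (simp add: flat_def algebra_simps)
  qed
  then show ?thesis
    by (rule DERIV_cong_ev[THEN iffD1, rotated 3])
      (use greater in \<open>auto simp: flat_def intro!: eventually_mono[OF eventually_nhds_in_open[of "{0<..}"]]\<close>)
qed

lemma smooth_flat: "smooth (flat m)"
proof -
  have "Ck k (flat m)" for k
  proof (induction k arbitrary: m)
    case 0
    then show ?case using DERIV_isCont[OF flat_deriv] by (simp add: continuous_on_eq_continuous_at)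
  next
    case (Suc k)
    have "dirder v (flat m) = (\<lambda>x. v * (flat (m + 2) x + (- m) * flat (m + 1) x))" for v
      by (rule ext) (simp add: real_dirderI[OF flat_deriv])
    moreover have "Ck k (\<lambda>x. v * (flat (m + 2) x + (- m) * flat (m + 1) x))" for v
      using Suc by (intro Ck_mult Ck_add Ck_const)
    ultimately show ?case using real_dirderI(2)[OF flat_deriv] by (simp only: Ck.simps simp_thms)
  qed
  then show ?thesis by (simp add: smooth_def)
qed

text \<open>The squared distance is a polynomial, so smoothness is not lost at the centre, as it
  would be with the norm.\<close>

definition bump :: "'a::euclidean_space \<Rightarrow> real \<Rightarrow> 'a \<Rightarrow> real" where
  "bump c r x = flat 0 (r\<^sup>2 - (x - c) \<bullet> (x - c))"

lemma smooth_bump: "smooth (bump c r)"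
proof -
  have "smooth (\<lambda>x. (x - c) \<bullet> (x - c))"
  proof -
    have "smooth (\<lambda>x. x \<bullet> e + - (c \<bullet> e))" for e
      using smooth_inner[of e] by (intro smooth_add smooth_const) (simp only: inner_commute)
    then have "smooth (\<lambda>x. \<Sum>e\<in>Basis. ((x - c) \<bullet> e) * ((x - c) \<bullet> e))"
      by (intro smooth_sum smooth_mult) (auto simp: inner_diff_left)
    then show ?thesis by (subst euclidean_inner)
  qed
  then have "smooth (\<lambda>x. r\<^sup>2 - (x - c) \<bullet> (x - c))" by (intro smooth_diff smooth_const)
  then show ?thesis using smooth_comp_real[OF smooth_flat] by (simp add: bump_def[abs_def])
qed

lemma norm_less_iff_inner: "r > 0 \<Longrightarrow> norm x < r \<longleftrightarrow> x \<bullet> x < r\<^sup>2"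
  by (metis less_eq_real_def norm_ge_zero power2_norm_eq_inner power_less_imp_less_base
      power_strict_mono zero_less_numeral)

lemma bump_pos: "r > 0 \<Longrightarrow> x \<in> ball c r \<Longrightarrow> bump c r x > 0"
  using norm_less_iff_inner[of r "x - c"]
  by (simp add: bump_def flat_def dist_norm norm_minus_commute)

lemma bump_nonneg: "bump c r x \<ge> 0"
  by (simp add: bump_def flat_def)

lemma bump_zero: "r > 0 \<Longrightarrow> x \<notin> ball c r \<Longrightarrow> bump c r x = 0"
  using norm_less_iff_inner[of r "x - c"]
  by (simp add: bump_def flat_def dist_norm norm_minus_commute)

section \<open>Approximation with derivatives\<close>

text \<open>Comparison in basis directions is the form in which one tolerance makes sense:
  derivatives depend linearly on the direction, so no bound could hold for all directions at
  once.\<close>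

primrec Ck_close ::
  "nat \<Rightarrow> 'a::euclidean_space set \<Rightarrow> real \<Rightarrow> ('a \<Rightarrow> real) \<Rightarrow> ('a \<Rightarrow> real) \<Rightarrow> bool" where
  "Ck_close 0 S \<epsilon> f g \<longleftrightarrow> (\<forall>z\<in>S. \<bar>f z - g z\<bar> \<le> \<epsilon>)"
| "Ck_close (Suc k) S \<epsilon> f g \<longleftrightarrow>
     (\<forall>z\<in>S. \<bar>f z - g z\<bar> \<le> \<epsilon>) \<and> (\<forall>e\<in>Basis. Ck_close k S \<epsilon> (dirder e f) (dirder e g))"

lemma Ck_closeD: "Ck_close k S \<epsilon> f g \<Longrightarrow> z \<in> S \<Longrightarrow> \<bar>f z - g z\<bar> \<le> \<epsilon>"
  by (cases k) auto

lemma Ck_close_SucD: "Ck_close (Suc k) S \<epsilon> f g \<Longrightarrow> Ck_close k S \<epsilon> f g"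
proof (induction k arbitrary: f g)
  case (Suc k)
  have "Ck_close k S \<epsilon> (dirder e f) (dirder e g)" if "e \<in> Basis" for e
    by (rule Suc.IH) (use Suc.prems that in \<open>subst (asm) Ck_close.simps, blast\<close>)
  then show ?case using Ck_closeD[OF Suc.prems] by simp
qed auto

lemma Ck_close_mono: "Ck_close k S \<epsilon> f g \<Longrightarrow> \<epsilon> \<le> \<epsilon>' \<Longrightarrow> Ck_close k S \<epsilon>' f g"
  by (induction k arbitrary: f g) (auto intro: order_trans)

lemma Ck_close_refl: "0 \<le> \<epsilon> \<Longrightarrow> Ck_close k S \<epsilon> f f"
  by (induction k arbitrary: f) auto

lemma Ck_close_trans: "Ck_close k S a f g \<Longrightarrow> Ck_close k S b g h \<Longrightarrow> Ck_close k S (a + b) f h"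
proof (induction k arbitrary: f g h)
  case 0
  have "\<bar>f z - h z\<bar> \<le> a + b" if "z \<in> S" for z
    using Ck_closeD[OF 0(1) that] Ck_closeD[OF 0(2) that] by linarith
  then show ?case by simp
next
  case (Suc k)
  have "\<bar>f z - h z\<bar> \<le> a + b" if "z \<in> S" for z
    using Ck_closeD[OF Suc.prems(1) that] Ck_closeD[OF Suc.prems(2) that] by linarith
  moreover have "Ck_close k S (a + b) (dirder e f) (dirder e h)" if "e \<in> Basis" for e
    by (rule Suc.IH[where g = "dirder e g"]) (use Suc.prems that in auto)
  ultimately show ?case by simp
qed

lemma smooth_dirder_add:
  "smooth f \<Longrightarrow> smooth g \<Longrightarrow> dirder v (\<lambda>x. f x + g x) = (\<lambda>x. dirder v f x + dirder v g x)"
  by (rule ext) (simp add: dirder_add smooth_differentiable)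

lemma smooth_dirder_diff:
  "smooth f \<Longrightarrow> smooth g \<Longrightarrow> dirder v (\<lambda>x. f x - g x) = (\<lambda>x. dirder v f x - dirder v g x)"
  by (rule ext) (simp add: dirder_diff smooth_differentiable)

lemma smooth_dirder_mult:
  "smooth f \<Longrightarrow> smooth g \<Longrightarrow>
    dirder v (\<lambda>x. f x * g x) = (\<lambda>x. f x * dirder v g x + dirder v f x * g x)"
  by (rule ext) (simp add: dirder_mult smooth_differentiable)

lemma smooth_dirder_cmult:
  "smooth f \<Longrightarrow> dirder v (\<lambda>x. c * f x) = (\<lambda>x. c * dirder v f x)"
  by (rule ext) (simp add: dirder_cmult smooth_differentiable)

lemma Ck_close_add:
  assumes "smooth f" "smooth g" "smooth f'" "smooth g'"
    "Ck_close k S a f g" "Ck_close k S b f' g'"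
  shows "Ck_close k S (a + b) (\<lambda>z. f z + f' z) (\<lambda>z. g z + g' z)"
  using assms
proof (induction k arbitrary: f g f' g')
  case 0
  have "\<bar>f z + f' z - (g z + g' z)\<bar> \<le> a + b" if "z \<in> S" for z
    using Ck_closeD[OF 0(5) that] Ck_closeD[OF 0(6) that] by linarith
  then show ?case by simp
next
  case (Suc k)
  have "\<bar>f z + f' z - (g z + g' z)\<bar> \<le> a + b" if "z \<in> S" for z
    using Ck_closeD[OF Suc.prems(5) that] Ck_closeD[OF Suc.prems(6) that] by linarith
  moreover have "Ck_close k S (a + b) (dirder e (\<lambda>z. f z + f' z)) (dirder e (\<lambda>z. g z + g' z))"
    if "e \<in> Basis" for e
    unfolding smooth_dirder_add[OF Suc.prems(1,3)] smooth_dirder_add[OF Suc.prems(2,4)]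
    by (rule Suc.IH) (use Suc.prems that in \<open>auto intro: smooth_dirder\<close>)
  ultimately show ?case by simp
qed

lemma Ck_close_cmult:
  assumes "smooth f" "smooth g" "Ck_close k S a f g"
  shows "Ck_close k S (\<bar>c\<bar> * a) (\<lambda>z. c * f z) (\<lambda>z. c * g z)"
  using assms
proof (induction k arbitrary: f g)
  case 0 then show ?case by (auto simp: right_diff_distrib[symmetric] abs_mult mult_left_mono)
next
  case (Suc k)
  have "Ck_close k S (\<bar>c\<bar> * a) (dirder e (\<lambda>z. c * f z)) (dirder e (\<lambda>z. c * g z))"
    if "e \<in> Basis" for e
    unfolding smooth_dirder_cmult[OF Suc.prems(1)] smooth_dirder_cmult[OF Suc.prems(2)]
    by (rule Suc.IH) (use Suc.prems that in \<open>auto intro: smooth_dirder\<close>)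
  moreover have "\<bar>c * f z - c * g z\<bar> \<le> \<bar>c\<bar> * a" if "z \<in> S" for z
    using Ck_closeD[OF Suc.prems(3) that]
    by (simp add: right_diff_distrib[symmetric] abs_mult mult_left_mono)
  ultimately show ?case by simp
qed

lemma smooth_bounded_on:
  assumes "smooth f" "bounded S"
  obtains B where "B \<ge> 0" "\<And>z. z \<in> S \<Longrightarrow> \<bar>f z\<bar> \<le> B"
proof -
  have "compact (f ` closure S)"
    using assms by (intro compact_continuous_image smooth_continuous) (simp_all add: compact_closure)
  then obtain B where "\<forall>y\<in>f ` closure S. norm y \<le> B"
    using compact_imp_bounded bounded_iff by metis
  then have "\<bar>f z\<bar> \<le> max B 0" if "z \<in> S" for z
    using that closure_subset[of S] by force
  then show ?thesis using that[of "max B 0"] by simp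
qed

text \<open>Closeness to the zero function plays the part of a C^k norm bound.\<close>

lemma Ck_close_bounded:
  assumes "smooth f" "bounded S"
  shows "\<exists>B\<ge>0. Ck_close k S B f (\<lambda>_. 0)"
  using assms(1)
proof (induction k arbitrary: f)
  case 0
  then show ?case using smooth_bounded_on[OF _ assms(2), of f] by (metis Ck_close.simps(1) diff_zero)
next
  case (Suc k)
  obtain B where B: "B \<ge> 0" "\<And>z. z \<in> S \<Longrightarrow> \<bar>f z\<bar> \<le> B"
    using smooth_bounded_on[OF Suc.prems assms(2)] by metis
  have "\<forall>e. \<exists>B\<ge>0. Ck_close k S B (dirder e f) (\<lambda>_. 0)"
    using Suc.IH smooth_dirder[OF Suc.prems] by blast
  then obtain C where C: "\<And>e. C e \<ge> 0" "\<And>e. Ck_close k S (C e) (dirder e f) (\<lambda>_. 0)" by metis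
  let ?B = "B + (\<Sum>e\<in>Basis. C e)"
  have "C e \<le> ?B" if "e \<in> Basis" for e
    using B(1) member_le_sum[of e Basis C] C(1) that by fastforce
  moreover have "B \<le> ?B" using C(1) by (simp add: sum_nonneg)
  ultimately have "Ck_close (Suc k) S ?B f (\<lambda>_. 0)"
    using B(2) C(2) by (fastforce intro: Ck_close_mono order_trans)
  then show ?case using B(1) C(1) by (intro exI[of _ ?B]) (simp add: sum_nonneg)
qed

text \<open>By the Leibniz rule the error is linear in \<epsilon>. The factor M is fixed before
  \<epsilon>, q and q', which is what allows a limit to be multiplied by P.\<close>

lemma Ck_close_mult:
  assumes "smooth P" "bounded S"
  shows "\<exists>M\<ge>0. \<forall>\<epsilon> q q'. smooth q \<longrightarrow> smooth q' \<longrightarrow> Ck_close k S \<epsilon> q q' \<longrightarrow> \<epsilon> \<ge> 0 \<longrightarrow>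
    Ck_close k S (M * \<epsilon>) (\<lambda>z. P z * q z) (\<lambda>z. P z * q' z)"
  using assms(1)
proof (induction k arbitrary: P)
  case 0
  obtain B where B: "B \<ge> 0" "\<And>z. z \<in> S \<Longrightarrow> \<bar>P z\<bar> \<le> B"
    using smooth_bounded_on[OF 0 assms(2)] by metis
  have "\<bar>P z * q z - P z * q' z\<bar> \<le> B * \<epsilon>" if "z \<in> S" "\<bar>q z - q' z\<bar> \<le> \<epsilon>" for z q q' and \<epsilon> :: real
    unfolding right_diff_distrib[symmetric] abs_mult by (rule mult_mono) (use B that in auto)
  then show ?case using B(1) by (intro exI[of _ B]) simp
next
  case (Suc k)
  obtain B where B: "B \<ge> 0" "\<And>z. z \<in> S \<Longrightarrow> \<bar>P z\<bar> \<le> B"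
    using smooth_bounded_on[OF Suc.prems assms(2)] by metis
  let ?R = "\<lambda>M P. \<forall>\<epsilon> q q'. smooth q \<longrightarrow> smooth q' \<longrightarrow> Ck_close k S \<epsilon> q q' \<longrightarrow> \<epsilon> \<ge> 0 \<longrightarrow>
    Ck_close k S (M * \<epsilon>) (\<lambda>z. P z * q z) (\<lambda>z. P z * q' z)"
  obtain A where A: "A \<ge> 0" "?R A P" using Suc.IH[OF Suc.prems] by auto
  have "\<forall>e. \<exists>M\<ge>0. ?R M (dirder e P)" using Suc.IH smooth_dirder[OF Suc.prems] by auto
  then obtain C where C: "\<And>e. C e \<ge> 0" "\<And>e. ?R (C e) (dirder e P)" by metis
  \<comment> \<open>B covers the values, A the terms with the derivative on q, and the sum over all
    directions the terms with the derivative on P.\<close>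
  let ?M = "B + A + (\<Sum>e\<in>Basis. C e)"
  have S0: "(\<Sum>e\<in>Basis. C e) \<ge> 0" using C(1) by (simp add: sum_nonneg)
  have "Ck_close (Suc k) S (?M * \<epsilon>) (\<lambda>z. P z * q z) (\<lambda>z. P z * q' z)"
    if q: "smooth q" "smooth q'" "Ck_close (Suc k) S \<epsilon> q q'" "\<epsilon> \<ge> 0" for \<epsilon> q q'
  proof -
    have "Ck_close k S (?M * \<epsilon>) (dirder e (\<lambda>z. P z * q z)) (dirder e (\<lambda>z. P z * q' z))"
      if e: "e \<in> Basis" for e
    proof -
      have "Ck_close k S (A * \<epsilon>) (\<lambda>z. P z * dirder e q z) (\<lambda>z. P z * dirder e q' z)"
        using q e by (intro A(2)[rule_format] smooth_dirder) auto
      moreover have "Ck_close k S (C e * \<epsilon>) (\<lambda>z. dirder e P z * q z) (\<lambda>z. dirder e P z * q' z)"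
        using C(2) q Ck_close_SucD[OF q(3)] by blast
      ultimately have "Ck_close k S (A * \<epsilon> + C e * \<epsilon>)
          (\<lambda>z. P z * dirder e q z + dirder e P z * q z) (\<lambda>z. P z * dirder e q' z + dirder e P z * q' z)"
        by (intro Ck_close_add smooth_mult smooth_dirder q Suc.prems)
      moreover have "A * \<epsilon> + C e * \<epsilon> \<le> ?M * \<epsilon>"
        using B(1) member_le_sum[of e Basis C] C(1) e q(4)
        by (simp add: distrib_right[symmetric] mult_right_mono)
      ultimately show ?thesis
        unfolding smooth_dirder_mult[OF Suc.prems q(1)] smooth_dirder_mult[OF Suc.prems q(2)]
        by (rule Ck_close_mono)
    qed
    moreover have "\<bar>P z * q z - P z * q' z\<bar> \<le> ?M * \<epsilon>" if "z \<in> S" for z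
    proof -
      have "\<bar>P z * q z - P z * q' z\<bar> = \<bar>P z\<bar> * \<bar>q z - q' z\<bar>"
        by (simp add: right_diff_distrib[symmetric] abs_mult)
      also have "\<dots> \<le> ?M * \<epsilon>"
        using B A(1) S0 that Ck_closeD[OF q(3) that] by (intro mult_mono) fastforce+
      finally show ?thesis .
    qed
    ultimately show ?thesis by simp
  qed
  then show ?case using B(1) A(1) S0 by (intro exI[of _ ?M]) auto
qed

text \<open>A general filter serves two uses: \<open>at 0\<close> for difference quotients in a
  weight, and \<open>sequentially\<close> for approximate identities.\<close>

definition Ck_lim ::
  "'b filter \<Rightarrow> nat \<Rightarrow> 'a::euclidean_space set \<Rightarrow> ('b \<Rightarrow> 'a \<Rightarrow> real) \<Rightarrow> ('a \<Rightarrow> real) \<Rightarrow> bool" where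
  "Ck_lim F k S f g \<longleftrightarrow> (\<forall>\<epsilon>>0. \<forall>\<^sub>F h in F. Ck_close k S \<epsilon> (f h) g)"

lemma Ck_lim_Suc:
  "Ck_lim F (Suc k) S f g \<longleftrightarrow>
    Ck_lim F 0 S f g \<and> (\<forall>e\<in>Basis. Ck_lim F k S (\<lambda>h. dirder e (f h)) (dirder e g))"
  unfolding Ck_lim_def
  by (auto simp: eventually_conj_iff eventually_ball_finite_distrib)

lemma Ck_lim_cong:
  assumes "\<forall>\<^sub>F h in F. f h = f' h" "Ck_lim F k S f g"
  shows "Ck_lim F k S f' g"
  unfolding Ck_lim_def
proof (intro allI impI)
  fix \<epsilon> :: real assume "\<epsilon> > 0"
  with assms(2) have "\<forall>\<^sub>F h in F. Ck_close k S \<epsilon> (f h) g" by (simp add: Ck_lim_def)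
  with assms(1) show "\<forall>\<^sub>F h in F. Ck_close k S \<epsilon> (f' h) g" by eventually_elim simp
qed

lemma Ck_lim_add:
  assumes "\<And>h. smooth (f h)" "\<And>h. smooth (f' h)" "smooth g" "smooth g'"
    "Ck_lim F k S f g" "Ck_lim F k S f' g'"
  shows "Ck_lim F k S (\<lambda>h z. f h z + f' h z) (\<lambda>z. g z + g' z)"
  unfolding Ck_lim_def
proof (intro allI impI)
  fix \<epsilon> :: real assume "\<epsilon> > 0"
  then have "\<forall>\<^sub>F h in F. Ck_close k S (\<epsilon>/2) (f h) g" "\<forall>\<^sub>F h in F. Ck_close k S (\<epsilon>/2) (f' h) g'"
    using assms(5,6) by (simp_all add: Ck_lim_def)
  then show "\<forall>\<^sub>F h in F. Ck_close k S \<epsilon> (\<lambda>z. f h z + f' h z) (\<lambda>z. g z + g' z)"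
  proof eventually_elim
    case (elim h)
    show ?case using Ck_close_add[OF assms(1,3,2,4) elim] by simp
  qed
qed

lemma Ck_lim_mult:
  assumes "\<And>h. smooth (f h)" "smooth g" "smooth P" "bounded S" "Ck_lim F k S f g"
  shows "Ck_lim F k S (\<lambda>h z. P z * f h z) (\<lambda>z. P z * g z)"
  unfolding Ck_lim_def
proof (intro allI impI)
  fix \<epsilon> :: real assume \<epsilon>: "\<epsilon> > 0"
  obtain M where M: "M \<ge> 0" "\<And>\<epsilon> q q'. smooth q \<Longrightarrow> smooth q' \<Longrightarrow> Ck_close k S \<epsilon> q q' \<Longrightarrow> \<epsilon> \<ge> 0 \<Longrightarrow>
    Ck_close k S (M * \<epsilon>) (\<lambda>z. P z * q z) (\<lambda>z. P z * q' z)"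
    using Ck_close_mult[OF assms(3,4)] by blast
  let ?d = "\<epsilon> / (M + 1)"
  have d: "?d > 0" "M * ?d \<le> \<epsilon>" using M(1) \<epsilon> by (auto simp: field_simps)
  then have "\<forall>\<^sub>F h in F. Ck_close k S ?d (f h) g" using assms(5) by (simp only: Ck_lim_def)
  then show "\<forall>\<^sub>F h in F. Ck_close k S \<epsilon> (\<lambda>z. P z * f h z) (\<lambda>z. P z * g z)"
    by eventually_elim (use M(2) assms(1,2) d in \<open>meson Ck_close_mono less_imp_le\<close>)
qed

text \<open>The varying scalar is a component of a varying weight vector, which the chain rule for
  ridge functions produces.\<close>

lemma Ck_lim_scale:
  fixes s :: "'b \<Rightarrow> real"
  assumes "\<And>h. smooth (f h)" "smooth g" "bounded S" "Ck_lim F k S f g" "(s \<longlongrightarrow> s0) F"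
  shows "Ck_lim F k S (\<lambda>h z. s h * f h z) (\<lambda>z. s0 * g z)"
  unfolding Ck_lim_def
proof (intro allI impI)
  fix \<epsilon> :: real assume \<epsilon>: "\<epsilon> > 0"
  obtain B where B: "B \<ge> 0" "Ck_close k S B g (\<lambda>_. 0)" using Ck_close_bounded[OF assms(2,3)] by metis
  \<comment> \<open>The total error will be \<open>d * (\<bar>s0\<bar> + d + B)\<close>; capping d
    at 1 turns the bracket into the denominator.\<close>
  define d where "d = min 1 (\<epsilon> / (B + \<bar>s0\<bar> + 1))"
  have p: "B + \<bar>s0\<bar> + 1 > 0" using B(1) by simp
  then have d: "d > 0" using \<epsilon> by (simp add: d_def)
  have "d * (B + \<bar>s0\<bar> + 1) \<le> \<epsilon>"
    using p by (simp add: d_def min_le_iff_disj pos_le_divide_eq[symmetric])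
  moreover have "d * (B + \<bar>s0\<bar> + d) \<le> d * (B + \<bar>s0\<bar> + 1)"
    using d by (intro mult_left_mono) (auto simp: d_def)
  ultimately have d2: "(\<bar>s0\<bar> + d) * d + d * B \<le> \<epsilon>" by (simp add: algebra_simps)
  have "\<forall>\<^sub>F h in F. Ck_close k S d (f h) g" "\<forall>\<^sub>F h in F. dist (s h) s0 < d"
    using assms(4,5) d by (simp_all add: Ck_lim_def tendsto_iff)
  then show "\<forall>\<^sub>F h in F. Ck_close k S \<epsilon> (\<lambda>z. s h * f h z) (\<lambda>z. s0 * g z)"
  proof eventually_elim
    case (elim h)
    have sh: "\<bar>s h - s0\<bar> \<le> d" using elim(2) by (simp add: dist_real_def)
    have 1: "Ck_close k S (\<bar>s h\<bar> * d) (\<lambda>z. s h * f h z) (\<lambda>z. s h * g z)"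
      by (rule Ck_close_cmult[OF assms(1,2) elim(1)])
    have "Ck_close k S (\<bar>s h - s0\<bar> * B) (\<lambda>z. (s h - s0) * g z) (\<lambda>z. (s h - s0) * 0)"
      by (rule Ck_close_cmult[OF assms(2) smooth_const B(2)])
    then have "Ck_close k S (\<bar>s h - s0\<bar> * B + 0) (\<lambda>z. (s h - s0) * g z + s0 * g z) (\<lambda>z. (s h - s0) * 0 + s0 * g z)"
      by (intro Ck_close_add smooth_cmult smooth_const assms(2) Ck_close_refl) auto
    then have 2: "Ck_close k S (\<bar>s h - s0\<bar> * B) (\<lambda>z. s h * g z) (\<lambda>z. s0 * g z)"
      by (simp add: algebra_simps)
    have "\<bar>s h\<bar> * d + \<bar>s h - s0\<bar> * B \<le> (\<bar>s0\<bar> + d) * d + d * B"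
      using sh d B(1) by (intro add_mono mult_right_mono) auto
    then show ?case using d2 by (intro Ck_close_mono[OF Ck_close_trans[OF 1 2]]) simp
  qed
qed

section \<open>Polynomials are limits of shallow networks\<close>

lemma real_smooth_Lipschitz:
  fixes \<tau> :: "real \<Rightarrow> real"
  assumes "smooth \<tau>"
  obtains M where "M \<ge> 0" "\<And>x y. \<bar>x\<bar> \<le> R \<Longrightarrow> \<bar>y\<bar> \<le> R \<Longrightarrow> \<bar>\<tau> x - \<tau> y\<bar> \<le> M * \<bar>x - y\<bar>"
proof -
  obtain M where M: "M \<ge> 0" "\<And>z. z \<in> {-R..R} \<Longrightarrow> \<bar>dirder 1 \<tau> z\<bar> \<le> M"
    using smooth_bounded_on[OF smooth_dirder[OF assms], of "{-R..R}"] by auto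
  have "\<bar>\<tau> x - \<tau> y\<bar> \<le> M * \<bar>x - y\<bar>" if "\<bar>x\<bar> \<le> R" "\<bar>y\<bar> \<le> R" for x y
  proof (rule field_differentiable_bound[of "{-R..R}" \<tau> "dirder 1 \<tau>", unfolded real_norm_def])
    show "(\<tau> has_real_derivative dirder 1 \<tau> z) (at z within {- R..R})" for z
      by (rule has_field_derivative_at_within)
        (intro real_has_derivative_dirder smooth_differentiable assms)
  qed (use M that in auto)
  then show ?thesis using that M by blast
qed

lemma real_smooth_Taylor1:
  fixes \<tau> :: "real \<Rightarrow> real"
  assumes "smooth \<tau>"
  obtains M where "M \<ge> 0"
    "\<And>x h. \<bar>x\<bar> \<le> R \<Longrightarrow> \<bar>x + h\<bar> \<le> R \<Longrightarrow> \<bar>\<tau> (x + h) - \<tau> x - h * dirder 1 \<tau> x\<bar> \<le> M * h\<^sup>2"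
proof -
  obtain M where M: "M \<ge> 0"
    "\<And>x y. \<bar>x\<bar> \<le> R \<Longrightarrow> \<bar>y\<bar> \<le> R \<Longrightarrow> \<bar>dirder 1 \<tau> x - dirder 1 \<tau> y\<bar> \<le> M * \<bar>x - y\<bar>"
    using real_smooth_Lipschitz[OF smooth_dirder[OF assms]] by metis
  have "\<bar>\<tau> (x + h) - \<tau> x - h * dirder 1 \<tau> x\<bar> \<le> M * h\<^sup>2" if "\<bar>x\<bar> \<le> R" "\<bar>x + h\<bar> \<le> R" for x h
  proof -
    let ?S = "closed_segment x (x + h)"
    have S: "\<bar>y - x\<bar> \<le> \<bar>h\<bar>" "\<bar>y\<bar> \<le> R" if "y \<in> ?S" for y
      using that \<open>\<bar>x\<bar> \<le> R\<close> \<open>\<bar>x + h\<bar> \<le> R\<close>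
      by (auto simp: closed_segment_eq_real_ivl split: if_splits)
    \<comment> \<open>Mean value inequality for \<tau> minus a multiple of the identity: the
      derivative of the difference is at most \<open>M * \<bar>h\<bar>\<close> on the segment, which
      supplies the second factor h.\<close>
    have "\<bar>(\<tau> (x + h) - (x + h) * dirder 1 \<tau> x) - (\<tau> x - x * dirder 1 \<tau> x)\<bar> \<le> (M * \<bar>h\<bar>) * \<bar>(x + h) - x\<bar>"
    proof (rule field_differentiable_bound[of ?S "\<lambda>y. \<tau> y - y * dirder 1 \<tau> x"
          "\<lambda>y. dirder 1 \<tau> y - dirder 1 \<tau> x", unfolded real_norm_def])
      fix y assume y: "y \<in> ?S"
      have "((\<lambda>y. \<tau> y - y * dirder 1 \<tau> x) has_real_derivative dirder 1 \<tau> y - 1 * dirder 1 \<tau> x) (at y)"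
        by (intro DERIV_diff DERIV_cmult_right DERIV_ident real_has_derivative_dirder
            smooth_differentiable assms)
      then show "((\<lambda>y. \<tau> y - y * dirder 1 \<tau> x) has_real_derivative dirder 1 \<tau> y - dirder 1 \<tau> x)
          (at y within ?S)" by (simp add: has_field_derivative_at_within)
      show "\<bar>dirder 1 \<tau> y - dirder 1 \<tau> x\<bar> \<le> M * \<bar>h\<bar>"
        using M(2)[OF S(2)[OF y] \<open>\<bar>x\<bar> \<le> R\<close>] S(1)[OF y] M(1)
        by (meson mult_left_mono order_trans)
    qed auto
    then show ?thesis by (simp add: algebra_simps power2_eq_square abs_mult_self_eq)
  qed
  then show ?thesis using that M(1) by blast
qed

lemma smooth_ridge:
  fixes \<tau> :: "real \<Rightarrow> real"
  shows "smooth \<tau> \<Longrightarrow> smooth (\<lambda>z::'a::euclidean_space. \<tau> (w \<bullet> z + b'))"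
  by (rule smooth_comp_real[where f = "\<lambda>z. w \<bullet> z + b'"])
    (simp_all add: smooth_add smooth_inner)

lemma dirder_ridge:
  fixes \<tau> :: "real \<Rightarrow> real"
  assumes "smooth \<tau>"
  shows "dirder v (\<lambda>z::'a::euclidean_space. \<tau> (w \<bullet> z + b')) = (\<lambda>z. (w \<bullet> v) * dirder 1 \<tau> (w \<bullet> z + b'))"
proof
  fix z
  have "dirder v (\<lambda>z. w \<bullet> z + b') z = w \<bullet> v"
    by (simp add: smooth_dirder_add smooth_inner)
  then show "dirder v (\<lambda>z. \<tau> (w \<bullet> z + b')) z = (w \<bullet> v) * dirder 1 \<tau> (w \<bullet> z + b')"
    using dirder_comp_real(1)[of \<tau> "\<lambda>z. w \<bullet> z + b'" z v]
    by (simp add: smooth_differentiable assms smooth_add smooth_inner)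
qed

context
  fixes a c :: "'a::euclidean_space" and b :: real and S :: "'a set"
  assumes S: "bounded S"
begin

text \<open>One interval contains all arguments of \<tau>, for every z in S and every step h up to
  1, so Lipschitz and Taylor constants can be chosen independently of both.\<close>

lemma ridge_arg_bound:
  obtains B R where "B \<ge> 0" "\<And>z. z \<in> S \<Longrightarrow> \<bar>a \<bullet> z\<bar> \<le> B"
    "\<And>z h. z \<in> S \<Longrightarrow> \<bar>h\<bar> \<le> 1 \<Longrightarrow> \<bar>(c + h *\<^sub>R a) \<bullet> z + b\<bar> \<le> R"
proof -
  obtain B where B: "B \<ge> 0" "\<And>z. z \<in> S \<Longrightarrow> \<bar>a \<bullet> z\<bar> \<le> B"
    using smooth_bounded_on[OF smooth_inner S] by metis
  obtain C where C: "C \<ge> 0" "\<And>z. z \<in> S \<Longrightarrow> \<bar>c \<bullet> z\<bar> \<le> C"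
    using smooth_bounded_on[OF smooth_inner S] by metis
  have "\<bar>(c + h *\<^sub>R a) \<bullet> z + b\<bar> \<le> C + B + \<bar>b\<bar>" if "z \<in> S" "\<bar>h\<bar> \<le> 1" for z h
  proof -
    have "\<bar>h * (a \<bullet> z)\<bar> \<le> 1 * B" unfolding abs_mult using B that by (intro mult_mono) auto
    then show ?thesis using C(2)[OF that(1)] by (simp add: inner_add_left)
  qed
  then show ?thesis using that B by blast
qed

lemma eventually_abs_le_at_0: "d > 0 \<Longrightarrow> \<forall>\<^sub>F h in at (0::real). \<bar>h\<bar> \<le> d \<and> h \<noteq> 0"
  by (auto simp: eventually_at dist_real_def intro!: exI[of _ d])

text \<open>A derivative of a ridge function is a ridge function of the derivative of \<tau>, times
  a component of the weight. The uniform estimate \<open>base\<close>, proved for every smooth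
  \<tau>, therefore gives all orders by induction.\<close>

lemma ridge_lim:
  fixes \<tau> :: "real \<Rightarrow> real"
  assumes "smooth \<tau>"
  shows "Ck_lim (at 0) k S (\<lambda>h z. \<tau> ((c + h *\<^sub>R a) \<bullet> z + b)) (\<lambda>z. \<tau> (c \<bullet> z + b))"
proof -
  have base: "Ck_lim (at 0) 0 S (\<lambda>h z. \<tau> ((c + h *\<^sub>R a) \<bullet> z + b)) (\<lambda>z. \<tau> (c \<bullet> z + b))"
    if \<tau>: "smooth \<tau>" for \<tau> :: "real \<Rightarrow> real"
    unfolding Ck_lim_def
  proof (intro allI impI)
    fix \<epsilon> :: real assume \<epsilon>: "\<epsilon> > 0"
    obtain B R where BR: "B \<ge> 0" "\<And>z. z \<in> S \<Longrightarrow> \<bar>a \<bullet> z\<bar> \<le> B"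
      "\<And>z h. z \<in> S \<Longrightarrow> \<bar>h\<bar> \<le> 1 \<Longrightarrow> \<bar>(c + h *\<^sub>R a) \<bullet> z + b\<bar> \<le> R"
      using ridge_arg_bound by metis
    obtain M where M: "M \<ge> 0" "\<And>x y. \<bar>x\<bar> \<le> R \<Longrightarrow> \<bar>y\<bar> \<le> R \<Longrightarrow> \<bar>\<tau> x - \<tau> y\<bar> \<le> M * \<bar>x - y\<bar>"
      using real_smooth_Lipschitz[OF \<tau>] by metis
    define d where "d = min 1 (\<epsilon> / (M * B + 1))"
    have p: "M * B + 1 > 0" using M(1) BR(1) by (simp add: add_nonneg_pos)
    have d: "d > 0" using \<epsilon> p by (simp add: d_def)
    have "d * (M * B + 1) \<le> \<epsilon>" using p by (simp add: d_def min_le_iff_disj pos_le_divide_eq[symmetric])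
    then have d': "d * (M * B) \<le> \<epsilon>" using d by (simp add: distrib_left)
    show "\<forall>\<^sub>F h in at 0. Ck_close 0 S \<epsilon> (\<lambda>z. \<tau> ((c + h *\<^sub>R a) \<bullet> z + b)) (\<lambda>z. \<tau> (c \<bullet> z + b))"
      using eventually_abs_le_at_0[OF d]
    proof eventually_elim
      case (elim h)
      have h1: "\<bar>h\<bar> \<le> 1" using elim by (auto simp: d_def)
      have "\<bar>\<tau> ((c + h *\<^sub>R a) \<bullet> z + b) - \<tau> (c \<bullet> z + b)\<bar> \<le> \<epsilon>" if z: "z \<in> S" for z
      proof -
        have "\<bar>\<tau> ((c + h *\<^sub>R a) \<bullet> z + b) - \<tau> (c \<bullet> z + b)\<bar> \<le> M * \<bar>h * (a \<bullet> z)\<bar>"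
          using M(2)[OF BR(3)[OF z h1] BR(3)[OF z, of 0, simplified]] by (simp add: inner_add_left)
        also have "\<dots> \<le> M * (d * B)"
          unfolding abs_mult using M(1) elim BR(2)[OF z] d by (intro mult_left_mono mult_mono) auto
        finally show ?thesis using d' by (simp add: ac_simps)
      qed
      then show ?case by simp
    qed
  qed
  show ?thesis
    using assms
  proof (induction k arbitrary: \<tau>)
  case 0 then show ?case by (rule base)
next
  case (Suc k)
  have "Ck_lim (at 0) k S (\<lambda>h. dirder e (\<lambda>z. \<tau> ((c + h *\<^sub>R a) \<bullet> z + b))) (dirder e (\<lambda>z. \<tau> (c \<bullet> z + b)))"
    for e
    unfolding dirder_ridge[OF Suc.prems]
  proof (rule Ck_lim_scale)
    show "((\<lambda>h. (c + h *\<^sub>R a) \<bullet> e) \<longlongrightarrow> c \<bullet> e) (at 0)" by (auto intro!: tendsto_eq_intros)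
    show "Ck_lim (at 0) k S (\<lambda>h z. dirder 1 \<tau> ((c + h *\<^sub>R a) \<bullet> z + b)) (\<lambda>z. dirder 1 \<tau> (c \<bullet> z + b))"
      by (rule Suc.IH[OF smooth_dirder[OF Suc.prems]])
  qed (use Suc.prems S in \<open>auto intro!: smooth_ridge smooth_dirder\<close>)
  then show ?case using base[OF Suc.prems] by (simp add: Ck_lim_Suc)
  qed
qed

text \<open>The quotients are combinations of two neurons. Their derivative in direction e is
  \<open>c \<bullet> e\<close> times the quotient for the derivative of \<tau>, plus
  \<open>a \<bullet> e\<close> times a ridge function, so the induction over k stays within the same
  two families.\<close>

lemma ridge_quotient_lim:
  fixes \<tau> :: "real \<Rightarrow> real"
  assumes "smooth \<tau>"
  shows "Ck_lim (at 0) k S (\<lambda>h z. inverse h * (\<tau> ((c + h *\<^sub>R a) \<bullet> z + b) - \<tau> (c \<bullet> z + b)))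
    (\<lambda>z. (a \<bullet> z) * dirder 1 \<tau> (c \<bullet> z + b))"
proof -
  let ?Q = "\<lambda>\<tau> h z. inverse h * (\<tau> ((c + h *\<^sub>R a) \<bullet> z + b) - \<tau> (c \<bullet> z + b))"
  have base: "Ck_lim (at 0) 0 S (?Q \<tau>) (\<lambda>z. (a \<bullet> z) * dirder 1 \<tau> (c \<bullet> z + b))"
    if \<tau>: "smooth \<tau>" for \<tau> :: "real \<Rightarrow> real"
    unfolding Ck_lim_def
  proof (intro allI impI)
    fix \<epsilon> :: real assume \<epsilon>: "\<epsilon> > 0"
    obtain B R where BR: "B \<ge> 0" "\<And>z. z \<in> S \<Longrightarrow> \<bar>a \<bullet> z\<bar> \<le> B"
      "\<And>z h. z \<in> S \<Longrightarrow> \<bar>h\<bar> \<le> 1 \<Longrightarrow> \<bar>(c + h *\<^sub>R a) \<bullet> z + b\<bar> \<le> R"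
      using ridge_arg_bound by metis
    obtain M where M: "M \<ge> 0"
      "\<And>x h. \<bar>x\<bar> \<le> R \<Longrightarrow> \<bar>x + h\<bar> \<le> R \<Longrightarrow> \<bar>\<tau> (x + h) - \<tau> x - h * dirder 1 \<tau> x\<bar> \<le> M * h\<^sup>2"
      using real_smooth_Taylor1[OF \<tau>] by metis
    define d where "d = min 1 (\<epsilon> / (M * B\<^sup>2 + 1))"
    have p: "M * B\<^sup>2 + 1 > 0" using M(1) BR(1) by (simp add: add_nonneg_pos)
    have d: "d > 0" using \<epsilon> p by (simp add: d_def)
    have "d * (M * B\<^sup>2 + 1) \<le> \<epsilon>" using p by (simp add: d_def min_le_iff_disj pos_le_divide_eq[symmetric])
    then have d': "d * (M * B\<^sup>2) \<le> \<epsilon>" using d by (simp add: distrib_left)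
    show "\<forall>\<^sub>F h in at 0. Ck_close 0 S \<epsilon> (?Q \<tau> h) (\<lambda>z. (a \<bullet> z) * dirder 1 \<tau> (c \<bullet> z + b))"
      using eventually_abs_le_at_0[OF d]
    proof eventually_elim
      case (elim h)
      have h1: "\<bar>h\<bar> \<le> 1" "h \<noteq> 0" using elim by (auto simp: d_def)
      have "\<bar>?Q \<tau> h z - (a \<bullet> z) * dirder 1 \<tau> (c \<bullet> z + b)\<bar> \<le> \<epsilon>" if z: "z \<in> S" for z
      proof -
        let ?x = "c \<bullet> z + b" and ?y = "h * (a \<bullet> z)"
        have eq: "(c + h *\<^sub>R a) \<bullet> z + b = ?x + ?y" by (simp add: inner_add_left)
        have "\<bar>?x\<bar> \<le> R" using BR(3)[OF z, of 0] by simp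
        then have "\<bar>\<tau> (?x + ?y) - \<tau> ?x - ?y * dirder 1 \<tau> ?x\<bar> \<le> M * ?y\<^sup>2"
          using M(2) BR(3)[OF z h1(1)] unfolding eq by blast
        moreover have "?Q \<tau> h z - (a \<bullet> z) * dirder 1 \<tau> ?x
            = inverse h * (\<tau> (?x + ?y) - \<tau> ?x - ?y * dirder 1 \<tau> ?x)"
          unfolding eq using h1(2) by (simp add: field_simps)
        ultimately have "\<bar>?Q \<tau> h z - (a \<bullet> z) * dirder 1 \<tau> ?x\<bar> \<le> \<bar>inverse h\<bar> * (M * ?y\<^sup>2)"
          by (simp add: abs_mult mult_left_mono)
        also have "\<dots> = \<bar>h\<bar> * (M * \<bar>a \<bullet> z\<bar>\<^sup>2)" using h1(2) by (simp add: field_simps power2_eq_square abs_if)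
        also have "\<dots> \<le> d * (M * B\<^sup>2)"
          using elim M(1) BR(2)[OF z] d by (intro mult_mono mult_left_mono power_mono) auto
        finally show ?thesis using d' by simp
      qed
      then show ?case by simp
    qed
  qed
  show ?thesis
    using assms
  proof (induction k arbitrary: \<tau>)
  case 0 then show ?case by (rule base)
next
  case (Suc k)
  have sm: "smooth (?Q \<tau> h)" if "smooth \<tau>" for \<tau> h
    by (rule smooth_cmult[OF smooth_diff[OF smooth_ridge[OF that] smooth_ridge[OF that]]])
  note D = smooth_dirder[OF Suc.prems, of 1]
  note DD = smooth_mult[OF smooth_inner smooth_ridge[OF smooth_dirder[OF D]]]
  have "Ck_lim (at 0) k S (\<lambda>h. dirder e (?Q \<tau> h)) (dirder e (\<lambda>z. (a \<bullet> z) * dirder 1 \<tau> (c \<bullet> z + b)))"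
    for e
  proof -
    have "Ck_lim (at 0) k S (\<lambda>h z. (c \<bullet> e) * ?Q (dirder 1 \<tau>) h z + (a \<bullet> e) * dirder 1 \<tau> ((c + h *\<^sub>R a) \<bullet> z + b))
      (\<lambda>z. (c \<bullet> e) * ((a \<bullet> z) * dirder 1 (dirder 1 \<tau>) (c \<bullet> z + b)) + (a \<bullet> e) * dirder 1 \<tau> (c \<bullet> z + b))"
      by (rule Ck_lim_add[OF smooth_cmult[OF sm[OF D]] smooth_cmult[OF smooth_ridge[OF D]]
            smooth_cmult[OF DD] smooth_cmult[OF smooth_ridge[OF D]]
            Ck_lim_mult[OF sm[OF D] DD smooth_const S Suc.IH[OF D]]
            Ck_lim_mult[OF smooth_ridge[OF D] smooth_ridge[OF D] smooth_const S ridge_lim[OF D]]])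
    \<comment> \<open>The identity cancels h against its inverse, hence it is claimed only
      eventually, for nonzero h.\<close>
    moreover have "\<forall>\<^sub>F h in at 0. (\<lambda>z. (c \<bullet> e) * ?Q (dirder 1 \<tau>) h z + (a \<bullet> e) * dirder 1 \<tau> ((c + h *\<^sub>R a) \<bullet> z + b))
        = dirder e (?Q \<tau> h)"
      using eventually_abs_le_at_0[OF zero_less_one]
    proof eventually_elim
      case (elim h)
      have "dirder e (?Q \<tau> h) = (\<lambda>z. inverse h * (((c + h *\<^sub>R a) \<bullet> e) * dirder 1 \<tau> ((c + h *\<^sub>R a) \<bullet> z + b)
            - (c \<bullet> e) * dirder 1 \<tau> (c \<bullet> z + b)))"
        using Suc.prems
        by (simp only: smooth_dirder_cmult smooth_dirder_diff smooth_diff smooth_ridge dirder_ridge)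
      then show ?case using elim by (auto simp: fun_eq_iff inner_add_left field_simps)
    qed
    moreover have "dirder e (\<lambda>z. (a \<bullet> z) * dirder 1 \<tau> (c \<bullet> z + b)) =
      (\<lambda>z. (c \<bullet> e) * ((a \<bullet> z) * dirder 1 (dirder 1 \<tau>) (c \<bullet> z + b)) + (a \<bullet> e) * dirder 1 \<tau> (c \<bullet> z + b))"
      by (subst smooth_dirder_mult)
        (auto simp: smooth_inner smooth_ridge smooth_dirder Suc.prems dirder_ridge)
    ultimately show ?thesis by (simp add: Ck_lim_cong)
  qed
  then show ?case using base[OF Suc.prems] by (simp add: Ck_lim_Suc)
  qed
qed

end

section \<open>Shallow networks and products of linear forms\<close>

text \<open>Adding neurons one at a time makes closure under sums and multiples an induction; lists
  of weights appear only in the passage to \<open>network_class\<close>.\<close>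

inductive_set shallow :: "(real \<Rightarrow> real) \<Rightarrow> ('a::euclidean_space \<Rightarrow> real) set" for \<sigma> where
  const: "(\<lambda>_. c) \<in> shallow \<sigma>"
| neuron: "f \<in> shallow \<sigma> \<Longrightarrow> (\<lambda>z. a * \<sigma> (w \<bullet> z + b) + f z) \<in> shallow \<sigma>"

lemma shallow_smooth: "f \<in> shallow \<sigma> \<Longrightarrow> smooth \<sigma> \<Longrightarrow> smooth f"
  by (induction rule: shallow.induct) (auto intro!: smooth_add smooth_cmult smooth_ridge)

lemma shallow_add: "f \<in> shallow \<sigma> \<Longrightarrow> g \<in> shallow \<sigma> \<Longrightarrow> (\<lambda>z. f z + g z) \<in> shallow \<sigma>"
proof (induction rule: shallow.induct)
  case (const c)
  from const show ?case
  proof (induction rule: shallow.induct)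
    case (neuron f a w b)
    have "(\<lambda>z. c + (a * \<sigma> (w \<bullet> z + b) + f z)) = (\<lambda>z. a * \<sigma> (w \<bullet> z + b) + (c + f z))" by auto
    then show ?case using shallow.neuron[OF neuron.IH] by simp
  qed (auto intro: shallow.const)
next
  case (neuron f a w b)
  then show ?case using shallow.neuron[OF neuron.IH] by (simp add: add.assoc)
qed

lemma shallow_cmult: "f \<in> shallow \<sigma> \<Longrightarrow> (\<lambda>z. c * f z) \<in> shallow \<sigma>"
proof (induction rule: shallow.induct)
  case (neuron f a w b)
  have "(\<lambda>z. c * (a * \<sigma> (w \<bullet> z + b) + f z)) = (\<lambda>z. (c * a) * \<sigma> (w \<bullet> z + b) + c * f z)"
    by (auto simp: algebra_simps)
  then show ?case using shallow.neuron[OF neuron.IH] by simp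
qed (auto intro: shallow.const)

lemma shallow_network:
  assumes "f \<in> shallow \<sigma>"
  shows "\<exists>N. f \<in> network_class \<sigma> N"
proof -
  have "\<exists>L c c0. length c = length L \<and>
      f = (\<lambda>z. (\<Sum>i<length L. c ! i * \<sigma> (fst (L ! i) \<bullet> z + snd (L ! i))) + c0)"
    using assms
  proof (induction rule: shallow.induct)
    case (const c)
    then show ?case by (intro exI[of _ "[]"] exI[of _ c]) auto
  next
    case (neuron f a w b)
    then obtain L c c0 where "length c = length L"
      "f = (\<lambda>z. (\<Sum>i<length L. c ! i * \<sigma> (fst (L ! i) \<bullet> z + snd (L ! i))) + c0)" by blast
    then show ?case
      by (intro exI[of _ "(w, b) # L"] exI[of _ "a # c"] exI[of _ c0])
        (simp add: sum.lessThan_Suc_shift algebra_simps del: sum.lessThan_Suc)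
  qed
  then obtain L c c0 where L: "length c = length L"
    and f: "f = (\<lambda>z. (\<Sum>i<length L. c ! i * \<sigma> (fst (L ! i) \<bullet> z + snd (L ! i))) + c0)" by blast
  \<comment> \<open>One hidden layer and an empty list of further layers.\<close>
  have "net_eval \<sigma> (L, [], (c, c0)) = f"
    unfolding f by (rule ext) (auto simp: affine_list_def case_prod_beta intro!: sum.cong)
  moreover have "net_wf (L, [], (c, c0))" using L by simp
  ultimately show ?thesis unfolding network_class_def by blast
qed

text \<open>The remainder in Maclaurin's formula of order n is zero. Contraposition provides, for
  each order, a bias at which the derivative of \<sigma> does not vanish.\<close>

lemma polynomial_fun_if_derivative_vanishes:
  assumes "smooth \<sigma>" "\<And>x. ((dirder 1 ^^ n) \<sigma>) x = 0"
  shows "polynomial_fun \<sigma>"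
proof -
  have sm: "smooth ((dirder 1 ^^ m) \<sigma>)" for m
    by (induction m) (auto intro: smooth_dirder assms)
  have D: "\<forall>m x. DERIV ((dirder 1 ^^ m) \<sigma>) x :> (dirder 1 ^^ Suc m) \<sigma> x"
    by (auto intro!: real_has_derivative_dirder smooth_differentiable sm)
  define p where "p = (\<Sum>m<n. monom ((dirder 1 ^^ m) \<sigma> 0 / fact m) m)"
  have "\<sigma> x = poly p x" for x
    using Maclaurin_all_le[OF _ D, of \<sigma> x n] assms(2)
    by (auto simp: p_def poly_sum poly_monom)
  then show ?thesis by (auto simp: polynomial_fun_def)
qed

definition shallow_approx ::
  "(real \<Rightarrow> real) \<Rightarrow> nat \<Rightarrow> 'a::euclidean_space set \<Rightarrow> ('a \<Rightarrow> real) \<Rightarrow> bool" where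
  "shallow_approx \<sigma> k S f \<longleftrightarrow> smooth f \<and> (\<forall>\<epsilon>>0. \<exists>g\<in>shallow \<sigma>. Ck_close k S \<epsilon> g f)"

text \<open>Products of arbitrary linear forms instead of monomials in coordinates: each factor
  corresponds to one differentiation in the weight, along that vector.\<close>

definition linmon :: "'a::euclidean_space list \<Rightarrow> 'a \<Rightarrow> real" where
  "linmon as z = prod_list (map (\<lambda>a. a \<bullet> z) as)"

inductive_set linmon_span :: "('a::euclidean_space \<Rightarrow> real) set" where
  zero: "(\<lambda>_. 0) \<in> linmon_span"
| step: "f \<in> linmon_span \<Longrightarrow> (\<lambda>z. c * linmon as z + f z) \<in> linmon_span"

lemma linmon_span_add: "f \<in> linmon_span \<Longrightarrow> g \<in> linmon_span \<Longrightarrow> (\<lambda>z. f z + g z) \<in> linmon_span"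
  by (induction rule: linmon_span.induct) (auto simp: add.assoc intro: linmon_span.step)

lemma linmon_span_mult_const: "f \<in> linmon_span \<Longrightarrow> (\<lambda>z. c * f z) \<in> linmon_span"
  by (induction rule: linmon_span.induct)
    (auto simp: distrib_left mult.assoc[symmetric] intro: linmon_span.intros)

lemma linmon_span_mult_inner: "f \<in> linmon_span \<Longrightarrow> (\<lambda>z. (a \<bullet> z) * f z) \<in> linmon_span"
proof (induction rule: linmon_span.induct)
  case (step f c as)
  have "(\<lambda>z. (a \<bullet> z) * (c * linmon as z + f z)) = (\<lambda>z. c * linmon (a # as) z + (a \<bullet> z) * f z)"
    by (auto simp: linmon_def algebra_simps)
  then show ?case using linmon_span.step[OF step.IH] by simp
qed (simp add: linmon_span.zero)

text \<open>The induction is over operators: multiplication by p maps the span to itself. Products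
  of polynomials then become compositions, and applying the operator to the constant 1 gives the
  claim.\<close>

lemma polynomial_in_linmon_span:
  assumes "real_polynomial_function (p :: 'a::euclidean_space \<Rightarrow> real)"
  shows "p \<in> linmon_span"
proof -
  have H: "\<forall>q\<in>linmon_span. (\<lambda>z. p z * q z) \<in> linmon_span"
    using assms
  proof (induction rule: real_polynomial_function.induct)
    case (linear f)
    have "f z = (\<Sum>e\<in>Basis. f e *\<^sub>R e) \<bullet> z" for z
    proof -
      interpret bounded_linear f by (rule linear)
      have "f (\<Sum>e\<in>Basis. (z \<bullet> e) *\<^sub>R e) = (\<Sum>e\<in>Basis. f e *\<^sub>R e) \<bullet> z"
        unfolding sum scaleR inner_sum_left by (simp add: inner_commute mult.commute)
      then show ?thesis by (simp only: euclidean_representation)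
    qed
    then have "f = (\<lambda>z. (\<Sum>e\<in>Basis. f e *\<^sub>R e) \<bullet> z)" by blast
    then show ?case using linmon_span_mult_inner by metis
  next
    case (const c)
    then show ?case by (blast intro: linmon_span_mult_const)
  next
    case (add f g)
    show ?case
    proof
      fix q :: "'a \<Rightarrow> real" assume q: "q \<in> linmon_span"
      show "(\<lambda>z. (f z + g z) * q z) \<in> linmon_span"
        using linmon_span_add[OF bspec[OF add.IH(1) q] bspec[OF add.IH(2) q]] by (simp add: distrib_right)
    qed
  next
    case (mult f g)
    show ?case
    proof
      fix q :: "'a \<Rightarrow> real" assume "q \<in> linmon_span"
      then have "(\<lambda>z. f z * (g z * q z)) \<in> linmon_span"
        using bspec[OF mult.IH(1) bspec[OF mult.IH(2)]] by simp
      then show "(\<lambda>z. (f z * g z) * q z) \<in> linmon_span" by (simp add: mult.assoc)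
    qed
  qed
  have one: "(\<lambda>z::'a. 1) \<in> linmon_span"
    using linmon_span.step[OF linmon_span.zero, of 1 "[]"] by (simp add: linmon_def)
  show ?thesis using bspec[OF H one] by simp
qed

context
  fixes \<sigma> :: "real \<Rightarrow> real" and k :: nat and S :: "'a::euclidean_space set"
  assumes \<sigma>: "smooth \<sigma>" and S: "bounded S"
begin

abbreviation "approximable \<equiv> shallow_approx \<sigma> k S"

lemma approximable_smooth: "approximable f \<Longrightarrow> smooth f"
  by (simp add: shallow_approx_def)

lemma approximable_shallow: "f \<in> shallow \<sigma> \<Longrightarrow> approximable f"
  unfolding shallow_approx_def
  using shallow_smooth[OF _ \<sigma>, of f] Ck_close_refl[OF less_imp_le, of _ k S f] by blast

lemma approximable_add:
  assumes "approximable f" "approximable g"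
  shows "approximable (\<lambda>z. f z + g z)"
  unfolding shallow_approx_def
proof (intro conjI allI impI)
  show "smooth (\<lambda>z. f z + g z)" using assms approximable_smooth smooth_add by blast
  fix \<epsilon> :: real assume "\<epsilon> > 0"
  then obtain f' g' where "f' \<in> shallow \<sigma>" "g' \<in> shallow \<sigma>"
    "Ck_close k S (\<epsilon>/2) f' f" "Ck_close k S (\<epsilon>/2) g' g"
    using assms unfolding shallow_approx_def by (meson half_gt_zero)
  then have "(\<lambda>z. f' z + g' z) \<in> shallow \<sigma>" "Ck_close k S (\<epsilon>/2 + \<epsilon>/2) (\<lambda>z. f' z + g' z) (\<lambda>z. f z + g z)"
    using shallow_add Ck_close_add[OF shallow_smooth[OF _ \<sigma>] approximable_smooth[OF assms(1)]
        shallow_smooth[OF _ \<sigma>] approximable_smooth[OF assms(2)]] by blast+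
  then show "\<exists>h\<in>shallow \<sigma>. Ck_close k S \<epsilon> h (\<lambda>z. f z + g z)" by auto
qed

lemma approximable_cmult:
  assumes "approximable f"
  shows "approximable (\<lambda>z. c * f z)"
  unfolding shallow_approx_def
proof (intro conjI allI impI)
  show "smooth (\<lambda>z. c * f z)" using assms approximable_smooth smooth_cmult by blast
  fix \<epsilon> :: real assume \<epsilon>: "\<epsilon> > 0"
  let ?d = "\<epsilon> / (\<bar>c\<bar> + 1)"
  have d: "?d > 0" "\<bar>c\<bar> * ?d \<le> \<epsilon>" using \<epsilon> by (auto simp: field_simps)
  then obtain f' where f': "f' \<in> shallow \<sigma>" "Ck_close k S ?d f' f"
    using assms unfolding shallow_approx_def by blast
  then have "Ck_close k S \<epsilon> (\<lambda>z. c * f' z) (\<lambda>z. c * f z)"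
    using Ck_close_mono[OF Ck_close_cmult[OF shallow_smooth[OF _ \<sigma>] approximable_smooth[OF assms]] d(2)] by blast
  then show "\<exists>h\<in>shallow \<sigma>. Ck_close k S \<epsilon> h (\<lambda>z. c * f z)" using f' shallow_cmult by blast
qed

lemma approximable_close:
  assumes "smooth f" "\<And>\<epsilon>. \<epsilon> > 0 \<Longrightarrow> \<exists>g. approximable g \<and> Ck_close k S \<epsilon> g f"
  shows "approximable f"
  unfolding shallow_approx_def
proof (intro conjI allI impI assms(1))
  fix \<epsilon> :: real assume "\<epsilon> > 0"
  then obtain g where "approximable g" "Ck_close k S (\<epsilon>/2) g f" using assms(2)[of "\<epsilon>/2"] by auto
  moreover from this(1) obtain h where "h \<in> shallow \<sigma>" "Ck_close k S (\<epsilon>/2) h g"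
    using \<open>\<epsilon> > 0\<close> unfolding shallow_approx_def by (meson half_gt_zero)
  ultimately show "\<exists>h\<in>shallow \<sigma>. Ck_close k S \<epsilon> h f"
    using Ck_close_trans[of k S "\<epsilon>/2" h g "\<epsilon>/2" f] by auto
qed

lemma approximable_lim:
  assumes "smooth f" "\<forall>\<^sub>F h in F. approximable (g h)" "F \<noteq> bot" "Ck_lim F k S g f"
  shows "approximable f"
proof (rule approximable_close[OF assms(1)])
  fix \<epsilon> :: real assume "\<epsilon> > 0"
  then have "\<forall>\<^sub>F h in F. Ck_close k S \<epsilon> (g h) f" using assms(4) by (simp add: Ck_lim_def)
  then have "\<forall>\<^sub>F h in F. approximable (g h) \<and> Ck_close k S \<epsilon> (g h) f"
    using assms(2) by eventually_elim simp
  then show "\<exists>g. approximable g \<and> Ck_close k S \<epsilon> g f"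
    using eventually_happens assms(3) by blast
qed

lemma smooth_linmon: "smooth (linmon (as :: 'a list))"
proof (induction as)
  case Nil
  have "linmon ([] :: 'a list) = (\<lambda>_. 1)" by (auto simp: linmon_def)
  then show ?case by simp
next
  case (Cons a as)
  have "linmon (a # as) = (\<lambda>z. (a \<bullet> z) * linmon as z)" by (auto simp: linmon_def)
  then show ?case using smooth_mult[OF smooth_inner Cons] by simp
qed

text \<open>Differentiating in the weight \<open>c\<close> in direction \<open>a\<close> multiplies by \<open>a \<bullet> z\<close>.\<close>

lemma approximable_linmon_ridge:
  "approximable (\<lambda>z. linmon as z * (dirder 1 ^^ length as) \<sigma> (c \<bullet> z + b))"
proof (induction as arbitrary: c b)
  case Nil
  have "(\<lambda>z::'a. 1 * \<sigma> (c \<bullet> z + b) + 0) \<in> shallow \<sigma>" by (rule shallow.neuron) (rule shallow.const)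
  then show ?case by (auto simp: linmon_def intro: approximable_shallow)
next
  case (Cons a as)
  define \<tau> where "\<tau> = (dirder 1 ^^ length as) \<sigma>"
  have \<tau>: "smooth \<tau>"
  proof -
    have "smooth ((dirder 1 ^^ n) \<sigma>)" for n
      by (induction n) (auto intro: smooth_dirder \<sigma>)
    then show ?thesis by (simp add: \<tau>_def)
  qed
  let ?Q = "\<lambda>h z. inverse h * (\<tau> ((c + h *\<^sub>R a) \<bullet> z + b) - \<tau> (c \<bullet> z + b))"
  have "approximable (\<lambda>z. linmon as z * ((a \<bullet> z) * dirder 1 \<tau> (c \<bullet> z + b)))"
  proof (rule approximable_lim)
    show "Ck_lim (at 0) k S (\<lambda>h z. linmon as z * ?Q h z)
        (\<lambda>z. linmon as z * ((a \<bullet> z) * dirder 1 \<tau> (c \<bullet> z + b)))"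
      by (rule Ck_lim_mult[OF smooth_cmult[OF smooth_diff[OF smooth_ridge[OF \<tau>] smooth_ridge[OF \<tau>]]]
            smooth_mult[OF smooth_inner smooth_ridge[OF smooth_dirder[OF \<tau>]]]
            smooth_linmon S ridge_quotient_lim[OF S \<tau>]])
    show "smooth (\<lambda>z. linmon as z * ((a \<bullet> z) * dirder 1 \<tau> (c \<bullet> z + b)))"
      by (rule smooth_mult[OF smooth_linmon smooth_mult[OF smooth_inner smooth_ridge[OF smooth_dirder[OF \<tau>]]]])
    \<comment> \<open>The induction hypothesis is used at the two weights of the difference
      quotient, which is why it is generalised over c.\<close>
    have "(\<lambda>z. linmon as z * ?Q h z) = (\<lambda>z. inverse h * (linmon as z * \<tau> ((c + h *\<^sub>R a) \<bullet> z + b))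
       + (- inverse h) * (linmon as z * \<tau> (c \<bullet> z + b)))" for h
      by (auto simp: algebra_simps)
    then have "approximable (\<lambda>z. linmon as z * ?Q h z)" for h
      using approximable_add[OF approximable_cmult[OF Cons.IH] approximable_cmult[OF Cons.IH], of "inverse h" "c + h *\<^sub>R a" b "- inverse h" c b]
      by (simp add: \<tau>_def)
    then show "\<forall>\<^sub>F h in at 0. approximable (\<lambda>z. linmon as z * ?Q h z)" by simp
  qed simp
  then show ?case by (simp add: \<tau>_def linmon_def ac_simps)
qed

text \<open>At weight 0 the ridge factor is a constant, and b can be chosen so that it is nonzero;
  dividing by it leaves the product of linear forms.\<close>

lemma approximable_linmon:
  assumes "\<not> polynomial_fun \<sigma>"
  shows "approximable (linmon as)"
proof -
  obtain b where b: "(dirder 1 ^^ length as) \<sigma> b \<noteq> 0"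
    using assms polynomial_fun_if_derivative_vanishes[OF \<sigma>] by blast
  have "approximable (\<lambda>z. inverse ((dirder 1 ^^ length as) \<sigma> b) * (linmon as z * (dirder 1 ^^ length as) \<sigma> (0 \<bullet> z + b)))"
    by (rule approximable_cmult[OF approximable_linmon_ridge])
  moreover have "(\<lambda>z. inverse ((dirder 1 ^^ length as) \<sigma> b) * (linmon as z * (dirder 1 ^^ length as) \<sigma> (0 \<bullet> z + b)))
      = linmon as"
    using b by (auto simp: field_simps)
  ultimately show ?thesis by simp
qed

lemma approximable_polynomial:
  assumes "\<not> polynomial_fun \<sigma>" "real_polynomial_function p"
  shows "approximable p"
proof -
  have "p \<in> linmon_span" by (rule polynomial_in_linmon_span[OF assms(2)])
  then show ?thesis
  proof (induction rule: linmon_span.induct)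
    case zero
    show ?case by (rule approximable_shallow) (rule shallow.const)
  next
    case (step f c as)
    then show ?case using approximable_add[OF approximable_cmult[OF approximable_linmon[OF assms(1)]]] by simp
  qed
qed

end

section \<open>Mollification\<close>

lemma test_function_dirder: "test_function \<Omega> f \<Longrightarrow> test_function \<Omega> (dirder v f)"
  unfolding test_function_def
  by (metis smooth_dirder dirder_support compact_imp_closed)

lemma test_function_UNIV: "test_function \<Omega> f \<Longrightarrow> test_function UNIV f"
  unfolding test_function_def by blast

lemma test_function_smooth: "test_function \<Omega> f \<Longrightarrow> smooth f"
  by (simp add: test_function_def)

lemma test_function_continuous: "test_function \<Omega> f \<Longrightarrow> continuous_on S f"
  by (simp add: smooth_continuous test_function_def)

lemma smooth_borel: "smooth f \<Longrightarrow> f \<in> borel_measurable borel"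
  by (intro borel_measurable_continuous_onI smooth_continuous)

lemma test_function_borel: "test_function \<Omega> f \<Longrightarrow> f \<in> borel_measurable borel"
  by (intro smooth_borel test_function_smooth)

lemma test_function_ball:
  assumes "test_function \<Omega> f"
  obtains R where "R > 0" "\<And>x. norm x > R \<Longrightarrow> f x = 0"
proof -
  obtain K where K: "compact K" "\<And>x. x \<notin> K \<Longrightarrow> f x = 0" using assms by (auto simp: test_function_def)
  obtain R where "R > 0" "\<And>x. x \<in> K \<Longrightarrow> norm x \<le> R"
    using compact_imp_bounded[OF K(1)] by (auto simp: bounded_pos)
  then show ?thesis using that K(2) by (meson not_le)
qed

lemma test_function_bounded:
  assumes "test_function \<Omega> f"
  obtains B where "B \<ge> 0" "\<And>x. \<bar>f x\<bar> \<le> B"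
proof -
  obtain R where R: "R > 0" "\<And>x. norm x > R \<Longrightarrow> f x = 0" using test_function_ball[OF assms] by metis
  obtain B where B: "B \<ge> 0" "\<And>x. x \<in> cball 0 R \<Longrightarrow> \<bar>f x\<bar> \<le> B"
    using smooth_bounded_on[OF test_function_smooth[OF assms] bounded_cball] by metis
  have "\<bar>f x\<bar> \<le> B" for x
    using B R(2)[of x] by (cases "norm x \<le> R") auto
  then show ?thesis using that B(1) by blast
qed

lemma test_function_uniformly_continuous:
  assumes "test_function \<Omega> f" "\<epsilon> > 0"
  obtains \<delta> where "\<delta> > 0" "\<And>x y. dist x y < \<delta> \<Longrightarrow> \<bar>f x - f y\<bar> < \<epsilon>"
proof -
  obtain R where R: "R > 0" "\<And>x. norm x > R \<Longrightarrow> f x = 0" using test_function_ball[OF assms(1)] by metis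
  \<comment> \<open>With radius \<open>R + 1\<close> and distances below 1, two points either both
    lie in this ball or both have norm above R, where f vanishes.\<close>
  have "uniformly_continuous_on (cball 0 (R + 1)) f"
    by (intro compact_uniformly_continuous test_function_continuous[OF assms(1)]) auto
  then obtain d where d: "d > 0"
    "\<And>x y. x \<in> cball 0 (R + 1) \<Longrightarrow> y \<in> cball 0 (R + 1) \<Longrightarrow> dist x y < d \<Longrightarrow> dist (f x) (f y) < \<epsilon>"
    unfolding uniformly_continuous_on_def using assms(2) by metis
  have "\<bar>f x - f y\<bar> < \<epsilon>" if xy: "dist x y < min d 1" for x y
  proof (cases "norm x \<le> R + 1 \<and> norm y \<le> R + 1")
    case True
    then show ?thesis using d(2)[of x y] xy by (simp add: dist_real_def)
  next
    case False
    have "norm x \<le> norm y + dist x y" "norm y \<le> norm x + dist x y"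
      using norm_triangle_sub[of x y] norm_triangle_sub[of y x] by (simp_all add: dist_norm norm_minus_commute)
    then have "norm x > R" "norm y > R" using False xy by auto
    then show ?thesis using R(2) assms(2) by simp
  qed
  then show ?thesis using that[of "min d 1"] d(1) by simp
qed

text \<open>Uniformity in the base point lets the difference quotient pass under the convolution
  integral against a merely integrable function.\<close>

lemma test_function_uniformly_differentiable:
  assumes f: "test_function \<Omega> f" and "\<epsilon> > 0"
  obtains \<delta> where "\<delta> > 0"
    "\<And>y h. norm h < \<delta> \<Longrightarrow> \<bar>f (y + h) - f y - dirder h f y\<bar> \<le> \<epsilon> * norm h"
proof -
  let ?n = "real DIM('a)"
  have e: "\<epsilon> / ?n > 0" using assms(2) by simp
  have "\<forall>b. \<exists>d>0. \<forall>x y. dist x y < d \<longrightarrow> \<bar>dirder b f x - dirder b f y\<bar> < \<epsilon> / ?n"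
    using test_function_uniformly_continuous[OF test_function_dirder[OF f] e] by metis
  then obtain d where d: "\<And>b. d b > 0"
    "\<And>b x y. dist x y < d b \<Longrightarrow> \<bar>dirder b f x - dirder b f y\<bar> < \<epsilon> / ?n" by metis
  define D where "D = Min (d ` Basis)"
  have D: "D > 0" "\<And>b. b \<in> Basis \<Longrightarrow> D \<le> d b" using d(1) by (auto simp: D_def)
  have "\<bar>f (y + h) - f y - dirder h f y\<bar> \<le> \<epsilon> * norm h" if h: "norm h < D" for y h
  proof -
    have "norm (f (y + h) - f y - (\<lambda>v. dirder v f y) ((y + h) - y)) \<le> norm ((y + h) - y) * \<epsilon>"
    proof (rule differentiable_bound_linearization[where S = "ball y D" and f' = "\<lambda>x v. dirder v f x"])
      show "y + t *\<^sub>R ((y + h) - y) \<in> ball y D" if "t \<in> {0..1}" for t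
      proof -
        have "\<bar>t\<bar> * norm h \<le> 1 * norm h" using that by (intro mult_right_mono) auto
        then show ?thesis using h by (simp add: dist_norm)
      qed
      show "(f has_derivative (\<lambda>v. dirder v f x)) (at x within ball y D)" for x
        using smooth_has_derivative[OF test_function_smooth[OF f]] by (rule has_derivative_at_withinI)
      show "onorm ((\<lambda>v. dirder v f x) - (\<lambda>v. dirder v f y)) \<le> \<epsilon>" if x: "x \<in> ball y D" for x
      proof (rule onorm_bound)
        fix v
        have dif: "f differentiable (at z)" for z
          by (rule smooth_differentiable[OF test_function_smooth[OF f]])
        have "((\<lambda>v. dirder v f x) - (\<lambda>v. dirder v f y)) v
            = (\<Sum>b\<in>Basis. (v \<bullet> b) * (dirder b f x - dirder b f y))"
          using dirder_Basis_sum[OF dif, of v x] dirder_Basis_sum[OF dif, of v y]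
          by (simp add: sum_subtractf right_diff_distrib)
        also have "norm \<dots> \<le> (\<Sum>b\<in>(Basis :: 'a set). norm v * (\<epsilon> / ?n))"
        proof (rule order_trans[OF norm_sum sum_mono])
          fix b :: 'a assume b: "b \<in> Basis"
          have "dist x y < d b" using x D(2)[OF b] by (simp add: dist_commute)
          then show "norm ((v \<bullet> b) * (dirder b f x - dirder b f y)) \<le> norm v * (\<epsilon> / ?n)"
            unfolding real_norm_def abs_mult using Basis_le_norm[OF b, of v] d(2)[of x y b]
            by (intro mult_mono) auto
        qed
        also have "\<dots> = \<epsilon> * norm v" by simp
        finally show "norm (((\<lambda>v. dirder v f x) - (\<lambda>v. dirder v f y)) v) \<le> \<epsilon> * norm v" .
      qed (use assms(2) in simp)
    qed (use D(1) in auto)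
    then show ?thesis by (simp add: mult.commute)
  qed
  then show ?thesis using that D(1) by blast
qed

section \<open>Convolution and rescaled kernels\<close>

text \<open>The roles are asymmetric: the first factor carries all derivatives, the second is the
  rough function.\<close>

definition conv :: "('a::euclidean_space \<Rightarrow> real) \<Rightarrow> ('a \<Rightarrow> real) \<Rightarrow> 'a \<Rightarrow> real" where
  "conv f g z = (\<integral>\<zeta>. f (z - \<zeta>) * g \<zeta> \<partial>lborel)"

context
  fixes f g :: "'a::euclidean_space \<Rightarrow> real"
  assumes f: "test_function UNIV f" and g: "integrable lborel g"
begin

lemma conv_integrable: "integrable lborel (\<lambda>\<zeta>. f (z - \<zeta>) * g \<zeta>)"
proof -
  obtain B where B: "B \<ge> 0" "\<And>x. \<bar>f x\<bar> \<le> B" using test_function_bounded[OF f] by metis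
  have [measurable]: "f \<in> borel_measurable borel" by (rule test_function_borel[OF f])
  show ?thesis
  proof (rule Bochner_Integration.integrable_bound)
    show "integrable lborel (\<lambda>\<zeta>. B * g \<zeta>)" using g by simp
    show "AE \<zeta> in lborel. norm (f (z - \<zeta>) * g \<zeta>) \<le> norm (B * g \<zeta>)"
      using B by (auto simp: abs_mult intro!: mult_right_mono)
  qed (use g in measurable)
qed

end

lemma conv_has_derivative:
  fixes f g :: "'a::euclidean_space \<Rightarrow> real"
  assumes f: "test_function UNIV f" and g: "integrable lborel g"
  shows "(conv f g has_derivative (\<lambda>v. conv (dirder v f) g z)) (at z)"
  unfolding has_derivative_at_alt
proof
  note I = conv_integrable[OF f g] conv_integrable[OF test_function_dirder[OF f] g]
  have dl: "linear (\<lambda>v. dirder v f x)" for x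
    by (rule dirder_linear[OF smooth_differentiable[OF test_function_smooth[OF f]]])
  have "linear (\<lambda>v. conv (dirder v f) g z)"
    unfolding conv_def
    using I by (intro linearI) (simp_all add: linear_add[OF dl] linear_cmul[OF dl] distrib_right mult.assoc)
  then show "bounded_linear (\<lambda>v. conv (dirder v f) g z)" by (simp add: linear_conv_bounded_linear)
  show "\<forall>e>0. \<exists>d>0. \<forall>y. norm (y - z) < d \<longrightarrow>
      norm (conv f g y - conv f g z - conv (dirder (y - z) f) g z) \<le> e * norm (y - z)"
  proof (intro allI impI)
    fix e :: real assume e: "e > 0"
    define G where "G = (\<integral>\<zeta>. \<bar>g \<zeta>\<bar> \<partial>lborel)"
    have G: "G \<ge> 0" by (simp add: G_def)
    \<comment> \<open>The pointwise remainder is integrated against the absolute value of g, so the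
      tolerance is divided by its mass G; adding 1 excludes a zero divisor.\<close>
    have "e / (G + 1) > 0" using e G by simp
    from test_function_uniformly_differentiable[OF f this]
    obtain d where d: "d > 0"
      "\<And>y h. norm h < d \<Longrightarrow> \<bar>f (y + h) - f y - dirder h f y\<bar> \<le> e / (G + 1) * norm h" by metis
    have "norm (conv f g y - conv f g z - conv (dirder (y - z) f) g z) \<le> e * norm (y - z)"
      if y: "norm (y - z) < d" for y
    proof -
      let ?h = "y - z"
      have eq: "conv f g y - conv f g z - conv (dirder ?h f) g z
          = (\<integral>\<zeta>. (f (y - \<zeta>) - f (z - \<zeta>) - dirder ?h f (z - \<zeta>)) * g \<zeta> \<partial>lborel)"
        using I by (simp add: conv_def left_diff_distrib)
      have "norm \<dots> \<le> (\<integral>\<zeta>. (e / (G + 1) * norm ?h) * \<bar>g \<zeta>\<bar> \<partial>lborel)"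
      proof (rule order_trans[OF integral_norm_bound integral_mono])
        show "integrable lborel (\<lambda>\<zeta>. norm ((f (y - \<zeta>) - f (z - \<zeta>) - dirder ?h f (z - \<zeta>)) * g \<zeta>))"
          using I by (intro integrable_norm) (simp add: left_diff_distrib)
        show "integrable lborel (\<lambda>\<zeta>. (e / (G + 1) * norm ?h) * \<bar>g \<zeta>\<bar>)"
          using g by (intro integrable_mult_right integrable_abs)
        fix \<zeta>
        have "\<bar>f ((z - \<zeta>) + ?h) - f (z - \<zeta>) - dirder ?h f (z - \<zeta>)\<bar> \<le> e / (G + 1) * norm ?h"
          by (rule d(2)[OF y])
        from mult_right_mono[OF this abs_ge_zero[of "g \<zeta>"]]
        show "norm ((f (y - \<zeta>) - f (z - \<zeta>) - dirder ?h f (z - \<zeta>)) * g \<zeta>)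
            \<le> (e / (G + 1) * norm ?h) * \<bar>g \<zeta>\<bar>"
          by (simp add: abs_mult)
      qed
      also have "\<dots> = (e * norm ?h) * (G / (G + 1))" by (simp add: G_def)
      also have "\<dots> \<le> (e * norm ?h) * 1" using e G by (intro mult_left_mono) auto
      finally show ?thesis using eq by simp
    qed
    then show "\<exists>d>0. \<forall>y. norm (y - z) < d \<longrightarrow>
      norm (conv f g y - conv f g z - conv (dirder (y - z) f) g z) \<le> e * norm (y - z)"
      using d(1) by blast
  qed
qed

lemma dirder_conv:
  "test_function UNIV f \<Longrightarrow> integrable lborel g \<Longrightarrow> dirder v (conv f g) = conv (dirder v f) g"
  by (rule ext, rule dirder_eqI, rule conv_has_derivative)

lemma smooth_conv:
  assumes "test_function UNIV f" "integrable lborel g"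
  shows "smooth (conv f g)"
proof (rule smooth_coinduct[of "{conv f g | f. test_function UNIV f}"])
  fix h assume "h \<in> {conv f g | f. test_function UNIV f}"
  then obtain f where f: "h = conv f g" "test_function UNIV f" by blast
  then show "(\<forall>x. h differentiable (at x)) \<and> (\<forall>v. dirder v h \<in> {conv f g | f. test_function UNIV f})"
    using conv_has_derivative[OF f(2) assms(2)] dirder_conv[OF f(2) assms(2)] test_function_dirder[OF f(2)]
    by (auto intro: differentiableI)
qed (use assms in blast)

lemma lborel_integral_affine:
  fixes F :: "'a::euclidean_space \<Rightarrow> real"
  assumes "c \<noteq> 0" and [measurable]: "F \<in> borel_measurable borel"
  shows "(\<integral>x. F x \<partial>lborel) = \<bar>c\<bar> ^ DIM('a) * (\<integral>x. F (t + c *\<^sub>R x) \<partial>lborel)"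
  by (subst lborel_affine[OF assms(1), of t]) (simp add: integral_density integral_distr)

lemma nn_integral_lborel_affine:
  fixes F :: "'a::euclidean_space \<Rightarrow> ennreal"
  assumes "c \<noteq> 0" and [measurable]: "F \<in> borel_measurable borel"
  shows "(\<integral>\<^sup>+x. F x \<partial>lborel) = ennreal (\<bar>c\<bar> ^ DIM('a)) * (\<integral>\<^sup>+x. F (t + c *\<^sub>R x) \<partial>lborel)"
  by (subst lborel_affine[OF assms(1), of t])
    (simp add: nn_integral_density nn_integral_distr nn_integral_cmult ennreal_power)

lemma nn_integral_lborel_shift:
  fixes F :: "'a::euclidean_space \<Rightarrow> ennreal"
  assumes [measurable]: "F \<in> borel_measurable borel"
  shows "(\<integral>\<^sup>+x. F (t + x) \<partial>lborel) = (\<integral>\<^sup>+x. F x \<partial>lborel)"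
  using nn_integral_lborel_affine[of 1 F t] by simp

text \<open>For positive s the power of s keeps the integral of the kernel fixed.\<close>

definition rescale :: "real \<Rightarrow> ('a::euclidean_space \<Rightarrow> real) \<Rightarrow> 'a \<Rightarrow> real" where
  "rescale s J y = J ((1 / s) *\<^sub>R y) / s ^ DIM('a)"

text \<open>Substituting \<open>\<zeta> = z - s *\<^sub>R b\<close> exhibits the convolution as an
  average of values of g at displaced points. The support of J thus decides on which side of z the
  function g is sampled.\<close>

lemma conv_rescale:
  fixes J g :: "'a::euclidean_space \<Rightarrow> real"
  assumes "s > 0" and [measurable]: "J \<in> borel_measurable borel" "g \<in> borel_measurable borel"
  shows "conv (rescale s J) g z = (\<integral>b. J b * g (z - s *\<^sub>R b) \<partial>lborel)"
proof -
  have "conv (rescale s J) g z = \<bar>- s\<bar> ^ DIM('a) * (\<integral>b. rescale s J (z - (z + (- s) *\<^sub>R b)) * g (z + (- s) *\<^sub>R b) \<partial>lborel)"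
    unfolding conv_def using assms(1) by (intro lborel_integral_affine) (auto simp: rescale_def)
  also have "\<dots> = (\<integral>b. s ^ DIM('a) * (rescale s J (z - (z + (- s) *\<^sub>R b)) * g (z + (- s) *\<^sub>R b)) \<partial>lborel)"
    using assms(1) by simp
  also have "\<dots> = (\<integral>b. J b * g (z - s *\<^sub>R b) \<partial>lborel)"
    using assms(1) by (intro Bochner_Integration.integral_cong) (auto simp: rescale_def)
  finally show ?thesis .
qed

lemma test_function_rescale:
  fixes J :: "'a::euclidean_space \<Rightarrow> real"
  assumes J: "test_function UNIV J" and s: "s > 0"
  shows "test_function UNIV (rescale s J)"
proof -
  have "smooth (\<lambda>y. (1 / s ^ DIM('a)) * J ((1 / s) *\<^sub>R y + 0))"
    by (rule smooth_cmult[OF smooth_comp_affine[OF _ test_function_smooth[OF J]]])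
      (simp add: bounded_linear.linear bounded_linear_scaleR_right)
  then have sm: "smooth (rescale s J)" by (simp add: rescale_def[abs_def])
  obtain R where R: "R > 0" "\<And>x. norm x > R \<Longrightarrow> J x = 0" using test_function_ball[OF J] by metis
  have "rescale s J x = 0" if "x \<notin> cball 0 (s * R)" for x
  proof -
    have "norm ((1 / s) *\<^sub>R x) > R" using that s by (simp add: field_simps)
    then show ?thesis unfolding rescale_def by (simp add: R(2))
  qed
  then show ?thesis using sm unfolding test_function_def by (intro conjI exI[of _ "cball 0 (s * R)"]) auto
qed

text \<open>The centre c is free, because near the boundary the kernel has to be supported away from
  the origin, in the direction opposite to the cone.\<close>

lemma mollifier_exists:
  fixes c :: "'a::euclidean_space"
  assumes r: "r > 0"
  obtains J where "test_function UNIV J" "\<And>x. J x \<ge> 0" "(\<integral>x. J x \<partial>lborel) = 1"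
    "integrable lborel J" "\<And>x. x \<notin> cball c r \<Longrightarrow> J x = 0"
proof -
  let ?b = "bump c r"
  have z: "?b x = 0" if "x \<notin> cball c r" for x
    by (rule bump_zero[OF r]) (use that in auto)
  have tf: "test_function UNIV ?b"
    unfolding test_function_def using smooth_bump z by (intro conjI exI[of _ "cball c r"]) auto
  have cont: "continuous_on S ?b" for S by (rule smooth_continuous[OF smooth_bump])
  have "integrable lborel (\<lambda>x. indicator (cball c r) x *\<^sub>R ?b x)"
    using borel_integrable_compact[OF compact_cball cont] by (simp add: set_integrable_def)
  moreover have "(\<lambda>x. indicator (cball c r) x *\<^sub>R ?b x) = ?b"
    using z by (force simp: indicator_def fun_eq_iff)
  ultimately have int: "integrable lborel ?b" by simp
  have "(\<integral>x. ?b x \<partial>lborel) > 0"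
  proof -
    \<comment> \<open>A vanishing integral would make the open ball, on which the bump is positive,
      a null set.\<close>
    have "(\<integral>x. ?b x \<partial>lborel) \<noteq> 0"
    proof
      assume "(\<integral>x. ?b x \<partial>lborel) = 0"
      then have "AE x in lborel. ?b x = 0"
        using integral_nonneg_eq_0_iff_AE[OF int] bump_nonneg by auto
      then have "AE x in lborel. x \<notin> ball c r"
        by eventually_elim (metis bump_pos r less_irrefl)
      then have "ball c r \<in> null_sets lborel"
        using AE_iff_null_sets[of "ball c r" lborel] by simp
      then have "negligible (ball c r)"
        using null_sets_completionI negligible_iff_null_sets by blast
      then show False using r using open_not_negligible[of "ball c r"] by simp
    qed
    moreover have "(\<integral>x. ?b x \<partial>lborel) \<ge> 0" by (simp add: bump_nonneg)
    ultimately show ?thesis by simp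
  qed
  moreover have "smooth (\<lambda>x. ?b x / (\<integral>x. ?b x \<partial>lborel))"
    using smooth_cmult[OF smooth_bump, of "1 / (\<integral>x. ?b x \<partial>lborel)" c r] by simp
  ultimately show ?thesis
    using that[of "\<lambda>x. ?b x / (\<integral>x. ?b x \<partial>lborel)"] tf int z bump_nonneg[of c r]
    by (auto simp: test_function_def)
qed

section \<open>Continuity of translations in the mean square\<close>

text \<open>The factor 2 on squares replaces Minkowski's inequality, so that the estimates stay in
  \<open>ennreal\<close>, without roots and without finiteness conditions.\<close>

lemma L2sq_add_le:
  assumes [measurable]: "f \<in> borel_measurable M" "g \<in> borel_measurable M"
  shows "L2sq M (\<lambda>x. f x + g x) \<le> 2 * L2sq M f + 2 * L2sq M g"
proof -
  have *: "(a + b)\<^sup>2 \<le> 2 * a\<^sup>2 + 2 * b\<^sup>2" for a b :: real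
    using sum_squares_bound[of a b] by (simp add: power2_sum)
  have "L2sq M (\<lambda>x. f x + g x) \<le> (\<integral>\<^sup>+x. 2 * ennreal ((f x)\<^sup>2) + 2 * ennreal ((g x)\<^sup>2) \<partial>M)"
    unfolding L2sq_def
  proof (rule nn_integral_mono)
    fix x
    have "ennreal ((f x + g x)\<^sup>2) \<le> ennreal (2 * (f x)\<^sup>2 + 2 * (g x)\<^sup>2)"
      using *[of "f x" "g x"] by (rule ennreal_leI)
    also have "\<dots> = 2 * ennreal ((f x)\<^sup>2) + 2 * ennreal ((g x)\<^sup>2)"
      by (simp add: ennreal_mult)
    finally show "ennreal ((f x + g x)\<^sup>2) \<le> 2 * ennreal ((f x)\<^sup>2) + 2 * ennreal ((g x)\<^sup>2)" .
  qed
  also have "\<dots> = 2 * L2sq M f + 2 * L2sq M g"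
    unfolding L2sq_def by (simp add: nn_integral_add nn_integral_cmult)
  finally show ?thesis .
qed

lemma L2sq_uminus: "L2sq M (\<lambda>x. - f x) = L2sq M f"
  by (simp add: L2sq_def)

lemma L2sq_diff_le:
  assumes "f \<in> borel_measurable M" "g \<in> borel_measurable M"
  shows "L2sq M (\<lambda>x. f x - g x) \<le> 2 * L2sq M f + 2 * L2sq M g"
  using L2sq_add_le[of f M "\<lambda>x. - g x"] assms by (simp add: L2sq_uminus)

lemma L2sq_cmult:
  assumes "f \<in> borel_measurable M"
  shows "L2sq M (\<lambda>x. c * f x) = ennreal (c\<^sup>2) * L2sq M f"
  using assms by (simp add: L2sq_def power_mult_distrib ennreal_mult nn_integral_cmult)

lemma L2sq_mono: "(\<And>x. x \<in> space M \<Longrightarrow> \<bar>f x\<bar> \<le> \<bar>g x\<bar>) \<Longrightarrow> L2sq M f \<le> L2sq M g"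
  unfolding L2sq_def
  by (rule nn_integral_mono) (auto intro!: ennreal_leI simp: abs_le_square_iff)

lemma L2sq_cong_AE: "AE x in M. f x = g x \<Longrightarrow> L2sq M f = L2sq M g"
  unfolding L2sq_def by (rule nn_integral_cong_AE) auto

lemma L2sq_shift:
  fixes f :: "'a::euclidean_space \<Rightarrow> real"
  assumes [measurable]: "f \<in> borel_measurable borel"
  shows "L2sq lborel (\<lambda>z. f (z + h)) = L2sq lborel f"
  unfolding L2sq_def using nn_integral_lborel_shift[of "\<lambda>z. ennreal ((f z)\<^sup>2)" h]
  by (simp add: add.commute)

text \<open>Phrased with sequences, to match dominated convergence.\<close>

definition translation_cont :: "('a::euclidean_space \<Rightarrow> real) \<Rightarrow> bool" where
  "translation_cont g \<longleftrightarrow> (\<forall>h. h \<longlonglongrightarrow> 0 \<longrightarrow> (\<lambda>n. L2sq lborel (\<lambda>z. g (z + h n) - g z)) \<longlonglongrightarrow> 0)"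

lemma ennreal_tendsto_0_squeeze:
  fixes f :: "'b \<Rightarrow> ennreal"
  assumes "\<And>e::real. e > 0 \<Longrightarrow> \<forall>\<^sub>F n in F. f n \<le> ennreal e"
  shows "(f \<longlongrightarrow> 0) F"
proof (rule order_tendstoI)
  fix a :: ennreal assume "0 < a"
  then obtain b where b: "0 < b" "b < a" using dense by blast
  have "b < top" by (rule order.strict_trans2[OF b(2) top_greatest])
  then have "b = ennreal (enn2real b)" "enn2real b > 0"
    using b(1) by (simp_all add: enn2real_positive_iff)
  then have "\<forall>\<^sub>F n in F. f n \<le> b" using assms by metis
  then show "\<forall>\<^sub>F n in F. f n < a" by eventually_elim (use b in auto)
qed simp

lemma tendsto_0_eventually_le:
  fixes f :: "'b \<Rightarrow> ennreal"
  assumes "(f \<longlongrightarrow> 0) F" "e > (0::real)"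
  shows "\<forall>\<^sub>F n in F. f n \<le> ennreal e"
proof -
  have "\<forall>\<^sub>F n in F. f n < ennreal e" using assms by (intro order_tendstoD(2)) auto
  then show ?thesis by eventually_elim auto
qed

text \<open>Translation invariance of Lebesgue measure makes the error of g minus g' the same before
  and after the shift, so continuity passes to mean square limits.\<close>

lemma translation_cont_limit:
  fixes g :: "'a::euclidean_space \<Rightarrow> real"
  assumes [measurable]: "g \<in> borel_measurable borel"
    and "\<And>e::real. e > 0 \<Longrightarrow> \<exists>g'\<in>borel_measurable borel. translation_cont g' \<and> L2sq lborel (\<lambda>z. g z - g' z) \<le> ennreal e"
  shows "translation_cont g"
  unfolding translation_cont_def
proof (intro allI impI)
  fix h :: "nat \<Rightarrow> 'a" assume h: "h \<longlonglongrightarrow> 0"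
  show "(\<lambda>n. L2sq lborel (\<lambda>z. g (z + h n) - g z)) \<longlonglongrightarrow> 0"
  proof (rule ennreal_tendsto_0_squeeze)
    fix e :: real assume e: "e > 0"
    \<comment> \<open>The three errors enter with total weight 4 + 4 + 2 = 10, and 10/12 is below
      1.\<close>
    then obtain g' where [measurable]: "g' \<in> borel_measurable borel" and t: "translation_cont g'"
      and le: "L2sq lborel (\<lambda>z. g z - g' z) \<le> ennreal (e / 12)"
      using assms(2)[of "e / 12"] by auto
    have "\<forall>\<^sub>F n in sequentially. L2sq lborel (\<lambda>z. g' (z + h n) - g' z) \<le> ennreal (e / 12)"
      using t h e by (intro tendsto_0_eventually_le) (auto simp: translation_cont_def)
    then show "\<forall>\<^sub>F n in sequentially. L2sq lborel (\<lambda>z. g (z + h n) - g z) \<le> ennreal e"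
    proof eventually_elim
      case (elim n)
      let ?d = "\<lambda>z. g z - g' z"
      have "L2sq lborel (\<lambda>z. g (z + h n) - g z) =
          L2sq lborel (\<lambda>z. (?d (z + h n) - ?d z) + (g' (z + h n) - g' z))"
        by (simp add: algebra_simps)
      also have "\<dots> \<le> 2 * L2sq lborel (\<lambda>z. ?d (z + h n) - ?d z) + 2 * L2sq lborel (\<lambda>z. g' (z + h n) - g' z)"
        by (rule L2sq_add_le) measurable
      also have "L2sq lborel (\<lambda>z. ?d (z + h n) - ?d z) \<le> 2 * L2sq lborel (\<lambda>z. ?d (z + h n)) + 2 * L2sq lborel ?d"
        by (rule L2sq_diff_le) measurable
      also have "L2sq lborel (\<lambda>z. ?d (z + h n)) = L2sq lborel ?d"
        by (rule L2sq_shift) measurable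
      finally have "L2sq lborel (\<lambda>z. g (z + h n) - g z) \<le>
          2 * (2 * L2sq lborel ?d + 2 * L2sq lborel ?d) + 2 * L2sq lborel (\<lambda>z. g' (z + h n) - g' z)"
        by (simp add: mult_left_mono add_mono)
      also have "\<dots> \<le> 2 * (2 * ennreal (e / 12) + 2 * ennreal (e / 12)) + 2 * ennreal (e / 12)"
        by (intro add_mono mult_left_mono le elim) auto
      also have "\<dots> = ennreal (10 * (e / 12))"
        using e by (simp add: ennreal_mult'' ennreal_plus[symmetric] ennreal_numeral[symmetric]
            ennreal_mult[symmetric] del: ennreal_plus ennreal_numeral)
      also have "\<dots> \<le> ennreal e" using e by (intro ennreal_leI) simp
      finally show ?case .
    qed
  qed
qed

lemma translation_cont_add:
  assumes [measurable]: "f \<in> borel_measurable borel" "g \<in> borel_measurable borel" and "translation_cont f" "translation_cont g"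
  shows "translation_cont (\<lambda>x. f x + g x)"
  unfolding translation_cont_def
proof (intro allI impI)
  fix h :: "nat \<Rightarrow> 'a" assume h: "h \<longlonglongrightarrow> 0"
  have "(\<lambda>n. 2 * L2sq lborel (\<lambda>z. f (z + h n) - f z) + 2 * L2sq lborel (\<lambda>z. g (z + h n) - g z))
      \<longlonglongrightarrow> 2 * 0 + 2 * 0"
    using assms(3,4) h by (intro tendsto_add ennreal_tendsto_cmult) (auto simp: translation_cont_def)
  then have lim: "(\<lambda>n. 2 * L2sq lborel (\<lambda>z. f (z + h n) - f z) + 2 * L2sq lborel (\<lambda>z. g (z + h n) - g z))
      \<longlonglongrightarrow> 0" by simp
  have le: "L2sq lborel (\<lambda>z. (f (z + h n) + g (z + h n)) - (f z + g z)) \<le>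
      2 * L2sq lborel (\<lambda>z. f (z + h n) - f z) + 2 * L2sq lborel (\<lambda>z. g (z + h n) - g z)" for n
    using L2sq_add_le[of "\<lambda>z. f (z + h n) - f z" lborel "\<lambda>z. g (z + h n) - g z"]
    by (simp add: algebra_simps)
  show "(\<lambda>n. L2sq lborel (\<lambda>z. (f (z + h n) + g (z + h n)) - (f z + g z))) \<longlonglongrightarrow> 0"
    by (rule tendsto_sandwich[OF _ _ tendsto_const lim]) (use le in auto)
qed

lemma translation_cont_cmult:
  assumes [measurable]: "f \<in> borel_measurable borel" and "translation_cont f"
  shows "translation_cont (\<lambda>x. c * f x)"
  unfolding translation_cont_def
proof (intro allI impI)
  fix h :: "nat \<Rightarrow> 'a" assume h: "h \<longlonglongrightarrow> 0"
  have "(\<lambda>n. ennreal (c\<^sup>2) * L2sq lborel (\<lambda>z. f (z + h n) - f z)) \<longlonglongrightarrow> ennreal (c\<^sup>2) * 0"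
    using assms(2) h by (intro ennreal_tendsto_cmult) (auto simp: translation_cont_def)
  moreover have "L2sq lborel (\<lambda>z. c * f (z + h n) - c * f z) = ennreal (c\<^sup>2) * L2sq lborel (\<lambda>z. f (z + h n) - f z)" for n
    by (subst L2sq_cmult[symmetric]) (auto simp: right_diff_distrib)
  ultimately show "(\<lambda>n. L2sq lborel (\<lambda>z. c * f (z + h n) - c * f z)) \<longlonglongrightarrow> 0" by simp
qed

text \<open>A point of V stays in V under small shifts, so the part of V that is shifted out tends
  to zero by dominated convergence. The part that is shifted in is the same quantity for the
  opposite shift, after a translation of the integral.\<close>

lemma translation_cont_indicator_open:
  fixes V :: "'a::euclidean_space set"
  assumes V: "open V" "emeasure lborel V < \<infinity>"
  shows "translation_cont (indicator V)"
  unfolding translation_cont_def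
proof (intro allI impI)
  fix h :: "nat \<Rightarrow> 'a" assume h: "h \<longlonglongrightarrow> 0"
  have [measurable]: "V \<in> sets borel" using V by simp
  have A: "(\<lambda>n. (\<integral>\<^sup>+z. indicator V z * indicator (- V) (z + k n) \<partial>lborel)) \<longlonglongrightarrow> 0"
    if k: "k \<longlonglongrightarrow> 0" for k :: "nat \<Rightarrow> 'a"
  proof -
    have "(\<lambda>n. (\<integral>\<^sup>+z. indicator V z * indicator (- V) (z + k n) \<partial>lborel)) \<longlonglongrightarrow> (\<integral>\<^sup>+z. 0 \<partial>(lborel :: 'a measure))"
    proof (rule nn_integral_dominated_convergence[where w = "indicator V"])
      show "AE z in lborel. (\<lambda>n. indicator V z * indicator (- V) (z + k n) :: ennreal) \<longlonglongrightarrow> 0"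
      proof (rule AE_I2)
        fix z
        show "(\<lambda>n. indicator V z * indicator (- V) (z + k n) :: ennreal) \<longlonglongrightarrow> 0"
        proof (cases "z \<in> V")
          case True
          have "(\<lambda>n. z + k n) \<longlonglongrightarrow> z + 0" by (intro tendsto_intros k)
          then have "\<forall>\<^sub>F n in sequentially. z + k n \<in> V"
            using topological_tendstoD[OF _ V(1)] True by simp
          then have "\<forall>\<^sub>F n in sequentially. (indicator V z * indicator (- V) (z + k n) :: ennreal) = 0"
            by eventually_elim simp
          then show ?thesis by (rule tendsto_eventually)
        qed simp
      qed
      show "AE z in lborel. indicator V z * indicator (- V) (z + k n) \<le> (indicator V z :: ennreal)" for n
        by (simp add: indicator_def)
      show "(\<integral>\<^sup>+z. indicator V z \<partial>lborel) < \<infinity>" using V by simp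
    qed measurable
    then show ?thesis by simp
  qed
  have "(\<lambda>n. (\<integral>\<^sup>+z. indicator V z * indicator (- V) (z + h n) \<partial>lborel)
      + (\<integral>\<^sup>+z. indicator V z * indicator (- V) (z + - h n) \<partial>lborel)) \<longlonglongrightarrow> 0 + 0"
    using A[OF h] A[of "\<lambda>n. - h n"] tendsto_minus[OF h] by (intro tendsto_add) auto
  moreover have "L2sq lborel (\<lambda>z. indicator V (z + h n) - indicator V z) =
      (\<integral>\<^sup>+z. indicator V z * indicator (- V) (z + h n) \<partial>lborel)
      + (\<integral>\<^sup>+z. indicator V z * indicator (- V) (z + - h n) \<partial>lborel)" for n
  proof -
    have "(\<integral>\<^sup>+z. indicator V z * indicator (- V) (z + - h n) \<partial>lborel)
        = (\<integral>\<^sup>+z. indicator V (h n + z) * indicator (- V) (h n + z + - h n) \<partial>lborel)"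
      by (rule nn_integral_lborel_shift[symmetric]) measurable
    also have "\<dots> = (\<integral>\<^sup>+z. indicator V (z + h n) * indicator (- V) z \<partial>lborel)"
      by (simp add: add.commute)
    finally have 2: "(\<integral>\<^sup>+z. indicator V z * indicator (- V) (z + - h n) \<partial>lborel)
      = (\<integral>\<^sup>+z. indicator V (z + h n) * indicator (- V) z \<partial>lborel)" .
    show ?thesis unfolding 2 L2sq_def
      by (subst nn_integral_add[symmetric]) (auto intro!: nn_integral_cong simp: indicator_def)
  qed
  ultimately show "(\<lambda>n. L2sq lborel (\<lambda>z. indicator V (z + h n) - indicator V z)) \<longlonglongrightarrow> 0"
    by simp
qed

text \<open>Outer regularity of Lebesgue measure reduces this to open sets.\<close>

lemma translation_cont_indicator:
  fixes A :: "'a::euclidean_space set"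
  assumes A[measurable]: "A \<in> sets borel" and fin: "emeasure lborel A < \<infinity>"
  shows "translation_cont (indicator A)"
proof (rule translation_cont_limit)
  fix e :: real assume e: "e > 0"
  have "A \<in> sets lebesgue" using A by simp
  then obtain V where V: "open V" "A \<subseteq> V" "emeasure lebesgue (V - A) < ennreal e"
    using sets_lebesgue_outer_open e by metis
  have [measurable]: "V \<in> sets borel" using V by simp
  have em: "emeasure lborel (V - A) < ennreal e" using V(3) by simp
  have "emeasure lborel V \<le> emeasure lborel A + emeasure lborel (V - A)"
    using emeasure_subadditive[of A lborel "V - A"] V(2) by (simp add: Un_absorb1)
  also have "\<dots> < \<infinity>" using fin em by (simp add: less_top[symmetric]) (metis ennreal_less_top order_less_trans less_irrefl top.not_eq_extremum)
  finally have "translation_cont (indicator V)" by (intro translation_cont_indicator_open V)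
  moreover have "L2sq lborel (\<lambda>z. indicator A z - indicator V z) \<le> ennreal e"
  proof -
    have "L2sq lborel (\<lambda>z. indicator A z - indicator V z) = (\<integral>\<^sup>+z. indicator (V - A) z \<partial>lborel)"
      unfolding L2sq_def using V(2) by (intro nn_integral_cong) (auto simp: indicator_def)
    then show ?thesis using em by simp
  qed
  ultimately show "\<exists>g'\<in>borel_measurable borel. translation_cont g' \<and> L2sq lborel (\<lambda>z. indicator A z - g' z) \<le> ennreal e"
    by (intro bexI[of _ "indicator V"]) auto
qed simp

text \<open>Monotone class induction for nonnegative functions, then positive and negative parts.
  Finiteness is a premise inside the induction, since the parts of a sum and the members of an
  increasing sequence inherit it from the whole.\<close>

lemma translation_cont_L2:
  fixes g :: "'a::euclidean_space \<Rightarrow> real"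
  assumes [measurable]: "g \<in> borel_measurable borel" and fin: "L2sq lborel g < \<infinity>"
  shows "translation_cont g"
proof -
  have pos: "L2sq lborel u < \<infinity> \<longrightarrow> translation_cont u" if "u \<in> borel_measurable lborel" "\<And>x. 0 \<le> u x" for u :: "'a \<Rightarrow> real"
    using that
  proof (induction rule: borel_measurable_induct_real)
    case (set A)
    have "L2sq lborel (indicator A) = emeasure lborel A"
    proof -
      have "ennreal ((indicator A x)\<^sup>2) = indicator A x" for x by (simp split: split_indicator)
      then show ?thesis unfolding L2sq_def using set by simp
    qed
    then show ?case using translation_cont_indicator set by auto
  next
    case (mult u c)
    show ?case
    \<comment> \<open>For c = 0 the finiteness of the product says nothing about u.\<close>
    proof (cases "c = 0")
      case True
      then show ?thesis by (simp add: translation_cont_def L2sq_def)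
    next
      case False
      then have "L2sq lborel u < \<infinity>" if "L2sq lborel (\<lambda>x. c * u x) < \<infinity>"
        using that mult(2) by (auto simp: L2sq_cmult ennreal_mult_less_top)
      then show ?thesis using mult translation_cont_cmult by auto
    qed
  next
    case (add u v)
    have "L2sq lborel u \<le> L2sq lborel (\<lambda>x. v x + u x)" "L2sq lborel v \<le> L2sq lborel (\<lambda>x. v x + u x)"
      using add by (auto intro!: L2sq_mono)
    then show ?case using add by (auto intro!: translation_cont_add intro: order_le_less_trans)
  next
    case (seq U)
    have mU[measurable]: "U i \<in> borel_measurable borel" for i using seq by simp
    have lim: "(\<lambda>i. U i x) \<longlonglongrightarrow> u x" for x using seq by simp
    have mu[measurable]: "u \<in> borel_measurable borel" by (rule borel_measurable_LIMSEQ_real[OF lim mU])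
    have le: "U i x \<le> u x" for i x
      using seq lim by (intro incseq_le) (auto simp: incseq_def le_fun_def)
    show ?case
    proof
      assume fin: "L2sq lborel u < \<infinity>"
      have tU: "translation_cont (U i)" for i
      proof -
        have "\<bar>U i x\<bar> \<le> \<bar>u x\<bar>" for x using le[of i x] seq by (metis abs_of_nonneg order_trans)
        then have "L2sq lborel (U i) \<le> L2sq lborel u" by (intro L2sq_mono) auto
        then show ?thesis using seq fin by (auto intro: order_le_less_trans)
      qed
      have "(\<lambda>i. L2sq lborel (\<lambda>x. u x - U i x)) \<longlonglongrightarrow> (\<integral>\<^sup>+x. 0 \<partial>(lborel :: 'a measure))"
        unfolding L2sq_def
      proof (rule nn_integral_dominated_convergence[where w = "\<lambda>x. ennreal ((u x)\<^sup>2)"])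
        show "AE x in lborel. ennreal ((u x - U i x)\<^sup>2) \<le> ennreal ((u x)\<^sup>2)" for i
          using le seq by (intro AE_I2 ennreal_leI power_mono) auto
        show "AE x in lborel. (\<lambda>i. ennreal ((u x - U i x)\<^sup>2)) \<longlonglongrightarrow> 0"
        proof (rule AE_I2)
          fix x
          have "(\<lambda>i. ennreal ((u x - U i x)\<^sup>2)) \<longlonglongrightarrow> ennreal ((u x - u x)\<^sup>2)"
            by (intro tendsto_intros lim)
          then show "(\<lambda>i. ennreal ((u x - U i x)\<^sup>2)) \<longlonglongrightarrow> 0" by simp
        qed
      qed (use fin in \<open>auto simp: L2sq_def\<close>)
      then have L: "(\<lambda>i. L2sq lborel (\<lambda>x. u x - U i x)) \<longlonglongrightarrow> 0" by simp
      show "translation_cont u"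
      proof (rule translation_cont_limit[OF mu])
        fix e :: real assume "e > 0"
        from eventually_happens[OF tendsto_0_eventually_le[OF L this]]
        obtain i where "L2sq lborel (\<lambda>x. u x - U i x) \<le> ennreal e" by auto
        then show "\<exists>g'\<in>borel_measurable borel. translation_cont g' \<and> L2sq lborel (\<lambda>z. u z - g' z) \<le> ennreal e"
          using tU mU by blast
      qed
    qed
  qed
  let ?p = "\<lambda>x. max 0 (g x)" and ?n = "\<lambda>x. max 0 (- g x)"
  have "L2sq lborel ?p \<le> L2sq lborel g" "L2sq lborel ?n \<le> L2sq lborel g"
    by (auto intro!: L2sq_mono)
  then have "translation_cont ?p" "translation_cont ?n" using pos[of ?p] pos[of ?n] fin by (auto intro: order_le_less_trans)
  then have "translation_cont (\<lambda>x. ?p x + (-1) * ?n x)" by (intro translation_cont_add translation_cont_cmult) auto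
  moreover have "(\<lambda>x. ?p x + (-1) * ?n x) = g" by auto
  ultimately show ?thesis by simp
qed

text \<open>Jensen's inequality for the square: the variance with respect to the probability density
  J is nonnegative. If the second moment is infinite, there is nothing to show.\<close>

lemma square_integral_le:
  assumes J: "integrable M J" "\<And>x. J x \<ge> 0" "(\<integral>x. J x \<partial>M) = 1"
    and \<phi>: "integrable M (\<lambda>x. J x * \<phi> x)" "\<phi> \<in> borel_measurable M"
  shows "ennreal ((\<integral>x. J x * \<phi> x \<partial>M)\<^sup>2) \<le> (\<integral>\<^sup>+x. ennreal (J x * (\<phi> x)\<^sup>2) \<partial>M)"
proof (cases "integrable M (\<lambda>x. J x * (\<phi> x)\<^sup>2)")
  case True
  let ?m = "\<integral>x. J x * \<phi> x \<partial>M"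
  have "0 \<le> (\<integral>x. J x * (\<phi> x - ?m)\<^sup>2 \<partial>M)" using J(2) by (simp add: integral_nonneg_AE)
  also have "(\<integral>x. J x * (\<phi> x - ?m)\<^sup>2 \<partial>M) = (\<integral>x. J x * (\<phi> x)\<^sup>2 - 2 * ?m * (J x * \<phi> x) + ?m\<^sup>2 * J x \<partial>M)"
    by (intro Bochner_Integration.integral_cong) (auto simp: power2_diff algebra_simps)
  also have "\<dots> = (\<integral>x. J x * (\<phi> x)\<^sup>2 \<partial>M) - 2 * ?m * ?m + ?m\<^sup>2"
    using True J(1) \<phi>(1) J(3) by simp
  finally have "?m\<^sup>2 \<le> (\<integral>x. J x * (\<phi> x)\<^sup>2 \<partial>M)" by (simp add: power2_eq_square)
  then show ?thesis using True J(2) by (subst nn_integral_eq_integral) (auto intro: ennreal_leI)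
next
  case False
  have "(\<integral>\<^sup>+x. ennreal (J x * (\<phi> x)\<^sup>2) \<partial>M) = \<infinity>"
  proof (rule ccontr)
    assume "\<not> ?thesis"
    then have "(\<integral>\<^sup>+x. ennreal (norm (J x * (\<phi> x)\<^sup>2)) \<partial>M) < \<infinity>"
      using J(2) by (simp add: abs_mult less_top)
    moreover have "(\<lambda>x. J x * (\<phi> x)\<^sup>2) \<in> borel_measurable M" using J(1) \<phi>(2) by measurable
    ultimately show False using False by (simp add: integrable_iff_bounded)
  qed
  then show ?thesis by simp
qed

locale mollifier =
  fixes J :: "'a::euclidean_space \<Rightarrow> real"
  assumes test: "test_function UNIV J" and nonneg: "J x \<ge> 0"
    and integral_1: "(\<integral>x. J x \<partial>lborel) = 1" and integ: "integrable lborel J"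
begin

lemma meas [measurable]: "J \<in> borel_measurable borel"
  by (rule test_function_borel[OF test])

lemma nn_integral_1: "(\<integral>\<^sup>+x. ennreal (J x) \<partial>lborel) = 1"
  using nn_integral_eq_integral[OF integ] nonneg integral_1 by simp

text \<open>The dominating function is \<open>B * J b\<close> plus the square of the displaced g,
  because a product is at most the sum of the squares and J is bounded by B.\<close>

lemma integrable_mult_L2:
  assumes [measurable]: "g \<in> borel_measurable borel" and "L2sq lborel g < \<infinity>" and s: "s > 0"
  shows "integrable lborel (\<lambda>b. J b * g (z - s *\<^sub>R b))"
proof -
  obtain B where B: "B \<ge> 0" "\<And>x. \<bar>J x\<bar> \<le> B" using test_function_bounded[OF test] by metis
  have "(\<integral>\<^sup>+b. ennreal ((g b)\<^sup>2) \<partial>lborel)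
      = ennreal (\<bar>- s\<bar> ^ DIM('a)) * (\<integral>\<^sup>+b. ennreal ((g (z + (- s) *\<^sub>R b))\<^sup>2) \<partial>lborel)"
    using s by (intro nn_integral_lborel_affine) auto
  then have fin: "(\<integral>\<^sup>+b. ennreal ((g (z - s *\<^sub>R b))\<^sup>2) \<partial>lborel) < \<infinity>"
    using assms(2) s by (auto simp: L2sq_def ennreal_mult_less_top)
  have "integrable lborel (\<lambda>b. (g (z - s *\<^sub>R b))\<^sup>2)"
    by (rule integrableI_bounded) (use fin in auto)
  moreover have "integrable lborel (\<lambda>b. B * J b)" using integ by simp
  ultimately have "integrable lborel (\<lambda>b. B * J b + (g (z - s *\<^sub>R b))\<^sup>2)" by (intro Bochner_Integration.integrable_add)
  then show ?thesis
  proof (rule Bochner_Integration.integrable_bound)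
    show "AE b in lborel. norm (J b * g (z - s *\<^sub>R b)) \<le> norm (B * J b + (g (z - s *\<^sub>R b))\<^sup>2)"
    proof (rule AE_I2)
      fix b
      let ?g = "g (z - s *\<^sub>R b)"
      have "\<bar>J b\<bar> * \<bar>?g\<bar> \<le> (J b)\<^sup>2 + ?g\<^sup>2"
      proof -
        have "2 * (\<bar>J b\<bar> * \<bar>?g\<bar>) \<le> (J b)\<^sup>2 + ?g\<^sup>2"
          using sum_squares_bound[of "\<bar>J b\<bar>" "\<bar>?g\<bar>"] by (simp add: mult.assoc)
        moreover have "0 \<le> \<bar>J b\<bar> * \<bar>?g\<bar>" by simp
        ultimately show ?thesis by linarith
      qed
      moreover have "(J b)\<^sup>2 \<le> B * J b"
        using B(2)[of b] nonneg[of b] by (simp add: power2_eq_square mult_right_mono)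
      ultimately show "norm (J b * ?g) \<le> norm (B * J b + ?g\<^sup>2)"
        using B(1) nonneg[of b] by (simp add: abs_mult)
    qed
  qed measurable
qed

text \<open>By Jensen and Fubini the error is at most the J-average over b of the translation errors
  of g for the shifts \<open>- s n *\<^sub>R b\<close>. These tend to zero for every b and are
  dominated by four times the squared norm of g.\<close>

lemma conv_rescale_tendsto:
  assumes [measurable]: "g \<in> borel_measurable borel" and fin: "L2sq lborel g < \<infinity>"
    and s: "\<And>n. s n > 0" "s \<longlonglongrightarrow> (0::real)"
  shows "(\<lambda>n. L2sq lborel (\<lambda>z. conv (rescale (s n) J) g z - g z)) \<longlonglongrightarrow> 0"
proof -
  have le: "L2sq lborel (\<lambda>z. conv (rescale (s n) J) g z - g z)
      \<le> (\<integral>\<^sup>+b. ennreal (J b) * L2sq lborel (\<lambda>z. g (z + - s n *\<^sub>R b) - g z) \<partial>lborel)" for n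
  proof -
    have "L2sq lborel (\<lambda>z. conv (rescale (s n) J) g z - g z)
      \<le> (\<integral>\<^sup>+z. \<integral>\<^sup>+b. ennreal (J b * (g (z - s n *\<^sub>R b) - g z)\<^sup>2) \<partial>lborel \<partial>lborel)"
      unfolding L2sq_def
    proof (rule nn_integral_mono)
      fix z
      have I: "integrable lborel (\<lambda>b. J b * g (z - s n *\<^sub>R b))"
        by (rule integrable_mult_L2[OF assms(1) fin s(1)])
      have "conv (rescale (s n) J) g z - g z = (\<integral>b. J b * (g (z - s n *\<^sub>R b) - g z) \<partial>lborel)"
        using I integ integral_1 by (simp add: conv_rescale s(1) right_diff_distrib)
      then show "ennreal ((conv (rescale (s n) J) g z - g z)\<^sup>2)
          \<le> (\<integral>\<^sup>+b. ennreal (J b * (g (z - s n *\<^sub>R b) - g z)\<^sup>2) \<partial>lborel)"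
        using square_integral_le[OF integ nonneg integral_1, of "\<lambda>b. g (z - s n *\<^sub>R b) - g z"] I integ
        by (simp add: right_diff_distrib)
    qed
    also have "\<dots> = (\<integral>\<^sup>+b. \<integral>\<^sup>+z. ennreal (J b * (g (z - s n *\<^sub>R b) - g z)\<^sup>2) \<partial>lborel \<partial>lborel)"
      by (rule lborel_pair.Fubini') (simp add: case_prod_beta)
    also have "\<dots> = (\<integral>\<^sup>+b. ennreal (J b) * L2sq lborel (\<lambda>z. g (z + - s n *\<^sub>R b) - g z) \<partial>lborel)"
      unfolding L2sq_def by (intro nn_integral_cong) (simp add: ennreal_mult nonneg nn_integral_cmult)
    finally show ?thesis .
  qed
  have "(\<lambda>n. (\<integral>\<^sup>+b. ennreal (J b) * L2sq lborel (\<lambda>z. g (z + - s n *\<^sub>R b) - g z) \<partial>lborel))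
      \<longlonglongrightarrow> (\<integral>\<^sup>+b. 0 \<partial>(lborel :: 'a measure))"
  proof (rule nn_integral_dominated_convergence[where w = "\<lambda>b. ennreal (J b) * (4 * L2sq lborel g)"])
    show "AE b in lborel. ennreal (J b) * L2sq lborel (\<lambda>z. g (z + - s n *\<^sub>R b) - g z)
        \<le> ennreal (J b) * (4 * L2sq lborel g)" for n
    proof (intro AE_I2 mult_left_mono)
      fix b
      have "L2sq lborel (\<lambda>z. g (z + - s n *\<^sub>R b) - g z)
          \<le> 2 * L2sq lborel (\<lambda>z. g (z + - s n *\<^sub>R b)) + 2 * L2sq lborel g"
        by (rule L2sq_diff_le) measurable
      also have "\<dots> = 2 * L2sq lborel g + 2 * L2sq lborel g"
        by (subst L2sq_shift) auto
      also have "\<dots> = 4 * L2sq lborel g"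
        by (simp add: distrib_right[symmetric])
      finally show "L2sq lborel (\<lambda>z. g (z + - s n *\<^sub>R b) - g z) \<le> 4 * L2sq lborel g" .
    qed simp
    show "(\<integral>\<^sup>+b. ennreal (J b) * (4 * L2sq lborel g) \<partial>lborel) < \<infinity>"
      using fin by (simp add: nn_integral_multc nn_integral_1 ennreal_mult_less_top)
    show "AE b in lborel. (\<lambda>n. ennreal (J b) * L2sq lborel (\<lambda>z. g (z + - s n *\<^sub>R b) - g z)) \<longlonglongrightarrow> 0"
    proof (rule AE_I2)
      fix b :: 'a
      have "(\<lambda>n. - s n *\<^sub>R b) \<longlonglongrightarrow> - 0 *\<^sub>R b" by (intro tendsto_intros s)
      then have "(\<lambda>n. L2sq lborel (\<lambda>z. g (z + - s n *\<^sub>R b) - g z)) \<longlonglongrightarrow> 0"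
        using translation_cont_L2[OF assms(1) fin, unfolded translation_cont_def, rule_format, of "\<lambda>n. - s n *\<^sub>R b"] by simp
      then have "(\<lambda>n. ennreal (J b) * L2sq lborel (\<lambda>z. g (z + - s n *\<^sub>R b) - g z)) \<longlonglongrightarrow> ennreal (J b) * 0"
        by (intro ennreal_tendsto_cmult) auto
      then show "(\<lambda>n. ennreal (J b) * L2sq lborel (\<lambda>z. g (z + - s n *\<^sub>R b) - g z)) \<longlonglongrightarrow> 0" by simp
    qed
    show "(\<lambda>b. ennreal (J b) * L2sq lborel (\<lambda>z. g (z + - s n *\<^sub>R b) - g z)) \<in> borel_measurable lborel" for n
      unfolding L2sq_def by measurable
  qed auto
  then have "(\<lambda>n. (\<integral>\<^sup>+b. ennreal (J b) * L2sq lborel (\<lambda>z. g (z + - s n *\<^sub>R b) - g z) \<partial>lborel)) \<longlonglongrightarrow> 0"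
    by simp
  from tendsto_sandwich[OF _ _ tendsto_const this] le show ?thesis by simp
qed

end

section \<open>Cone condition\<close>

text \<open>The ball of directions spans a truncated cone along which every point of D near p moves
  inside D. The point p itself may lie on the boundary; around interior points y = 0 works.\<close>

definition cone_at :: "'a::euclidean_space set \<Rightarrow> 'a \<Rightarrow> bool" where
  "cone_at D p \<longleftrightarrow> (\<exists>r>0. \<exists>\<rho>>0. \<exists>y. \<forall>x\<in>D \<inter> ball p r. \<forall>b\<in>cball y \<rho>. \<forall>s\<in>{0<..1}. x + s *\<^sub>R b \<in> D)"

lemma cone_at_open:
  assumes "open D" "p \<in> D"
  shows "cone_at D p"
proof -
  obtain e where e: "e > 0" "ball p e \<subseteq> D" using assms openE by blast
  have "x + s *\<^sub>R b \<in> D" if "x \<in> ball p (e/2)" "b \<in> cball 0 (e/2)" "s \<in> {0<..1::real}" for x b s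
  proof -
    have "s * norm b \<le> 1 * (e/2)" using that by (intro mult_mono) auto
    then have "dist p (x + s *\<^sub>R b) < e"
      using that norm_triangle_ineq[of "x - p" "s *\<^sub>R b"]
      by (simp add: dist_norm norm_minus_commute algebra_simps)
    then show ?thesis using e(2) by auto
  qed
  then show ?thesis unfolding cone_at_def
    using e(1) by (intro exI[of _ "e/2"] conjI exI[of _ "0::'a"]) auto
qed

text \<open>Take an interior ball around some c in D and directions near c - p. For x near p the
  endpoint x + b lies in that ball, and x + s b lies on the segment from x to it.\<close>

lemma cone_at_convex:
  assumes "open D" "convex D" "D \<noteq> {}"
  shows "cone_at D p"
proof -
  obtain c where "c \<in> D" using assms by blast
  then obtain e where e: "e > 0" "ball c e \<subseteq> D" using assms openE by blast
  have "x + s *\<^sub>R b \<in> D"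
    if "x \<in> D \<inter> ball p (e/2)" "b \<in> cball (c - p) (e/2)" "s \<in> {0<..1::real}" for x b s
  proof -
    have "x + b - c = (x - p) + (b - (c - p))" by simp
    then have "norm (x + b - c) \<le> norm (x - p) + norm (b - (c - p))" by (metis norm_triangle_ineq)
    then have "x + b \<in> ball c e" using that by (simp add: dist_norm norm_minus_commute)
    then have "(1 - s) *\<^sub>R x + s *\<^sub>R (x + b) \<in> D"
      using that e(2) by (intro convexD[OF assms(2)]) auto
    then show ?thesis by (simp add: algebra_simps)
  qed
  then show ?thesis unfolding cone_at_def
    using e(1) by (intro exI[of _ "e/2"] conjI exI[of _ "c - p"]) auto
qed

lemma Ck1_locally_Lipschitz:
  fixes \<gamma> :: "'a::euclidean_space \<Rightarrow> real"
  assumes "Ck (Suc 0) \<gamma>"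
  obtains L where "L \<ge> 0" "\<And>x y. x \<in> cball 0 R \<Longrightarrow> y \<in> cball 0 R \<Longrightarrow> \<bar>\<gamma> x - \<gamma> y\<bar> \<le> L * norm (x - y)"
proof -
  have "\<forall>e. \<exists>B\<ge>0. \<forall>z\<in>cball 0 R. \<bar>dirder e \<gamma> z\<bar> \<le> B"
  proof
    fix e
    have "compact (dirder e \<gamma> ` cball 0 R)"
      using assms by (intro compact_continuous_image) (auto intro: continuous_on_subset)
    then obtain B where B: "\<forall>y\<in>dirder e \<gamma> ` cball 0 R. norm y \<le> B"
      using compact_imp_bounded bounded_iff by metis
    then have "\<forall>z\<in>cball 0 R. \<bar>dirder e \<gamma> z\<bar> \<le> max B 0" by force
    then show "\<exists>B\<ge>0. \<forall>z\<in>cball 0 R. \<bar>dirder e \<gamma> z\<bar> \<le> B" by (intro exI[of _ "max B 0"]) auto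
  qed
  then obtain B where B: "\<And>e. B e \<ge> 0" "\<And>e z. z \<in> cball 0 R \<Longrightarrow> \<bar>dirder e \<gamma> z\<bar> \<le> B e" by metis
  let ?L = "\<Sum>e\<in>Basis. B e"
  have dif: "\<gamma> differentiable (at x)" for x using assms by simp
  have "norm (\<gamma> x - \<gamma> y) \<le> ?L * norm (x - y)" if "x \<in> cball 0 R" "y \<in> cball 0 R" for x y
  proof (rule differentiable_bound[OF convex_cball _ _ that(1,2)])
    fix z :: 'a assume z: "z \<in> cball 0 R"
    show "(\<gamma> has_derivative (\<lambda>v. dirder v \<gamma> z)) (at z within cball 0 R)"
      by (rule has_derivative_at_withinI[OF has_derivative_dirder[OF dif]])
    show "onorm (\<lambda>v. dirder v \<gamma> z) \<le> ?L"
    proof (rule onorm_bound)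
      fix v
      have "norm (dirder v \<gamma> z) = norm (\<Sum>e\<in>Basis. (v \<bullet> e) * dirder e \<gamma> z)"
        by (subst dirder_Basis_sum[OF dif]) simp
      also have "\<dots> \<le> (\<Sum>e\<in>(Basis :: 'a set). norm v * B e)"
      proof (rule order_trans[OF norm_sum sum_mono])
        fix e :: 'a assume "e \<in> Basis"
        then show "norm ((v \<bullet> e) * dirder e \<gamma> z) \<le> norm v * B e"
          unfolding real_norm_def abs_mult using B z Basis_le_norm by (intro mult_mono) auto
      qed
      finally show "norm (dirder v \<gamma> z) \<le> ?L * norm v" by (simp add: sum_distrib_left mult.commute)
    qed (use B in \<open>simp add: sum_nonneg\<close>)
  qed
  then show ?thesis using that[of ?L] B(1) by (simp add: sum_nonneg)
qed

text \<open>Directions near \<open>h *\<^sub>R e\<close> point upwards. Along s b the height grows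
  by at least \<open>s * h * (1 - k)\<close>, while the graph function, with Lipschitz constant L,
  grows by at most \<open>s * h * (2 * L * k)\<close>; the point therefore stays above the
  graph.\<close>

lemma cone_at_C2_boundary:
  fixes \<Omega> :: "'a::euclidean_space set"
  assumes "C2_boundary \<Omega>" "p \<in> frontier \<Omega>"
  shows "cone_at \<Omega> p"
proof -
  from bspec[OF assms(1)[unfolded C2_boundary_def] assms(2)]
  obtain r e \<gamma> where r: "r > 0" and e: "norm e = 1" and C2: "Ck 2 \<gamma>"
    and eq: "\<Omega> \<inter> ball p r = {x \<in> ball p r. \<gamma> (x - (x \<bullet> e) *\<^sub>R e) < x \<bullet> e}"
    by (elim exE conjE)
  have ee: "e \<bullet> e = 1" using e by (simp add: dot_square_norm)
  define \<pi> where "\<pi> x = x - (x \<bullet> e) *\<^sub>R e" for x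
  have \<pi>n: "norm (\<pi> x) \<le> 2 * norm x" for x
  proof -
    have "norm (\<pi> x) \<le> norm x + \<bar>x \<bullet> e\<bar> * norm e"
      unfolding \<pi>_def using norm_triangle_ineq4[of x "(x \<bullet> e) *\<^sub>R e"] by simp
    then show ?thesis using Cauchy_Schwarz_ineq2[of x e] e by simp
  qed
  have "Ck (Suc 0) \<gamma>" using Ck_SucD[of 1 \<gamma>] C2 by (simp add: numeral_2_eq_2)
  then obtain L where L: "L \<ge> 0" "\<And>x y. x \<in> cball 0 (2 * (norm p + r)) \<Longrightarrow> y \<in> cball 0 (2 * (norm p + r))
      \<Longrightarrow> \<bar>\<gamma> x - \<gamma> y\<bar> \<le> L * norm (x - y)"
    using Ck1_locally_Lipschitz by metis
  \<comment> \<open>From \<open>k * (2 * L + 2) = 1\<close> one gets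
    \<open>2 * L * k = 1 - 2 * k\<close>, strictly below \<open>1 - k\<close>.\<close>
  define k where "k = 1 / (2 * L + 2)"
  have k: "k > 0" "k \<le> 1/2" using L(1) by (auto simp: k_def field_simps)
  have kL: "2 * L * k < 1 - k"
  proof -
    have "k * (2 * L + 2) = 1" unfolding k_def using L(1) by simp
    then show ?thesis using k(1) by (simp add: algebra_simps)
  qed
  \<comment> \<open>Since the norm of b is at most 2 h = r/2, a point of the half ball stays within
    distance r of p, where the graph description is valid.\<close>
  define h where "h = r / 4"
  have h: "h > 0" using r by (simp add: h_def)
  have "x + s *\<^sub>R b \<in> \<Omega>"
    if x: "x \<in> \<Omega> \<inter> ball p (r/2)" and b: "b \<in> cball (h *\<^sub>R e) (h * k)" and s: "s \<in> {0<..1::real}" for x b s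
  proof -
    have xr: "x \<in> ball p r" using x r by auto
    have gx: "\<gamma> (\<pi> x) < x \<bullet> e" using eq x xr unfolding \<pi>_def by blast
    have nb: "norm (b - h *\<^sub>R e) \<le> h * k" using b by (simp add: dist_norm norm_minus_commute)
    have "norm b \<le> norm (b - h *\<^sub>R e) + norm (h *\<^sub>R e)" by (metis diff_add_cancel norm_triangle_ineq)
    also have "\<dots> \<le> h * k + h" using nb e h by simp
    also have "\<dots> \<le> h * (1/2) + h" using h k by (intro add_mono mult_left_mono) auto
    finally have "norm b \<le> 2 * h" using h by simp
    then have "s * norm b \<le> 1 * (2 * h)" using s by (intro mult_mono) auto
    then have sb: "norm (s *\<^sub>R b) \<le> r / 2" using s by (simp add: h_def)
    have "norm (x + s *\<^sub>R b - p) \<le> norm (x - p) + norm (s *\<^sub>R b)"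
      using norm_triangle_ineq[of "x - p" "s *\<^sub>R b"] by (simp add: algebra_simps)
    then have xb: "x + s *\<^sub>R b \<in> ball p r" using x sb by (simp add: dist_norm norm_minus_commute)
    have inb: "\<pi> z \<in> cball 0 (2 * (norm p + r))" if "z \<in> ball p r" for z
    proof -
      have "norm z \<le> norm p + norm (z - p)" using norm_triangle_ineq[of p "z - p"] by simp
      then have "norm z \<le> norm p + r" using that by (simp add: dist_norm norm_minus_commute)
      then show ?thesis using \<pi>n[of z] by simp
    qed
    have "\<pi> (x + s *\<^sub>R b) - \<pi> x = s *\<^sub>R \<pi> (b - h *\<^sub>R e)"
      using ee by (simp add: \<pi>_def algebra_simps)
    then have "norm (\<pi> (x + s *\<^sub>R b) - \<pi> x) \<le> s * (2 * (h * k))"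
      using \<pi>n[of "b - h *\<^sub>R e"] nb s by (simp add: mult_left_mono)
    then have "\<gamma> (\<pi> (x + s *\<^sub>R b)) - \<gamma> (\<pi> x) \<le> L * (s * (2 * (h * k)))"
      using L(2)[OF inb[OF xb] inb[OF xr]] L(1) by (smt (verit) mult_left_mono)
    also have "\<dots> = s * h * (2 * L * k)" by simp
    also have "\<dots> < s * h * (1 - k)" using kL s h by (intro mult_strict_left_mono) auto
    also have "\<dots> \<le> s * (b \<bullet> e)"
    proof -
      have "\<bar>(b - h *\<^sub>R e) \<bullet> e\<bar> \<le> h * k" using Cauchy_Schwarz_ineq2[of "b - h *\<^sub>R e" e] e nb by simp
      then have "h * (1 - k) \<le> b \<bullet> e" using ee by (simp add: inner_diff_left algebra_simps)
      then show ?thesis using s by (simp add: mult.assoc mult_left_mono)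
    qed
    finally have "\<gamma> (\<pi> (x + s *\<^sub>R b)) < (x + s *\<^sub>R b) \<bullet> e" using gx by (simp add: inner_add_left)
    then have "x + s *\<^sub>R b \<in> \<Omega> \<inter> ball p r" using xb unfolding eq \<pi>_def by simp
    then show ?thesis by simp
  qed
  then show ?thesis unfolding cone_at_def
    using r h k by (intro exI[of _ "r/2"] conjI exI[of _ "h * k"] exI[of _ "h *\<^sub>R e"]) auto
qed

lemma cone_at_Times:
  fixes A :: "'a::euclidean_space set" and B :: "'b::euclidean_space set"
  assumes "cone_at A p" "cone_at B q"
  shows "cone_at (A \<times> B) (p, q)"
proof -
  obtain r1 \<rho>1 y1 where 1: "r1 > 0" "\<rho>1 > 0"
    "\<And>x b s. x \<in> A \<inter> ball p r1 \<Longrightarrow> b \<in> cball y1 \<rho>1 \<Longrightarrow> s \<in> {0<..1::real} \<Longrightarrow> x + s *\<^sub>R b \<in> A"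
    using assms(1) unfolding cone_at_def by metis
  obtain r2 \<rho>2 y2 where 2: "r2 > 0" "\<rho>2 > 0"
    "\<And>x b s. x \<in> B \<inter> ball q r2 \<Longrightarrow> b \<in> cball y2 \<rho>2 \<Longrightarrow> s \<in> {0<..1::real} \<Longrightarrow> x + s *\<^sub>R b \<in> B"
    using assms(2) unfolding cone_at_def by metis
  have d: "dist a c \<le> dist (a, b) (c, d)" "dist b d \<le> dist (a, b) (c, d)" for a c :: 'a and b d :: 'b
    using dist_fst_le[of "(a, b)" "(c, d)"] dist_snd_le[of "(a, b)" "(c, d)"] by auto
  have "x + s *\<^sub>R b \<in> A \<times> B"
    if x: "x \<in> (A \<times> B) \<inter> ball (p, q) (min r1 r2)" and b: "b \<in> cball (y1, y2) (min \<rho>1 \<rho>2)"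
      and s: "s \<in> {0<..1::real}" for x b s
  proof -
    obtain x1 x2 b1 b2 where xb: "x = (x1, x2)" "b = (b1, b2)" by (metis surj_pair)
    have "x1 \<in> A \<inter> ball p r1" "x2 \<in> B \<inter> ball q r2" "b1 \<in> cball y1 \<rho>1" "b2 \<in> cball y2 \<rho>2"
      using x b d(1)[of p x1 q x2] d(1)[of y1 b1 y2 b2] d(2)[of q x2 p x1] d(2)[of y2 b2 y1 b1] unfolding xb by auto
    then show ?thesis using 1(3) 2(3) s unfolding xb by auto
  qed
  then show ?thesis unfolding cone_at_def using 1(1,2) 2(1,2)
    by (intro exI[of _ "min r1 r2"] conjI exI[of _ "min \<rho>1 \<rho>2"] exI[of _ "(y1, y2)"]) auto
qed

lemma cone_at_domain:
  assumes "open \<Omega>" "\<Omega> \<noteq> {}" "convex \<Omega> \<or> C2_boundary \<Omega>" "p \<in> closure \<Omega>"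
  shows "cone_at \<Omega> p"
  using assms cone_at_open cone_at_convex cone_at_C2_boundary
  by (metis Diff_iff frontier_def interior_open)

section \<open>Weak derivatives of representatives\<close>

text \<open>
  Borel representatives vanishing outside \<open>D\<close> turn integrals over \<open>lebesgue_on D\<close> into integrals
  over \<open>lborel\<close>, where convolution and Fubini are available.
\<close>

definition is_rep :: "'a::euclidean_space set \<Rightarrow> ('a \<Rightarrow> real) \<Rightarrow> ('a \<Rightarrow> real) \<Rightarrow> bool" where
  "is_rep D f f' \<longleftrightarrow> f' \<in> borel_measurable borel \<and> (\<forall>x. x \<notin> D \<longrightarrow> f' x = 0) \<and>
     (AE x in lborel. x \<in> D \<longrightarrow> f x = f' x)"

lemma AE_lebesgue_on_iff:
  "D \<in> sets borel \<Longrightarrow> (AE x in lebesgue_on D. P x) \<longleftrightarrow> (AE x in lborel. x \<in> D \<longrightarrow> P x)"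
  by (subst AE_restrict_space_iff) (auto simp: AE_completion_iff)

lemma nn_integral_lebesgue_on:
  "D \<in> sets borel \<Longrightarrow> (\<integral>\<^sup>+x. f x \<partial>lebesgue_on D) = (\<integral>\<^sup>+x. f x * indicator D x \<partial>lborel)"
  by (subst nn_integral_restrict_space) (auto simp: nn_integral_completion)

lemma is_rep_exists:
  assumes "D \<in> sets borel" "f \<in> borel_measurable (lebesgue_on D)"
  obtains f' where "is_rep D f f'"
proof -
  have "(\<lambda>x. indicator D x *\<^sub>R f x) \<in> borel_measurable lebesgue"
    using assms by (subst borel_measurable_restrict_space_iff[symmetric]) auto
  then obtain g where g: "g \<in> borel_measurable lborel" "AE x in lborel. indicator D x *\<^sub>R f x = g x"
    using completion_ex_borel_measurable_real by blast
  have [measurable]: "D \<in> sets borel" "g \<in> borel_measurable borel" using assms(1) g(1) by simp_all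
  have "is_rep D f (\<lambda>x. indicator D x * g x)"
    unfolding is_rep_def
  proof (intro conjI allI impI)
    show "AE x in lborel. x \<in> D \<longrightarrow> f x = indicator D x * g x"
      using g(2) by eventually_elim auto
  qed auto
  then show ?thesis using that by blast
qed

lemma is_rep_L2sq:
  assumes "D \<in> sets borel" "is_rep D f f'"
  shows "L2sq (lebesgue_on D) f = L2sq lborel f'"
proof -
  have "AE x in lborel. ennreal ((f x)\<^sup>2) * indicator D x = ennreal ((f' x)\<^sup>2)"
    using assms(2)[unfolded is_rep_def, THEN conjunct2, THEN conjunct2]
    by eventually_elim (use assms(2) in \<open>auto simp: is_rep_def indicator_def\<close>)
  then show ?thesis
    unfolding L2sq_def nn_integral_lebesgue_on[OF assms(1)] by (rule nn_integral_cong_AE)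
qed

lemma is_rep_integral:
  assumes D: "D \<in> sets borel" and rep: "is_rep D f f'" and [measurable]: "\<phi> \<in> borel_measurable borel"
  shows "(\<integral>x. f x * \<phi> x \<partial>lebesgue_on D) = (\<integral>x. f' x * \<phi> x \<partial>lborel)"
proof -
  have [measurable]: "f' \<in> borel_measurable borel" using rep by (simp add: is_rep_def)
  have ae: "AE x in lborel. indicator D x * (f x * \<phi> x) = f' x * \<phi> x"
    using rep[unfolded is_rep_def, THEN conjunct2, THEN conjunct2]
    by eventually_elim (use rep in \<open>auto simp: is_rep_def indicator_def\<close>)
  have "(\<integral>x. f x * \<phi> x \<partial>lebesgue_on D) = (\<integral>x. indicator D x *\<^sub>R (f x * \<phi> x) \<partial>lebesgue)"
    using D by (intro integral_restrict_space) auto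
  also have "\<dots> = (\<integral>x. f' x * \<phi> x \<partial>lebesgue)"
  proof (rule integral_cong_AE)
    show ae': "AE x in lebesgue. indicator D x *\<^sub>R (f x * \<phi> x) = f' x * \<phi> x"
      unfolding AE_completion_iff real_scaleR_def by (rule ae)
    have m0: "(\<lambda>x. f' x * \<phi> x) \<in> borel_measurable lborel" by measurable
    show m: "(\<lambda>x. f' x * \<phi> x) \<in> borel_measurable lebesgue" by (rule measurable_completion[OF m0])
    \<comment> \<open>Completeness of Lebesgue measure transfers measurability from the Borel
      function along the almost everywhere equality.\<close>
    have "AE x in lebesgue. f' x * \<phi> x = indicator D x *\<^sub>R (f x * \<phi> x)"
      using ae' by eventually_elim (rule sym)
    then show "(\<lambda>x. indicator D x *\<^sub>R (f x * \<phi> x)) \<in> borel_measurable lebesgue"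
      by (rule borel_measurable_AE[OF m])
  qed
  also have "\<dots> = (\<integral>x. f' x * \<phi> x \<partial>lborel)" by (rule integral_completion) measurable
  finally show ?thesis .
qed

section \<open>Weak derivatives as integrals over the whole space\<close>

definition L2z :: "'a::euclidean_space set \<Rightarrow> ('a \<Rightarrow> real) \<Rightarrow> bool" where
  "L2z D f \<longleftrightarrow> f \<in> borel_measurable borel \<and> (\<forall>x. x \<notin> D \<longrightarrow> f x = 0) \<and> L2sq lborel f < \<infinity>"

definition wd :: "'a::euclidean_space set \<Rightarrow> 'a \<Rightarrow> ('a \<Rightarrow> real) \<Rightarrow> ('a \<Rightarrow> real) \<Rightarrow> bool" where
  "wd D v f g \<longleftrightarrow> (\<forall>\<phi>. test_function D \<phi> \<longrightarrow>
     (\<integral>x. f x * dirder v \<phi> x \<partial>lborel) = - (\<integral>x. g x * \<phi> x \<partial>lborel))"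

lemma L2z_meas: "L2z D f \<Longrightarrow> f \<in> borel_measurable borel"
  and L2z_fin: "L2z D f \<Longrightarrow> L2sq lborel f < \<infinity>"
  and L2z_zero: "L2z D f \<Longrightarrow> x \<notin> D \<Longrightarrow> f x = 0"
  by (auto simp: L2z_def)

lemma is_rep_L2z:
  assumes "D \<in> sets borel" "f \<in> L2 (lebesgue_on D)" "is_rep D f f'"
  shows "L2z D f'"
  using assms is_rep_L2sq[OF assms(1,3)] by (auto simp: L2z_def is_rep_def L2_def)

lemma has_wderiv_wd:
  assumes D: "D \<in> sets borel" and "has_wderiv D v f g" "is_rep D f f'" "is_rep D g g'"
  shows "wd D v f' g'"
  unfolding wd_def
proof (intro allI impI)
  fix \<phi> assume \<phi>: "test_function D \<phi>"
  have "(\<integral>x. f x * dirder v \<phi> x \<partial>lebesgue_on D) = - (\<integral>x. g x * \<phi> x \<partial>lebesgue_on D)"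
    using assms(2) \<phi> by (simp add: has_wderiv_def)
  then show "(\<integral>x. f' x * dirder v \<phi> x \<partial>lborel) = - (\<integral>x. g' x * \<phi> x \<partial>lborel)"
    using is_rep_integral[OF D assms(3) test_function_borel[OF test_function_dirder[OF \<phi>]]]
      is_rep_integral[OF D assms(4) test_function_borel[OF \<phi>]] by simp
qed

lemma L2z_integrable:
  assumes "bounded D" "L2z D f"
  shows "integrable lborel f"
proof -
  obtain R where "\<forall>x\<in>D. norm x \<le> R" using assms(1) bounded_iff by metis
  then have R: "D \<subseteq> cball 0 R" by auto
  have [measurable]: "f \<in> borel_measurable borel" by (rule L2z_meas[OF assms(2)])
  have "integrable lborel (\<lambda>x. (f x)\<^sup>2)"
    by (rule integrableI_bounded) (use L2z_fin[OF assms(2)] in \<open>auto simp: L2sq_def\<close>)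
  moreover have "integrable lborel (indicator (cball (0::'a) R) :: 'a \<Rightarrow> real)"
    using emeasure_lborel_cball_finite[of "0::'a" R] by (simp add: integrable_indicator_iff)
  ultimately have "integrable lborel (\<lambda>x. indicator (cball (0::'a) R) x + (f x)\<^sup>2)"
    by (rule Bochner_Integration.integrable_add[rotated])
  then show ?thesis
  proof (rule Bochner_Integration.integrable_bound)
    show "AE x in lborel. norm (f x) \<le> norm (indicator (cball (0::'a) R) x + (f x)\<^sup>2)"
    proof (rule AE_I2)
      fix x
      have "2 * \<bar>f x\<bar> \<le> 1 + (f x)\<^sup>2" using sum_squares_bound[of 1 "\<bar>f x\<bar>"] by simp
      then show "norm (f x) \<le> norm (indicator (cball (0::'a) R) x + (f x)\<^sup>2)"
        using R L2z_zero[OF assms(2), of x] by (cases "x \<in> D") (auto simp: indicator_def)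
    qed
  qed measurable
qed

lemma L2z_diff:
  assumes "L2z D f" "L2z D g"
  shows "L2z D (\<lambda>x. f x - g x)"
proof -
  note [measurable] = L2z_meas[OF assms(1)] L2z_meas[OF assms(2)]
  have "L2sq lborel (\<lambda>x. f x - g x) \<le> 2 * L2sq lborel f + 2 * L2sq lborel g"
    by (rule L2sq_diff_le) measurable
  also have "\<dots> < \<infinity>" using assms by (simp add: L2z_def ennreal_mult_less_top)
  finally show ?thesis using assms by (simp add: L2z_def)
qed

lemma dirder_reflect:
  fixes f :: "'a::euclidean_space \<Rightarrow> real"
  assumes "smooth f"
  shows "dirder v (\<lambda>y. f (z - y)) x = - dirder v f (z - x)" and "smooth (\<lambda>y. f (z - y))"
proof -
  have l: "linear (\<lambda>x::'a. - x)" by (simp add: linear_iff)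
  have "dirder v (\<lambda>y. f (- y + z)) x = dirder (- v) f (- x + z)"
    by (rule dirder_comp_affine(1)[OF l smooth_differentiable[OF assms]])
  moreover have "dirder (- v) f (- x + z) = - dirder v f (- x + z)"
    using linear_neg[OF dirder_linear[OF smooth_differentiable[OF assms]]] .
  ultimately show "dirder v (\<lambda>y. f (z - y)) x = - dirder v f (z - x)" by simp
  show "smooth (\<lambda>y. f (z - y))" using smooth_comp_affine[OF l assms, of z] by simp
qed

text \<open>As a function of \<zeta> the reflected kernel is itself a test function on D, so the
  derivative moves onto g. The sign from the reflection cancels the sign from integration by
  parts.\<close>

lemma dirder_conv_wd:
  assumes f: "test_function UNIV f" and u: "integrable lborel u" and w: "wd D v u g"
    and \<phi>: "test_function D (\<lambda>\<zeta>. f (z - \<zeta>))"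
  shows "dirder v (conv f u) z = conv f g z"
proof -
  have "dirder v (conv f u) z = - (\<integral>\<zeta>. u \<zeta> * dirder v (\<lambda>\<zeta>. f (z - \<zeta>)) \<zeta> \<partial>lborel)"
    unfolding dirder_conv[OF f u] conv_def dirder_reflect(1)[OF test_function_smooth[OF f]]
    by (simp add: mult.commute)
  also have "\<dots> = (\<integral>\<zeta>. g \<zeta> * f (z - \<zeta>) \<partial>lborel)"
    using w \<phi> by (simp add: wd_def)
  finally show ?thesis by (simp add: conv_def mult.commute)
qed

text \<open>This is where geometry becomes analysis: if all points sampled from z lie in D, their
  compact set contains the support of the kernel.\<close>

lemma test_function_rescale_reflect:
  fixes J :: "'a::euclidean_space \<Rightarrow> real"
  assumes J: "test_function UNIV J" and supp: "\<And>b. b \<notin> cball c \<rho> \<Longrightarrow> J b = 0" and s: "s > 0"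
    and D: "\<And>b. b \<in> cball c \<rho> \<Longrightarrow> z - s *\<^sub>R b \<in> D"
  shows "test_function D (\<lambda>\<zeta>. rescale s J (z - \<zeta>))"
  unfolding test_function_def
proof (intro conjI exI[of _ "(\<lambda>b. z - s *\<^sub>R b) ` cball c \<rho>"] allI impI)
  show "smooth (\<lambda>\<zeta>. rescale s J (z - \<zeta>))"
    by (rule dirder_reflect(2)[OF test_function_smooth[OF test_function_rescale[OF J s]]])
  show "compact ((\<lambda>b. z - s *\<^sub>R b) ` cball c \<rho>)"
    by (intro compact_continuous_image continuous_intros) simp
  show "(\<lambda>b. z - s *\<^sub>R b) ` cball c \<rho> \<subseteq> D" using D by blast
  fix x assume x: "x \<notin> (\<lambda>b. z - s *\<^sub>R b) ` cball c \<rho>"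
  have "x = z - s *\<^sub>R ((1 / s) *\<^sub>R (z - x))" using s by simp
  then have "(1 / s) *\<^sub>R (z - x) \<notin> cball c \<rho>" using x by blast
  then show "rescale s J (z - x) = 0" using supp unfolding rescale_def by simp
qed

text \<open>The fundamental lemma of the calculus of variations. At each z in D the mollifications
  of h eventually vanish, by orthogonality to the kernels, so their errors eventually equal the
  square of h; Fatou's lemma and the convergence of the mollifications force h to be zero.\<close>

lemma null_if_orthogonal_to_tests:
  fixes h :: "'a::euclidean_space \<Rightarrow> real"
  assumes D: "open D" and h: "L2z D h"
    and orth: "\<And>\<phi>. test_function D \<phi> \<Longrightarrow> (\<integral>x. h x * \<phi> x \<partial>lborel) = 0"
  shows "AE x in lborel. h x = 0"
proof -
  note [measurable] = L2z_meas[OF h]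
  obtain J :: "'a \<Rightarrow> real" where J: "test_function UNIV J" "\<And>x. J x \<ge> 0" "(\<integral>x. J x \<partial>lborel) = 1"
    "integrable lborel J" "\<And>x. x \<notin> cball 0 1 \<Longrightarrow> J x = 0"
    using mollifier_exists[OF zero_less_one, of "0::'a"] by metis
  interpret mollifier J using J by unfold_locales auto
  define s where "s = (\<lambda>n. inverse (real (Suc n)))"
  have s: "s n > 0" "s \<longlonglongrightarrow> 0" for n
    using LIMSEQ_inverse_real_of_nat by (auto simp: s_def)
  let ?c = "\<lambda>n. conv (rescale (s n) J) h"
  have lim: "(\<lambda>n. L2sq lborel (\<lambda>z. ?c n z - h z)) \<longlonglongrightarrow> 0"
    by (rule conv_rescale_tendsto[OF L2z_meas[OF h] L2z_fin[OF h] s])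
  have cm: "(\<lambda>z. ?c n z) \<in> borel_measurable borel" for n
    using test_function_borel[OF test_function_rescale[OF J(1) s(1)]] unfolding conv_def by measurable
  have "ennreal ((h z)\<^sup>2) \<le> liminf (\<lambda>n. ennreal ((?c n z - h z)\<^sup>2))" for z
  proof (cases "z \<in> D")
    case True
    then obtain e where e: "e > 0" "ball z e \<subseteq> D" using D openE by blast
    have "\<forall>\<^sub>F n in sequentially. s n < e" using order_tendstoD(2)[OF s(2) e(1)] .
    then have "\<forall>\<^sub>F n in sequentially. ennreal ((h z)\<^sup>2) \<le> ennreal ((?c n z - h z)\<^sup>2)"
    proof eventually_elim
      case (elim n)
      have "z - s n *\<^sub>R b \<in> D" if "b \<in> cball 0 1" for b
      proof -
        have "s n * norm b \<le> s n * 1" using that s(1)[of n] by (intro mult_left_mono) auto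
        then have "s n * norm b < e" using elim by linarith
        then have "z - s n *\<^sub>R b \<in> ball z e" using s(1)[of n] by (simp add: dist_norm)
        then show ?thesis using e by blast
      qed
      then have "test_function D (\<lambda>\<zeta>. rescale (s n) J (z - \<zeta>))"
        by (intro test_function_rescale_reflect[OF J(1) J(5) s(1)])
      from orth[OF this] have "?c n z = 0" by (simp add: conv_def mult.commute)
      then show ?case by simp
    qed
    then show ?thesis by (rule Liminf_bounded)
  qed (simp add: L2z_zero[OF h])
  then have "L2sq lborel h \<le> (\<integral>\<^sup>+z. liminf (\<lambda>n. ennreal ((?c n z - h z)\<^sup>2)) \<partial>lborel)"
    unfolding L2sq_def by (intro nn_integral_mono) auto
  also have "\<dots> \<le> liminf (\<lambda>n. L2sq lborel (\<lambda>z. ?c n z - h z))"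
    unfolding L2sq_def by (rule nn_integral_liminf) (use cm in measurable)
  also have "\<dots> = 0" using lim by (simp add: lim_imp_Liminf)
  finally have "(\<integral>\<^sup>+x. ennreal ((h x)\<^sup>2) \<partial>lborel) = 0" by (simp add: L2sq_def)
  then have "AE x in lborel. ennreal ((h x)\<^sup>2) = 0"
    by (subst (asm) nn_integral_0_iff_AE) auto
  then show ?thesis by eventually_elim simp
qed

lemma wd_unique:
  assumes "open D" "bounded D" "L2z D g" "L2z D h" "wd D v f g" "wd D v f h"
  shows "AE x in lborel. g x = h x"
proof -
  have "(\<integral>x. (g x - h x) * \<phi> x \<partial>lborel) = 0" if \<phi>: "test_function D \<phi>" for \<phi>
  proof -
    obtain B where B: "B \<ge> 0" "\<And>x. \<bar>\<phi> x\<bar> \<le> B" using test_function_bounded[OF \<phi>] by metis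
    have int: "integrable lborel (\<lambda>x. k x * \<phi> x)" if "L2z D k" for k
    proof (rule Bochner_Integration.integrable_bound)
      show "integrable lborel (\<lambda>x. B * k x)" using L2z_integrable[OF assms(2) that] by simp
      show "AE x in lborel. norm (k x * \<phi> x) \<le> norm (B * k x)"
        using B by (auto simp: abs_mult mult.commute intro!: mult_right_mono)
      show "(\<lambda>x. k x * \<phi> x) \<in> borel_measurable lborel"
        using L2z_meas[OF that] test_function_borel[OF \<phi>] by simp
    qed
    have "(\<integral>x. g x * \<phi> x \<partial>lborel) = (\<integral>x. h x * \<phi> x \<partial>lborel)"
      using assms(5,6) \<phi> unfolding wd_def by (metis neg_equal_iff_equal)
    then show ?thesis using int[OF assms(3)] int[OF assms(4)] by (simp add: left_diff_distrib)
  qed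
  then have "AE x in lborel. g x - h x = 0"
    by (rule null_if_orthogonal_to_tests[OF assms(1) L2z_diff[OF assms(3,4)]])
  then show ?thesis by eventually_elim simp
qed

primrec Dl :: "'a::euclidean_space list \<Rightarrow> ('a \<Rightarrow> real) \<Rightarrow> 'a \<Rightarrow> real" where
  "Dl [] f = f"
| "Dl (v # l) f = dirder v (Dl l f)"

lemma smooth_Dl: "smooth f \<Longrightarrow> smooth (Dl l f)"
  by (induction l) (auto intro: smooth_dirder)

text \<open>
  Lists of directions index iterated derivatives, the outermost derivative being the head.
\<close>

definition wjet :: "'a::euclidean_space set \<Rightarrow> 'a list set \<Rightarrow> ('a list \<Rightarrow> 'a \<Rightarrow> real) \<Rightarrow> bool" where
  "wjet D I g \<longleftrightarrow> (\<forall>l\<in>I. L2z D (g l)) \<and> (\<forall>v l. v # l \<in> I \<longrightarrow> l \<in> I \<and> wd D v (g l) (g (v # l)))"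

text \<open>Near p, mollification with kernels that sample along the cone commutes with weak
  derivatives up to the boundary. The identity is proved on the open set
  \<open>D \<inter> ball p r\<close>, so that it can be differentiated there at each induction
  step.\<close>

lemma Dl_conv:
  fixes J :: "'a::euclidean_space \<Rightarrow> real"
  assumes D: "open D" "bounded D" and g: "wjet D I g" and s: "s \<in> {0<..1}"
    and J: "test_function UNIV J" "\<And>b. b \<notin> cball (- y) \<rho> \<Longrightarrow> J b = 0"
    and cone: "\<And>x b s. x \<in> D \<inter> ball p r \<Longrightarrow> b \<in> cball y \<rho> \<Longrightarrow> s \<in> {0<..1} \<Longrightarrow> x + s *\<^sub>R b \<in> D"
    and "l \<in> I" "z \<in> D \<inter> ball p r"
  shows "Dl l (conv (rescale s J) (g [])) z = conv (rescale s J) (g l) z"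
  using \<open>l \<in> I\<close> \<open>z \<in> D \<inter> ball p r\<close>
proof (induction l arbitrary: z)
  case (Cons v l)
  have l: "l \<in> I" "wd D v (g l) (g (v # l))" "L2z D (g l)"
    using g Cons.prems(1) by (auto simp: wjet_def)
  have "dirder v (Dl l (conv (rescale s J) (g []))) z = dirder v (conv (rescale s J) (g l)) z"
    by (rule dirder_cong_open[of "D \<inter> ball p r"]) (use D Cons.IH[OF l(1)] Cons.prems in auto)
  also have "\<dots> = conv (rescale s J) (g (v # l)) z"
  proof (rule dirder_conv_wd[OF test_function_rescale[OF J(1)] L2z_integrable[OF D(2) l(3)] l(2)])
    show "test_function D (\<lambda>\<zeta>. rescale s J (z - \<zeta>))"
    proof (rule test_function_rescale_reflect[OF J(1) J(2)])
      fix b assume "b \<in> cball (- y) \<rho>"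
      \<comment> \<open>The kernel is centred at -y, hence z - s b is z displaced by s along the
        cone direction -b.\<close>
      then have "- b \<in> cball y \<rho>" using dist_minus[of "- y" b] by simp
      from cone[OF Cons.prems(2) this s] show "z - s *\<^sub>R b \<in> D" by simp
    qed (use s in auto)
  qed (use s in simp)
  finally show ?case by simp
qed simp

section \<open>Density of smooth functions\<close>

text \<open>A slice of the mollified function is an average of spatial translates of slices at other
  times. Almost all of these satisfy the bound, and translation does not change their norms.\<close>

lemma conv_rescale_slice_bound:
  fixes h :: "'b::euclidean_space \<times> real \<Rightarrow> real" and K :: "'b \<times> real \<Rightarrow> real"
  assumes K: "mollifier K" and h[measurable]: "h \<in> borel_measurable borel" and fin: "L2sq lborel h < \<infinity>"
    and M: "AE \<tau> in lborel. (\<integral>\<^sup>+x. ennreal ((h (x, \<tau>))\<^sup>2) \<partial>lborel) \<le> M" and s: "s > 0"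
  shows "(\<integral>\<^sup>+x. ennreal ((conv (rescale s K) h (x, t))\<^sup>2) \<partial>lborel) \<le> M"
proof -
  interpret K: mollifier K by (rule K)
  define m where "m \<tau> = (\<integral>\<^sup>+x. ennreal ((h (x, \<tau>))\<^sup>2) \<partial>lborel)" for \<tau>
  have [measurable]: "m \<in> borel_measurable borel" unfolding m_def by measurable
  have "(\<integral>\<^sup>+x. ennreal ((conv (rescale s K) h (x, t))\<^sup>2) \<partial>lborel)
      \<le> (\<integral>\<^sup>+x. \<integral>\<^sup>+b. ennreal (K b * (h ((x, t) - s *\<^sub>R b))\<^sup>2) \<partial>lborel \<partial>lborel)"
  proof (rule nn_integral_mono)
    fix x
    show "ennreal ((conv (rescale s K) h (x, t))\<^sup>2) \<le> (\<integral>\<^sup>+b. ennreal (K b * (h ((x, t) - s *\<^sub>R b))\<^sup>2) \<partial>lborel)"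
      unfolding conv_rescale[OF s K.meas h]
      by (rule square_integral_le[OF K.integ K.nonneg K.integral_1 K.integrable_mult_L2[OF h fin s]]) measurable
  qed
  also have "\<dots> = (\<integral>\<^sup>+b. \<integral>\<^sup>+x. ennreal (K b * (h ((x, t) - s *\<^sub>R b))\<^sup>2) \<partial>lborel \<partial>lborel)"
    by (rule lborel_pair.Fubini'[symmetric]) measurable
  also have "\<dots> \<le> (\<integral>\<^sup>+b. ennreal (K b) * M \<partial>lborel)"
  proof (rule nn_integral_mono_AE)
    have "AE \<tau> in lborel. m \<tau> \<le> M" using M by (simp add: m_def)
    \<comment> \<open>The exceptional times form a null set; its preimage under the affine map, and
      then the product with all of space, is again a null set of kernel points.\<close>
    then have "AE \<tau> in lborel. m (t + (- s) * \<tau>) \<le> M"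
      using s by (intro AE_borel_affine) auto
    then have "AE \<xi> in (lborel :: 'b measure). AE \<tau> in lborel. m (t + (- s) * \<tau>) \<le> M" by simp
    then have "AE b in (lborel :: 'b measure) \<Otimes>\<^sub>M lborel. m (t + (- s) * snd b) \<le> M"
    proof (intro lborel_pair.AE_pair_measure)
      have "Measurable.pred (lborel \<Otimes>\<^sub>M lborel) (\<lambda>b::'b \<times> real. m (t + (- s) * snd b) \<le> M)" by measurable
      then show "{b \<in> space (lborel \<Otimes>\<^sub>M lborel). m (t + (- s) * snd (b::'b \<times> real)) \<le> M} \<in> sets (lborel \<Otimes>\<^sub>M lborel)"
        by (simp only: pred_def)
    qed simp
    then have "AE b in (lborel :: ('b \<times> real) measure). m (t + (- s) * snd b) \<le> M"
      unfolding lborel_prod .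
    then show "AE b in lborel. (\<integral>\<^sup>+x. ennreal (K b * (h ((x, t) - s *\<^sub>R b))\<^sup>2) \<partial>lborel) \<le> ennreal (K b) * M"
    proof eventually_elim
      case (elim b)
      have "(\<integral>\<^sup>+x. ennreal (K b * (h ((x, t) - s *\<^sub>R b))\<^sup>2) \<partial>lborel)
        = ennreal (K b) * (\<integral>\<^sup>+x. ennreal ((h ((x, t) - s *\<^sub>R b))\<^sup>2) \<partial>lborel)"
        by (subst nn_integral_cmult[symmetric]) (auto simp: ennreal_mult K.nonneg)
      also have "(\<integral>\<^sup>+x. ennreal ((h ((x, t) - s *\<^sub>R b))\<^sup>2) \<partial>lborel)
          = (\<integral>\<^sup>+x. ennreal ((h (- s *\<^sub>R fst b + x, t + (- s) * snd b))\<^sup>2) \<partial>lborel)"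
        by (cases b) (simp add: algebra_simps)
      also have "\<dots> = m (t + (- s) * snd b)"
        unfolding m_def by (rule nn_integral_lborel_shift) measurable
      finally show ?case using elim by (simp add: mult_left_mono)
    qed
  qed
  also have "\<dots> = M" by (simp add: nn_integral_multc K.nn_integral_1)
  finally show ?thesis .
qed

section \<open>Jets, cutoffs and patching\<close>

text \<open>With both first-order parts of every second-order list present, the Leibniz rule does
  not leave I.\<close>

definition jetset :: "'a::euclidean_space list set \<Rightarrow> bool" where
  "jetset I \<longleftrightarrow> finite I \<and> [] \<in> I \<and> (\<forall>l\<in>I. length l \<le> 2) \<and> (\<forall>v v'. [v, v'] \<in> I \<longrightarrow> [v] \<in> I \<and> [v'] \<in> I)"

text \<open>With g constantly zero this is the pointwise size of the jet of w.\<close>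

definition jet_dist ::
  "'a::euclidean_space list set \<Rightarrow> ('a list \<Rightarrow> 'a \<Rightarrow> real) \<Rightarrow> ('a \<Rightarrow> real) \<Rightarrow> 'a \<Rightarrow> real" where
  "jet_dist I g w z = (\<Sum>l\<in>I. \<bar>Dl l w z - g l z\<bar>)"

lemma jet_dist_nonneg: "jet_dist I g w z \<ge> 0"
  by (simp add: jet_dist_def sum_nonneg)

lemma jetset_cases:
  assumes "jetset I" "l \<in> I"
  obtains "l = []" | v where "l = [v]" | v v' where "l = [v, v']" "[v] \<in> I" "[v'] \<in> I"
proof -
  have "length l \<le> 2" using assms by (simp add: jetset_def)
  then consider "l = []" | v where "l = [v]" | v v' where "l = [v, v']"
    by (cases l rule: remdups_adj.cases) (auto simp: numeral_2_eq_2)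
  then show ?thesis using that assms by cases (auto simp: jetset_def)
qed

lemma Dl_const_open:
  assumes "open S" "\<And>x. x \<in> S \<Longrightarrow> f x = c" "z \<in> S" "l \<noteq> []"
  shows "Dl l f z = 0"
proof -
  have "\<forall>z\<in>S. Dl l f z = (if l = [] then c else 0)"
  proof (induction l)
    case (Cons v l)
    then have "\<And>x. x \<in> S \<Longrightarrow> Dl l f x = (if l = [] then c else 0)" by blast
    then show ?case using dirder_eq_0_open[OF assms(1)] by simp
  qed (use assms(2) in simp)
  then show ?thesis using assms(3,4) by simp
qed

lemma test_function_Dl: "test_function \<Omega> f \<Longrightarrow> test_function \<Omega> (Dl l f)"
  by (induction l) (auto intro: test_function_dirder)

text \<open>A second derivative of the product of \<psi> and U - w has four Leibniz terms, which
  accounts for the factor 4. Where all derivatives of \<psi> vanish, the undifferentiated term alone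
  is left.\<close>

lemma Dl_patch:
  assumes I: "jetset I" and sm: "smooth U" "smooth w" "smooth \<psi>" and l: "l \<in> I"
    and B: "B \<ge> 0" "\<And>l. l \<in> I \<Longrightarrow> \<bar>Dl l \<psi> z\<bar> \<le> B"
  shows "\<bar>Dl l (\<lambda>x. w x + \<psi> x * (U x - w x)) z - Dl l w z\<bar> \<le> 4 * B * (\<Sum>l\<in>I. \<bar>Dl l U z - Dl l w z\<bar>)"
    and "(\<And>l. l \<in> I \<Longrightarrow> l \<noteq> [] \<Longrightarrow> Dl l \<psi> z = 0) \<Longrightarrow>
      Dl l (\<lambda>x. w x + \<psi> x * (U x - w x)) z - Dl l w z = \<psi> z * (Dl l U z - Dl l w z)"
proof -
  let ?d = "\<lambda>l. Dl l U z - Dl l w z" and ?S = "\<Sum>l\<in>I. \<bar>Dl l U z - Dl l w z\<bar>"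
  have fin: "finite I" and nil: "[] \<in> I" using I by (auto simp: jetset_def)
  have d: "\<bar>?d l\<bar> \<le> ?S" if "l \<in> I" for l using that fin by (intro member_le_sum[where f = "\<lambda>l. \<bar>?d l\<bar>"]) auto
  have S0: "?S \<ge> 0" by (simp add: sum_nonneg)
  have m: "\<bar>Dl k \<psi> z * ?d k'\<bar> \<le> B * ?S" if "k \<in> I" "k' \<in> I" for k k'
    unfolding abs_mult using that B d by (intro mult_mono) auto
  have D: "smooth (\<lambda>x. U x - w x)" by (rule smooth_diff[OF sm(1,2)])
  have D1: "dirder v (\<lambda>x. w x + \<psi> x * (U x - w x))
      = (\<lambda>x. dirder v w x + (\<psi> x * (dirder v U x - dirder v w x) + dirder v \<psi> x * (U x - w x)))" for v
    unfolding smooth_dirder_add[OF sm(2) smooth_mult[OF sm(3) D]] smooth_dirder_mult[OF sm(3) D]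
      smooth_dirder_diff[OF sm(1,2)] ..
  show "\<bar>Dl l (\<lambda>x. w x + \<psi> x * (U x - w x)) z - Dl l w z\<bar> \<le> 4 * B * ?S"
    and "(\<And>l. l \<in> I \<Longrightarrow> l \<noteq> [] \<Longrightarrow> Dl l \<psi> z = 0) \<Longrightarrow>
      Dl l (\<lambda>x. w x + \<psi> x * (U x - w x)) z - Dl l w z = \<psi> z * (Dl l U z - Dl l w z)"
  proof -
    from I l have "\<bar>Dl l (\<lambda>x. w x + \<psi> x * (U x - w x)) z - Dl l w z\<bar> \<le> 4 * B * ?S \<and>
      ((\<forall>l\<in>I. l \<noteq> [] \<longrightarrow> Dl l \<psi> z = 0) \<longrightarrow>
      Dl l (\<lambda>x. w x + \<psi> x * (U x - w x)) z - Dl l w z = \<psi> z * (Dl l U z - Dl l w z))"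
    proof (cases rule: jetset_cases)
      case 1
      then show ?thesis using m[OF nil nil] mult_nonneg_nonneg[OF B(1) S0] by simp
    next
      case (2 v)
      have v: "[v] \<in> I" using 2 l by simp
      have eq: "Dl l (\<lambda>x. w x + \<psi> x * (U x - w x)) z - Dl l w z = Dl [] \<psi> z * ?d [v] + Dl [v] \<psi> z * ?d []"
        using 2 by (simp add: D1)
      show ?thesis unfolding eq
        using m[OF nil v] m[OF v nil] mult_nonneg_nonneg[OF B(1) S0] 2 v by (auto intro: order_trans[OF abs_triangle_ineq])
    next
      case (3 v v')
      have v: "[v, v'] \<in> I" using 3 l by simp
      let ?E = "\<lambda>x. U x - w x" and ?F = "\<lambda>x. dirder v' U x - dirder v' w x"
      have F: "smooth ?F" by (rule smooth_diff[OF smooth_dirder[OF sm(1)] smooth_dirder[OF sm(2)]])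
      have "dirder v (\<lambda>x. dirder v' w x + (\<psi> x * ?F x + dirder v' \<psi> x * ?E x)) =
        (\<lambda>x. dirder v (dirder v' w) x + ((\<psi> x * (dirder v (dirder v' U) x - dirder v (dirder v' w) x) + dirder v \<psi> x * ?F x)
          + (dirder v' \<psi> x * (dirder v U x - dirder v w x) + dirder v (dirder v' \<psi>) x * ?E x)))"
        unfolding smooth_dirder_add[OF smooth_dirder[OF sm(2)] smooth_add[OF smooth_mult[OF sm(3) F] smooth_mult[OF smooth_dirder[OF sm(3)] D]]]
          smooth_dirder_add[OF smooth_mult[OF sm(3) F] smooth_mult[OF smooth_dirder[OF sm(3)] D]]
          smooth_dirder_mult[OF sm(3) F] smooth_dirder_mult[OF smooth_dirder[OF sm(3)] D]
          smooth_dirder_diff[OF smooth_dirder[OF sm(1)] smooth_dirder[OF sm(2)]] smooth_dirder_diff[OF sm(1,2)] ..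
      then have eq: "Dl l (\<lambda>x. w x + \<psi> x * (U x - w x)) z - Dl l w z =
          (Dl [] \<psi> z * ?d [v, v'] + Dl [v] \<psi> z * ?d [v']) + (Dl [v'] \<psi> z * ?d [v] + Dl [v, v'] \<psi> z * ?d [])"
        using 3(1) by (simp add: D1)
      have "\<bar>(Dl [] \<psi> z * ?d [v, v'] + Dl [v] \<psi> z * ?d [v']) + (Dl [v'] \<psi> z * ?d [v] + Dl [v, v'] \<psi> z * ?d [])\<bar>
          \<le> (B * ?S + B * ?S) + (B * ?S + B * ?S)"
        by (intro order_trans[OF abs_triangle_ineq] add_mono m nil v 3(2,3))
      moreover have "Dl [v] \<psi> z = 0 \<and> Dl [v'] \<psi> z = 0 \<and> Dl [v, v'] \<psi> z = 0"
        if "\<forall>l\<in>I. l \<noteq> [] \<longrightarrow> Dl l \<psi> z = 0"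
        using bspec[OF that 3(2)] bspec[OF that 3(3)] bspec[OF that v] by simp
      ultimately show ?thesis unfolding eq using 3(1) by simp
    qed
    then show "\<bar>Dl l (\<lambda>x. w x + \<psi> x * (U x - w x)) z - Dl l w z\<bar> \<le> 4 * B * ?S"
      and "(\<And>l. l \<in> I \<Longrightarrow> l \<noteq> [] \<Longrightarrow> Dl l \<psi> z = 0) \<Longrightarrow>
      Dl l (\<lambda>x. w x + \<psi> x * (U x - w x)) z - Dl l w z = \<psi> z * (Dl l U z - Dl l w z)" by blast+
  qed
qed

text \<open>Off \<open>ball p r\<close> the patched function is locally w, and in the half ball it
  is locally U. Where errors of both functions are available, U - w is bounded by their sum and the
  Leibniz rule applies. So w has to be good on A only, and U on the ball only.\<close>

lemma patch_pointwise:
  fixes \<psi> :: "'a::euclidean_space \<Rightarrow> real"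
  assumes I: "jetset I" and \<psi>: "test_function UNIV \<psi>" and r: "r > 0"
    and one: "\<And>x. x \<in> ball p (r/2) \<Longrightarrow> \<psi> x = 1" and zero: "\<And>x. x \<notin> cball p (3 * r / 4) \<Longrightarrow> \<psi> x = 0"
  obtains C where "C \<ge> 0" "\<And>U w g A z. smooth U \<Longrightarrow> smooth w \<Longrightarrow> z \<in> A \<union> ball p (r/2) \<Longrightarrow>
    jet_dist I g (\<lambda>x. w x + \<psi> x * (U x - w x)) z
      \<le> C * (indicator (ball p r) z * jet_dist I g U z + indicator A z * jet_dist I g w z)"
proof -
  have fin: "finite I" and nil: "[] \<in> I" using I by (auto simp: jetset_def)
  have "\<forall>l. \<exists>b\<ge>0. \<forall>z. \<bar>Dl l \<psi> z\<bar> \<le> b"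
    using test_function_bounded[OF test_function_Dl[OF \<psi>]] by metis
  then obtain b where b: "\<And>l. b l \<ge> 0" "\<And>l z. \<bar>Dl l \<psi> z\<bar> \<le> b l" by metis
  define B where "B = (\<Sum>l\<in>I. b l)"
  have B: "B \<ge> 0" "\<And>l z. l \<in> I \<Longrightarrow> \<bar>Dl l \<psi> z\<bar> \<le> B"
  proof -
    show "B \<ge> 0" using b(1) by (simp add: B_def sum_nonneg)
    show "\<bar>Dl l \<psi> z\<bar> \<le> B" if "l \<in> I" for l z
      unfolding B_def by (rule order_trans[OF b(2) member_le_sum[OF that b(1) fin]])
  qed
  \<comment> \<open>The 1 stands for the errors of U and w themselves, the other summand for the
    Leibniz terms of U - w added over I.\<close>
  define C where "C = 1 + real (card I) * (4 * B)"
  have C: "C \<ge> 1" using B(1) by (simp add: C_def)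
  have "jet_dist I g (\<lambda>x. w x + \<psi> x * (U x - w x)) z
      \<le> C * (indicator (ball p r) z * jet_dist I g U z + indicator A z * jet_dist I g w z)"
    if sm: "smooth U" "smooth w" and z: "z \<in> A \<union> ball p (r/2)" for U w g A z
  proof -
    note P = Dl_patch[OF I sm test_function_smooth[OF \<psi>] _ B, of _ z]
    let ?w = "\<lambda>x. w x + \<psi> x * (U x - w x)"
    consider (out) "z \<notin> ball p r" "z \<in> A" | (inn) "z \<in> ball p (r/2)" "z \<in> ball p r" "z \<notin> A"
      | (both) "z \<in> ball p r" "z \<in> A"
      using z r by fastforce
    then show ?thesis
    proof cases
      case out
      have zz: "z \<in> - cball p (3 * r / 4)" using out r by auto
      have "Dl l \<psi> z = 0" if "l \<noteq> []" for l
        by (rule Dl_const_open[of "- cball p (3 * r / 4)" \<psi> 0]) (use zero zz that in auto)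
      then have "Dl l ?w z - Dl l w z = 0" if "l \<in> I" for l
        using P(2)[OF that] zero[of z] zz by simp
      then have "jet_dist I g ?w z = 1 * jet_dist I g w z" by (auto simp: jet_dist_def intro!: sum.cong)
      also have "\<dots> \<le> C * jet_dist I g w z" using C jet_dist_nonneg by (rule mult_right_mono)
      finally show ?thesis using out by (simp add: indicator_def)
    next
      case inn
      have "Dl l \<psi> z = 0" if "l \<noteq> []" for l
        by (rule Dl_const_open[of "ball p (r/2)" \<psi> 1]) (use one inn that in auto)
      then have "Dl l ?w z = Dl l U z" if "l \<in> I" for l
        using P(2)[OF that] one[OF inn(1)] by simp
      then have "jet_dist I g ?w z = 1 * jet_dist I g U z" by (auto simp: jet_dist_def intro!: sum.cong)
      also have "\<dots> \<le> C * jet_dist I g U z" using C jet_dist_nonneg by (rule mult_right_mono)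
      finally show ?thesis using inn by (simp add: indicator_def)
    next
      case both
      let ?U = "jet_dist I g U z" and ?W = "jet_dist I g w z"
      have S: "(\<Sum>l\<in>I. \<bar>Dl l U z - Dl l w z\<bar>) \<le> ?U + ?W"
        unfolding jet_dist_def sum.distrib[symmetric] by (rule sum_mono) linarith
      have "jet_dist I g ?w z \<le> (\<Sum>l\<in>I. \<bar>Dl l w z - g l z\<bar> + 4 * B * (?U + ?W))"
        unfolding jet_dist_def[of I g ?w]
      proof (rule sum_mono)
        fix l assume l: "l \<in> I"
        have "4 * B * (\<Sum>l\<in>I. \<bar>Dl l U z - Dl l w z\<bar>) \<le> 4 * B * (?U + ?W)"
          using S B(1) by (intro mult_left_mono) auto
        then show "\<bar>Dl l ?w z - g l z\<bar> \<le> \<bar>Dl l w z - g l z\<bar> + 4 * B * (?U + ?W)"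
          using P(1)[OF l] by linarith
      qed
      also have "\<dots> = ?W + real (card I) * (4 * B) * (?U + ?W)" by (simp add: sum.distrib jet_dist_def)
      also have "\<dots> \<le> C * (?U + ?W)" using jet_dist_nonneg[of I g U z] by (simp add: C_def algebra_simps)
      finally show ?thesis using both by (simp add: indicator_def)
    qed
  qed
  then show ?thesis using that[of C] C by simp
qed

text \<open>The measure is left open for two uses: \<open>lborel\<close> on the cylinder, and
  \<open>slice_measure t\<close> for a fixed time.\<close>

definition jet_error where
  "jet_error \<mu> S I g w = (\<integral>\<^sup>+z. indicator S z * ennreal ((jet_dist I g w z)\<^sup>2) \<partial>\<mu>)"

lemma jet_dist_measurable:
  assumes "smooth w" "\<And>l. l \<in> I \<Longrightarrow> g l \<in> borel_measurable borel"
  shows "jet_dist I g w \<in> borel_measurable borel"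
  unfolding jet_dist_def[abs_def]
  by (intro borel_measurable_sum borel_measurable_abs borel_measurable_diff assms(2)
      smooth_borel[OF smooth_Dl[OF assms(1)]])

lemma square_add_bound: "(C * (a + b))\<^sup>2 \<le> 2 * C\<^sup>2 * (a\<^sup>2 + b\<^sup>2)" for a b C :: real
proof -
  have "(a + b)\<^sup>2 \<le> 2 * (a\<^sup>2 + b\<^sup>2)" using sum_squares_bound[of a b] by (simp add: power2_sum)
  then have "C\<^sup>2 * (a + b)\<^sup>2 \<le> C\<^sup>2 * (2 * (a\<^sup>2 + b\<^sup>2))" by (intro mult_left_mono) auto
  then show ?thesis by (simp only: power_mult_distrib mult.left_commute mult.assoc)
qed

text \<open>The pointwise patching estimate squared and integrated, for a Borel measure that may be
  concentrated on a time slice.\<close>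

lemma jet_error_patch:
  assumes C: "C \<ge> 0" "\<And>z. z \<in> D \<inter> (A \<union> B') \<Longrightarrow>
      jet_dist I g w' z \<le> C * (indicator B z * jet_dist I g U z + indicator A z * jet_dist I g w z)"
    and m: "sets \<mu> = sets borel" "D \<in> sets borel" "A \<in> sets borel" "B \<in> sets borel"
    and "smooth U" "smooth w" "\<And>l. l \<in> I \<Longrightarrow> g l \<in> borel_measurable borel"
  shows "jet_error \<mu> (D \<inter> (A \<union> B')) I g w' \<le> ennreal (2 * C\<^sup>2) * (jet_error \<mu> (D \<inter> B) I g U + jet_error \<mu> (D \<inter> A) I g w)"
proof -
  have [measurable]: "jet_dist I g U \<in> borel_measurable \<mu>" "jet_dist I g w \<in> borel_measurable \<mu>"
    "D \<in> sets \<mu>" "A \<in> sets \<mu>" "B \<in> sets \<mu>"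
    using jet_dist_measurable[of U I g] jet_dist_measurable[of w I g] assms measurable_cong_sets[OF m(1) refl] by auto
  have "jet_error \<mu> (D \<inter> (A \<union> B')) I g w' \<le> (\<integral>\<^sup>+z. ennreal (2 * C\<^sup>2) *
      (indicator (D \<inter> B) z * ennreal ((jet_dist I g U z)\<^sup>2) + indicator (D \<inter> A) z * ennreal ((jet_dist I g w z)\<^sup>2)) \<partial>\<mu>)"
    unfolding jet_error_def
  proof (rule nn_integral_mono)
    fix z
    let ?u = "indicator B z * jet_dist I g U z :: real" and ?v = "indicator A z * jet_dist I g w z :: real"
    have "ennreal ((jet_dist I g w' z)\<^sup>2) \<le> ennreal (2 * C\<^sup>2) *
      (indicator (D \<inter> B) z * ennreal ((jet_dist I g U z)\<^sup>2) + indicator (D \<inter> A) z * ennreal ((jet_dist I g w z)\<^sup>2))"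
      if z: "z \<in> D \<inter> (A \<union> B')"
    proof -
      have "(jet_dist I g w' z)\<^sup>2 \<le> (C * (?u + ?v))\<^sup>2"
        by (rule power_mono[OF C(2)[OF z] jet_dist_nonneg])
      also have "\<dots> \<le> 2 * C\<^sup>2 * (?u\<^sup>2 + ?v\<^sup>2)"
        by (rule square_add_bound)
      finally have "ennreal ((jet_dist I g w' z)\<^sup>2) \<le> ennreal (2 * C\<^sup>2 * (?u\<^sup>2 + ?v\<^sup>2))" by (rule ennreal_leI)
      also have "\<dots> = ennreal (2 * C\<^sup>2) * (ennreal (?u\<^sup>2) + ennreal (?v\<^sup>2))"
        by (simp add: ennreal_mult[symmetric] ennreal_plus[symmetric] del: ennreal_plus)
      also have "ennreal (?u\<^sup>2) = indicator (D \<inter> B) z * ennreal ((jet_dist I g U z)\<^sup>2)"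
        using z by (simp add: indicator_def)
      also have "ennreal (?v\<^sup>2) = indicator (D \<inter> A) z * ennreal ((jet_dist I g w z)\<^sup>2)"
        using z by (simp add: indicator_def)
      finally show ?thesis .
    qed
    then show "indicator (D \<inter> (A \<union> B')) z * ennreal ((jet_dist I g w' z)\<^sup>2) \<le> ennreal (2 * C\<^sup>2) *
      (indicator (D \<inter> B) z * ennreal ((jet_dist I g U z)\<^sup>2) + indicator (D \<inter> A) z * ennreal ((jet_dist I g w z)\<^sup>2))"
      by (cases "z \<in> D \<inter> (A \<union> B')") auto
  qed
  also have "\<dots> = ennreal (2 * C\<^sup>2) * (jet_error \<mu> (D \<inter> B) I g U + jet_error \<mu> (D \<inter> A) I g w)"
    unfolding jet_error_def by (subst nn_integral_cmult, measurable, subst nn_integral_add) auto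
  finally show ?thesis .
qed

text \<open>The indicator of the ball of radius 5r/8 is mollified at scale r/8, since 5/8 - 1/8 =
  1/2 and 5/8 + 1/8 = 3/4.\<close>

lemma cutoff_exists:
  fixes p :: "'a::euclidean_space"
  assumes r: "r > 0"
  obtains \<psi> where "test_function UNIV \<psi>" "\<And>x. x \<in> ball p (r/2) \<Longrightarrow> \<psi> x = 1"
    "\<And>x. x \<notin> cball p (3 * r / 4) \<Longrightarrow> \<psi> x = 0"
proof -
  have "r / 8 > 0" using r by simp
  then obtain J :: "'a \<Rightarrow> real" where J: "test_function UNIV J" "\<And>x. J x \<ge> 0" "(\<integral>x. J x \<partial>lborel) = 1"
    "integrable lborel J" "\<And>x. x \<notin> cball 0 (r / 8) \<Longrightarrow> J x = 0"
    using mollifier_exists[of "r / 8" "0::'a"] by metis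
  let ?B = "ball p (5 * r / 8)"
  have int: "integrable lborel (indicator ?B :: 'a \<Rightarrow> real)"
    using emeasure_lborel_ball_finite[of p "5 * r / 8"] by (simp add: integrable_indicator_iff)
  let ?\<psi> = "conv J (indicator ?B)"
  have one: "?\<psi> x = 1" if x: "x \<in> ball p (r/2)" for x
  proof -
    have eqJ: "J (x - \<zeta>) * indicator ?B \<zeta> = J (x - \<zeta>)" for \<zeta>
    proof (cases "\<zeta> \<in> ?B")
      case False
      have "dist p \<zeta> \<le> dist p x + dist x \<zeta>" by (rule dist_triangle)
      then have "norm (x - \<zeta>) > r / 8" using False x by (simp add: dist_norm)
      then show ?thesis using J(5)[of "x - \<zeta>"] by simp
    qed simp
    have "?\<psi> x = (\<integral>\<zeta>. J (x - \<zeta>) \<partial>lborel)" by (simp only: conv_def eqJ)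
    also have "\<dots> = (\<integral>\<zeta>. J (x - (x + (-1) *\<^sub>R \<zeta>)) \<partial>lborel)"
      using lborel_integral_affine[of "-1" "\<lambda>\<zeta>. J (x - \<zeta>)" x] test_function_borel[OF J(1)] by simp
    finally show ?thesis using J(3) by simp
  qed
  have zero: "?\<psi> x = 0" if x: "x \<notin> cball p (3 * r / 4)" for x
  proof -
    have eqJ: "J (x - \<zeta>) * indicator ?B \<zeta> = 0" for \<zeta>
    proof (cases "\<zeta> \<in> ?B")
      case True
      have "dist p x \<le> dist p \<zeta> + dist \<zeta> x" by (rule dist_triangle)
      then have "norm (x - \<zeta>) > r / 8" using True x by (simp add: dist_norm norm_minus_commute)
      then show ?thesis using J(5)[of "x - \<zeta>"] by simp
    qed simp
    show ?thesis by (simp only: conv_def eqJ) simp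
  qed
  have "test_function UNIV ?\<psi>"
    unfolding test_function_def using smooth_conv[OF J(1) int] zero
    by (intro conjI exI[of _ "cball p (3 * r / 4)"]) auto
  then show ?thesis using that one zero by blast
qed

definition slice_measure :: "real \<Rightarrow> ('b::euclidean_space \<times> real) measure" where
  "slice_measure t = distr lborel borel (\<lambda>x. (x, t))"

lemma sets_slice_measure [simp]: "sets (slice_measure t) = sets borel"
  by (simp add: slice_measure_def)

lemma nn_integral_slice_measure:
  "f \<in> borel_measurable borel \<Longrightarrow> (\<integral>\<^sup>+z. f z \<partial>slice_measure t) = (\<integral>\<^sup>+x. f (x, t) \<partial>lborel)"
  unfolding slice_measure_def by (subst nn_integral_distr) auto

text \<open>Cauchy-Schwarz over the finite index set, which is the origin of the factor
  \<open>card I\<close>.\<close>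

lemma jet_error_le_L2sq:
  assumes \<mu>: "sets \<mu> = sets borel" and I: "finite I"
    and e: "\<And>z l. z \<in> S \<Longrightarrow> l \<in> I \<Longrightarrow> Dl l w z - g l z = e l z" "\<And>l. l \<in> I \<Longrightarrow> e l \<in> borel_measurable borel"
  shows "jet_error \<mu> S I g w \<le> of_nat (card I) * (\<Sum>l\<in>I. L2sq \<mu> (e l))"
proof -
  have [measurable]: "e l \<in> borel_measurable \<mu>" if "l \<in> I" for l
    using e(2)[OF that] measurable_cong_sets[OF \<mu> refl] by blast
  have "jet_error \<mu> S I g w \<le> (\<integral>\<^sup>+z. of_nat (card I) * (\<Sum>l\<in>I. ennreal ((e l z)\<^sup>2)) \<partial>\<mu>)"
    unfolding jet_error_def
  proof (rule nn_integral_mono)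
    fix z
    have "ennreal ((jet_dist I g w z)\<^sup>2) \<le> of_nat (card I) * (\<Sum>l\<in>I. ennreal ((e l z)\<^sup>2))" if "z \<in> S"
    proof -
      have "jet_dist I g w z = (\<Sum>l\<in>I. \<bar>e l z\<bar>)" unfolding jet_dist_def using e(1)[OF that] by (intro sum.cong) auto
      then have "(jet_dist I g w z)\<^sup>2 \<le> real (card I) * (\<Sum>l\<in>I. (e l z)\<^sup>2)"
        using sum_squared_le_sum_of_squares[of "\<lambda>l. \<bar>e l z\<bar>" I] by (simp add: mult.commute)
      then have "ennreal ((jet_dist I g w z)\<^sup>2) \<le> ennreal (real (card I) * (\<Sum>l\<in>I. (e l z)\<^sup>2))" by (rule ennreal_leI)
      also have "\<dots> = of_nat (card I) * (\<Sum>l\<in>I. ennreal ((e l z)\<^sup>2))"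
        by (simp add: ennreal_mult sum_nonneg sum_ennreal ennreal_of_nat_eq_real_of_nat)
      finally show ?thesis .
    qed
    then show "indicator S z * ennreal ((jet_dist I g w z)\<^sup>2) \<le> of_nat (card I) * (\<Sum>l\<in>I. ennreal ((e l z)\<^sup>2))"
      by (cases "z \<in> S") auto
  qed
  also have "\<dots> = of_nat (card I) * (\<Sum>l\<in>I. L2sq \<mu> (e l))"
    unfolding L2sq_def by (subst nn_integral_cmult, measurable, subst nn_integral_sum) auto
  finally show ?thesis .
qed

lemma conv_measurable:
  fixes f g :: "'a::euclidean_space \<Rightarrow> real"
  assumes [measurable]: "f \<in> borel_measurable borel" "g \<in> borel_measurable borel"
  shows "conv f g \<in> borel_measurable borel"
  unfolding conv_def[abs_def] by measurable

text \<open>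
  The derivatives in \<open>I\<close> are approximated in \<open>L\<^sup>2\<close> of the cylinder, while those in \<open>I1\<close> are square
  integrable in space uniformly in time, which the approximations have to inherit.
\<close>

locale cylinder_jet =
  fixes D :: "('b::euclidean_space \<times> real) set" and I I1 :: "('b \<times> real) list set"
    and g :: "('b \<times> real) list \<Rightarrow> ('b \<times> real) \<Rightarrow> real" and M0 :: ennreal
  assumes D: "open D" "bounded D" "\<And>p. p \<in> closure D \<Longrightarrow> cone_at D p"
    and I: "jetset I" and g: "wjet D I g"
    and I1: "jetset I1" "I1 \<subseteq> I"
    and M0: "M0 < \<infinity>" "\<And>l. l \<in> I1 \<Longrightarrow> AE \<tau> in lborel. (\<integral>\<^sup>+x. ennreal ((g l (x, \<tau>))\<^sup>2) \<partial>lborel) \<le> M0"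
begin

text \<open>On time slices the target is replaced by zero: there a common bound is recorded, not
  convergence.\<close>

definition jet_approx_on where
  "jet_approx_on A w M \<longleftrightarrow> (\<forall>k::nat. smooth (w k)) \<and> (\<lambda>k. jet_error lborel (D \<inter> A) I g (w k)) \<longlonglongrightarrow> 0 \<and>
     M < \<infinity> \<and> (\<forall>k t. jet_error (slice_measure t) (D \<inter> A) I1 (\<lambda>_ _. 0) (w k) \<le> M)"

lemma gl: "l \<in> I \<Longrightarrow> L2z D (g l)"
  using g by (simp add: wjet_def)

lemma gl_meas: "l \<in> I \<Longrightarrow> g l \<in> borel_measurable borel"
  using gl L2z_meas by blast

lemma local_approx:
  assumes "p \<in> closure D"
  shows "\<exists>r>0. \<exists>w M. jet_approx_on (ball p r) w M"
proof -
  obtain r \<rho> y where r: "r > 0" "\<rho> > 0"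
    and cone: "\<And>x b s. x \<in> D \<inter> ball p r \<Longrightarrow> b \<in> cball y \<rho> \<Longrightarrow> s \<in> {0<..1} \<Longrightarrow> x + s *\<^sub>R b \<in> D"
    using D(3)[OF assms] unfolding cone_at_def by metis
  \<comment> \<open>A convolution evaluates at z - s b, so centring at -y makes it sample inside the
    cone.\<close>
  obtain J :: "'b \<times> real \<Rightarrow> real" where J: "test_function UNIV J" "\<And>x. J x \<ge> 0" "(\<integral>x. J x \<partial>lborel) = 1"
    "integrable lborel J" "\<And>x. x \<notin> cball (- y) \<rho> \<Longrightarrow> J x = 0"
    using mollifier_exists[OF r(2), of "- y"] by metis
  interpret mollifier J using J by unfold_locales auto
  define s where "s = (\<lambda>n. inverse (real (Suc n)))"
  have s: "s n > 0" "s n \<in> {0<..1}" for n by (auto simp: s_def field_simps)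
  have s0: "s \<longlonglongrightarrow> 0" using LIMSEQ_inverse_real_of_nat by (simp add: s_def)
  define w where "w k = conv (rescale (s k) J) (g [])" for k
  have nil: "[] \<in> I" and fin: "finite I" "finite I1" using I I1 by (auto simp: jetset_def)
  have sm: "smooth (w k)" for k
    unfolding w_def by (rule smooth_conv[OF test_function_rescale[OF J(1) s(1)] L2z_integrable[OF D(2) gl[OF nil]]])
  have Dw: "Dl l (w k) z = conv (rescale (s k) J) (g l) z" if "l \<in> I" "z \<in> D \<inter> ball p r" for l k z
    unfolding w_def by (rule Dl_conv[OF D(1,2) g s(2) J(1) J(5) cone that])
  have cm: "conv (rescale (s k) J) (g l) \<in> borel_measurable borel" if "l \<in> I" for l k
    by (rule conv_measurable[OF test_function_borel[OF test_function_rescale[OF J(1) s(1)]] gl_meas[OF that]])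
  have lim: "(\<lambda>k. jet_error lborel (D \<inter> ball p r) I g (w k)) \<longlonglongrightarrow> 0"
  proof (rule tendsto_sandwich[OF _ _ tendsto_const])
    show "\<forall>\<^sub>F k in sequentially. jet_error lborel (D \<inter> ball p r) I g (w k)
        \<le> of_nat (card I) * (\<Sum>l\<in>I. L2sq lborel (\<lambda>z. conv (rescale (s k) J) (g l) z - g l z))"
      using Dw cm gl_meas fin by (intro always_eventually allI jet_error_le_L2sq) auto
    have "(\<lambda>k. of_nat (card I) * (\<Sum>l\<in>I. L2sq lborel (\<lambda>z. conv (rescale (s k) J) (g l) z - g l z)))
        \<longlonglongrightarrow> of_nat (card I) * (\<Sum>l\<in>I. 0)"
      using L2z_fin[OF gl]
      by (intro ennreal_tendsto_cmult tendsto_sum conv_rescale_tendsto gl_meas s(1) s0) (auto simp: of_nat_less_top)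
    then show "(\<lambda>k. of_nat (card I) * (\<Sum>l\<in>I. L2sq lborel (\<lambda>z. conv (rescale (s k) J) (g l) z - g l z))) \<longlonglongrightarrow> 0"
      by simp
  qed auto
  define M where "M = of_nat (card I1) * (\<Sum>l\<in>I1. M0)"
  have bnd: "jet_error (slice_measure t) (D \<inter> ball p r) I1 (\<lambda>_ _. 0) (w k) \<le> M" for k t
  proof -
    have "jet_error (slice_measure t) (D \<inter> ball p r) I1 (\<lambda>_ _. 0) (w k)
        \<le> of_nat (card I1) * (\<Sum>l\<in>I1. L2sq (slice_measure t) (conv (rescale (s k) J) (g l)))"
      using Dw cm fin I1(2) by (intro jet_error_le_L2sq) auto
    also have "\<dots> \<le> M"
      unfolding M_def
    proof (intro mult_left_mono sum_mono)
      fix l assume l: "l \<in> I1"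
      then have lI: "l \<in> I" using I1 by blast
      have "L2sq (slice_measure t) (conv (rescale (s k) J) (g l)) = (\<integral>\<^sup>+x. ennreal ((conv (rescale (s k) J) (g l) (x, t))\<^sup>2) \<partial>lborel)"
        unfolding L2sq_def using cm[OF lI] by (subst nn_integral_slice_measure) auto
      also have "\<dots> \<le> M0"
        by (rule conv_rescale_slice_bound[OF mollifier_axioms gl_meas[OF lI] L2z_fin[OF gl[OF lI]] M0(2)[OF l] s(1)])
      finally show "L2sq (slice_measure t) (conv (rescale (s k) J) (g l)) \<le> M0" .
    qed simp
    finally show ?thesis .
  qed
  have "M < \<infinity>" using M0(1) fin by (simp add: M_def ennreal_mult_less_top of_nat_less_top)
  then show ?thesis using r sm lim bnd unfolding jet_approx_on_def by blast
qed

text \<open>The patching constants depend on the cutoff and the index sets, but not on k or t.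
  Convergence on the cylinder and the slice bound therefore both survive.\<close>

lemma patch_approx:
  assumes "jet_approx_on (ball p r) U MU" "r > 0" "jet_approx_on A w Mw" "open A" "\<And>k. test_function UNIV (w k)"
  shows "\<exists>w' M. (\<forall>k. test_function UNIV (w' k)) \<and> jet_approx_on (A \<union> ball p (r/2)) w' M"
proof -
  obtain \<psi> where \<psi>: "test_function UNIV \<psi>" "\<And>x. x \<in> ball p (r/2) \<Longrightarrow> \<psi> x = 1"
    "\<And>x. x \<notin> cball p (3 * r / 4) \<Longrightarrow> \<psi> x = 0"
    using cutoff_exists[OF assms(2), of p] by metis
  obtain C where C: "C \<ge> 0" "\<And>U w g A z. smooth U \<Longrightarrow> smooth w \<Longrightarrow> z \<in> A \<union> ball p (r/2) \<Longrightarrow>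
    jet_dist I g (\<lambda>x. w x + \<psi> x * (U x - w x)) z
      \<le> C * (indicator (ball p r) z * jet_dist I g U z + indicator A z * jet_dist I g w z)"
    using patch_pointwise[OF I \<psi>(1) assms(2) \<psi>(2,3)] by blast
  obtain C1 where C1: "C1 \<ge> 0" "\<And>U w g A z. smooth U \<Longrightarrow> smooth w \<Longrightarrow> z \<in> A \<union> ball p (r/2) \<Longrightarrow>
    jet_dist I1 g (\<lambda>x. w x + \<psi> x * (U x - w x)) z
      \<le> C1 * (indicator (ball p r) z * jet_dist I1 g U z + indicator A z * jet_dist I1 g w z)"
    using patch_pointwise[OF I1(1) \<psi>(1) assms(2) \<psi>(2,3)] by blast
  have smU: "smooth (U k)" for k using assms(1) by (simp add: jet_approx_on_def)
  have smw: "smooth (w k)" for k using assms(3) by (simp add: jet_approx_on_def)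
  define w' where "w' k = (\<lambda>x. w k x + \<psi> x * (U k x - w k x))" for k
  have sm': "smooth (w' k)" for k
    unfolding w'_def
    by (rule smooth_add[OF smw smooth_mult[OF test_function_smooth[OF \<psi>(1)] smooth_diff[OF smU smw]]])
  have test: "test_function UNIV (w' k)" for k
  proof -
    obtain K where K: "compact K" "\<And>x. x \<notin> K \<Longrightarrow> w k x = 0" using assms(5)[of k] by (auto simp: test_function_def)
    then show ?thesis unfolding test_function_def using sm'[of k] \<psi>(3)
      by (intro conjI exI[of _ "K \<union> cball p (3 * r / 4)"]) (auto simp: w'_def compact_Un)
  qed
  have meas: "D \<in> sets borel" "A \<in> sets borel" "ball p r \<in> sets borel" using D(1) assms(4) by auto
  have E: "jet_error lborel (D \<inter> (A \<union> ball p (r/2))) I g (w' k) \<le>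
      ennreal (2 * C\<^sup>2) * (jet_error lborel (D \<inter> ball p r) I g (U k) + jet_error lborel (D \<inter> A) I g (w k))" for k
    unfolding w'_def by (rule jet_error_patch[OF C(1) C(2)[OF smU smw] _ meas smU smw gl_meas]) auto
  have E1: "jet_error (slice_measure t) (D \<inter> (A \<union> ball p (r/2))) I1 (\<lambda>_ _. 0) (w' k) \<le>
      ennreal (2 * C1\<^sup>2) * (jet_error (slice_measure t) (D \<inter> ball p r) I1 (\<lambda>_ _. 0) (U k)
        + jet_error (slice_measure t) (D \<inter> A) I1 (\<lambda>_ _. 0) (w k))" for k t
    unfolding w'_def by (rule jet_error_patch[OF C1(1) C1(2)[OF smU smw] _ meas smU smw]) auto
  have "(\<lambda>k. ennreal (2 * C\<^sup>2) * (jet_error lborel (D \<inter> ball p r) I g (U k) + jet_error lborel (D \<inter> A) I g (w k)))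
      \<longlonglongrightarrow> ennreal (2 * C\<^sup>2) * (0 + 0)"
    using assms(1,3) by (intro ennreal_tendsto_cmult tendsto_add) (auto simp: jet_approx_on_def)
  then have lim: "(\<lambda>k. ennreal (2 * C\<^sup>2) * (jet_error lborel (D \<inter> ball p r) I g (U k) + jet_error lborel (D \<inter> A) I g (w k)))
      \<longlonglongrightarrow> 0" by simp
  have "(\<lambda>k. jet_error lborel (D \<inter> (A \<union> ball p (r/2))) I g (w' k)) \<longlonglongrightarrow> 0"
    by (rule tendsto_sandwich[OF _ _ tendsto_const lim]) (use E in auto)
  moreover have "jet_error (slice_measure t) (D \<inter> (A \<union> ball p (r/2))) I1 (\<lambda>_ _. 0) (w' k) \<le> ennreal (2 * C1\<^sup>2) * (MU + Mw)" for k t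
    using assms(1,3) by (intro order_trans[OF E1] mult_left_mono add_mono) (auto simp: jet_approx_on_def)
  moreover have "ennreal (2 * C1\<^sup>2) * (MU + Mw) < \<infinity>"
    using assms(1,3) by (auto simp: jet_approx_on_def ennreal_mult_less_top)
  ultimately have "jet_approx_on (A \<union> ball p (r/2)) w' (ennreal (2 * C1\<^sup>2) * (MU + Mw))"
    using sm' by (simp add: jet_approx_on_def)
  then show ?thesis using test by blast
qed

text \<open>Patching gains only the half ball, so the compact closure is covered by half balls. The
  gluing starts from the zero function and keeps compact support, which the later polynomial
  approximation relies on.\<close>

lemma global_approx:
  obtains w M where "\<And>k. test_function UNIV (w k)" "jet_approx_on UNIV w M"
proof -
  have "\<forall>p\<in>closure D. \<exists>r>0. \<exists>w M. jet_approx_on (ball p r) w M" using local_approx by blast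
  then obtain r where r: "\<And>p. p \<in> closure D \<Longrightarrow> r p > 0 \<and> (\<exists>w M. jet_approx_on (ball p (r p)) w M)" by metis
  have "compact (closure D)" using D(2) by (simp add: compact_closure)
  then obtain F where F: "F \<subseteq> closure D" "finite F" "closure D \<subseteq> (\<Union>p\<in>F. ball p (r p / 2))"
  proof (rule compactE_image)
    show "open (ball p (r p / 2))" for p by simp
    show "closure D \<subseteq> (\<Union>p\<in>closure D. ball p (r p / 2))"
      using r by force
  qed
  have "F \<subseteq> closure D \<longrightarrow> (\<exists>w M. (\<forall>k. test_function UNIV (w k)) \<and> jet_approx_on (\<Union>p\<in>F. ball p (r p / 2)) w M)"
    using F(2)
  proof (induction F rule: finite_induct)
    case empty
    have "jet_approx_on {} (\<lambda>_ _. 0) 0" by (simp add: jet_approx_on_def jet_error_def)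
    moreover have "test_function UNIV (\<lambda>_::'b \<times> real. 0)"
      by (auto simp: test_function_def intro!: exI[of _ "{}"])
    ultimately show ?case by auto
  next
    case (insert p F)
    show ?case
    proof
      assume sub: "insert p F \<subseteq> closure D"
      then obtain w M where w: "\<forall>k. test_function UNIV (w k)" "jet_approx_on (\<Union>p\<in>F. ball p (r p / 2)) w M"
        using insert by auto
      obtain U MU where U: "jet_approx_on (ball p (r p)) U MU" "r p > 0" using r sub by blast
      have "open (\<Union>p\<in>F. ball p (r p / 2))" by auto
      from patch_approx[OF U w(2) this] w(1)
      show "\<exists>w M. (\<forall>k. test_function UNIV (w k)) \<and> jet_approx_on (\<Union>p\<in>insert p F. ball p (r p / 2)) w M"
        by (simp add: Un_commute)
    qed
  qed
  then obtain w M where w: "\<And>k. test_function UNIV (w k)" "jet_approx_on (\<Union>p\<in>F. ball p (r p / 2)) w M"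
    using F(1) by blast
  have "D \<inter> (\<Union>p\<in>F. ball p (r p / 2)) = D \<inter> UNIV" using F(3) closure_subset[of D] by blast
  then have "jet_approx_on UNIV w M" using w(2) by (simp add: jet_approx_on_def)
  then show ?thesis using that w(1) by blast
qed

end

section \<open>A Sobolev inequality\<close>

definition jets2 :: "'a::euclidean_space list set" where
  "jets2 = {[]} \<union> (\<lambda>e. [e]) ` Basis \<union> (\<lambda>(e, e'). [e, e']) ` (Basis \<times> Basis)"

lemma jetset_jets2: "jetset jets2"
  by (auto simp: jetset_def jets2_def)

lemma jets2_memb: "[] \<in> jets2" "e \<in> Basis \<Longrightarrow> [e] \<in> jets2"
  "e \<in> Basis \<Longrightarrow> e' \<in> Basis \<Longrightarrow> [e, e'] \<in> jets2"
  by (auto simp: jets2_def)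

lemma finite_jets2: "finite jets2"
  by (rule conjunct1[OF jetset_jets2[unfolded jetset_def]])

abbreviation jet2_norm where "jet2_norm v \<equiv> jet_dist jets2 (\<lambda>_ _. 0) v"

lemma Dl_le_jet2_norm: "l \<in> jets2 \<Longrightarrow> \<bar>Dl l v z\<bar> \<le> jet2_norm v z"
  unfolding jet_dist_def using member_le_sum[OF _ _ finite_jets2, of l "\<lambda>l. \<bar>Dl l v z - 0\<bar>"] by simp

lemma dirder_le_jet2_norm:
  fixes v :: "'a::euclidean_space \<Rightarrow> real"
  assumes v: "smooth v" and R: "norm b \<le> R"
  shows "\<bar>dirder b v z\<bar> \<le> real DIM('a) * R * jet2_norm v z"
    and "\<bar>dirder b (dirder b v) z\<bar> \<le> (real DIM('a) * R)\<^sup>2 * jet2_norm v z"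
proof -
  have R0: "R \<ge> 0" using R norm_ge_zero order_trans by blast
  have *: "\<bar>\<Sum>e\<in>Basis. (b \<bullet> e) * f e\<bar> \<le> real DIM('a) * R * m"
    if "\<And>e. e \<in> Basis \<Longrightarrow> \<bar>f e\<bar> \<le> m" for f and m :: real
  proof -
    have "\<bar>\<Sum>e\<in>Basis. (b \<bullet> e) * f e\<bar> \<le> (\<Sum>e\<in>(Basis :: 'a set). R * m)"
    proof (rule order_trans[OF sum_abs sum_mono])
      fix e :: 'a assume e: "e \<in> Basis"
      show "\<bar>(b \<bullet> e) * f e\<bar> \<le> R * m"
        unfolding abs_mult using that[OF e] Basis_le_norm[OF e, of b] R R0 by (intro mult_mono) auto
    qed
    then show ?thesis by simp
  qed
  have d: "f differentiable (at z)" if "smooth f" for f :: "'a \<Rightarrow> real" using that by (rule smooth_differentiable)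
  show "\<bar>dirder b v z\<bar> \<le> real DIM('a) * R * jet2_norm v z"
    by (subst dirder_Basis_sum[OF d[OF v]], rule *) (use Dl_le_jet2_norm[OF jets2_memb(2)] in fastforce)
  have "\<bar>dirder e (dirder b v) z\<bar> \<le> real DIM('a) * R * jet2_norm v z" if e: "e \<in> Basis" for e
  proof -
    have "dirder b v = (\<lambda>z. \<Sum>e'\<in>Basis. (b \<bullet> e') * dirder e' v z)"
      by (rule ext, rule dirder_Basis_sum[OF smooth_differentiable[OF v]])
    then have "dirder e (dirder b v) z = dirder e (\<lambda>z. \<Sum>e'\<in>Basis. (b \<bullet> e') * dirder e' v z) z" by (rule arg_cong)
    also have "\<dots> = (\<Sum>e'\<in>Basis. dirder e (\<lambda>z. (b \<bullet> e') * dirder e' v z) z)"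
      by (rule smooth_dirder_sum) (rule smooth_cmult[OF smooth_dirder[OF v]])
    also have "\<dots> = (\<Sum>e'\<in>Basis. (b \<bullet> e') * dirder e (dirder e' v) z)"
      by (simp only: smooth_dirder_cmult[OF smooth_dirder[OF v]])
    finally have eq: "dirder e (dirder b v) z = (\<Sum>e'\<in>Basis. (b \<bullet> e') * dirder e (dirder e' v) z)" .
    show ?thesis unfolding eq
      by (rule *) (use Dl_le_jet2_norm[OF jets2_memb(3)[OF e]] in fastforce)
  qed
  then have "\<bar>dirder b (dirder b v) z\<bar> \<le> real DIM('a) * R * (real DIM('a) * R * jet2_norm v z)"
    by (subst dirder_Basis_sum[OF d[OF smooth_dirder[OF v]]]) (rule *)
  then show "\<bar>dirder b (dirder b v) z\<bar> \<le> (real DIM('a) * R)\<^sup>2 * jet2_norm v z"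
    by (simp add: power2_eq_square mult.assoc)
qed

text \<open>
  With \<open>F s = (1 - s)\<^sup>2 * v (x + s b)\<close> one has \<open>v x = F 0\<close>, which is the integral of
  \<open>s * F'' s\<close> over the unit interval; the substitution \<open>s = \<tau>\<^sup>2\<close> makes the
  Cauchy-Schwarz inequality with constant weight sufficient in dimension at most three.
\<close>

lemma ray_bound:
  fixes v :: "'a::euclidean_space \<Rightarrow> real"
  assumes v: "smooth v" and R: "norm b \<le> R" and K: "K = 2 + 4 * (real DIM('a) * R) + (real DIM('a) * R)\<^sup>2"
  shows "ennreal ((v x)\<^sup>2) \<le>
    (\<integral>\<^sup>+\<tau>. indicator {0..1} \<tau> * ennreal (4 * K\<^sup>2 * \<tau> ^ 6 * (jet2_norm v (x + \<tau>\<^sup>2 *\<^sub>R b))\<^sup>2) \<partial>lborel)"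
proof -
  define h where "h s = v (s *\<^sub>R b + x)" for s
  define h1 where "h1 s = dirder b v (s *\<^sub>R b + x)" for s
  define h2 where "h2 s = dirder b (dirder b v) (s *\<^sub>R b + x)" for s
  have l: "linear (\<lambda>s::real. s *\<^sub>R b)" by (simp add: linear_iff algebra_simps)
  have D: "((\<lambda>s. f (s *\<^sub>R b + x)) has_real_derivative dirder b f (s *\<^sub>R b + x)) (at s)"
    if "smooth f" for f s
  proof -
    have "(\<lambda>s. f (s *\<^sub>R b + x)) differentiable (at s)"
      by (rule dirder_comp_affine(2)[OF l smooth_differentiable[OF that]])
    from real_has_derivative_dirder[OF this]
    show ?thesis using dirder_comp_affine(1)[OF l smooth_differentiable[OF that], where v = 1 and x = s and b = x] by simp
  qed
  have d1: "(h has_real_derivative h1 s) (at s)" for s unfolding h_def h1_def by (rule D[OF v])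
  have d2: "(h1 has_real_derivative h2 s) (at s)" for s unfolding h2_def h1_def by (rule D[OF smooth_dirder[OF v]])
  have c: "continuous_on UNIV h" "continuous_on UNIV h1" "continuous_on UNIV h2"
    unfolding h_def h1_def h2_def
    by (rule smooth_continuous[OF smooth_comp_affine[OF l v]]
        smooth_continuous[OF smooth_comp_affine[OF l smooth_dirder[OF v]]]
        smooth_continuous[OF smooth_comp_affine[OF l smooth_dirder[OF smooth_dirder[OF v]]]])+
  define F2 where "F2 s = 2 * h s - 4 * (1 - s) * h1 s + (1 - s)\<^sup>2 * h2 s" for s
  \<comment> \<open>With F as above, G is \<open>s * F' s - F s\<close>, hence its derivative is
    \<open>s * F'' s\<close>; moreover G vanishes at 1 and equals -v x at 0.\<close>
  define G where "G s = s * (- 2 * (1 - s) * h s + (1 - s)\<^sup>2 * h1 s) - (1 - s)\<^sup>2 * h s" for s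
  have dG: "(G has_real_derivative s * F2 s) (at s)" for s
    unfolding G_def F2_def
    by (rule derivative_eq_intros d1 d2 refl | simp)+ (simp add: algebra_simps power2_eq_square)
  have cF: "continuous_on UNIV F2"
    unfolding F2_def by (intro continuous_intros c)
  define \<phi> where "\<phi> \<tau> = 2 * \<tau> ^ 3 * F2 (\<tau>\<^sup>2)" for \<tau>
  have dG2: "((\<lambda>\<tau>. G (\<tau>\<^sup>2)) has_real_derivative \<phi> \<tau>) (at \<tau>)" for \<tau>
    by (rule DERIV_cong[OF DERIV_chain2[OF dG]])
      (auto intro!: derivative_eq_intros simp: \<phi>_def power2_eq_square power3_eq_cube)
  have c\<phi>: "continuous_on UNIV \<phi>"
    unfolding \<phi>_def by (intro continuous_intros continuous_on_compose2[OF cF]) auto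
  have m[measurable]: "\<phi> \<in> borel_measurable borel" by (rule borel_measurable_continuous_onI[OF c\<phi>])
  have HB: "has_bochner_integral lborel (\<lambda>\<tau>. \<phi> \<tau> * indicator {0..1} \<tau>) (G (1\<^sup>2) - G (0\<^sup>2))"
    by (rule has_bochner_integral_FTC_Icc_real[OF zero_le_one dG2])
      (use c\<phi> in \<open>simp add: continuous_on_eq_continuous_at\<close>)
  have "G (1\<^sup>2) - G (0\<^sup>2) = v x" by (simp add: G_def h_def)
  with HB have int: "integrable lborel (\<lambda>\<tau>. indicator {0..1} \<tau> * \<phi> \<tau>)"
    and val: "(\<integral>\<tau>. indicator {0..1} \<tau> * \<phi> \<tau> \<partial>lborel) = v x"
    by (auto simp: has_bochner_integral_iff mult.commute)
  have i1: "integrable lborel (indicator {0..1::real} :: real \<Rightarrow> real)" by simp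
  have "ennreal ((v x)\<^sup>2) \<le> (\<integral>\<^sup>+\<tau>. ennreal (indicator {0..1} \<tau> * (\<phi> \<tau>)\<^sup>2) \<partial>lborel)"
    using square_integral_le[OF i1 _ _ int] m val by simp
  also have "\<dots> \<le> (\<integral>\<^sup>+\<tau>. indicator {0..1} \<tau> * ennreal (4 * K\<^sup>2 * \<tau> ^ 6 * (jet2_norm v (x + \<tau>\<^sup>2 *\<^sub>R b))\<^sup>2) \<partial>lborel)"
  proof (rule nn_integral_mono)
    fix \<tau> :: real
    show "ennreal (indicator {0..1} \<tau> * (\<phi> \<tau>)\<^sup>2) \<le>
      indicator {0..1} \<tau> * ennreal (4 * K\<^sup>2 * \<tau> ^ 6 * (jet2_norm v (x + \<tau>\<^sup>2 *\<^sub>R b))\<^sup>2)"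
    proof (cases "\<tau> \<in> {0..1}")
      case True
      let ?s = "\<tau>\<^sup>2" and ?S = "jet2_norm v (\<tau>\<^sup>2 *\<^sub>R b + x)"
      have s: "0 \<le> ?s" "?s \<le> 1" using True by (auto simp: power_le_one)
      have S0: "?S \<ge> 0" by (rule jet_dist_nonneg)
      have b1: "\<bar>h1 ?s\<bar> \<le> real DIM('a) * R * ?S" and b2: "\<bar>h2 ?s\<bar> \<le> (real DIM('a) * R)\<^sup>2 * ?S"
        unfolding h1_def h2_def by (rule dirder_le_jet2_norm[OF v R])+
      have b0: "\<bar>h ?s\<bar> \<le> ?S" using Dl_le_jet2_norm[OF jets2_memb(1), of v] by (simp add: h_def)
      have "\<bar>F2 ?s\<bar> \<le> \<bar>2 * h ?s\<bar> + \<bar>4 * (1 - ?s) * h1 ?s\<bar> + \<bar>(1 - ?s)\<^sup>2 * h2 ?s\<bar>" unfolding F2_def by linarith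
      also have "\<dots> \<le> 2 * ?S + 4 * (real DIM('a) * R * ?S) + 1 * ((real DIM('a) * R)\<^sup>2 * ?S)"
      proof (intro add_mono)
        show "\<bar>2 * h ?s\<bar> \<le> 2 * ?S" using b0 by simp
        show "\<bar>4 * (1 - ?s) * h1 ?s\<bar> \<le> 4 * (real DIM('a) * R * ?S)"
          unfolding abs_mult using b1 s by (intro mult_mono) auto
        show "\<bar>(1 - ?s)\<^sup>2 * h2 ?s\<bar> \<le> 1 * ((real DIM('a) * R)\<^sup>2 * ?S)"
          unfolding abs_mult using b2 s by (intro mult_mono) (auto simp: power_le_one)
      qed
      also have "\<dots> = K * ?S" by (simp add: K algebra_simps)
      finally have "\<bar>F2 ?s\<bar> \<le> \<bar>K * ?S\<bar>" by linarith
      then have "(F2 ?s)\<^sup>2 \<le> (K * ?S)\<^sup>2" by (simp add: abs_le_square_iff)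
      then have "(2 * \<tau> ^ 3)\<^sup>2 * (F2 ?s)\<^sup>2 \<le> (2 * \<tau> ^ 3)\<^sup>2 * (K * ?S)\<^sup>2" by (intro mult_left_mono) auto
      then have "(\<phi> \<tau>)\<^sup>2 \<le> 4 * K\<^sup>2 * \<tau> ^ 6 * ?S\<^sup>2"
        unfolding \<phi>_def by (simp add: power_mult_distrib power_mult[symmetric] algebra_simps)
      then show ?thesis using True by (simp add: add.commute ennreal_leI)
    qed simp
  qed
  finally show ?thesis .
qed

lemma Sobolev_local:
  fixes \<Omega> :: "'a::euclidean_space set"
  assumes dim: "DIM('a) \<le> 3" and \<Omega>: "\<Omega> \<in> sets borel" and \<rho>: "\<rho> > 0"
  obtains C where "C \<ge> 0" "\<And>v x. smooth v \<Longrightarrow>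
      (\<And>b s. b \<in> cball y \<rho> \<Longrightarrow> s \<in> {0<..1} \<Longrightarrow> x + s *\<^sub>R b \<in> \<Omega>) \<Longrightarrow>
      ennreal ((v x)\<^sup>2) \<le> ennreal C * jet_error lborel \<Omega> jets2 (\<lambda>_ _. 0) v"
proof -
  define R where "R = norm y + \<rho>"
  define K where "K = 2 + 4 * (real DIM('a) * R) + (real DIM('a) * R)\<^sup>2"
  let ?B = "cball y \<rho>"
  define V where "V = measure lborel ?B"
  have V: "V > 0" unfolding V_def using \<rho> by (simp add: content_cball_pos)
  have emV: "emeasure lborel ?B = ennreal V"
    unfolding V_def using emeasure_lborel_cball_finite by (intro emeasure_eq_ennreal_measure) (auto simp: less_top)
  have main: "ennreal V * ennreal ((v x)\<^sup>2) \<le> ennreal (4 * K\<^sup>2) * jet_error lborel \<Omega> jets2 (\<lambda>_ _. 0) v"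
    if v: "smooth v" and cone: "\<And>b s. b \<in> ?B \<Longrightarrow> s \<in> {0<..1} \<Longrightarrow> x + s *\<^sub>R b \<in> \<Omega>" for v x
  proof -
    have [measurable]: "jet2_norm v \<in> borel_measurable borel" "\<Omega> \<in> sets borel"
      using jet_dist_measurable[OF v, of jets2 "\<lambda>_ _. 0"] \<Omega> by auto
    have [measurable]: "?B \<in> sets borel" by simp
    let ?N = "jet_error lborel \<Omega> jets2 (\<lambda>_ _. 0) v"
    have "ennreal V * ennreal ((v x)\<^sup>2) = (\<integral>\<^sup>+b. ennreal ((v x)\<^sup>2) * indicator ?B b \<partial>lborel)"
      by (subst nn_integral_cmult_indicator) (simp_all add: emV mult.commute)
    also have "\<dots> \<le> (\<integral>\<^sup>+b. \<integral>\<^sup>+\<tau>. indicator ?B b * (indicator {0..1} \<tau> *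
        ennreal (4 * K\<^sup>2 * \<tau> ^ 6 * (jet2_norm v (x + \<tau>\<^sup>2 *\<^sub>R b))\<^sup>2)) \<partial>lborel \<partial>lborel)"
    proof (rule nn_integral_mono)
      fix b
      show "ennreal ((v x)\<^sup>2) * indicator ?B b \<le> (\<integral>\<^sup>+\<tau>. indicator ?B b * (indicator {0..1} \<tau> *
        ennreal (4 * K\<^sup>2 * \<tau> ^ 6 * (jet2_norm v (x + \<tau>\<^sup>2 *\<^sub>R b))\<^sup>2)) \<partial>lborel)"
      proof (cases "b \<in> ?B")
        case True
        have "norm b \<le> norm y + norm (b - y)" using norm_triangle_ineq[of y "b - y"] by simp
        then have "norm b \<le> R" using True by (simp add: R_def dist_norm norm_minus_commute)
        from ray_bound[OF v this K_def, of x] show ?thesis using True by simp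
      qed simp
    qed
    also have "\<dots> = (\<integral>\<^sup>+\<tau>. \<integral>\<^sup>+b. indicator ?B b * (indicator {0..1} \<tau> *
        ennreal (4 * K\<^sup>2 * \<tau> ^ 6 * (jet2_norm v (x + \<tau>\<^sup>2 *\<^sub>R b))\<^sup>2)) \<partial>lborel \<partial>lborel)"
      by (rule lborel_pair.Fubini'[symmetric]) measurable
    also have "\<dots> \<le> (\<integral>\<^sup>+\<tau>. ennreal (4 * K\<^sup>2) * ?N * indicator {0..1::real} \<tau> \<partial>lborel)"
    proof (rule nn_integral_mono_AE)
      \<comment> \<open>At \<tau> = 0 the substitution degenerates.\<close>
      have "AE \<tau> in lborel. \<tau> \<noteq> (0::real)" by (rule AE_lborel_singleton)
      then show "AE \<tau> in lborel. (\<integral>\<^sup>+b. indicator ?B b * (indicator {0..1} \<tau> *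
        ennreal (4 * K\<^sup>2 * \<tau> ^ 6 * (jet2_norm v (x + \<tau>\<^sup>2 *\<^sub>R b))\<^sup>2)) \<partial>lborel)
        \<le> ennreal (4 * K\<^sup>2) * ?N * indicator {0..1::real} \<tau>"
      proof eventually_elim
        case (elim \<tau>)
        show ?case
        proof (cases "\<tau> \<in> {0..1}")
          case True
          then have \<tau>: "0 < \<tau>\<^sup>2" "\<tau>\<^sup>2 \<le> 1" using elim by (auto simp: power_le_one)
          let ?g = "\<lambda>z. indicator \<Omega> z * ennreal ((jet2_norm v z)\<^sup>2)"
          have "(\<integral>\<^sup>+b. indicator ?B b * (indicator {0..1} \<tau> *
              ennreal (4 * K\<^sup>2 * \<tau> ^ 6 * (jet2_norm v (x + \<tau>\<^sup>2 *\<^sub>R b))\<^sup>2)) \<partial>lborel)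
            \<le> (\<integral>\<^sup>+b. ennreal (4 * K\<^sup>2) * (ennreal ((\<tau>\<^sup>2) ^ DIM('a)) * ?g (x + \<tau>\<^sup>2 *\<^sub>R b)) \<partial>lborel)"
          proof (rule nn_integral_mono)
            fix b
            have "\<tau> ^ 6 = (\<tau>\<^sup>2) ^ 3" by (simp add: power_mult[symmetric])
            also have "\<dots> \<le> (\<tau>\<^sup>2) ^ DIM('a)" using \<tau> dim by (intro power_decreasing) auto
            finally have "4 * K\<^sup>2 * \<tau> ^ 6 * (jet2_norm v (x + \<tau>\<^sup>2 *\<^sub>R b))\<^sup>2
                \<le> 4 * K\<^sup>2 * (\<tau>\<^sup>2) ^ DIM('a) * (jet2_norm v (x + \<tau>\<^sup>2 *\<^sub>R b))\<^sup>2"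
              by (intro mult_right_mono mult_left_mono) auto
            then have "ennreal (4 * K\<^sup>2 * \<tau> ^ 6 * (jet2_norm v (x + \<tau>\<^sup>2 *\<^sub>R b))\<^sup>2)
                \<le> ennreal (4 * K\<^sup>2) * (ennreal ((\<tau>\<^sup>2) ^ DIM('a)) * ennreal ((jet2_norm v (x + \<tau>\<^sup>2 *\<^sub>R b))\<^sup>2))"
              by (simp add: ennreal_mult[symmetric] mult.assoc ennreal_leI)
            then show "indicator ?B b * (indicator {0..1} \<tau> *
              ennreal (4 * K\<^sup>2 * \<tau> ^ 6 * (jet2_norm v (x + \<tau>\<^sup>2 *\<^sub>R b))\<^sup>2))
              \<le> ennreal (4 * K\<^sup>2) * (ennreal ((\<tau>\<^sup>2) ^ DIM('a)) * ?g (x + \<tau>\<^sup>2 *\<^sub>R b))"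
              using cone[of b "\<tau>\<^sup>2"] \<tau> True by (cases "b \<in> ?B") auto
          qed
          also have "\<dots> = ennreal (4 * K\<^sup>2) * (ennreal ((\<tau>\<^sup>2) ^ DIM('a)) * (\<integral>\<^sup>+b. ?g (x + \<tau>\<^sup>2 *\<^sub>R b) \<partial>lborel))"
            by (simp add: nn_integral_cmult)
          also have "ennreal ((\<tau>\<^sup>2) ^ DIM('a)) * (\<integral>\<^sup>+b. ?g (x + \<tau>\<^sup>2 *\<^sub>R b) \<partial>lborel) = ?N"
            unfolding jet_error_def using nn_integral_lborel_affine[of "\<tau>\<^sup>2" ?g x] \<tau> by simp
          finally show ?thesis using True by simp
        qed simp
      qed
    qed
    also have "\<dots> = ennreal (4 * K\<^sup>2) * ?N" by (simp add: nn_integral_cmult_indicator)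
    finally show ?thesis .
  qed
  show ?thesis
  proof (rule that[of "4 * K\<^sup>2 / V"])
    show "4 * K\<^sup>2 / V \<ge> 0" using V by simp
    fix v :: "'a \<Rightarrow> real" and x :: 'a assume v: "smooth v" and cone: "\<And>b s. b \<in> ?B \<Longrightarrow> s \<in> {0<..1} \<Longrightarrow> x + s *\<^sub>R b \<in> \<Omega>"
    have "ennreal ((v x)\<^sup>2) = ennreal (1 / V) * (ennreal V * ennreal ((v x)\<^sup>2))"
      using V by (simp add: mult.assoc[symmetric] ennreal_mult[symmetric])
    also have "\<dots> \<le> ennreal (1 / V) * (ennreal (4 * K\<^sup>2) * jet_error lborel \<Omega> jets2 (\<lambda>_ _. 0) v)"
      by (intro mult_left_mono main[OF v cone]) auto
    also have "\<dots> = ennreal (4 * K\<^sup>2 / V) * jet_error lborel \<Omega> jets2 (\<lambda>_ _. 0) v"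
      using V by (simp add: mult.assoc[symmetric] ennreal_mult[symmetric])
    finally show "ennreal ((v x)\<^sup>2) \<le> ennreal (4 * K\<^sup>2 / V) * jet_error lborel \<Omega> jets2 (\<lambda>_ _. 0) v" .
  qed
qed

text \<open>Finitely many cones serve all of \<Omega>, by compactness of its closure; the sum of
  their constants dominates each of them.\<close>

lemma Sobolev:
  fixes \<Omega> :: "'a::euclidean_space set"
  assumes dim: "DIM('a) \<le> 3" and \<Omega>: "open \<Omega>" "bounded \<Omega>" and cone: "\<And>p. p \<in> closure \<Omega> \<Longrightarrow> cone_at \<Omega> p"
  obtains C where "C \<ge> 0" "\<And>v x. smooth v \<Longrightarrow> x \<in> \<Omega> \<Longrightarrow>
      ennreal ((v x)\<^sup>2) \<le> ennreal C * jet_error lborel \<Omega> jets2 (\<lambda>_ _. 0) v"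
proof -
  have meas: "\<Omega> \<in> sets borel" using \<Omega> by simp
  have "\<forall>p\<in>closure \<Omega>. \<exists>r>0. \<exists>C\<ge>0. \<forall>v x. smooth v \<longrightarrow> x \<in> \<Omega> \<inter> ball p r \<longrightarrow>
      ennreal ((v x)\<^sup>2) \<le> ennreal C * jet_error lborel \<Omega> jets2 (\<lambda>_ _. 0) v"
  proof
    fix p assume "p \<in> closure \<Omega>"
    from cone[OF this] obtain r \<rho> y where r: "r > 0" "\<rho> > 0"
      and cn: "\<And>x b s. x \<in> \<Omega> \<inter> ball p r \<Longrightarrow> b \<in> cball y \<rho> \<Longrightarrow> s \<in> {0<..1} \<Longrightarrow> x + s *\<^sub>R b \<in> \<Omega>"
      unfolding cone_at_def by metis
    obtain C where C: "C \<ge> 0" "\<And>v x. smooth v \<Longrightarrow>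
      (\<And>b s. b \<in> cball y \<rho> \<Longrightarrow> s \<in> {0<..1} \<Longrightarrow> x + s *\<^sub>R b \<in> \<Omega>) \<Longrightarrow>
      ennreal ((v x)\<^sup>2) \<le> ennreal C * jet_error lborel \<Omega> jets2 (\<lambda>_ _. 0) v"
      using Sobolev_local[OF dim meas r(2), of y] by blast
    show "\<exists>r>0. \<exists>C\<ge>0. \<forall>v x. smooth v \<longrightarrow> x \<in> \<Omega> \<inter> ball p r \<longrightarrow>
      ennreal ((v x)\<^sup>2) \<le> ennreal C * jet_error lborel \<Omega> jets2 (\<lambda>_ _. 0) v"
      using r(1) C(1) C(2)[OF _ cn] by blast
  qed
  then obtain r C where rC: "\<And>p. p \<in> closure \<Omega> \<Longrightarrow> r p > 0" "\<And>p. p \<in> closure \<Omega> \<Longrightarrow> C p \<ge> 0"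
    "\<And>p v x. p \<in> closure \<Omega> \<Longrightarrow> smooth v \<Longrightarrow> x \<in> \<Omega> \<inter> ball p (r p) \<Longrightarrow>
      ennreal ((v x)\<^sup>2) \<le> ennreal (C p) * jet_error lborel \<Omega> jets2 (\<lambda>_ _. 0) v"
    by metis
  have "compact (closure \<Omega>)" using \<Omega> by (simp add: compact_closure)
  then obtain F where F: "F \<subseteq> closure \<Omega>" "finite F" "closure \<Omega> \<subseteq> (\<Union>p\<in>F. ball p (r p))"
  proof (rule compactE_image)
    show "open (ball p (r p))" for p by simp
    show "closure \<Omega> \<subseteq> (\<Union>p\<in>closure \<Omega>. ball p (r p))" using rC(1) by force
  qed
  have pos: "C p \<ge> 0" if "p \<in> F" for p using rC(2) F(1) that by blast
  show ?thesis
  proof (rule that[of "\<Sum>p\<in>F. C p"])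
    show "(\<Sum>p\<in>F. C p) \<ge> 0" using pos by (rule sum_nonneg)
    fix v :: "'a \<Rightarrow> real" and x assume v: "smooth v" and x: "x \<in> \<Omega>"
    then obtain p where p: "p \<in> F" "x \<in> ball p (r p)" using F(3) closure_subset by blast
    have "ennreal ((v x)\<^sup>2) \<le> ennreal (C p) * jet_error lborel \<Omega> jets2 (\<lambda>_ _. 0) v"
      using rC(3)[OF _ v] p x F(1) by blast
    also have "\<dots> \<le> ennreal (\<Sum>p\<in>F. C p) * jet_error lborel \<Omega> jets2 (\<lambda>_ _. 0) v"
      using member_le_sum[OF p(1) _ F(2), of C] pos by (intro mult_right_mono ennreal_leI) auto
    finally show "ennreal ((v x)\<^sup>2) \<le> ennreal (\<Sum>p\<in>F. C p) * jet_error lborel \<Omega> jets2 (\<lambda>_ _. 0) v" .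
  qed
qed

section \<open>Polynomial approximation of test functions\<close>

lemma Ck_close_cong_open:
  assumes "open T" "S \<subseteq> T" "\<And>x. x \<in> T \<Longrightarrow> f x = f' x"
  shows "Ck_close k S \<epsilon> f g \<longleftrightarrow> Ck_close k S \<epsilon> f' g"
  using assms(3)
proof (induction k arbitrary: f f' g)
  case 0
  then show ?case using assms(2) by (auto simp: subset_eq)
next
  case (Suc k)
  have "Ck_close k S \<epsilon> (dirder e f) (dirder e g) \<longleftrightarrow> Ck_close k S \<epsilon> (dirder e f') (dirder e g)" for e
    by (rule Suc.IH) (rule dirder_cong_open[OF assms(1)], use Suc.prems in auto)
  then show ?case using Suc.prems assms(2) by (auto simp: subset_eq)
qed

lemma test_function_integrable:
  assumes "test_function \<Omega> f"
  shows "integrable lborel f"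
proof -
  obtain K where K: "compact K" "\<And>x. x \<notin> K \<Longrightarrow> f x = 0" using assms by (auto simp: test_function_def)
  have "integrable lborel (\<lambda>x. indicator K x *\<^sub>R f x)"
    using borel_integrable_compact[OF K(1) test_function_continuous[OF assms]] by (simp add: set_integrable_def)
  moreover have "(\<lambda>x. indicator K x *\<^sub>R f x) = f"
    using K(2) by (force simp: indicator_def fun_eq_iff)
  ultimately show ?thesis by simp
qed

text \<open>Derivatives of the convolution fall on w and leave a test function, so the uniform
  estimate for all test functions yields every order by induction.\<close>

lemma approximate_identity_Ck:
  fixes L :: "nat \<Rightarrow> 'a::euclidean_space \<Rightarrow> real"
  assumes L: "\<And>n x. L n x \<ge> 0" "\<And>n. integrable lborel (L n)" "\<And>n. (\<integral>x. L n x \<partial>lborel) = 1"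
    and tail: "\<And>\<delta>. \<delta> > 0 \<Longrightarrow> (\<lambda>n. \<integral>x. indicator (- ball 0 \<delta>) x * L n x \<partial>lborel) \<longlonglongrightarrow> 0"
    and w: "test_function UNIV w"
  shows "Ck_lim sequentially k UNIV (\<lambda>n. conv w (L n)) w"
  using w
proof (induction k arbitrary: w)
  have base: "Ck_lim sequentially 0 UNIV (\<lambda>n. conv w (L n)) w" if w: "test_function UNIV w" for w
    unfolding Ck_lim_def
  proof (intro allI impI)
    fix \<epsilon> :: real assume \<epsilon>: "\<epsilon> > 0"
    obtain B where B: "B \<ge> 0" "\<And>x. \<bar>w x\<bar> \<le> B" using test_function_bounded[OF w] by metis
    obtain \<delta> where \<delta>: "\<delta> > 0" "\<And>x y. dist x y < \<delta> \<Longrightarrow> \<bar>w x - w y\<bar> < \<epsilon> / 2"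
      using test_function_uniformly_continuous[OF w, of "\<epsilon> / 2"] \<epsilon> by (metis half_gt_zero)
    let ?t = "\<lambda>n. \<integral>x. indicator (- ball 0 \<delta>) x * L n x \<partial>lborel"
    \<comment> \<open>Outside the small ball w changes by at most 2 B, and 2 B times this threshold
      is at most \<epsilon>/2.\<close>
    have "\<forall>\<^sub>F n in sequentially. ?t n < \<epsilon> / (4 * B + 1)"
      by (rule order_tendstoD(2)[OF tail[OF \<delta>(1)]]) (use \<epsilon> B(1) in auto)
    then show "\<forall>\<^sub>F n in sequentially. Ck_close 0 UNIV \<epsilon> (conv w (L n)) w"
    proof eventually_elim
      case (elim n)
      have "\<bar>conv w (L n) z - w z\<bar> \<le> \<epsilon>" for z
      proof -
        have I: "integrable lborel (\<lambda>\<zeta>. w (z - \<zeta>) * L n \<zeta>)" by (rule conv_integrable[OF w L(2)])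
        have IT: "integrable lborel (\<lambda>\<zeta>. indicator (- ball 0 \<delta>) \<zeta> * L n \<zeta>)"
        proof -
          have "integrable lborel (\<lambda>\<zeta>. indicator (- ball 0 \<delta>) \<zeta> *\<^sub>R L n \<zeta>)"
            by (rule integrable_mult_indicator[OF _ L(2)]) auto
          then show ?thesis by simp
        qed
        have "conv w (L n) z - w z = (\<integral>\<zeta>. (w (z - \<zeta>) - w z) * L n \<zeta> \<partial>lborel)"
          using I L(2,3) by (simp add: conv_def left_diff_distrib)
        also have "\<bar>\<dots>\<bar> \<le> (\<integral>\<zeta>. \<epsilon> / 2 * L n \<zeta> + 2 * B * (indicator (- ball 0 \<delta>) \<zeta> * L n \<zeta>) \<partial>lborel)"
        proof (rule order_trans[OF integral_abs_bound integral_mono])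
          show "integrable lborel (\<lambda>\<zeta>. \<bar>(w (z - \<zeta>) - w z) * L n \<zeta>\<bar>)"
            using I L(2) by (intro integrable_abs) (simp add: left_diff_distrib)
          show "integrable lborel (\<lambda>\<zeta>. \<epsilon> / 2 * L n \<zeta> + 2 * B * (indicator (- ball 0 \<delta>) \<zeta> * L n \<zeta>))"
            by (intro Bochner_Integration.integrable_add integrable_mult_right L(2) IT)
          fix \<zeta>
          have "\<bar>w (z - \<zeta>) - w z\<bar> \<le> \<epsilon> / 2 + 2 * B * indicator (- ball 0 \<delta>) \<zeta>"
          proof (cases "\<zeta> \<in> ball 0 \<delta>")
            case True
            then have "dist (z - \<zeta>) z < \<delta>" by (simp add: dist_norm)
            from \<delta>(2)[OF this] True show ?thesis by simp
          next
            case False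
            have "\<bar>w (z - \<zeta>) - w z\<bar> \<le> B + B" using B(2)[of "z - \<zeta>"] B(2)[of z] by linarith
            then show ?thesis using False \<epsilon> by simp
          qed
          from mult_right_mono[OF this L(1)[of n \<zeta>]]
          show "\<bar>(w (z - \<zeta>) - w z) * L n \<zeta>\<bar> \<le> \<epsilon> / 2 * L n \<zeta> + 2 * B * (indicator (- ball 0 \<delta>) \<zeta> * L n \<zeta>)"
            unfolding abs_mult abs_of_nonneg[OF L(1)] by (simp only: distrib_right mult.assoc)
        qed
        also have "\<dots> = \<epsilon> / 2 + 2 * B * ?t n"
          using L(2,3) IT by simp
        also have "\<dots> \<le> \<epsilon> / 2 + 2 * B * (\<epsilon> / (4 * B + 1))"
          using elim B(1) by (intro add_left_mono mult_left_mono) auto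
        also have "\<dots> \<le> \<epsilon>" using \<epsilon> B(1) by (simp add: field_simps)
        finally show ?thesis .
      qed
      then show ?case by simp
    qed
  qed
  {
    case 0
    then show ?case by (rule base)
  next
    case (Suc k)
    have "Ck_lim sequentially k UNIV (\<lambda>n. dirder e (conv w (L n))) (dirder e w)" for e
      unfolding dirder_conv[OF Suc.prems L(2)] by (rule Suc.IH[OF test_function_dirder[OF Suc.prems]])
    then show ?case using base[OF Suc.prems] by (simp add: Ck_lim_Suc)
  }
qed

section \<open>Landau kernels\<close>

text \<open>Expanding one factor separates z from \<zeta>: what remains are polynomials in z times
  integrals of lower order, with w multiplied by \<open>\<zeta> \<bullet> \<zeta>\<close> or by a
  coordinate. The induction is therefore over all such w.\<close>

lemma real_polynomial_function_conv_power:
  fixes w :: "'a::euclidean_space \<Rightarrow> real"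
  assumes "continuous_on UNIV w" "\<And>x. norm x > R \<Longrightarrow> w x = 0"
  shows "real_polynomial_function (\<lambda>z. \<integral>\<zeta>. w \<zeta> * (1 - c * ((z - \<zeta>) \<bullet> (z - \<zeta>))) ^ n \<partial>lborel)"
  using assms
proof (induction n arbitrary: w)
  case 0
  then show ?case by (simp add: real_polynomial_function.intros(2))
next
  case (Suc n)
  let ?q = "\<lambda>z \<zeta>. 1 - c * ((z - \<zeta>) \<bullet> (z - \<zeta>))"
  let ?I = "\<lambda>w z. \<integral>\<zeta>. w \<zeta> * ?q z \<zeta> ^ n \<partial>lborel"
  have int: "integrable lborel (\<lambda>\<zeta>. v \<zeta> * ?q z \<zeta> ^ n)"
    if "continuous_on UNIV v" "\<And>x. norm x > R \<Longrightarrow> v x = 0" for v z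
  proof -
    have "continuous_on (cball 0 R) (\<lambda>\<zeta>. v \<zeta> * ?q z \<zeta> ^ n)"
      by (intro continuous_intros continuous_on_subset[OF that(1)]) auto
    from borel_integrable_compact[OF compact_cball this]
    have "integrable lborel (\<lambda>\<zeta>. indicator (cball 0 R) \<zeta> *\<^sub>R (v \<zeta> * ?q z \<zeta> ^ n))"
      by (simp add: set_integrable_def)
    moreover have "(\<lambda>\<zeta>. indicator (cball 0 R) \<zeta> *\<^sub>R (v \<zeta> * ?q z \<zeta> ^ n)) = (\<lambda>\<zeta>. v \<zeta> * ?q z \<zeta> ^ n)"
      using that(2) by (force simp: indicator_def fun_eq_iff)
    ultimately show ?thesis by simp
  qed
  let ?wq = "\<lambda>\<zeta>. w \<zeta> * (\<zeta> \<bullet> \<zeta>)" and ?we = "\<lambda>e \<zeta>. w \<zeta> * (\<zeta> \<bullet> e)"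
  have cw: "continuous_on UNIV ?wq" "continuous_on UNIV (?we e)" for e
    using Suc.prems(1) by (auto intro!: continuous_intros)
  have zw: "norm x > R \<Longrightarrow> ?wq x = 0" "norm x > R \<Longrightarrow> ?we e x = 0" for x e using Suc.prems(2) by auto
  have eq: "(\<integral>\<zeta>. w \<zeta> * ?q z \<zeta> ^ Suc n \<partial>lborel)
      = (1 - c * (z \<bullet> z)) * ?I w z + ((\<Sum>e\<in>Basis. (2 * c * (z \<bullet> e)) * ?I (?we e) z) - c * ?I ?wq z)" for z
  proof -
    have "w \<zeta> * ?q z \<zeta> ^ Suc n = (1 - c * (z \<bullet> z)) * (w \<zeta> * ?q z \<zeta> ^ n)
        + ((\<Sum>e\<in>Basis. (2 * c * (z \<bullet> e)) * (?we e \<zeta> * ?q z \<zeta> ^ n)) - c * (?wq \<zeta> * ?q z \<zeta> ^ n))" for \<zeta>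
    proof -
      have "z \<bullet> \<zeta> = (\<Sum>e\<in>Basis. (z \<bullet> e) * (\<zeta> \<bullet> e))" by (rule euclidean_inner)
      then have s: "(\<Sum>e\<in>Basis. (2 * c * (z \<bullet> e)) * (?we e \<zeta> * ?q z \<zeta> ^ n))
          = 2 * c * (z \<bullet> \<zeta>) * (w \<zeta> * ?q z \<zeta> ^ n)"
        by (simp add: sum_distrib_left sum_distrib_right mult_ac)
      have q: "?q z \<zeta> = 1 - c * (z \<bullet> z) + 2 * c * (z \<bullet> \<zeta>) - c * (\<zeta> \<bullet> \<zeta>)"
        by (simp add: inner_diff inner_commute algebra_simps)
      show ?thesis unfolding s power_Suc
        by (subst (1) q) (simp add: algebra_simps)
    qed
    then have "(\<integral>\<zeta>. w \<zeta> * ?q z \<zeta> ^ Suc n \<partial>lborel) = (\<integral>\<zeta>. (1 - c * (z \<bullet> z)) * (w \<zeta> * ?q z \<zeta> ^ n)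
        + ((\<Sum>e\<in>Basis. (2 * c * (z \<bullet> e)) * (?we e \<zeta> * ?q z \<zeta> ^ n)) - c * (?wq \<zeta> * ?q z \<zeta> ^ n)) \<partial>lborel)"
      by presburger
    also have "\<dots> = (1 - c * (z \<bullet> z)) * ?I w z + ((\<Sum>e\<in>Basis. (2 * c * (z \<bullet> e)) * ?I (?we e) z) - c * ?I ?wq z)"
      using int[OF Suc.prems] int[OF cw(1) zw(1)] int[OF cw(2) zw(2)]
      by (simp del: sum_mult_indicator add: integral_sum)
    finally show ?thesis .
  qed
  have lin: "real_polynomial_function (\<lambda>z. z \<bullet> e)" for e :: 'a
    by (rule real_polynomial_function.intros(1)) (rule bounded_linear_inner_left)
  have sq: "real_polynomial_function (\<lambda>z::'a. z \<bullet> z)"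
  proof -
    have "real_polynomial_function (\<lambda>z::'a. \<Sum>e\<in>Basis. (z \<bullet> e) * (z \<bullet> e))"
      by (intro real_polynomial_function_sum real_polynomial_function.intros(4) lin) auto
    then show ?thesis by (simp add: euclidean_inner[symmetric])
  qed
  show ?case unfolding eq
    by (intro real_polynomial_function.intros(3) real_polynomial_function_diff real_polynomial_function.intros(4)
        real_polynomial_function_sum real_polynomial_function.intros(2) lin sq Suc.IH cw zw Suc.prems) auto
qed

text \<open>The Landau kernels are polynomial on the region that matters for a compactly supported function.\<close>

definition landau :: "real \<Rightarrow> nat \<Rightarrow> 'a::euclidean_space \<Rightarrow> real" where
  "landau \<rho> n x = indicator (cball 0 \<rho>) x * (1 - (x \<bullet> x) / \<rho>\<^sup>2) ^ n"

lemma landau_props: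
  fixes x :: "'a::euclidean_space"
  assumes \<rho>: "\<rho> > 0"
  shows "landau \<rho> n x \<ge> 0" "integrable lborel (landau \<rho> n :: 'a \<Rightarrow> real)"
    "0 \<le> \<delta> \<Longrightarrow> \<delta> \<le> \<rho> \<Longrightarrow> norm x \<ge> \<delta> \<Longrightarrow> landau \<rho> n x \<le> (1 - \<delta>\<^sup>2 / \<rho>\<^sup>2) ^ n"
    "0 \<le> \<delta> \<Longrightarrow> \<delta> \<le> \<rho> \<Longrightarrow> norm x \<le> \<delta> \<Longrightarrow> landau \<rho> n x \<ge> (1 - \<delta>\<^sup>2 / \<rho>\<^sup>2) ^ n"
proof -
  have xx: "x \<bullet> x = (norm x)\<^sup>2" by (simp add: power2_norm_eq_inner)
  have nn: "0 \<le> 1 - (x \<bullet> x) / \<rho>\<^sup>2" if "x \<in> cball 0 \<rho>"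
    using that \<rho> by (simp add: xx power_mono)
  show "landau \<rho> n x \<ge> 0" using nn by (simp add: landau_def indicator_def)
  have "continuous_on (cball 0 \<rho>) (\<lambda>x::'a. (1 - (x \<bullet> x) / \<rho>\<^sup>2) ^ n)"
    using \<rho> by (intro continuous_intros) auto
  from borel_integrable_compact[OF compact_cball this]
  show "integrable lborel (landau \<rho> n :: 'a \<Rightarrow> real)"
    by (simp add: set_integrable_def landau_def[abs_def])
  have d0: "0 \<le> 1 - \<delta>\<^sup>2 / \<rho>\<^sup>2" if "0 \<le> \<delta>" "\<delta> \<le> \<rho>" using that \<rho> by (simp add: power_mono)
  show "landau \<rho> n x \<le> (1 - \<delta>\<^sup>2 / \<rho>\<^sup>2) ^ n" if "0 \<le> \<delta>" "\<delta> \<le> \<rho>" "norm x \<ge> \<delta>"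
  proof (cases "x \<in> cball 0 \<rho>")
    case True
    have "1 - (x \<bullet> x) / \<rho>\<^sup>2 \<le> 1 - \<delta>\<^sup>2 / \<rho>\<^sup>2"
      using that by (simp add: xx divide_right_mono power_mono)
    then show ?thesis using True nn by (simp add: landau_def power_mono)
  next
    case False
    then show ?thesis using d0[OF that(1,2)] by (simp add: landau_def)
  qed
  show "landau \<rho> n x \<ge> (1 - \<delta>\<^sup>2 / \<rho>\<^sup>2) ^ n" if "0 \<le> \<delta>" "\<delta> \<le> \<rho>" "norm x \<le> \<delta>"
  proof -
    have "1 - \<delta>\<^sup>2 / \<rho>\<^sup>2 \<le> 1 - (x \<bullet> x) / \<rho>\<^sup>2"
      using that by (simp add: xx divide_right_mono power_mono)
    then show ?thesis using that d0[OF that(1,2)] by (simp add: landau_def power_mono)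
  qed
qed

definition landau_mass :: "'a::euclidean_space itself \<Rightarrow> real \<Rightarrow> nat \<Rightarrow> real" where
  "landau_mass _ \<rho> n = (\<integral>x. landau \<rho> n (x :: 'a) \<partial>lborel)"

lemma landau_mass_ge:
  assumes "\<rho> > 0" "0 < \<delta>" "\<delta> \<le> \<rho>"
  shows "landau_mass TYPE('a::euclidean_space) \<rho> n \<ge> measure lborel (cball (0::'a) \<delta>) * (1 - \<delta>\<^sup>2 / \<rho>\<^sup>2) ^ n"
proof -
  have fin: "emeasure lborel (cball (0::'a) \<delta>) < \<infinity>" by (rule emeasure_lborel_cball_finite)
  have "(\<integral>x. indicator (cball (0::'a) \<delta>) x * (1 - \<delta>\<^sup>2 / \<rho>\<^sup>2) ^ n \<partial>lborel) \<le> landau_mass TYPE('a) \<rho> n"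
    unfolding landau_mass_def
  proof (rule integral_mono)
    show "integrable lborel (\<lambda>x. indicator (cball (0::'a) \<delta>) x * (1 - \<delta>\<^sup>2 / \<rho>\<^sup>2) ^ n)"
      using fin by (intro integrable_mult_left) (simp add: integrable_indicator_iff)
    show "indicator (cball 0 \<delta>) x * (1 - \<delta>\<^sup>2 / \<rho>\<^sup>2) ^ n \<le> landau \<rho> n x" for x :: 'a
      using landau_props(1)[OF assms(1), of n x] landau_props(4)[OF assms(1), of \<delta> x n] assms
      by (cases "x \<in> cball 0 \<delta>") auto
  qed (rule landau_props(2)[OF assms(1)])
  then show ?thesis by simp
qed

lemma landau_mass_pos:
  assumes "\<rho> > 0"
  shows "landau_mass TYPE('a::euclidean_space) \<rho> n > 0"
proof -
  have "(0::real) < 1 - (\<rho> / 2)\<^sup>2 / \<rho>\<^sup>2" using assms by (simp add: power_divide)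
  then have "0 < measure lborel (cball (0::'a) (\<rho> / 2)) * (1 - (\<rho> / 2)\<^sup>2 / \<rho>\<^sup>2) ^ n"
    using assms by (intro mult_pos_pos zero_less_power) (auto simp: content_cball_pos)
  also have "\<dots> \<le> landau_mass TYPE('a) \<rho> n" using assms by (intro landau_mass_ge) auto
  finally show ?thesis .
qed

text \<open>Outside radius d the kernel is at most q1^n, while its mass is at least a constant times
  q2^n, by the values on the ball of radius d/2. As q1 is below q2, the normalised tail decays
  geometrically.\<close>

lemma landau_tail:
  assumes \<rho>: "\<rho> > 0" and \<delta>: "\<delta> > 0"
  shows "(\<lambda>n. \<integral>x. indicator (- ball (0::'a::euclidean_space) \<delta>) x *
    (landau \<rho> n x / landau_mass TYPE('a) \<rho> n) \<partial>lborel) \<longlonglongrightarrow> 0"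
proof -
  define d where "d = min \<delta> \<rho>"
  have d: "0 < d" "d \<le> \<delta>" "d \<le> \<rho>" using assms by (auto simp: d_def)
  let ?q1 = "1 - d\<^sup>2 / \<rho>\<^sup>2" and ?q2 = "1 - (d/2)\<^sup>2 / \<rho>\<^sup>2"
  let ?V = "measure lborel (cball (0::'a) \<rho>)" and ?V2 = "measure lborel (cball (0::'a) (d/2))"
  have "(d/2)\<^sup>2 < d\<^sup>2" using d by (simp add: power_divide)
  then have "(d/2)\<^sup>2 / \<rho>\<^sup>2 < d\<^sup>2 / \<rho>\<^sup>2" using \<rho> by (intro divide_strict_right_mono) auto
  then have q: "0 \<le> ?q1" "?q1 < ?q2" using d \<rho> by (auto simp: power_mono)
  have V2: "?V2 > 0" using d by (simp add: content_cball_pos)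
  let ?t = "\<lambda>n. \<integral>x. indicator (- ball (0::'a) \<delta>) x * (landau \<rho> n x / landau_mass TYPE('a) \<rho> n) \<partial>lborel"
  have le: "?t n \<le> (?V / ?V2) * (?q1 / ?q2) ^ n" for n
  proof -
    let ?m = "landau_mass TYPE('a) \<rho> n"
    have m: "?m > 0" by (rule landau_mass_pos[OF \<rho>])
    have "?t n \<le> (\<integral>x. indicator (cball (0::'a) \<rho>) x * (?q1 ^ n / ?m) \<partial>lborel)"
    proof (rule integral_mono)
      have "integrable lborel (\<lambda>x::'a. indicator (- ball 0 \<delta>) x *\<^sub>R (landau \<rho> n x / ?m))"
        by (intro integrable_mult_indicator integrable_divide landau_props(2)[OF \<rho>]) auto
      then show "integrable lborel (\<lambda>x::'a. indicator (- ball 0 \<delta>) x * (landau \<rho> n x / ?m))" by simp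
      show "integrable lborel (\<lambda>x. indicator (cball (0::'a) \<rho>) x * (?q1 ^ n / ?m))"
        using emeasure_lborel_cball_finite[of "0::'a" \<rho>]
        by (intro integrable_mult_left) (simp add: integrable_indicator_iff)
      fix x :: 'a
      show "indicator (- ball 0 \<delta>) x * (landau \<rho> n x / ?m) \<le> indicator (cball 0 \<rho>) x * (?q1 ^ n / ?m)"
      proof (cases "x \<in> cball 0 \<rho> \<and> x \<notin> ball 0 \<delta>")
        case True
        then have "landau \<rho> n x \<le> ?q1 ^ n" using d by (intro landau_props(3)[OF \<rho>]) auto
        then show ?thesis using True m by (simp add: divide_right_mono)
      next
        case False
        have "0 \<le> ?q1 ^ n / ?m" using q m by simp
        then show ?thesis using False by (cases "x \<in> cball 0 \<rho>") (auto simp: landau_def)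
      qed
    qed
    also have "\<dots> = ?V * (?q1 ^ n / ?m)" by simp
    also have "\<dots> \<le> ?V * (?q1 ^ n / (?V2 * ?q2 ^ n))"
    proof (intro mult_left_mono divide_left_mono)
      show "?V2 * ?q2 ^ n \<le> ?m" using d by (intro landau_mass_ge[OF \<rho>]) auto
      show "0 < ?m * (?V2 * ?q2 ^ n)" using m V2 q by (intro mult_pos_pos zero_less_power) auto
    qed (use q in auto)
    finally show ?thesis by (simp add: power_divide)
  qed
  have ge: "0 \<le> ?t n" for n
    by (intro integral_nonneg_AE AE_I2 mult_nonneg_nonneg divide_nonneg_pos
        landau_props(1)[OF \<rho>] landau_mass_pos[OF \<rho>]) simp
  have "(\<lambda>n. (?q1 / ?q2) ^ n) \<longlonglongrightarrow> 0"
    using q by (intro LIMSEQ_power_zero) (simp add: abs_if divide_simps)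
  then have "(\<lambda>n. (?V / ?V2) * (?q1 / ?q2) ^ n) \<longlonglongrightarrow> 0" by (rule tendsto_mult_right_zero)
  then show ?thesis by (rule tendsto_sandwich[OF _ _ tendsto_const, rotated 2]) (use le ge in auto)
qed

theorem polynomial_Ck_approx:
  fixes w :: "'a::euclidean_space \<Rightarrow> real"
  assumes w: "test_function UNIV w" and S: "bounded S" and \<epsilon>: "\<epsilon> > 0"
  obtains p where "real_polynomial_function p" "Ck_close k S \<epsilon> p w"
proof -
  obtain R1 where R1: "R1 > 0" "\<And>x. norm x > R1 \<Longrightarrow> w x = 0" using test_function_ball[OF w] by metis
  obtain R2 where R2: "\<And>x. x \<in> S \<Longrightarrow> norm x \<le> R2" using S by (auto simp: bounded_iff)
  define R where "R = max R1 R2 + 1"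
  have R: "R > 0" "S \<subseteq> ball 0 R" "\<And>x. norm x > R \<Longrightarrow> w x = 0"
    using R1 R2 by (force simp: R_def)+
  \<comment> \<open>The difference of two points of norm at most R has norm at most 2 R, so the
    kernel is evaluated where it is a polynomial.\<close>
  define \<rho> where "\<rho> = 2 * R"
  have \<rho>: "\<rho> > 0" using R by (simp add: \<rho>_def)
  let ?m = "landau_mass TYPE('a) \<rho>"
  define L where "L n x = landau \<rho> n (x::'a) / ?m n" for n x
  have m: "?m n > 0" for n by (rule landau_mass_pos[OF \<rho>])
  have "Ck_lim sequentially k UNIV (\<lambda>n. conv w (L n)) w"
  proof (rule approximate_identity_Ck[OF _ _ _ _ w])
    show "L n x \<ge> 0" for n x unfolding L_def by (rule divide_nonneg_pos[OF landau_props(1)[OF \<rho>] m])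
    show "integrable lborel (L n)" for n
      unfolding L_def by (intro integrable_divide landau_props(2)[OF \<rho>])
    show "(\<integral>x. L n x \<partial>lborel) = 1" for n
      using m[of n] by (simp add: L_def landau_mass_def)
    show "(\<lambda>n. \<integral>x. indicator (- ball 0 \<delta>) x * L n x \<partial>lborel) \<longlonglongrightarrow> 0" if "\<delta> > 0" for \<delta>
      unfolding L_def by (rule landau_tail[OF \<rho> that])
  qed
  then have "\<forall>\<^sub>F n in sequentially. Ck_close k UNIV \<epsilon> (conv w (L n)) w" using \<epsilon> by (simp add: Ck_lim_def)
  then obtain n where n: "Ck_close k UNIV \<epsilon> (conv w (L n)) w"
    using eventually_happens sequentially_bot by blast
  have "Ck_close k S \<epsilon> f g" if "Ck_close k UNIV \<epsilon> f g" for f g :: "'a \<Rightarrow> real"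
    using that by (induction k arbitrary: f g) auto
  with n have n': "Ck_close k S \<epsilon> (conv w (L n)) w" by blast
  let ?p = "\<lambda>z. (\<integral>\<zeta>. w \<zeta> * (1 - inverse (\<rho>\<^sup>2) * ((z - \<zeta>) \<bullet> (z - \<zeta>))) ^ n \<partial>lborel)"
  let ?P = "\<lambda>z. inverse (?m n) * ?p z"
  have eq: "conv w (L n) z = ?P z" if z: "z \<in> ball 0 R" for z
  proof -
    have [measurable]: "w \<in> borel_measurable borel" by (rule test_function_borel[OF w])
    have [measurable]: "L n \<in> borel_measurable borel"
      using borel_measurable_integrable[OF landau_props(2)[OF \<rho>, of n]]
      unfolding L_def by (intro borel_measurable_divide) simp_all
    \<comment> \<open>Reflecting the integration variable moves z into the kernel, so that the
      polynomial dependence on z becomes visible.\<close>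
    have "conv w (L n) z = (\<integral>\<zeta>. w (z - (z + (-1) *\<^sub>R \<zeta>)) * L n (z + (-1) *\<^sub>R \<zeta>) \<partial>lborel)"
      unfolding conv_def using lborel_integral_affine[of "-1" "\<lambda>\<zeta>. w (z - \<zeta>) * L n \<zeta>" z] by simp
    also have "\<dots> = (\<integral>\<zeta>. inverse (?m n) * (w \<zeta> * (1 - inverse (\<rho>\<^sup>2) * ((z - \<zeta>) \<bullet> (z - \<zeta>))) ^ n) \<partial>lborel)"
    proof (rule Bochner_Integration.integral_cong[OF refl])
      fix \<zeta>
      show "w (z - (z + (-1) *\<^sub>R \<zeta>)) * L n (z + (-1) *\<^sub>R \<zeta>)
          = inverse (?m n) * (w \<zeta> * (1 - inverse (\<rho>\<^sup>2) * ((z - \<zeta>) \<bullet> (z - \<zeta>))) ^ n)"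
      proof (cases "norm \<zeta> > R")
        case False
        have "norm (z - \<zeta>) \<le> norm z + norm \<zeta>" by (rule norm_triangle_ineq4)
        then have "z - \<zeta> \<in> cball 0 \<rho>" using False z by (simp add: \<rho>_def)
        then show ?thesis by (simp add: L_def landau_def divide_inverse mult_ac)
      qed (simp add: R(3))
    qed
    finally show ?thesis by simp
  qed
  have "Ck_close k S \<epsilon> ?P w"
    using n' Ck_close_cong_open[OF open_ball R(2), of "conv w (L n)" ?P k \<epsilon> w] eq by blast
  moreover have "real_polynomial_function ?P"
    by (intro real_polynomial_function.intros(4) real_polynomial_function.intros(2)
        real_polynomial_function_conv_power[OF test_function_continuous[OF w] R(3)])
  ultimately show ?thesis using that by blast
qed

theorem shallow_Ck_approx:
  fixes w :: "'a::euclidean_space \<Rightarrow> real"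
  assumes "smooth \<sigma>" "\<not> polynomial_fun \<sigma>" "test_function UNIV w" "bounded S" "\<epsilon> > 0"
  obtains h where "h \<in> shallow \<sigma>" "Ck_close k S \<epsilon> h w"
proof -
  have "shallow_approx \<sigma> k S w"
  proof (rule approximable_close[OF assms(1,4) test_function_smooth[OF assms(3)]])
    fix e :: real assume "e > 0"
    from polynomial_Ck_approx[OF assms(3,4) this, of k]
    obtain p where "real_polynomial_function p" "Ck_close k S e p w" by metis
    then show "\<exists>g. shallow_approx \<sigma> k S g \<and> Ck_close k S e g w"
      using approximable_polynomial[OF assms(1,4,2)] by blast
  qed
  then show ?thesis using that assms(5) unfolding shallow_approx_def by blast
qed

section \<open>Sobolev norms and traces\<close>

lemma L2z_test_integrable:
  assumes "bounded D" "L2z D k" "smooth \<phi>" "test_function UNIV \<phi>"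
  shows "integrable lborel (\<lambda>x. k x * \<phi> x)"
proof -
  obtain B where B: "B \<ge> 0" "\<And>x. \<bar>\<phi> x\<bar> \<le> B" using test_function_bounded[OF assms(4)] by metis
  show ?thesis
  proof (rule Bochner_Integration.integrable_bound)
    show "integrable lborel (\<lambda>x. B * k x)" using L2z_integrable[OF assms(1,2)] by simp
    show "AE x in lborel. norm (k x * \<phi> x) \<le> norm (B * k x)"
      using B by (auto simp: abs_mult mult.commute intro!: mult_right_mono)
    show "(\<lambda>x. k x * \<phi> x) \<in> borel_measurable lborel"
      using L2z_meas[OF assms(2)] test_function_borel[OF assms(4)] by simp
  qed
qed

section \<open>Weak derivatives modulo null sets\<close>

lemma wd_diff:
  assumes "bounded D" "L2z D f" "L2z D g" "L2z D f'" "L2z D g'" "wd D v f g" "wd D v f' g'"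
  shows "wd D v (\<lambda>x. f x - f' x) (\<lambda>x. g x - g' x)"
  unfolding wd_def
proof (intro allI impI)
  fix \<phi> assume \<phi>: "test_function D \<phi>"
  note t = test_function_UNIV[OF \<phi>]
  note t' = test_function_dirder[OF t, of v]
  note I = L2z_test_integrable[OF assms(1) _ test_function_smooth[OF t] t]
  note I' = L2z_test_integrable[OF assms(1) _ test_function_smooth[OF t'] t']
  show "(\<integral>x. (f x - f' x) * dirder v \<phi> x \<partial>lborel) = - (\<integral>x. (g x - g' x) * \<phi> x \<partial>lborel)"
    using assms(6,7) \<phi> I[OF assms(3)] I[OF assms(5)] I'[OF assms(2)] I'[OF assms(4)]
    by (simp add: wd_def left_diff_distrib)
qed

lemma wd_cong_AE:
  assumes "AE x in lborel. f x = f' x" "AE x in lborel. g x = g' x"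
    and m: "f \<in> borel_measurable borel" "f' \<in> borel_measurable borel"
      "g \<in> borel_measurable borel" "g' \<in> borel_measurable borel" and "wd D v f g"
  shows "wd D v f' g'"
  unfolding wd_def
proof (intro allI impI)
  fix \<phi> assume \<phi>: "test_function D \<phi>"
  note [measurable] = m test_function_borel[OF \<phi>] test_function_borel[OF test_function_dirder[OF \<phi>]]
  have "(\<integral>x. f' x * dirder v \<phi> x \<partial>lborel) = (\<integral>x. f x * dirder v \<phi> x \<partial>lborel)"
    by (rule integral_cong_AE) (measurable, use assms(1) in \<open>auto elim: eventually_mono\<close>)
  moreover have "(\<integral>x. g' x * \<phi> x \<partial>lborel) = (\<integral>x. g x * \<phi> x \<partial>lborel)"
    by (rule integral_cong_AE) (measurable, use assms(2) in \<open>auto elim: eventually_mono\<close>)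
  ultimately show "(\<integral>x. f' x * dirder v \<phi> x \<partial>lborel) = - (\<integral>x. g' x * \<phi> x \<partial>lborel)"
    using assms(7) \<phi> by (simp add: wd_def)
qed

lemma is_rep_meas: "is_rep D f f' \<Longrightarrow> f' \<in> borel_measurable borel"
  and is_rep_AE: "is_rep D f f' \<Longrightarrow> AE x in lborel. x \<in> D \<longrightarrow> f x = f' x"
  and is_rep_zero: "is_rep D f f' \<Longrightarrow> x \<notin> D \<Longrightarrow> f' x = 0"
  by (auto simp: is_rep_def)

lemma is_rep_AE_eq:
  assumes D: "D \<in> sets borel" and "is_rep D f f'" "is_rep D g g'"
  shows "(AE x in lebesgue_on D. f x = g x) \<longleftrightarrow> (AE x in lborel. f' x = g' x)"
proof -
  have a: "AE x in lborel. (x \<in> D \<longrightarrow> f x = f' x) \<and> (x \<in> D \<longrightarrow> g x = g' x)"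
    using is_rep_AE[OF assms(2)] is_rep_AE[OF assms(3)] by eventually_elim simp
  show ?thesis unfolding AE_lebesgue_on_iff[OF D]
  proof
    assume "AE x in lborel. x \<in> D \<longrightarrow> f x = g x"
    with a show "AE x in lborel. f' x = g' x"
      by eventually_elim (use is_rep_zero[OF assms(2)] is_rep_zero[OF assms(3)] in fastforce)
  next
    assume "AE x in lborel. f' x = g' x"
    with a show "AE x in lborel. x \<in> D \<longrightarrow> f x = g x" by eventually_elim auto
  qed
qed

lemma is_rep_measurable:
  assumes D: "D \<in> sets borel" and "is_rep D f f'"
  shows "f \<in> borel_measurable (lebesgue_on D)"
proof -
  have "(\<lambda>x. indicator D x *\<^sub>R f x) \<in> borel_measurable lebesgue"
  proof (rule borel_measurable_AE)
    show "f' \<in> borel_measurable lebesgue"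
      by (rule measurable_completion) (use is_rep_meas[OF assms(2)] in simp)
    have "AE x in lborel. f' x = indicator D x *\<^sub>R f x"
      using is_rep_AE[OF assms(2)]
      by eventually_elim (use is_rep_zero[OF assms(2)] in \<open>auto simp: indicator_def\<close>)
    then show "AE x in lebesgue. f' x = indicator D x *\<^sub>R f x" by (simp add: AE_completion_iff)
  qed
  then show ?thesis using D by (subst borel_measurable_restrict_space_iff) auto
qed

lemma is_rep_L2_iff:
  assumes "D \<in> sets borel" "is_rep D f f'"
  shows "f \<in> L2 (lebesgue_on D) \<longleftrightarrow> L2z D f'"
  using is_rep_L2z[OF assms(1) _ assms(2)] is_rep_measurable[OF assms] is_rep_L2sq[OF assms]
  by (auto simp: L2_def L2z_def)

lemma L2_rep:
  assumes "D \<in> sets borel" "f \<in> L2 (lebesgue_on D)"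
  obtains f' where "is_rep D f f'" "L2z D f'"
proof -
  obtain f' where "is_rep D f f'" using is_rep_exists[OF assms(1)] assms(2) by (auto simp: L2_def)
  then show ?thesis using that is_rep_L2z[OF assms] by blast
qed

lemma has_wderiv_iff_wd:
  assumes D: "D \<in> sets borel" and r: "is_rep D f f'" "is_rep D g g'"
  shows "has_wderiv D v f g \<longleftrightarrow> L2z D f' \<and> L2z D g' \<and> wd D v f' g'"
proof
  assume h: "has_wderiv D v f g"
  then show "L2z D f' \<and> L2z D g' \<and> wd D v f' g'"
    using has_wderiv_wd[OF D h r] is_rep_L2z[OF D _ r(1)] is_rep_L2z[OF D _ r(2)] by (simp add: has_wderiv_def)
next
  assume h: "L2z D f' \<and> L2z D g' \<and> wd D v f' g'"
  show "has_wderiv D v f g"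
    unfolding has_wderiv_def is_rep_L2_iff[OF D r(1)] is_rep_L2_iff[OF D r(2)]
  proof (intro conjI allI impI)
    fix \<phi> assume \<phi>: "test_function D \<phi>"
    show "(\<integral>x. f x * dirder v \<phi> x \<partial>lebesgue_on D) = - (\<integral>x. g x * \<phi> x \<partial>lebesgue_on D)"
      unfolding is_rep_integral[OF D r(2) test_function_borel[OF \<phi>]]
        is_rep_integral[OF D r(1) test_function_borel[OF test_function_dirder[OF \<phi>]]]
      using h \<phi> by (simp add: wd_def)
  qed (use h in auto)
qed

lemma is_rep_diff: "is_rep D f f' \<Longrightarrow> is_rep D g g' \<Longrightarrow> is_rep D (\<lambda>x. f x - g x) (\<lambda>x. f' x - g' x)"
  by (auto simp: is_rep_def elim!: eventually_rev_mp)

lemma has_wderiv_L2: "has_wderiv D v f g \<Longrightarrow> f \<in> L2 (lebesgue_on D)" "has_wderiv D v f g \<Longrightarrow> g \<in> L2 (lebesgue_on D)"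
  by (auto simp: has_wderiv_def)

lemma has_wderiv_diff:
  assumes D: "D \<in> sets borel" "bounded D" and h: "has_wderiv D v f g" "has_wderiv D v f' g'"
  shows "has_wderiv D v (\<lambda>x. f x - f' x) (\<lambda>x. g x - g' x)"
proof -
  obtain a where a: "is_rep D f a" "L2z D a" using L2_rep[OF D(1) has_wderiv_L2(1)[OF h(1)]] by metis
  obtain b where b: "is_rep D g b" "L2z D b" using L2_rep[OF D(1) has_wderiv_L2(2)[OF h(1)]] by metis
  obtain a' where a': "is_rep D f' a'" "L2z D a'" using L2_rep[OF D(1) has_wderiv_L2(1)[OF h(2)]] by metis
  obtain b' where b': "is_rep D g' b'" "L2z D b'" using L2_rep[OF D(1) has_wderiv_L2(2)[OF h(2)]] by metis
  show ?thesis
    unfolding has_wderiv_iff_wd[OF D(1) is_rep_diff[OF a(1) a'(1)] is_rep_diff[OF b(1) b'(1)]]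
    using has_wderiv_wd[OF D(1) h(1) a(1) b(1)] has_wderiv_wd[OF D(1) h(2) a'(1) b'(1)]
      L2z_diff[OF a(2) a'(2)] L2z_diff[OF b(2) b'(2)] wd_diff[OF D(2) a(2) b(2) a'(2) b'(2)] by blast
qed

lemma has_wderiv_unique:
  assumes D: "open D" "bounded D" and h: "has_wderiv D v f g" "has_wderiv D v f' g'"
    and eq: "AE x in lebesgue_on D. f x = f' x"
  shows "AE x in lebesgue_on D. g x = g' x" and "has_wderiv D v f' g"
proof -
  have Db: "D \<in> sets borel" using D by simp
  obtain a where a: "is_rep D f a" "L2z D a" using L2_rep[OF Db has_wderiv_L2(1)[OF h(1)]] by metis
  obtain b where b: "is_rep D g b" "L2z D b" using L2_rep[OF Db has_wderiv_L2(2)[OF h(1)]] by metis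
  obtain a' where a': "is_rep D f' a'" "L2z D a'" using L2_rep[OF Db has_wderiv_L2(1)[OF h(2)]] by metis
  obtain b' where b': "is_rep D g' b'" "L2z D b'" using L2_rep[OF Db has_wderiv_L2(2)[OF h(2)]] by metis
  have "AE x in lborel. a x = a' x" using eq is_rep_AE_eq[OF Db a(1) a'(1)] by simp
  then have w: "wd D v a' b"
    by (rule wd_cong_AE[OF _ _ _ _ _ _ has_wderiv_wd[OF Db h(1) a(1) b(1)]])
      (simp_all add: L2z_meas[OF a(2)] L2z_meas[OF b(2)] L2z_meas[OF a'(2)])
  then have "AE x in lborel. b x = b' x"
    by (rule wd_unique[OF D b(2) b'(2) _ has_wderiv_wd[OF Db h(2) a'(1) b'(1)]])
  then show "AE x in lebesgue_on D. g x = g' x" using is_rep_AE_eq[OF Db b(1) b'(1)] by simp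
  show "has_wderiv D v f' g" using w a'(2) b(2) has_wderiv_iff_wd[OF Db a'(1) b(1)] by simp
qed

text \<open>Second derivatives are the occasion: \<open>wderiv\<close> is an arbitrary choice, equal
  to a given first derivative only almost everywhere, and it is differentiated once more in the
  equation.\<close>

lemma has_wderiv_cong_AE:
  assumes D: "D \<in> sets borel" and h: "has_wderiv D v f g" and f': "f' \<in> L2 (lebesgue_on D)"
    and eq: "AE x in lebesgue_on D. f x = f' x"
  shows "has_wderiv D v f' g"
proof -
  obtain a where a: "is_rep D f a" "L2z D a" using L2_rep[OF D has_wderiv_L2(1)[OF h]] by metis
  obtain b where b: "is_rep D g b" "L2z D b" using L2_rep[OF D has_wderiv_L2(2)[OF h]] by metis
  obtain a' where a': "is_rep D f' a'" "L2z D a'" using L2_rep[OF D f'] by metis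
  have "AE x in lborel. a x = a' x" using eq is_rep_AE_eq[OF D a(1) a'(1)] by simp
  then have "wd D v a' b"
    by (rule wd_cong_AE[OF _ _ _ _ _ _ has_wderiv_wd[OF D h a(1) b(1)]])
      (simp_all add: L2z_meas[OF a(2)] L2z_meas[OF b(2)] L2z_meas[OF a'(2)])
  then show ?thesis using a'(2) b(2) has_wderiv_iff_wd[OF D a'(1) b(1)] by simp
qed

lemma has_wderiv_wderiv: "has_wderiv D v f g \<Longrightarrow> has_wderiv D v f (wderiv D v f)"
  unfolding wderiv_def by (rule someI[where P = "has_wderiv D v f"])

lemma wderiv_AE:
  assumes "open D" "bounded D" "has_wderiv D v f g"
  shows "AE x in lebesgue_on D. wderiv D v f x = g x"
  by (rule has_wderiv_unique(1)[OF assms(1,2) has_wderiv_wderiv[OF assms(3)] assms(3)]) simp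

lemma L2norm_sq: "L2sq M f < \<infinity> \<Longrightarrow> ennreal ((L2norm M f)\<^sup>2) = L2sq M f"
  by (simp add: L2norm_def)

text \<open>Any weak derivatives g compute the norm, since the chosen ones differ from them on null
  sets. All later statements about \<open>H1norm\<close> go through this formula.\<close>

lemma H1norm_sq:
  assumes D: "open D" "bounded D" and h: "\<And>e. e \<in> Basis \<Longrightarrow> has_wderiv D e f (g e)"
    and f: "f \<in> L2 (lebesgue_on D)"
  shows "ennreal ((H1norm D f)\<^sup>2) = L2sq (lebesgue_on D) f + (\<Sum>e\<in>Basis. L2sq (lebesgue_on D) (g e))"
proof -
  have "ennreal ((L2norm (lebesgue_on D) (wderiv D e f))\<^sup>2) = L2sq (lebesgue_on D) (g e)" if "e \<in> Basis" for e
  proof -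
    have "L2sq (lebesgue_on D) (wderiv D e f) = L2sq (lebesgue_on D) (g e)"
      by (rule L2sq_cong_AE[OF wderiv_AE[OF D h[OF that]]])
    moreover have "L2sq (lebesgue_on D) (g e) < \<infinity>" using has_wderiv_L2(2)[OF h[OF that]] by (simp add: L2_def)
    ultimately show ?thesis by (subst L2norm_sq) auto
  qed
  moreover have "ennreal ((L2norm (lebesgue_on D) f)\<^sup>2) = L2sq (lebesgue_on D) f"
    using f by (intro L2norm_sq) (simp add: L2_def)
  moreover have "(H1norm D f)\<^sup>2 = (L2norm (lebesgue_on D) f)\<^sup>2 + (\<Sum>e\<in>Basis. (L2norm (lebesgue_on D) (wderiv D e f))\<^sup>2)"
    by (simp add: H1norm_def grad_norm_def sum_nonneg)
  ultimately show ?thesis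
    by (simp add: sum_nonneg ennreal_plus sum_ennreal[symmetric])
qed

section \<open>Smooth functions as Sobolev functions, and traces\<close>

text \<open>Convolved with the indicator of a large ball, \<psi> becomes constant near 0, with value
  the integral of \<psi>. The derivative of that constant is zero, and it is also the convolution of
  the derivative, that is, the integral in question.\<close>

lemma integral_dirder_test:
  assumes "test_function UNIV \<psi>"
  shows "(\<integral>x. dirder v \<psi> x \<partial>lborel) = 0"
proof -
  obtain R where R: "R > 0" "\<And>x. norm x > R \<Longrightarrow> \<psi> x = 0" using test_function_ball[OF assms] by metis
  define B where "B = cball (0::'a) (R + 1)"
  have int: "integrable lborel (indicator B :: 'a \<Rightarrow> real)"
    using emeasure_lborel_cball_finite[of "0::'a" "R + 1"] by (simp add: integrable_indicator_iff B_def)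
  have flip: "(\<integral>\<zeta>. f (z - \<zeta>) \<partial>lborel) = (\<integral>\<zeta>. f \<zeta> \<partial>lborel)" if "f \<in> borel_measurable borel" for f :: "'a \<Rightarrow> real" and z
    using lborel_integral_affine[of "-1" "\<lambda>\<zeta>. f (z - \<zeta>)" z] that by simp
  have eq: "conv f (indicator B) z = (\<integral>x. f x \<partial>lborel)"
    if f: "f \<in> borel_measurable borel" "\<And>x. norm x > R \<Longrightarrow> f x = 0" and z: "z \<in> ball 0 1" for f z
  proof -
    have "f (z - \<zeta>) * indicator B \<zeta> = f (z - \<zeta>)" for \<zeta>
    proof (cases "\<zeta> \<in> B")
      case False
      have "norm \<zeta> \<le> norm z + norm (z - \<zeta>)" using norm_triangle_sub[of \<zeta> z] by (simp add: norm_minus_commute)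
      then have "norm (z - \<zeta>) > R" using False z by (simp add: B_def)
      then show ?thesis using f(2) by simp
    qed simp
    then show ?thesis unfolding conv_def by (simp only: flip[OF f(1)])
  qed
  have z: "dirder v \<psi> x = 0" if "norm x > R" for x
    by (rule dirder_support[of "cball 0 R"]) (use R(2) that in auto)
  have "dirder v (conv \<psi> (indicator B)) 0 = 0"
    by (rule dirder_eq_0_open[of "ball 0 1" _ "\<integral>x. \<psi> x \<partial>lborel"])
      (use eq[OF test_function_borel[OF assms] R(2)] in auto)
  then show ?thesis
    unfolding dirder_conv[OF assms int] using eq[of "dirder v \<psi>" 0, OF test_function_borel[OF test_function_dirder[OF assms]] z] by simp
qed

lemma smooth_is_rep:
  assumes "D \<in> sets borel" "smooth f"
  shows "is_rep D f (\<lambda>x. indicator D x * f x)"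
  using assms smooth_borel[OF assms(2)] by (auto simp: is_rep_def)

lemma smooth_L2z:
  assumes "open D" "bounded D" "smooth f"
  shows "L2z D (\<lambda>x. indicator D x * f x)"
proof -
  obtain B where B: "B \<ge> 0" "\<And>z. z \<in> D \<Longrightarrow> \<bar>f z\<bar> \<le> B" using smooth_bounded_on[OF assms(3,2)] by metis
  have fin: "emeasure lborel D < \<infinity>" using emeasure_bounded_finite[OF assms(2)] by simp
  have "L2sq lborel (\<lambda>x. indicator D x * f x) \<le> (\<integral>\<^sup>+x. ennreal (B\<^sup>2) * indicator D x \<partial>lborel)"
    unfolding L2sq_def
    by (rule nn_integral_mono) (use B in \<open>auto simp: indicator_def abs_le_square_iff[symmetric] intro!: ennreal_leI\<close>)
  also have "\<dots> < \<infinity>" using fin assms(1) by (simp add: nn_integral_cmult_indicator ennreal_mult_less_top)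
  finally show ?thesis using smooth_borel[OF assms(3)] assms(1) by (auto simp: L2z_def)
qed

lemma smooth_L2: "open D \<Longrightarrow> bounded D \<Longrightarrow> smooth f \<Longrightarrow> f \<in> L2 (lebesgue_on D)"
  using is_rep_L2_iff[OF borel_open smooth_is_rep[OF borel_open]] smooth_L2z by blast

text \<open>Integration by parts: the product of f with a test function is again a test function,
  and its derivative has integral zero.\<close>

lemma smooth_has_wderiv:
  assumes D: "open D" "bounded D" and f: "smooth f"
  shows "has_wderiv D v f (dirder v f)"
proof -
  have Db: "D \<in> sets borel" using D by simp
  show ?thesis
    unfolding has_wderiv_iff_wd[OF Db smooth_is_rep[OF Db f] smooth_is_rep[OF Db smooth_dirder[OF f]]]
  proof (intro conjI smooth_L2z D f smooth_dirder)
    show "wd D v (\<lambda>x. indicator D x * f x) (\<lambda>x. indicator D x * dirder v f x)"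
      unfolding wd_def
    proof (intro allI impI)
      fix \<phi> assume \<phi>: "test_function D \<phi>"
      note t = test_function_UNIV[OF \<phi>]
      have s: "smooth \<phi>" by (rule test_function_smooth[OF t])
      have z: "\<phi> x = 0" "dirder v \<phi> x = 0" if "x \<notin> D" for x
        using \<phi> test_function_dirder[OF \<phi>, of v] that by (auto simp: test_function_def)
      obtain K where K: "compact K" "\<And>x. x \<notin> K \<Longrightarrow> \<phi> x = 0" using \<phi> by (auto simp: test_function_def)
      have tm: "test_function UNIV (\<lambda>x. h x * \<psi> x)" if "smooth h" "test_function UNIV \<psi>" for h \<psi>
        using that smooth_mult[OF that(1)] unfolding test_function_def by fastforce
      have "0 = (\<integral>x. dirder v (\<lambda>x. f x * \<phi> x) x \<partial>lborel)" using integral_dirder_test[OF tm[OF f t]] by simp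
      also have "\<dots> = (\<integral>x. f x * dirder v \<phi> x + dirder v f x * \<phi> x \<partial>lborel)"
        by (simp only: smooth_dirder_mult[OF f s])
      also have "\<dots> = (\<integral>x. f x * dirder v \<phi> x \<partial>lborel) + (\<integral>x. dirder v f x * \<phi> x \<partial>lborel)"
        by (rule Bochner_Integration.integral_add)
          (rule test_function_integrable[OF tm[OF f test_function_dirder[OF t]]],
           rule test_function_integrable[OF tm[OF smooth_dirder[OF f] t]])
      also have "(\<integral>x. f x * dirder v \<phi> x \<partial>lborel) = (\<integral>x. indicator D x * f x * dirder v \<phi> x \<partial>lborel)"
        by (rule Bochner_Integration.integral_cong) (use z in \<open>auto simp: indicator_def\<close>)
      also have "(\<integral>x. dirder v f x * \<phi> x \<partial>lborel) = (\<integral>x. indicator D x * dirder v f x * \<phi> x \<partial>lborel)"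
        by (rule Bochner_Integration.integral_cong) (use z in \<open>auto simp: indicator_def\<close>)
      finally show "(\<integral>x. indicator D x * f x * dirder v \<phi> x \<partial>lborel)
          = - (\<integral>x. indicator D x * dirder v f x * \<phi> x \<partial>lborel)" by linarith
    qed
  qed
qed

lemma H1I:
  assumes "f \<in> L2 (lebesgue_on D)" "\<And>e. e \<in> Basis \<Longrightarrow> has_wderiv D e f (g e)"
  shows "f \<in> H 1 D"
  using assms has_wderiv_L2(2)[OF assms(2)] by (auto simp: One_nat_def)

lemma H1E:
  assumes "f \<in> H 1 D"
  obtains g where "f \<in> L2 (lebesgue_on D)" "\<And>e. e \<in> Basis \<Longrightarrow> has_wderiv D e f (g e)"
  using assms by (auto simp: One_nat_def) metis

text \<open>The function w - v has trace w and is admissible in the infimum. Indeed, subtracting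
  from w the test functions that approximate v gives smooth approximations which agree with w on the
  boundary exactly.\<close>

lemma Hhalf_norm_le:
  fixes \<Omega> :: "'a::euclidean_space set"
  assumes D: "open \<Omega>" "bounded \<Omega>" and w: "smooth w" and v: "v \<in> H10 \<Omega>"
  shows "Hhalf_norm \<Omega> w \<le> ennreal (H1norm \<Omega> (\<lambda>x. w x - v x))"
proof -
  have Db: "\<Omega> \<in> sets borel" using D by simp
  have vH: "v \<in> H 1 \<Omega>" using v by (simp add: H10_def)
  obtain g where vL: "v \<in> L2 (lebesgue_on \<Omega>)" and g: "\<And>e. e \<in> Basis \<Longrightarrow> has_wderiv \<Omega> e v (g e)"
    using H1E[OF vH] by metis
  obtain \<phi> where \<phi>: "\<And>k::nat. test_function \<Omega> (\<phi> k)" "(\<lambda>k. H1norm \<Omega> (\<lambda>x. v x - \<phi> k x)) \<longlonglongrightarrow> 0"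
    using v by (auto simp: H10_def)
  have diffL2: "(\<lambda>x. a x - b x) \<in> L2 (lebesgue_on \<Omega>)" if "a \<in> L2 (lebesgue_on \<Omega>)" "b \<in> L2 (lebesgue_on \<Omega>)" for a b
    using that L2_rep[OF Db] is_rep_L2_iff[OF Db is_rep_diff] L2z_diff by metis
  have h: "has_wderiv \<Omega> e (\<lambda>x. w x - v x) (\<lambda>x. dirder e w x - g e x)" if "e \<in> Basis" for e
    by (rule has_wderiv_diff[OF Db D(2) smooth_has_wderiv[OF D w] g[OF that]])
  \<comment> \<open>Symmetry is not immediate, because \<open>wderiv\<close> chooses independently
    for a function and for its negative; it follows from the formula with explicit
    derivatives.\<close>
  have neg: "H1norm \<Omega> (\<lambda>x. \<phi> k x - v x) = H1norm \<Omega> (\<lambda>x. v x - \<phi> k x)" for k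
  proof -
    have s: "smooth (\<phi> k)" by (rule test_function_smooth[OF \<phi>(1)])
    have 1: "ennreal ((H1norm \<Omega> (\<lambda>x. \<phi> k x - v x))\<^sup>2) = L2sq (lebesgue_on \<Omega>) (\<lambda>x. \<phi> k x - v x)
        + (\<Sum>e\<in>Basis. L2sq (lebesgue_on \<Omega>) (\<lambda>x. dirder e (\<phi> k) x - g e x))"
      by (rule H1norm_sq[OF D has_wderiv_diff[OF Db D(2) smooth_has_wderiv[OF D s] g] diffL2[OF smooth_L2[OF D s] vL]])
    have 2: "ennreal ((H1norm \<Omega> (\<lambda>x. v x - \<phi> k x))\<^sup>2) = L2sq (lebesgue_on \<Omega>) (\<lambda>x. v x - \<phi> k x)
        + (\<Sum>e\<in>Basis. L2sq (lebesgue_on \<Omega>) (\<lambda>x. g e x - dirder e (\<phi> k) x))"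
      by (rule H1norm_sq[OF D has_wderiv_diff[OF Db D(2) g smooth_has_wderiv[OF D s]] diffL2[OF vL smooth_L2[OF D s]]])
    have m: "L2sq M (\<lambda>x. a x - b x) = L2sq M (\<lambda>x. b x - a x)" for M :: "'a measure" and a b
      by (simp add: L2sq_def power2_commute)
    have "ennreal ((H1norm \<Omega> (\<lambda>x. \<phi> k x - v x))\<^sup>2) = ennreal ((H1norm \<Omega> (\<lambda>x. v x - \<phi> k x))\<^sup>2)"
      unfolding 1 2 by (simp add: m[of _ "\<phi> k"] m[of _ "dirder _ (\<phi> k)"])
    then have "(H1norm \<Omega> (\<lambda>x. \<phi> k x - v x))\<^sup>2 = (H1norm \<Omega> (\<lambda>x. v x - \<phi> k x))\<^sup>2"
      by (subst (asm) ennreal_inj) (rule zero_le_power2)+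
    moreover have "0 \<le> H1norm \<Omega> f" for f :: "'a \<Rightarrow> real" by (simp add: H1norm_def)
    ultimately show ?thesis by (metis power2_eq_iff_nonneg)
  qed
  have sets: "sets (hausdorff_measure (DIM('a) - 1) :: 'a measure) = sets borel"
    unfolding hausdorff_measure_def using sets.sigma_sets_eq[of "borel :: 'a measure"]
    by (subst sets_measure_of) (auto simp: sets.space_closed)
  have "has_trace \<Omega> (\<lambda>x. w x - v x) w"
    unfolding has_trace_def
  proof (intro conjI exI[of _ "\<lambda>k x. w x - \<phi> k x"] allI)
    show "(\<lambda>x. w x - v x) \<in> H 1 \<Omega>" by (rule H1I[OF diffL2[OF smooth_L2[OF D w] vL] h])
    show "w \<in> borel_measurable (surface_measure \<Omega>)"
      unfolding surface_measure_def
      using smooth_borel[OF w] measurable_cong_sets[OF sets refl] by (intro measurable_restrict_space1) auto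
    show "smooth (\<lambda>x. w x - \<phi> k x)" for k by (rule smooth_diff[OF w test_function_smooth[OF \<phi>(1)]])
    show "(\<lambda>k. H1norm \<Omega> (\<lambda>x. (w x - v x) - (w x - \<phi> k x))) \<longlonglongrightarrow> 0"
      using \<phi>(2) neg by simp
    have "\<phi> k x = 0" if "x \<in> frontier \<Omega>" for k x
    proof -
      have "x \<notin> \<Omega>" using that D(1) by (simp add: frontier_def interior_open)
      then show ?thesis using \<phi>(1)[of k] by (auto simp: test_function_def)
    qed
    then have "L2sq (surface_measure \<Omega>) (\<lambda>x. (w x - \<phi> k x) - w x) = 0" for k
      unfolding L2sq_def surface_measure_def
      by (subst nn_integral_cong[where v = "\<lambda>_. 0"]) (auto simp: space_restrict_space)
    then show "(\<lambda>k. L2sq (surface_measure \<Omega>) (\<lambda>x. (w x - \<phi> k x) - w x)) \<longlonglongrightarrow> 0" by simp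
  qed
  then show ?thesis unfolding Hhalf_norm_def by (intro INF_lower) simp
qed

section \<open>The nonlinear term\<close>

definition sp :: "'b::euclidean_space \<Rightarrow> 'b \<times> real" where "sp e = (e, 0)"

text \<open>The derivatives in the equation, together with the mixed second spatial ones, which the
  Sobolev inequality on time slices involves.\<close>

definition bjets :: "('b::euclidean_space \<times> real) list set" where
  "bjets = insert [(0, 1)] (map sp ` jets2)"

text \<open>The part of the jet whose mean square over \<Omega> is bounded uniformly in time, by
  continuity of u with values in \<open>H10\<close>.\<close>

definition bjets1 :: "('b::euclidean_space \<times> real) list set" where
  "bjets1 = insert [] ((\<lambda>e. [sp e]) ` Basis)"

lemma inj_sp: "inj sp"
  by (auto simp: inj_def sp_def)

lemma bjets_memb: "[] \<in> bjets" "e \<in> Basis \<Longrightarrow> [sp e] \<in> bjets" "e \<in> Basis \<Longrightarrow> e' \<in> Basis \<Longrightarrow> [sp e, sp e'] \<in> bjets"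
  "[(0, 1)] \<in> bjets"
  using jets2_memb(1) jets2_memb(2)[of e] jets2_memb(3)[of e e'] unfolding bjets_def by force+

lemma jetset_bjets: "jetset bjets"
  unfolding jetset_def
proof (intro conjI ballI allI impI)
  show "finite bjets" unfolding bjets_def by (simp add: finite_jets2)
  show "length l \<le> 2" if "l \<in> bjets" for l :: "('a \<times> real) list"
    using that by (auto simp: bjets_def jets2_def)
  show "[v] \<in> bjets" "[v'] \<in> bjets" if "[v, v'] \<in> bjets" for v v' :: "'a \<times> real"
    using that bjets_memb(2) by (auto simp: bjets_def jets2_def)
qed (rule bjets_memb)

lemma jetset_bjets1: "jetset bjets1"
  by (auto simp: jetset_def bjets1_def)

lemma bjets1_subset: "bjets1 \<subseteq> bjets"
  using bjets_memb by (auto simp: bjets1_def)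

lemma slice_affine: "slice f t = (\<lambda>x. f (sp x + (0, t)))"
  by (simp add: slice_def sp_def)

lemma linear_sp: "linear sp"
  by (simp add: linear_iff sp_def)

lemma smooth_slice: "smooth f \<Longrightarrow> smooth (slice f t)"
  unfolding slice_affine by (rule smooth_comp_affine[OF linear_sp])

lemma dirder_slice:
  assumes "smooth f"
  shows "dirder e (slice f t) = slice (dirder (sp e) f) t"
  unfolding slice_affine by (rule ext, rule dirder_comp_affine(1)[OF linear_sp smooth_differentiable[OF assms]])

lemma Dl_slice:
  assumes "smooth f"
  shows "Dl l (slice f t) = slice (Dl (map sp l) f) t"
  by (induction l) (simp_all add: dirder_slice smooth_Dl assms)

lemma jet2_norm_slice_le:
  assumes "smooth f"
  shows "jet2_norm (slice f t) x \<le> jet_dist bjets (\<lambda>_ _. 0) f (x, t)"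
proof -
  have "jet2_norm (slice f t) x = (\<Sum>l\<in>jets2. \<bar>Dl (map sp l) f (x, t) - 0\<bar>)"
    unfolding jet_dist_def Dl_slice[OF assms] by (simp add: slice_def)
  also have "\<dots> = (\<Sum>l\<in>map sp ` jets2. \<bar>Dl l f (x, t) - 0\<bar>)"
    by (subst sum.reindex) (simp_all add: inj_on_subset[OF inj_mapI[OF inj_sp]])
  also have "\<dots> \<le> jet_dist bjets (\<lambda>_ _. 0) f (x, t)"
    unfolding jet_dist_def bjets_def by (rule sum_mono2) (auto simp: finite_jets2)
  finally show ?thesis .
qed

text \<open>The gradient factor of the quadratic term: the derivative along the sum of the spatial
  basis vectors.\<close>

definition Vd :: "('b::euclidean_space \<times> real \<Rightarrow> real) \<Rightarrow> 'b \<times> real \<Rightarrow> real" where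
  "Vd w z = (\<Sum>e\<in>Basis. dirder (sp e) w z)"

lemma Vd_diff_le:
  assumes "bjets1 \<subseteq> I" "finite I"
  shows "\<bar>Vd w z - (\<Sum>e\<in>Basis. g [sp e] z)\<bar> \<le> jet_dist I g w z"
proof -
  have "\<bar>Vd w z - (\<Sum>e\<in>Basis. g [sp e] z)\<bar> \<le> (\<Sum>e\<in>Basis. \<bar>Dl [sp e] w z - g [sp e] z\<bar>)"
    unfolding Vd_def sum_subtractf[symmetric] by simp
  also have "\<dots> = (\<Sum>l\<in>(\<lambda>e. [sp e]) ` Basis. \<bar>Dl l w z - g l z\<bar>)"
    by (subst sum.reindex) (auto simp: inj_on_def inj_eq[OF inj_sp])
  also have "\<dots> \<le> jet_dist I g w z"
    unfolding jet_dist_def by (rule sum_mono2) (use assms in \<open>auto simp: bjets1_def\<close>)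
  finally show ?thesis .
qed

lemma smooth_Vd: "smooth w \<Longrightarrow> smooth (Vd w)"
  unfolding Vd_def[abs_def] by (rule smooth_sum) (rule smooth_dirder)

lemma Vd_diff:
  assumes "smooth f" "smooth g"
  shows "Vd (\<lambda>x. f x - g x) z = Vd f z - Vd g z"
  unfolding Vd_def smooth_dirder_diff[OF assms] by (simp add: sum_subtractf)

lemma Dl_diff:
  assumes "smooth f" "smooth g"
  shows "Dl l (\<lambda>x. f x - g x) = (\<lambda>x. Dl l f x - Dl l g x)"
  by (induction l) (simp_all add: smooth_dirder_diff smooth_Dl assms)

lemma jet_dist_diff_le:
  assumes "smooth f" "smooth h"
  shows "jet_dist I (\<lambda>_ _. 0) (\<lambda>x. f x - h x) z \<le> jet_dist I g f z + jet_dist I g h z"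
  unfolding jet_dist_def Dl_diff[OF assms] sum.distrib[symmetric] by (rule sum_mono) linarith

lemma jet_dist_ge: "finite I \<Longrightarrow> l \<in> I \<Longrightarrow> \<bar>Dl l w z - g l z\<bar> \<le> jet_dist I g w z"
  unfolding jet_dist_def using member_le_sum[of l I "\<lambda>l. \<bar>Dl l w z - g l z\<bar>"] by simp

lemma jet_error_diff_le:
  assumes "smooth f" "smooth h" "\<And>l. l \<in> I \<Longrightarrow> g l \<in> borel_measurable borel"
    and \<mu>: "sets \<mu> = sets borel" "S \<in> sets borel"
  shows "jet_error \<mu> S I (\<lambda>_ _. 0) (\<lambda>x. f x - h x) \<le> 2 * jet_error \<mu> S I g f + 2 * jet_error \<mu> S I g h"
proof -
  have [measurable]: "jet_dist I g f \<in> borel_measurable \<mu>" "jet_dist I g h \<in> borel_measurable \<mu>" "S \<in> sets \<mu>"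
    using jet_dist_measurable[OF assms(1,3)] jet_dist_measurable[OF assms(2,3)] measurable_cong_sets[OF \<mu>(1) refl] \<mu> by auto
  have "jet_error \<mu> S I (\<lambda>_ _. 0) (\<lambda>x. f x - h x) \<le>
    (\<integral>\<^sup>+z. 2 * (indicator S z * ennreal ((jet_dist I g f z)\<^sup>2)) + 2 * (indicator S z * ennreal ((jet_dist I g h z)\<^sup>2)) \<partial>\<mu>)"
    unfolding jet_error_def
  proof (rule nn_integral_mono)
    fix z
    let ?p = "jet_dist I g f z" and ?q = "jet_dist I g h z"
    have "(jet_dist I (\<lambda>_ _. 0) (\<lambda>x. f x - h x) z)\<^sup>2 \<le> (1 * (?p + ?q))\<^sup>2"
      using jet_dist_diff_le[OF assms(1,2), of I z g] by (intro power_mono jet_dist_nonneg) simp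
    also have "\<dots> \<le> 2 * 1\<^sup>2 * (?p\<^sup>2 + ?q\<^sup>2)" by (rule square_add_bound)
    finally have "ennreal ((jet_dist I (\<lambda>_ _. 0) (\<lambda>x. f x - h x) z)\<^sup>2) \<le> ennreal (2 * ?p\<^sup>2 + 2 * ?q\<^sup>2)"
      by (intro ennreal_leI) simp
    also have "\<dots> = 2 * ennreal (?p\<^sup>2) + 2 * ennreal (?q\<^sup>2)" by (simp add: ennreal_mult)
    finally show "indicator S z * ennreal ((jet_dist I (\<lambda>_ _. 0) (\<lambda>x. f x - h x) z)\<^sup>2)
       \<le> 2 * (indicator S z * ennreal (?p\<^sup>2)) + 2 * (indicator S z * ennreal (?q\<^sup>2))"
      by (cases "z \<in> S") auto
  qed
  also have "\<dots> = 2 * jet_error \<mu> S I g f + 2 * jet_error \<mu> S I g h"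
    unfolding jet_error_def by (simp add: nn_integral_add nn_integral_cmult)
  finally show ?thesis .
qed

lemma nn_integral_swap_product:
  fixes f :: "'b::euclidean_space \<times> real \<Rightarrow> ennreal"
  assumes "f \<in> borel_measurable borel"
  shows "(\<integral>\<^sup>+z. f z \<partial>lborel) = (\<integral>\<^sup>+t. \<integral>\<^sup>+x. f (x, t) \<partial>lborel \<partial>lborel)"
proof -
  have "f \<in> borel_measurable (lborel \<Otimes>\<^sub>M lborel)" using assms by (simp add: lborel_prod)
  from lborel_pair.nn_integral_snd[OF this] show ?thesis by (simp add: lborel_prod)
qed

text \<open>At each time the Sobolev inequality bounds f by the size of its slice jet, and h
  contributes at most M. Integrating over time leaves the jet error of f: a Hoelder estimate between
  L2(0,T;L^inf) and L^inf(0,T;L2).\<close>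

lemma product_Sobolev:
  fixes \<Omega> :: "'b::euclidean_space set"
  assumes dim: "DIM('b) \<le> 3" and \<Omega>: "open \<Omega>" "bounded \<Omega>" and cone: "\<And>p. p \<in> closure \<Omega> \<Longrightarrow> cone_at \<Omega> p"
  obtains C where "C \<ge> 0" "\<And>f h M. smooth f \<Longrightarrow> h \<in> borel_measurable borel \<Longrightarrow>
    (\<And>t. (\<integral>\<^sup>+x. indicator (cylinder \<Omega> T) (x, t) * ennreal ((h (x, t))\<^sup>2) \<partial>lborel) \<le> M) \<Longrightarrow>
    (\<integral>\<^sup>+z. indicator (cylinder \<Omega> T) z * ennreal ((f z * h z)\<^sup>2) \<partial>lborel)
      \<le> ennreal C * M * jet_error lborel (cylinder \<Omega> T) bjets (\<lambda>_ _. 0) f"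
proof -
  let ?D = "cylinder \<Omega> T"
  have mD[measurable]: "?D \<in> sets borel" "\<Omega> \<in> sets borel"
    using \<Omega>(1) by (auto simp: cylinder_def intro!: borel_open open_Times)
  obtain C where C: "C \<ge> 0" "\<And>v x. smooth v \<Longrightarrow> x \<in> \<Omega> \<Longrightarrow>
      ennreal ((v x)\<^sup>2) \<le> ennreal C * jet_error lborel \<Omega> jets2 (\<lambda>_ _. 0) v"
    using Sobolev[OF dim \<Omega> cone] by metis
  show ?thesis
  proof (rule that[OF C(1)])
    fix f h :: "'b \<times> real \<Rightarrow> real" and M :: ennreal
    assume f: "smooth f" and h[measurable]: "h \<in> borel_measurable borel"
      and M: "\<And>t. (\<integral>\<^sup>+x. indicator ?D (x, t) * ennreal ((h (x, t))\<^sup>2) \<partial>lborel) \<le> M"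
    have fm[measurable]: "f \<in> borel_measurable borel" by (rule smooth_borel[OF f])
    define j where "j = jet_dist bjets (\<lambda>_ _. 0) f"
    have jm[measurable]: "j \<in> borel_measurable borel" unfolding j_def by (rule jet_dist_measurable[OF f]) simp
    define N where "N t = (\<integral>\<^sup>+x. indicator ?D (x, t) * ennreal ((j (x, t))\<^sup>2) \<partial>lborel)" for t
    have Nm[measurable]: "N \<in> borel_measurable borel" unfolding N_def by measurable
    have fb: "ennreal ((f (x, t))\<^sup>2) \<le> ennreal C * N t" if "(x, t) \<in> ?D" for x t
    proof -
      have x: "x \<in> \<Omega>" and t: "t \<in> {0<..<T}" using that by (auto simp: cylinder_def)
      have "ennreal ((slice f t x)\<^sup>2) \<le> ennreal C * jet_error lborel \<Omega> jets2 (\<lambda>_ _. 0) (slice f t)"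
        by (rule C(2)[OF smooth_slice[OF f] x])
      also have "jet_error lborel \<Omega> jets2 (\<lambda>_ _. 0) (slice f t) \<le> N t"
        unfolding jet_error_def N_def
      proof (rule nn_integral_mono)
        fix y
        have "(jet2_norm (slice f t) y)\<^sup>2 \<le> (j (y, t))\<^sup>2"
          unfolding j_def by (intro power_mono jet2_norm_slice_le[OF f] jet_dist_nonneg)
        then show "indicator \<Omega> y * ennreal ((jet2_norm (slice f t) y)\<^sup>2) \<le> indicator ?D (y, t) * ennreal ((j (y, t))\<^sup>2)"
          using t by (auto simp: indicator_def cylinder_def intro: ennreal_leI)
      qed
      finally show ?thesis by (simp add: slice_def mult_left_mono)
    qed
    have "(\<integral>\<^sup>+z. indicator ?D z * ennreal ((f z * h z)\<^sup>2) \<partial>lborel)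
        = (\<integral>\<^sup>+t. \<integral>\<^sup>+x. indicator ?D (x, t) * ennreal ((f (x, t) * h (x, t))\<^sup>2) \<partial>lborel \<partial>lborel)"
      by (rule nn_integral_swap_product) measurable
    also have "\<dots> \<le> (\<integral>\<^sup>+t. ennreal C * M * N t \<partial>lborel)"
    proof (rule nn_integral_mono)
      fix t
      have "(\<integral>\<^sup>+x. indicator ?D (x, t) * ennreal ((f (x, t) * h (x, t))\<^sup>2) \<partial>lborel)
          \<le> (\<integral>\<^sup>+x. (ennreal C * N t) * (indicator ?D (x, t) * ennreal ((h (x, t))\<^sup>2)) \<partial>lborel)"
      proof (rule nn_integral_mono)
        fix x
        show "indicator ?D (x, t) * ennreal ((f (x, t) * h (x, t))\<^sup>2)
            \<le> (ennreal C * N t) * (indicator ?D (x, t) * ennreal ((h (x, t))\<^sup>2))"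
          using mult_right_mono[OF fb[of x t], of "ennreal ((h (x, t))\<^sup>2)"]
          by (cases "(x, t) \<in> ?D") (auto simp: power_mult_distrib ennreal_mult)
      qed
      also have "\<dots> = (ennreal C * N t) * (\<integral>\<^sup>+x. indicator ?D (x, t) * ennreal ((h (x, t))\<^sup>2) \<partial>lborel)"
        by (rule nn_integral_cmult) measurable
      also have "\<dots> \<le> (ennreal C * N t) * M" by (intro mult_left_mono M) simp
      also have "\<dots> = ennreal C * M * N t" by (simp add: mult_ac)
      finally show "(\<integral>\<^sup>+x. indicator ?D (x, t) * ennreal ((f (x, t) * h (x, t))\<^sup>2) \<partial>lborel) \<le> ennreal C * M * N t" .
    qed
    also have "\<dots> = ennreal C * M * (\<integral>\<^sup>+t. N t \<partial>lborel)" by (rule nn_integral_cmult) measurable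
    also have "(\<integral>\<^sup>+t. N t \<partial>lborel) = jet_error lborel ?D bjets (\<lambda>_ _. 0) f"
      unfolding N_def jet_error_def j_def[symmetric]
      by (rule nn_integral_swap_product[symmetric]) measurable
    finally show "(\<integral>\<^sup>+z. indicator ?D z * ennreal ((f z * h z)\<^sup>2) \<partial>lborel)
      \<le> ennreal C * M * jet_error lborel ?D bjets (\<lambda>_ _. 0) f" .
  qed
qed

section \<open>Convergence of the quadratic term\<close>

lemma square_add3_bound: "(a + b + c)\<^sup>2 \<le> 3 * a\<^sup>2 + 3 * b\<^sup>2 + 3 * c\<^sup>2" for a b c :: real
  using zero_le_power2[of "a - b"] zero_le_power2[of "a - c"] zero_le_power2[of "b - c"]
  by (simp add: power2_eq_square algebra_simps)

text \<open>The equation is absent here. The data are the weak jet g of a function on the cylinder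
  and the slice bounds that its regularity provides.\<close>

locale burgers_jet =
  fixes \<Omega> :: "'b::euclidean_space set" and T :: real
    and g :: "('b \<times> real) list \<Rightarrow> ('b \<times> real) \<Rightarrow> real" and M0 :: ennreal
  assumes dim: "DIM('b) \<le> 3" and \<Omega>: "open \<Omega>" "bounded \<Omega>" "\<And>p. p \<in> closure \<Omega> \<Longrightarrow> cone_at \<Omega> p"
    and T: "T > 0" and g: "wjet (cylinder \<Omega> T) bjets g"
    and M0: "M0 < \<infinity>" "\<And>l. l \<in> bjets1 \<Longrightarrow> AE \<tau> in lborel. (\<integral>\<^sup>+x. ennreal ((g l (x, \<tau>))\<^sup>2) \<partial>lborel) \<le> M0"
begin

abbreviation "D \<equiv> cylinder \<Omega> T"

lemma D_open: "open D" and D_bounded: "bounded D"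
  unfolding cylinder_def using \<Omega> by (auto intro: open_Times bounded_Times)

lemma D_borel [measurable]: "D \<in> sets borel"
  using D_open by simp

lemma D_cone: "p \<in> closure D \<Longrightarrow> cone_at D p"
proof -
  assume "p \<in> closure D"
  then have p: "fst p \<in> closure \<Omega>" "snd p \<in> closure {0<..<T}"
    by (auto simp: cylinder_def closure_Times)
  have "cone_at {0<..<T} (snd p)" using T by (intro cone_at_convex) auto
  from cone_at_Times[OF \<Omega>(3)[OF p(1)] this] show ?thesis by (simp add: cylinder_def)
qed

sublocale cylinder_jet D bjets bjets1 g M0
  by unfold_locales
    (simp_all add: D_open D_bounded D_cone jetset_bjets jetset_bjets1 bjets1_subset g M0[simplified])

definition W where "W z = (\<Sum>e\<in>Basis. g [sp e] z)"

lemma fin_bjets: "finite bjets"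
  by (rule conjunct1[OF jetset_bjets[unfolded jetset_def]])

lemma fin_bjets1: "finite bjets1"
  by (rule conjunct1[OF jetset_bjets1[unfolded jetset_def]])

lemma W_meas [measurable]: "W \<in> borel_measurable borel"
  unfolding W_def[abs_def] by (rule borel_measurable_sum) (rule gl_meas[OF bjets_memb(2)])

lemma g_nil_meas [measurable]: "g [] \<in> borel_measurable borel"
  by (rule gl_meas[OF bjets_memb(1)])

lemma W_err: "\<bar>Vd w z - W z\<bar> \<le> jet_dist bjets g w z"
  unfolding W_def by (rule Vd_diff_le[OF bjets1_subset fin_bjets])

lemma nil_err: "\<bar>w z - g [] z\<bar> \<le> jet_dist bjets g w z"
  using jet_dist_ge[OF fin_bjets bjets_memb(1), of w z g] by simp

lemma slice_bound_Vd:
  assumes "jet_approx_on UNIV w M"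
  shows "(\<integral>\<^sup>+x. indicator D (x, t) * ennreal ((Vd (w k) (x, t))\<^sup>2) \<partial>lborel) \<le> M"
proof -
  have sm: "smooth (w k)" using assms by (simp add: jet_approx_on_def)
  have jm[measurable]: "jet_dist bjets1 (\<lambda>_ _. 0) (w k) \<in> borel_measurable borel" by (rule jet_dist_measurable[OF sm]) simp
  have "(\<integral>\<^sup>+x. indicator D (x, t) * ennreal ((Vd (w k) (x, t))\<^sup>2) \<partial>lborel)
      \<le> (\<integral>\<^sup>+x. indicator D (x, t) * ennreal ((jet_dist bjets1 (\<lambda>_ _. 0) (w k) (x, t))\<^sup>2) \<partial>lborel)"
  proof (intro nn_integral_mono mult_left_mono ennreal_leI)
    fix x
    have "\<bar>Vd (w k) (x, t)\<bar> \<le> jet_dist bjets1 (\<lambda>_ _. 0) (w k) (x, t)"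
      using Vd_diff_le[OF order_refl fin_bjets1, of "w k" "(x, t)" "\<lambda>_ _. 0"] by simp
    from power_mono[OF this, of 2]
    show "(Vd (w k) (x, t))\<^sup>2 \<le> (jet_dist bjets1 (\<lambda>_ _. 0) (w k) (x, t))\<^sup>2" by simp
  qed simp
  also have "\<dots> = jet_error (slice_measure t) D bjets1 (\<lambda>_ _. 0) (w k)"
    unfolding jet_error_def by (rule nn_integral_slice_measure[symmetric]) measurable
  also have "\<dots> \<le> M" using assms by (simp add: jet_approx_on_def)
  finally show ?thesis .
qed

lemma slice_bound_Vd_diff:
  assumes "jet_approx_on UNIV w M"
  shows "(\<integral>\<^sup>+x. indicator D (x, t) * ennreal ((Vd (w k) (x, t) - Vd (w m) (x, t))\<^sup>2) \<partial>lborel) \<le> 4 * M"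
proof -
  have sm: "smooth (w k)" for k using assms by (simp add: jet_approx_on_def)
  note [measurable] = smooth_borel[OF smooth_Vd[OF sm]]
  have "(\<integral>\<^sup>+x. indicator D (x, t) * ennreal ((Vd (w k) (x, t) - Vd (w m) (x, t))\<^sup>2) \<partial>lborel)
    \<le> (\<integral>\<^sup>+x. 2 * (indicator D (x, t) * ennreal ((Vd (w k) (x, t))\<^sup>2))
        + 2 * (indicator D (x, t) * ennreal ((Vd (w m) (x, t))\<^sup>2)) \<partial>lborel)"
  proof (rule nn_integral_mono)
    fix x
    let ?p = "Vd (w k) (x, t)" and ?q = "Vd (w m) (x, t)"
    have "(?p - ?q)\<^sup>2 \<le> 2 * ?p\<^sup>2 + 2 * ?q\<^sup>2" using square_add_bound[of 1 ?p "- ?q"] by simp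
    then have "ennreal ((?p - ?q)\<^sup>2) \<le> ennreal (2 * ?p\<^sup>2 + 2 * ?q\<^sup>2)" by (rule ennreal_leI)
    also have "\<dots> = 2 * ennreal (?p\<^sup>2) + 2 * ennreal (?q\<^sup>2)" by (simp add: ennreal_mult)
    finally show "indicator D (x, t) * ennreal ((?p - ?q)\<^sup>2)
      \<le> 2 * (indicator D (x, t) * ennreal (?p\<^sup>2)) + 2 * (indicator D (x, t) * ennreal (?q\<^sup>2))"
      by (cases "(x, t) \<in> D") auto
  qed
  also have "\<dots> = 2 * (\<integral>\<^sup>+x. indicator D (x, t) * ennreal ((Vd (w k) (x, t))\<^sup>2) \<partial>lborel)
      + 2 * (\<integral>\<^sup>+x. indicator D (x, t) * ennreal ((Vd (w m) (x, t))\<^sup>2) \<partial>lborel)"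
    by (simp add: nn_integral_add nn_integral_cmult)
  also have "\<dots> \<le> 2 * M + 2 * M" by (intro add_mono mult_left_mono slice_bound_Vd[OF assms]) auto
  also have "\<dots> = 4 * M" by (simp add: distrib_right[symmetric])
  finally show ?thesis .
qed

lemma product_bound:
  "\<exists>C\<ge>0. \<forall>f h M. smooth f \<longrightarrow> h \<in> borel_measurable borel \<longrightarrow>
    (\<forall>t. (\<integral>\<^sup>+x. indicator D (x, t) * ennreal ((h (x, t))\<^sup>2) \<partial>lborel) \<le> M) \<longrightarrow>
    (\<integral>\<^sup>+z. indicator D z * ennreal ((f z * h z)\<^sup>2) \<partial>lborel)
      \<le> ennreal C * M * jet_error lborel D bjets (\<lambda>_ _. 0) f"
proof (rule product_Sobolev[OF dim \<Omega>(1,2), of T])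
  fix p assume "p \<in> closure \<Omega>"
  then show "cone_at \<Omega> p" by (rule \<Omega>(3))
next
  fix C :: real assume C: "C \<ge> 0" "\<And>f h M. smooth f \<Longrightarrow> h \<in> borel_measurable borel \<Longrightarrow>
    (\<And>t. (\<integral>\<^sup>+x. indicator D (x, t) * ennreal ((h (x, t))\<^sup>2) \<partial>lborel) \<le> M) \<Longrightarrow>
    (\<integral>\<^sup>+z. indicator D z * ennreal ((f z * h z)\<^sup>2) \<partial>lborel)
      \<le> ennreal C * M * jet_error lborel D bjets (\<lambda>_ _. 0) f"
  show ?thesis
  proof (intro exI[of _ C] conjI allI impI)
    show "C \<ge> 0" by (rule C(1))
  next
    fix f h :: "'b \<times> real \<Rightarrow> real" and M :: ennreal assume "smooth f" "h \<in> borel_measurable borel"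
      "\<forall>t. (\<integral>\<^sup>+x. indicator D (x, t) * ennreal ((h (x, t))\<^sup>2) \<partial>lborel) \<le> M"
    then show "(\<integral>\<^sup>+z. indicator D z * ennreal ((f z * h z)\<^sup>2) \<partial>lborel)
      \<le> ennreal C * M * jet_error lborel D bjets (\<lambda>_ _. 0) f" by (intro C(2)) simp_all
  qed
qed

text \<open>
  Differences \<open>w k - w m\<close> are small in \<open>L\<^sup>2(0,T;L\<^sup>\<infinity>(\<Omega>))\<close>, but those of the derivatives are small only in
  \<open>L\<^sup>2\<close> of the cylinder, while bounded in \<open>L\<^sup>2(\<Omega>)\<close> uniformly in time.  Hence their factor \<open>w m\<close> is first
  replaced by a fixed bounded \<open>w j\<close>.
\<close>

lemma nonlinear_Cauchy:
  assumes w: "jet_approx_on UNIV w M" and \<epsilon>: "(\<epsilon>::real) > 0"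
  shows "\<exists>K. \<forall>k\<ge>K. \<forall>m\<ge>K.
    (\<integral>\<^sup>+z. indicator D z * ennreal ((w k z * Vd (w k) z - w m z * Vd (w m) z)\<^sup>2) \<partial>lborel) \<le> ennreal \<epsilon>"
proof -
  define a where "a k = jet_error lborel D bjets g (w k)" for k
  have a0: "a \<longlonglongrightarrow> 0" using w by (simp add: jet_approx_on_def a_def[abs_def])
  have sm: "smooth (w k)" for k using w by (simp add: jet_approx_on_def)
  have smV: "smooth (Vd (w k))" for k by (rule smooth_Vd[OF sm])
  note [measurable] = smooth_borel[OF sm] smooth_borel[OF smV]
  have "M < top" using w by (simp add: jet_approx_on_def)
  then obtain Mr where Mr: "Mr \<ge> 0" "M = ennreal Mr" by (cases M) auto
  obtain C where C0: "C \<ge> 0" and C': "\<forall>f h M. smooth f \<longrightarrow> h \<in> borel_measurable borel \<longrightarrow>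
    (\<forall>t. (\<integral>\<^sup>+x. indicator D (x, t) * ennreal ((h (x, t))\<^sup>2) \<partial>lborel) \<le> M) \<longrightarrow>
    (\<integral>\<^sup>+z. indicator D z * ennreal ((f z * h z)\<^sup>2) \<partial>lborel)
      \<le> ennreal C * M * jet_error lborel D bjets (\<lambda>_ _. 0) f"
    using product_bound by (elim exE conjE)
  note C = C0 C'[rule_format]
  have E: "jet_error lborel D bjets (\<lambda>_ _. 0) (\<lambda>x. w k x - w m x) \<le> ennreal (4 * e)"
    if "a k \<le> ennreal e" "a m \<le> ennreal e" "e \<ge> 0" for k m e
  proof -
    have "jet_error lborel D bjets (\<lambda>_ _. 0) (\<lambda>x. w k x - w m x) \<le> 2 * a k + 2 * a m"
      unfolding a_def by (rule jet_error_diff_le[OF sm sm gl_meas]) auto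
    also have "\<dots> \<le> 2 * ennreal e + 2 * ennreal e" using that by (intro add_mono mult_left_mono) auto
    also have "\<dots> = ennreal (4 * e)" using that by (simp add: ennreal_mult distrib_right[symmetric])
    finally show ?thesis .
  qed
  \<comment> \<open>The first two products contribute 3 * 4 and 3 * 16 times
    \<open>C * Mr * \<eta>\<close>, together 60; with 120 they take up half of \<epsilon>.\<close>
  define \<eta> where "\<eta> = \<epsilon> / (120 * C * Mr + 1)"
  have pos: "120 * C * Mr + 1 > 0" using C(1) Mr(1) by (simp add: add_nonneg_pos)
  have \<eta>: "\<eta> > 0" "120 * C * Mr * \<eta> \<le> \<epsilon>"
    using \<epsilon> pos C(1) Mr(1) by (auto simp: \<eta>_def field_simps)
  obtain j where j: "a j \<le> ennreal \<eta>"
    using eventually_happens[OF tendsto_0_eventually_le[OF a0 \<eta>(1)]] by auto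
  obtain B where B: "B \<ge> 0" "\<And>z. z \<in> D \<Longrightarrow> \<bar>w j z\<bar> \<le> B" using smooth_bounded_on[OF sm D_bounded] by metis
  define \<eta>2 where "\<eta>2 = min \<eta> (\<epsilon> / (24 * B\<^sup>2 + 1))"
  have pos2: "24 * B\<^sup>2 + 1 > 0" by (simp add: add_nonneg_pos)
  have \<eta>2: "\<eta>2 > 0" "\<eta>2 \<le> \<eta>" using \<eta> \<epsilon> pos2 by (auto simp: \<eta>2_def)
  have "24 * B\<^sup>2 * \<eta>2 \<le> 24 * B\<^sup>2 * (\<epsilon> / (24 * B\<^sup>2 + 1))" by (intro mult_left_mono) (auto simp: \<eta>2_def)
  also have "\<dots> \<le> \<epsilon>" using \<epsilon> pos2 by (simp add: field_simps)
  finally have \<eta>2': "24 * B\<^sup>2 * \<eta>2 \<le> \<epsilon>" .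
  obtain K where K: "\<And>k. k \<ge> K \<Longrightarrow> a k \<le> ennreal \<eta>2"
    using tendsto_0_eventually_le[OF a0 \<eta>2(1)] by (auto simp: eventually_sequentially)
  have "(\<integral>\<^sup>+z. indicator D z * ennreal ((w k z * Vd (w k) z - w m z * Vd (w m) z)\<^sup>2) \<partial>lborel) \<le> ennreal \<epsilon>"
    if k: "k \<ge> K" and m: "m \<ge> K" for k m
  proof -
    let ?I = "\<lambda>f. \<integral>\<^sup>+z. indicator D z * ennreal ((f z)\<^sup>2) \<partial>lborel"
    define A where "A z = (w k z - w m z) * Vd (w k) z" for z
    define A2 where "A2 z = (w m z - w j z) * (Vd (w k) z - Vd (w m) z)" for z
    define A3 where "A3 z = w j z * (Vd (w k) z - Vd (w m) z)" for z
    have [measurable]: "A \<in> borel_measurable borel" "A2 \<in> borel_measurable borel" "A3 \<in> borel_measurable borel"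
      unfolding A_def A2_def A3_def by measurable
    have ak: "a k \<le> ennreal \<eta>2" "a m \<le> ennreal \<eta>2" using K k m by auto
    have ak': "a k \<le> ennreal \<eta>" "a m \<le> ennreal \<eta>" using ak \<eta>2 by (meson ennreal_leI order_trans)+
    have 1: "?I A \<le> ennreal (C * Mr * (4 * \<eta>))"
    proof -
      have "?I A \<le> ennreal C * M * jet_error lborel D bjets (\<lambda>_ _. 0) (\<lambda>x. w k x - w m x)"
        unfolding A_def by (rule C(2)[OF smooth_diff[OF sm sm] _ slice_bound_Vd[OF w]]) measurable
      also have "\<dots> \<le> ennreal C * M * ennreal (4 * \<eta>)" by (intro mult_left_mono E ak') (use \<eta> in auto)
      finally show ?thesis using Mr C0 \<eta> by (simp add: ennreal_mult[symmetric])
    qed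
    have V4: "(\<integral>\<^sup>+x. indicator D (x, t) * ennreal ((Vd (w k) (x, t) - Vd (w m) (x, t))\<^sup>2) \<partial>lborel) \<le> ennreal (4 * Mr)" for t
      using slice_bound_Vd_diff[OF w, of t k m] Mr by (simp add: ennreal_mult)
    have 2: "?I A2 \<le> ennreal (C * (4 * Mr) * (4 * \<eta>))"
    proof -
      have "?I A2 \<le> ennreal C * ennreal (4 * Mr) * jet_error lborel D bjets (\<lambda>_ _. 0) (\<lambda>x. w m x - w j x)"
        unfolding A2_def by (rule C(2)[OF smooth_diff[OF sm sm] _ V4]) measurable
      also have "\<dots> \<le> ennreal C * ennreal (4 * Mr) * ennreal (4 * \<eta>)"
        by (intro mult_left_mono E ak' j) (use \<eta> in auto)
      finally show ?thesis using Mr C0 \<eta> by (simp add: ennreal_mult[symmetric])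
    qed
    have 3: "?I A3 \<le> ennreal (B\<^sup>2 * (4 * \<eta>2))"
    proof -
      let ?e = "jet_dist bjets (\<lambda>_ _. 0) (\<lambda>x. w k x - w m x)"
      have em[measurable]: "?e \<in> borel_measurable borel" by (rule jet_dist_measurable[OF smooth_diff[OF sm sm]]) simp
      have "?I A3 \<le> (\<integral>\<^sup>+z. ennreal (B\<^sup>2) * (indicator D z * ennreal ((?e z)\<^sup>2)) \<partial>lborel)"
      proof (rule nn_integral_mono)
        fix z
        show "indicator D z * ennreal ((A3 z)\<^sup>2) \<le> ennreal (B\<^sup>2) * (indicator D z * ennreal ((?e z)\<^sup>2))"
        proof (cases "z \<in> D")
          case True
          have "\<bar>Vd (w k) z - Vd (w m) z\<bar> \<le> ?e z"
            using Vd_diff_le[OF bjets1_subset fin_bjets, of "\<lambda>x. w k x - w m x" z "\<lambda>_ _. 0"]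
            by (simp add: Vd_diff[OF sm sm])
          then have "\<bar>A3 z\<bar> \<le> B * ?e z"
            unfolding A3_def abs_mult using B(1) B(2)[OF True] by (intro mult_mono) auto
          from power_mono[OF this, of 2] have "(A3 z)\<^sup>2 \<le> B\<^sup>2 * (?e z)\<^sup>2" by (simp add: power_mult_distrib)
          then show ?thesis using True by (simp add: ennreal_mult[symmetric] ennreal_leI)
        qed simp
      qed
      also have "\<dots> = ennreal (B\<^sup>2) * jet_error lborel D bjets (\<lambda>_ _. 0) (\<lambda>x. w k x - w m x)"
        unfolding jet_error_def by (rule nn_integral_cmult) measurable
      also have "\<dots> \<le> ennreal (B\<^sup>2) * ennreal (4 * \<eta>2)" by (intro mult_left_mono E ak) (use \<eta>2 in auto)
      finally show ?thesis using \<eta>2 by (simp add: ennreal_mult[symmetric])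
    qed
    have "?I (\<lambda>z. w k z * Vd (w k) z - w m z * Vd (w m) z) \<le>
      (\<integral>\<^sup>+z. 3 * (indicator D z * ennreal ((A z)\<^sup>2)) + 3 * (indicator D z * ennreal ((A2 z)\<^sup>2))
        + 3 * (indicator D z * ennreal ((A3 z)\<^sup>2)) \<partial>lborel)"
    proof (rule nn_integral_mono)
      fix z
      have "w k z * Vd (w k) z - w m z * Vd (w m) z = A z + A2 z + A3 z"
        by (simp add: A_def A2_def A3_def algebra_simps)
      then have "ennreal ((w k z * Vd (w k) z - w m z * Vd (w m) z)\<^sup>2)
          \<le> ennreal (3 * (A z)\<^sup>2 + 3 * (A2 z)\<^sup>2 + 3 * (A3 z)\<^sup>2)"
        using square_add3_bound[of "A z" "A2 z" "A3 z"] by (simp only: ennreal_leI)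
      also have "\<dots> = 3 * ennreal ((A z)\<^sup>2) + 3 * ennreal ((A2 z)\<^sup>2) + 3 * ennreal ((A3 z)\<^sup>2)"
        by (simp add: ennreal_mult)
      finally show "indicator D z * ennreal ((w k z * Vd (w k) z - w m z * Vd (w m) z)\<^sup>2)
        \<le> 3 * (indicator D z * ennreal ((A z)\<^sup>2)) + 3 * (indicator D z * ennreal ((A2 z)\<^sup>2))
        + 3 * (indicator D z * ennreal ((A3 z)\<^sup>2))"
        by (cases "z \<in> D") auto
    qed
    also have "\<dots> = 3 * ?I A + 3 * ?I A2 + 3 * ?I A3" by (simp add: nn_integral_add nn_integral_cmult)
    also have "\<dots> \<le> 3 * ennreal (C * Mr * (4 * \<eta>)) + 3 * ennreal (C * (4 * Mr) * (4 * \<eta>)) + 3 * ennreal (B\<^sup>2 * (4 * \<eta>2))"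
      by (intro add_mono mult_left_mono 1 2 3) auto
    also have "\<dots> = ennreal (60 * C * Mr * \<eta> + 12 * B\<^sup>2 * \<eta>2)"
    proof -
      have n: "0 \<le> C * Mr * (4 * \<eta>)" "0 \<le> C * (4 * Mr) * (4 * \<eta>)" "0 \<le> B\<^sup>2 * (4 * \<eta>2)"
        using C(1) Mr(1) \<eta> \<eta>2 by auto
      have "3 * ennreal (C * Mr * (4 * \<eta>)) + 3 * ennreal (C * (4 * Mr) * (4 * \<eta>)) + 3 * ennreal (B\<^sup>2 * (4 * \<eta>2))
        = ennreal (3 * (C * Mr * (4 * \<eta>)) + 3 * (C * (4 * Mr) * (4 * \<eta>)) + 3 * (B\<^sup>2 * (4 * \<eta>2)))"
        using n by (simp only: ennreal_plus ennreal_mult'' ennreal_numeral mult_nonneg_nonneg add_nonneg_nonneg zero_le_numeral)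
      then show ?thesis by (simp add: algebra_simps)
    qed
    also have "\<dots> \<le> ennreal \<epsilon>" using \<eta>(2) \<eta>2' by (intro ennreal_leI) linarith
    finally show ?thesis .
  qed
  then show ?thesis by blast
qed

text \<open>The squared jet distance on D converges to 0 in mean, so a subsequence does so almost
  everywhere; the Fatou argument for the quadratic term runs along it.\<close>

lemma subseq_pointwise:
  assumes w: "jet_approx_on UNIV w M"
  shows "\<exists>r. strict_mono r \<and> (AE z in lborel. z \<in> D \<longrightarrow> (\<lambda>n. jet_dist bjets g (w (r n)) z) \<longlonglongrightarrow> 0)"
proof -
  have sm: "smooth (w k)" for k using w by (simp add: jet_approx_on_def)
  have [measurable]: "jet_dist bjets g (w k) \<in> borel_measurable borel" for k by (rule jet_dist_measurable[OF sm gl_meas])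
  have E0: "(\<lambda>k. jet_error lborel D bjets g (w k)) \<longlonglongrightarrow> 0" using w by (simp add: jet_approx_on_def)
  \<comment> \<open>The first errors may be infinite; shifting by K makes every term
    integrable.\<close>
  obtain K where K: "\<And>k. k \<ge> K \<Longrightarrow> jet_error lborel D bjets g (w k) \<le> ennreal 1"
    using tendsto_0_eventually_le[OF E0 zero_less_one] by (auto simp: eventually_sequentially)
  define u where "u n z = indicator D z * (jet_dist bjets g (w (n + K)) z)\<^sup>2" for n z
  have nn: "(\<integral>\<^sup>+z. ennreal (norm (u n z)) \<partial>lborel) = jet_error lborel D bjets g (w (n + K))" for n
    unfolding jet_error_def u_def by (intro nn_integral_cong) (auto simp: indicator_def)
  have um[measurable]: "u n \<in> borel_measurable lborel" for n unfolding u_def by measurable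
  have int: "integrable lborel (u n)" for n
  proof (rule integrableI_bounded[OF um])
    show "(\<integral>\<^sup>+z. ennreal (norm (u n z)) \<partial>lborel) < \<infinity>"
      unfolding nn using K[of "n + K"] by (rule le_less_trans[OF _ ennreal_less_top, unfolded infinity_ennreal_def[symmetric]]) simp
  qed
  have "(\<lambda>n. \<integral>z. norm (u n z) \<partial>lborel) \<longlonglongrightarrow> 0"
  proof -
    have "(\<lambda>n. jet_error lborel D bjets g (w (n + K))) \<longlonglongrightarrow> 0" by (rule LIMSEQ_ignore_initial_segment[OF E0])
    then have "(\<lambda>n. enn2real (jet_error lborel D bjets g (w (n + K)))) \<longlonglongrightarrow> 0" by (intro tendsto_enn2real) simp_all
    moreover have "enn2real (jet_error lborel D bjets g (w (n + K))) = (\<integral>z. norm (u n z) \<partial>lborel)" for n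
      unfolding nn[symmetric] by (subst integral_eq_nn_integral) auto
    ultimately show ?thesis by simp
  qed
  from tendsto_L1_AE_subseq[OF int this]
  obtain r where r: "strict_mono r" "AE z in lborel. (\<lambda>n. u (r n) z) \<longlonglongrightarrow> 0" by blast
  show ?thesis
  proof (intro exI[of _ "\<lambda>n. r n + K"] conjI)
    show "strict_mono (\<lambda>n. r n + K)" using r(1) by (simp add: strict_mono_def)
    show "AE z in lborel. z \<in> D \<longrightarrow> (\<lambda>n. jet_dist bjets g (w (r n + K)) z) \<longlonglongrightarrow> 0"
      using r(2)
    proof (eventually_elim, intro impI)
      fix z assume u: "(\<lambda>n. u (r n) z) \<longlonglongrightarrow> 0" and z: "z \<in> D"
      have "(\<lambda>n. sqrt (u (r n) z)) \<longlonglongrightarrow> sqrt 0" by (rule tendsto_real_sqrt[OF u])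
      then show "(\<lambda>n. jet_dist bjets g (w (r n + K)) z) \<longlonglongrightarrow> 0"
        using z by (simp add: u_def jet_dist_nonneg)
    qed
  qed
qed

text \<open>In the Cauchy estimate m goes to infinity along the almost everywhere convergent
  subsequence, by Fatou's lemma. This bounds the distance to the limit product directly.\<close>

lemma nonlinear_limit:
  assumes w: "jet_approx_on UNIV w M" and \<epsilon>: "(\<epsilon>::real) > 0"
  shows "\<exists>K. \<forall>k\<ge>K.
    (\<integral>\<^sup>+z. indicator D z * ennreal ((w k z * Vd (w k) z - g [] z * W z)\<^sup>2) \<partial>lborel) \<le> ennreal \<epsilon>"
proof -
  from nonlinear_Cauchy[OF assms] obtain K where K': "\<forall>k\<ge>K. \<forall>m\<ge>K.
    (\<integral>\<^sup>+z. indicator D z * ennreal ((w k z * Vd (w k) z - w m z * Vd (w m) z)\<^sup>2) \<partial>lborel) \<le> ennreal \<epsilon>"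
    by (elim exE)
  note K = K'[rule_format]
  obtain r where r: "strict_mono r" "AE z in lborel. z \<in> D \<longrightarrow> (\<lambda>n. jet_dist bjets g (w (r n)) z) \<longlonglongrightarrow> 0"
    using subseq_pointwise[OF w] by (elim exE conjE)
  have sm: "smooth (w k)" for k using w by (simp add: jet_approx_on_def)
  note [measurable] = smooth_borel[OF sm] smooth_borel[OF smooth_Vd[OF sm]]
  have "(\<integral>\<^sup>+z. indicator D z * ennreal ((w k z * Vd (w k) z - g [] z * W z)\<^sup>2) \<partial>lborel) \<le> ennreal \<epsilon>"
    if k: "k \<ge> K" for k
  proof -
    let ?f = "\<lambda>n z. indicator D z * ennreal ((w k z * Vd (w k) z - w (r n) z * Vd (w (r n)) z)\<^sup>2)"
    have "AE z in lborel. indicator D z * ennreal ((w k z * Vd (w k) z - g [] z * W z)\<^sup>2) = liminf (\<lambda>n. ?f n z)"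
      using r(2)
    proof eventually_elim
      case (elim z)
      show ?case
      proof (cases "z \<in> D")
        case True
        then have j: "(\<lambda>n. jet_dist bjets g (w (r n)) z) \<longlonglongrightarrow> 0" using elim by simp
        have "(\<lambda>n. w (r n) z - g [] z) \<longlonglongrightarrow> 0"
          by (rule Lim_null_comparison[OF _ j]) (simp add: nil_err)
        moreover have "(\<lambda>n. Vd (w (r n)) z - W z) \<longlonglongrightarrow> 0"
          by (rule Lim_null_comparison[OF _ j]) (simp add: W_err)
        ultimately have "(\<lambda>n. w (r n) z) \<longlonglongrightarrow> g [] z" "(\<lambda>n. Vd (w (r n)) z) \<longlonglongrightarrow> W z"
          by (simp_all add: LIM_zero_iff)
        then have "(\<lambda>n. ennreal ((w k z * Vd (w k) z - w (r n) z * Vd (w (r n)) z)\<^sup>2))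
            \<longlonglongrightarrow> ennreal ((w k z * Vd (w k) z - g [] z * W z)\<^sup>2)"
          by (intro tendsto_intros)
        then have "(\<lambda>n. ?f n z) \<longlonglongrightarrow> indicator D z * ennreal ((w k z * Vd (w k) z - g [] z * W z)\<^sup>2)"
          using True by simp
        from lim_imp_Liminf[OF sequentially_bot this] show ?thesis by (rule sym)
      qed (simp add: Liminf_const)
    qed
    then have "(\<integral>\<^sup>+z. indicator D z * ennreal ((w k z * Vd (w k) z - g [] z * W z)\<^sup>2) \<partial>lborel)
        = (\<integral>\<^sup>+z. liminf (\<lambda>n. ?f n z) \<partial>lborel)" by (rule nn_integral_cong_AE)
    also have "\<dots> \<le> liminf (\<lambda>n. \<integral>\<^sup>+z. ?f n z \<partial>lborel)" by (rule nn_integral_liminf) measurable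
    also have "\<dots> \<le> liminf (\<lambda>n. ennreal \<epsilon>)"
    proof (rule Liminf_mono)
      have "\<forall>\<^sub>F n in sequentially. r n \<ge> K"
        using filterlim_subseq[OF r(1)] by (simp add: filterlim_at_top)
      then show "\<forall>\<^sub>F n in sequentially. (\<integral>\<^sup>+z. ?f n z \<partial>lborel) \<le> ennreal \<epsilon>"
        by eventually_elim (rule K[OF k])
    qed
    also have "\<dots> = ennreal \<epsilon>" by (simp add: Liminf_const)
    finally show ?thesis .
  qed
  then show ?thesis by blast
qed

end

section \<open>Initial values\<close>

text \<open>A uniform perturbation by c costs the factor 2 and a term proportional to the finite
  measure of S.\<close>

lemma L2_perturb:
  fixes p q :: "'a::euclidean_space \<Rightarrow> real"
  assumes [measurable]: "S \<in> sets borel" "p \<in> borel_measurable borel" "q \<in> borel_measurable borel"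
    and le: "\<And>z. z \<in> S \<Longrightarrow> \<bar>p z\<bar> \<le> \<bar>q z\<bar> + c"
  shows "(\<integral>\<^sup>+z. indicator S z * ennreal ((p z)\<^sup>2) \<partial>lborel)
    \<le> 2 * (\<integral>\<^sup>+z. indicator S z * ennreal ((q z)\<^sup>2) \<partial>lborel) + ennreal (2 * c\<^sup>2) * emeasure lborel S"
proof -
  have "(\<integral>\<^sup>+z. indicator S z * ennreal ((p z)\<^sup>2) \<partial>lborel)
      \<le> (\<integral>\<^sup>+z. 2 * (indicator S z * ennreal ((q z)\<^sup>2)) + ennreal (2 * c\<^sup>2) * indicator S z \<partial>lborel)"
  proof (rule nn_integral_mono)
    fix z
    show "indicator S z * ennreal ((p z)\<^sup>2) \<le> 2 * (indicator S z * ennreal ((q z)\<^sup>2)) + ennreal (2 * c\<^sup>2) * indicator S z"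
    proof (cases "z \<in> S")
      case True
      have "(p z)\<^sup>2 \<le> (1 * (\<bar>q z\<bar> + c))\<^sup>2" using power_mono[OF le[OF True], of 2] by simp
      also have "\<dots> \<le> 2 * 1\<^sup>2 * (\<bar>q z\<bar>\<^sup>2 + c\<^sup>2)" by (rule square_add_bound)
      finally have "ennreal ((p z)\<^sup>2) \<le> ennreal (2 * (q z)\<^sup>2 + 2 * c\<^sup>2)" by (intro ennreal_leI) simp
      also have "\<dots> = 2 * ennreal ((q z)\<^sup>2) + ennreal (2 * c\<^sup>2)" by (simp add: ennreal_mult)
      finally show ?thesis using True by simp
    qed simp
  qed
  also have "\<dots> = 2 * (\<integral>\<^sup>+z. indicator S z * ennreal ((q z)\<^sup>2) \<partial>lborel) + ennreal (2 * c\<^sup>2) * emeasure lborel S"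
    by (simp add: nn_integral_add nn_integral_cmult nn_integral_cmult_indicator)
  finally show ?thesis .
qed

text \<open>The fundamental theorem of calculus, and Jensen's inequality for the uniform density on
  [0, t], which supplies the factor t.\<close>

lemma time_difference_bound:
  fixes w :: "'b::euclidean_space \<times> real \<Rightarrow> real"
  assumes w: "smooth w" and t: "0 < t"
  shows "ennreal ((w (x, 0) - w (x, t))\<^sup>2)
    \<le> ennreal t * (\<integral>\<^sup>+s. indicator {0..t} s * ennreal ((dirder (0, 1) w (x, s))\<^sup>2) \<partial>lborel)"
proof -
  define \<phi> where "\<phi> s = dirder (0, 1) w (x, s)" for s
  have l: "linear (\<lambda>s::real. (0::'b, s))" by (simp add: linear_iff)
  have eq: "(\<lambda>s. f (x, s)) = (\<lambda>s. f ((0, s) + (x, 0)))" for f :: "'b \<times> real \<Rightarrow> real" by simp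
  have "((\<lambda>s. w (x, s)) has_real_derivative \<phi> s) (at s)" for s
  proof -
    have "(\<lambda>s. w (x, s)) differentiable (at s)"
      unfolding eq[of w] by (rule dirder_comp_affine(2)[OF l smooth_differentiable[OF w]])
    from real_has_derivative_dirder[OF this]
    show ?thesis
      using dirder_comp_affine(1)[OF l smooth_differentiable[OF w], where v = 1 and x = s and b = "(x, 0)"]
      by (simp add: \<phi>_def)
  qed
  note d = this
  have c: "continuous_on UNIV \<phi>"
    unfolding \<phi>_def[abs_def] eq by (rule smooth_continuous[OF smooth_comp_affine[OF l smooth_dirder[OF w]]])
  have [measurable]: "\<phi> \<in> borel_measurable borel" by (rule borel_measurable_continuous_onI[OF c])
  have HB: "has_bochner_integral lborel (\<lambda>s. \<phi> s * indicator {0..t} s) (w (x, t) - w (x, 0))"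
    by (rule has_bochner_integral_FTC_Icc_real[OF less_imp_le[OF t] d])
      (use c in \<open>simp add: continuous_on_eq_continuous_at\<close>)
  let ?J = "\<lambda>s. indicator {0..t} s / t :: real"
  have Jphi: "(\<lambda>s. ?J s * (t * \<phi> s)) = (\<lambda>s. \<phi> s * indicator {0..t} s)" using t by (auto simp: fun_eq_iff)
  have "ennreal ((w (x, t) - w (x, 0))\<^sup>2) = ennreal ((\<integral>s. ?J s * (t * \<phi> s) \<partial>lborel)\<^sup>2)"
    unfolding Jphi using HB by (simp add: has_bochner_integral_iff)
  also have "\<dots> \<le> (\<integral>\<^sup>+s. ennreal (?J s * (t * \<phi> s)\<^sup>2) \<partial>lborel)"
  proof (rule square_integral_le)
    have "integrable lborel (indicator {0..t} :: real \<Rightarrow> real)" using t by (simp add: integrable_indicator_iff)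
    then show "integrable lborel ?J" by (rule integrable_divide)
    show "(\<integral>s. ?J s \<partial>lborel) = 1" using t by simp
    show "integrable lborel (\<lambda>s. ?J s * (t * \<phi> s))" unfolding Jphi using HB by (simp add: has_bochner_integral_iff)
  qed (use t in auto)
  also have "\<dots> = (\<integral>\<^sup>+s. ennreal t * (indicator {0..t} s * ennreal ((\<phi> s)\<^sup>2)) \<partial>lborel)"
  proof (rule nn_integral_cong)
    fix s
    show "ennreal (?J s * (t * \<phi> s)\<^sup>2) = ennreal t * (indicator {0..t} s * ennreal ((\<phi> s)\<^sup>2))"
    proof (cases "s \<in> {0..t}")
      case True
      have "?J s * (t * \<phi> s)\<^sup>2 = t * (\<phi> s)\<^sup>2" using True t by (simp add: power2_eq_square)
      then show ?thesis using True t by (simp add: ennreal_mult)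
    qed simp
  qed
  also have "\<dots> = ennreal t * (\<integral>\<^sup>+s. indicator {0..t} s * ennreal ((\<phi> s)\<^sup>2) \<partial>lborel)"
    by (rule nn_integral_cmult) measurable
  finally show ?thesis by (simp add: \<phi>_def power2_commute)
qed

context burgers_jet
begin

text \<open>
  The time derivatives are bounded in \<open>L\<^sup>2\<close>, so the value at time \<open>0\<close> differs from the one at a small
  time \<open>t\<close> by \<open>O(t\<^sup>1\<^sup>/\<^sup>2)\<close>, uniformly along the approximating sequence.
\<close>

lemma initial_limit:
  assumes w: "jet_approx_on UNIV w M" and \<epsilon>: "(\<epsilon>::real) > 0"
    and a[measurable]: "a \<in> borel_measurable borel"
    and init: "\<And>e::real. e > 0 \<Longrightarrow> \<exists>\<tau>>0. AE t in lborel. t \<in> {0<..<\<tau>} \<longrightarrow>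
      (\<integral>\<^sup>+x. indicator \<Omega> x * ennreal ((g [] (x, t) - a x)\<^sup>2) \<partial>lborel) \<le> ennreal e"
  shows "\<exists>K. \<forall>k\<ge>K. (\<integral>\<^sup>+x. indicator \<Omega> x * ennreal ((w k (x, 0) - a x)\<^sup>2) \<partial>lborel) \<le> ennreal \<epsilon>"
proof -
  have sm: "smooth (w k)" for k using w by (simp add: jet_approx_on_def)
  have [measurable]: "\<Omega> \<in> sets borel" using \<Omega> by simp
  define wt where "wt k = dirder (0, 1) (w k)" for k
  have [measurable]: "wt k \<in> borel_measurable borel" "w k \<in> borel_measurable borel" for k
    unfolding wt_def by (rule smooth_borel[OF smooth_dirder[OF sm]] smooth_borel[OF sm])+
  let ?gt = "g [(0, 1)]"
  have gtz: "L2z D ?gt" by (rule gl[OF bjets_memb(4)])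
  note [measurable] = L2z_meas[OF gtz]
  have "L2sq lborel ?gt < top" using L2z_fin[OF gtz] by simp
  then obtain G where G: "G \<ge> 0" "L2sq lborel ?gt = ennreal G" by (cases "L2sq lborel ?gt") auto
  have e9: "\<epsilon> / 9 > 0" using \<epsilon> by simp
  obtain \<tau>0 where \<tau>0: "\<tau>0 > 0" "AE t in lborel. t \<in> {0<..<\<tau>0} \<longrightarrow>
      (\<integral>\<^sup>+x. indicator \<Omega> x * ennreal ((g [] (x, t) - a x)\<^sup>2) \<partial>lborel) \<le> ennreal (\<epsilon> / 9)"
    using init[OF e9] by (elim exE conjE)
  \<comment> \<open>The mean square of the time derivative of every late \<open>w k\<close> will be
    at most 2 + 2 G, from a jet error below 1 and the norm G of the limit; \<tau> makes its
    contribution at most \<epsilon>/9.\<close>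
  define \<tau> where "\<tau> = min (min \<tau>0 (T / 2)) (\<epsilon> / (9 * (2 + 2 * G)))"
  have \<tau>: "\<tau> > 0" "\<tau> \<le> \<tau>0" "\<tau> < T" using \<tau>0(1) T \<epsilon> G(1) by (auto simp: \<tau>_def min_less_iff_disj)
  have \<tau>G: "\<tau> * (2 + 2 * G) \<le> \<epsilon> / 9"
  proof -
    have "\<tau> * (2 + 2 * G) \<le> (\<epsilon> / (9 * (2 + 2 * G))) * (2 + 2 * G)"
      using G(1) by (intro mult_right_mono) (auto simp: \<tau>_def)
    also have "\<dots> = \<epsilon> / 9" using G(1) by (simp add: field_simps)
    finally show ?thesis .
  qed
  \<comment> \<open>The jet error is integrated over time already, whereas the other two terms gain
    a factor \<tau> from integration over (0, \<tau>); so it has to be small relative to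
    \<tau>.\<close>
  define \<eta> where "\<eta> = min 1 (\<tau> * \<epsilon> / 9)"
  have \<eta>: "\<eta> > 0" "\<eta> \<le> 1" "\<eta> \<le> \<tau> * \<epsilon> / 9" using \<tau> \<epsilon> by (auto simp: \<eta>_def)
  have E0: "(\<lambda>k. jet_error lborel D bjets g (w k)) \<longlonglongrightarrow> 0" using w by (simp add: jet_approx_on_def)
  obtain K where K: "\<forall>k\<ge>K. jet_error lborel D bjets g (w k) \<le> ennreal \<eta>"
    using tendsto_0_eventually_le[OF E0 \<eta>(1)] unfolding eventually_sequentially by (elim exE)
  have "(\<integral>\<^sup>+x. indicator \<Omega> x * ennreal ((w k (x, 0) - a x)\<^sup>2) \<partial>lborel) \<le> ennreal \<epsilon>" if k: "k \<ge> K" for k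
  proof -
    let ?X = "\<integral>\<^sup>+x. indicator \<Omega> x * ennreal ((w k (x, 0) - a x)\<^sup>2) \<partial>lborel"
    have Ek: "jet_error lborel D bjets g (w k) \<le> ennreal \<eta>" using K k by blast
    have jm[measurable]: "jet_dist bjets g (w k) \<in> borel_measurable borel" by (rule jet_dist_measurable[OF sm gl_meas])
    define P where "P x = (\<integral>\<^sup>+s. indicator D (x, s) * ennreal ((wt k (x, s))\<^sup>2) \<partial>lborel)" for x
    have [measurable]: "P \<in> borel_measurable borel" unfolding P_def by measurable
    have PI: "(\<integral>\<^sup>+x. P x \<partial>lborel) \<le> ennreal (2 + 2 * G)"
    proof -
      have "(\<integral>\<^sup>+x. P x \<partial>lborel) = (\<integral>\<^sup>+z. indicator D z * ennreal ((wt k z)\<^sup>2) \<partial>lborel)"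
      proof -
        have m: "(\<lambda>z. indicator D z * ennreal ((wt k z)\<^sup>2)) \<in> borel_measurable (lborel \<Otimes>\<^sub>M lborel)"
          unfolding lborel_prod by measurable
        show ?thesis unfolding P_def using lborel.nn_integral_fst[OF m] by (simp add: lborel_prod)
      qed
      also have "\<dots> \<le> (\<integral>\<^sup>+z. 2 * (indicator D z * ennreal ((jet_dist bjets g (w k) z)\<^sup>2)) + 2 * ennreal ((?gt z)\<^sup>2) \<partial>lborel)"
      proof (rule nn_integral_mono)
        fix z
        have "\<bar>wt k z - ?gt z\<bar> \<le> jet_dist bjets g (w k) z"
          using jet_dist_ge[OF fin_bjets bjets_memb(4), of "w k" z g] by (simp add: wt_def)
        then have "\<bar>wt k z\<bar> \<le> jet_dist bjets g (w k) z + \<bar>?gt z\<bar>" by linarith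
        from power_mono[OF this, of 2]
        have "(wt k z)\<^sup>2 \<le> (1 * (jet_dist bjets g (w k) z + \<bar>?gt z\<bar>))\<^sup>2" by simp
        also have "\<dots> \<le> 2 * 1\<^sup>2 * ((jet_dist bjets g (w k) z)\<^sup>2 + \<bar>?gt z\<bar>\<^sup>2)" by (rule square_add_bound)
        finally have "ennreal ((wt k z)\<^sup>2) \<le> ennreal (2 * (jet_dist bjets g (w k) z)\<^sup>2 + 2 * (?gt z)\<^sup>2)"
          by (intro ennreal_leI) simp
        also have "\<dots> = 2 * ennreal ((jet_dist bjets g (w k) z)\<^sup>2) + 2 * ennreal ((?gt z)\<^sup>2)"
          by (simp add: ennreal_mult)
        finally show "indicator D z * ennreal ((wt k z)\<^sup>2)
          \<le> 2 * (indicator D z * ennreal ((jet_dist bjets g (w k) z)\<^sup>2)) + 2 * ennreal ((?gt z)\<^sup>2)"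
          by (cases "z \<in> D") auto
      qed
      also have "\<dots> = 2 * jet_error lborel D bjets g (w k) + 2 * L2sq lborel ?gt"
        unfolding jet_error_def L2sq_def by (simp add: nn_integral_add nn_integral_cmult)
      also have "\<dots> \<le> 2 * ennreal 1 + 2 * ennreal G"
        unfolding G(2) using order_trans[OF Ek ennreal_leI[OF \<eta>(2)]] by (intro add_mono mult_left_mono) auto
      also have "\<dots> = ennreal (2 + 2 * G)" using G(1) by (simp add: ennreal_mult)
      finally show ?thesis .
    qed
    have diff: "ennreal ((w k (x, 0) - w k (x, t))\<^sup>2) \<le> ennreal \<tau> * P x" if x: "x \<in> \<Omega>" and t: "t \<in> {0<..<\<tau>}" for x t
    proof -
      have "ennreal ((w k (x, 0) - w k (x, t))\<^sup>2)
          \<le> ennreal t * (\<integral>\<^sup>+s. indicator {0..t} s * ennreal ((wt k (x, s))\<^sup>2) \<partial>lborel)"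
        unfolding wt_def by (rule time_difference_bound[OF sm]) (use t in auto)
      also have "\<dots> \<le> ennreal \<tau> * P x"
      proof (rule mult_mono)
        show "ennreal t \<le> ennreal \<tau>" using t by (intro ennreal_leI) simp
        show "(\<integral>\<^sup>+s. indicator {0..t} s * ennreal ((wt k (x, s))\<^sup>2) \<partial>lborel) \<le> P x"
          unfolding P_def
        proof (rule nn_integral_mono_AE)
          \<comment> \<open>Time 0 is missing from the open cylinder, which a single null point
            allows.\<close>
          have "AE s in lborel. s \<noteq> (0::real)" by (rule AE_lborel_singleton)
          then show "AE s in lborel. indicator {0..t} s * ennreal ((wt k (x, s))\<^sup>2)
              \<le> indicator D (x, s) * ennreal ((wt k (x, s))\<^sup>2)"
            by eventually_elim (use x t \<tau> in \<open>auto simp: indicator_def cylinder_def\<close>)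
        qed
      qed auto
      finally show ?thesis .
    qed
    \<comment> \<open>The limit is known for almost every time only, so the comparison is averaged
      over the times in (0, \<tau>) and divided by \<tau> at the end.\<close>
    have "ennreal \<tau> * ?X = (\<integral>\<^sup>+t. ?X * indicator {0<..<\<tau>} t \<partial>lborel)"
      using \<tau> by (subst nn_integral_cmult_indicator) (simp_all add: mult.commute)
    also have "\<dots> \<le> (\<integral>\<^sup>+t. 3 * (ennreal (\<tau> * (2 + 2 * G)) * indicator {0<..<\<tau>} t)
        + 3 * (\<integral>\<^sup>+x. indicator D (x, t) * ennreal ((jet_dist bjets g (w k) (x, t))\<^sup>2) \<partial>lborel)
        + 3 * (ennreal (\<epsilon> / 9) * indicator {0<..<\<tau>} t) \<partial>lborel)"
    proof (rule nn_integral_mono_AE)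
      show "AE t in lborel. ?X * indicator {0<..<\<tau>} t \<le> 3 * (ennreal (\<tau> * (2 + 2 * G)) * indicator {0<..<\<tau>} t)
        + 3 * (\<integral>\<^sup>+x. indicator D (x, t) * ennreal ((jet_dist bjets g (w k) (x, t))\<^sup>2) \<partial>lborel)
        + 3 * (ennreal (\<epsilon> / 9) * indicator {0<..<\<tau>} t)"
        using \<tau>0(2)
      proof eventually_elim
        case (elim t)
        show ?case
        proof (cases "t \<in> {0<..<\<tau>}")
          case True
          then have tD: "t \<in> {0<..<T}" "t \<in> {0<..<\<tau>0}" using \<tau> by auto
          have "?X \<le> (\<integral>\<^sup>+x. 3 * (ennreal \<tau> * P x) + 3 * (indicator D (x, t) * ennreal ((jet_dist bjets g (w k) (x, t))\<^sup>2))
              + 3 * (indicator \<Omega> x * ennreal ((g [] (x, t) - a x)\<^sup>2)) \<partial>lborel)"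
          proof (rule nn_integral_mono)
            fix x
            let ?p = "w k (x, 0) - w k (x, t)" and ?q = "w k (x, t) - g [] (x, t)" and ?r = "g [] (x, t) - a x"
            let ?j = "jet_dist bjets g (w k) (x, t)"
            show "indicator \<Omega> x * ennreal ((w k (x, 0) - a x)\<^sup>2) \<le> 3 * (ennreal \<tau> * P x)
              + 3 * (indicator D (x, t) * ennreal (?j\<^sup>2)) + 3 * (indicator \<Omega> x * ennreal (?r\<^sup>2))"
            proof (cases "x \<in> \<Omega>")
              case x: True
              have "(w k (x, 0) - a x)\<^sup>2 \<le> 3 * ?p\<^sup>2 + 3 * ?q\<^sup>2 + 3 * ?r\<^sup>2"
                using square_add3_bound[of ?p ?q ?r] by simp
              also have "\<dots> \<le> 3 * ?p\<^sup>2 + 3 * ?j\<^sup>2 + 3 * ?r\<^sup>2"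
                using power_mono[OF nil_err[of "w k" "(x, t)"], of 2] by simp
              finally have "ennreal ((w k (x, 0) - a x)\<^sup>2) \<le> ennreal (3 * ?p\<^sup>2 + 3 * ?j\<^sup>2 + 3 * ?r\<^sup>2)"
                by (rule ennreal_leI)
              also have "\<dots> = 3 * ennreal (?p\<^sup>2) + 3 * ennreal (?j\<^sup>2) + 3 * ennreal (?r\<^sup>2)"
                by (simp add: ennreal_mult)
              also have "\<dots> \<le> 3 * (ennreal \<tau> * P x) + 3 * ennreal (?j\<^sup>2) + 3 * ennreal (?r\<^sup>2)"
                by (intro add_mono mult_left_mono diff[OF x True]) auto
              finally show ?thesis using x tD by (simp add: cylinder_def)
            qed simp
          qed
          also have "\<dots> = 3 * (ennreal \<tau> * (\<integral>\<^sup>+x. P x \<partial>lborel))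
              + 3 * (\<integral>\<^sup>+x. indicator D (x, t) * ennreal ((jet_dist bjets g (w k) (x, t))\<^sup>2) \<partial>lborel)
              + 3 * (\<integral>\<^sup>+x. indicator \<Omega> x * ennreal ((g [] (x, t) - a x)\<^sup>2) \<partial>lborel)"
            by (simp add: nn_integral_add nn_integral_cmult)
          also have "\<dots> \<le> 3 * (ennreal \<tau> * ennreal (2 + 2 * G))
              + 3 * (\<integral>\<^sup>+x. indicator D (x, t) * ennreal ((jet_dist bjets g (w k) (x, t))\<^sup>2) \<partial>lborel)
              + 3 * ennreal (\<epsilon> / 9)"
            using elim tD by (intro add_mono mult_left_mono PI) auto
          finally show ?thesis using True \<tau> G(1) by (simp add: ennreal_mult)
        qed simp
      qed
    qed
    also have "\<dots> = 3 * (ennreal (\<tau> * (2 + 2 * G)) * ennreal \<tau>) + 3 * jet_error lborel D bjets g (w k)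
        + 3 * (ennreal (\<epsilon> / 9) * ennreal \<tau>)"
    proof -
      have "jet_error lborel D bjets g (w k)
          = (\<integral>\<^sup>+t. \<integral>\<^sup>+x. indicator D (x, t) * ennreal ((jet_dist bjets g (w k) (x, t))\<^sup>2) \<partial>lborel \<partial>lborel)"
        unfolding jet_error_def by (rule nn_integral_swap_product) measurable
      then show ?thesis using \<tau>
        by (simp add: nn_integral_add nn_integral_cmult nn_integral_cmult_indicator)
    qed
    also have "\<dots> \<le> 3 * (ennreal (\<epsilon> / 9) * ennreal \<tau>) + 3 * ennreal (\<tau> * \<epsilon> / 9) + 3 * (ennreal (\<epsilon> / 9) * ennreal \<tau>)"
      using order_trans[OF Ek ennreal_leI[OF \<eta>(3)]]
      by (intro add_mono mult_left_mono mult_right_mono ennreal_leI \<tau>G) auto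
    also have "\<dots> = ennreal (\<tau> * \<epsilon>)"
    proof -
      have n: "0 \<le> \<epsilon> / 9" "0 \<le> \<tau>" "0 \<le> \<tau> * \<epsilon> / 9" using \<epsilon> \<tau> by auto
      have "3 * (ennreal (\<epsilon> / 9) * ennreal \<tau>) + 3 * ennreal (\<tau> * \<epsilon> / 9) + 3 * (ennreal (\<epsilon> / 9) * ennreal \<tau>)
          = ennreal (3 * (\<epsilon> / 9 * \<tau>) + 3 * (\<tau> * \<epsilon> / 9) + 3 * (\<epsilon> / 9 * \<tau>))"
        using n by (simp only: ennreal_plus ennreal_mult'' ennreal_numeral mult_nonneg_nonneg add_nonneg_nonneg zero_le_numeral)
      then show ?thesis by (simp add: field_simps)
    qed
    finally have "ennreal \<tau> * ?X \<le> ennreal (\<tau> * \<epsilon>)" .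
    then have "ennreal (1 / \<tau>) * (ennreal \<tau> * ?X) \<le> ennreal (1 / \<tau>) * ennreal (\<tau> * \<epsilon>)" by (intro mult_left_mono) auto
    then show ?thesis using \<tau> \<epsilon> by (simp add: mult.assoc[symmetric] ennreal_mult[symmetric])
  qed
  then show ?thesis by blast
qed

section \<open>Passage from smooth functions to networks\<close>

lemma Ck_close_bjets:
  fixes h w :: "'b \<times> real \<Rightarrow> real"
  assumes "Ck_close 2 S \<eta> h w" "l \<in> bjets" "z \<in> S"
  shows "\<bar>Dl l h z - Dl l w z\<bar> \<le> \<eta>"
proof -
  have 1: "Ck_close (Suc (Suc 0)) S \<eta> h w" using assms(1) by (simp add: numeral_2_eq_2)
  have B: "sp e \<in> Basis" if "e \<in> Basis" for e :: 'b using that by (simp add: sp_def Basis_prod_def)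
  have t: "(0::'b, 1::real) \<in> Basis" by (simp add: Basis_prod_def)
  have d0: "\<bar>h z - w z\<bar> \<le> \<eta>" using 1 assms(3) by simp
  have d1: "\<bar>dirder e h z - dirder e w z\<bar> \<le> \<eta>" if "e \<in> Basis" for e using 1 assms(3) that by simp
  have d2: "\<bar>dirder e' (dirder e h) z - dirder e' (dirder e w) z\<bar> \<le> \<eta>" if "e \<in> Basis" "e' \<in> Basis" for e e'
    using 1 assms(3) that by simp
  from assms(2) consider "l = [(0, 1)]" | "l = []" | e where "l = [sp e]" "e \<in> Basis"
    | e e' where "l = [sp e, sp e']" "e \<in> Basis" "e' \<in> Basis"
    by (auto simp: bjets_def jets2_def)
  then show ?thesis by cases (simp_all add: d0 d1[OF t] d1[OF B] d2[OF B B])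
qed

text \<open>One member w of the sequence meets all three requirements with tolerance \<epsilon>/4.
  Only then is the network chosen, close in C2 with a tolerance that depends on the bounds of
  w.\<close>

theorem network_approx:
  assumes \<sigma>: "smooth \<sigma>" "\<not> polynomial_fun \<sigma>" and \<epsilon>: "(\<epsilon>::real) > 0"
    and a[measurable]: "a \<in> borel_measurable borel"
    and init: "\<And>e::real. e > 0 \<Longrightarrow> \<exists>\<tau>>0. AE t in lborel. t \<in> {0<..<\<tau>} \<longrightarrow>
      (\<integral>\<^sup>+x. indicator \<Omega> x * ennreal ((g [] (x, t) - a x)\<^sup>2) \<partial>lborel) \<le> ennreal e"
  shows "\<exists>h\<in>shallow \<sigma>. jet_error lborel D bjets g h \<le> ennreal \<epsilon> \<and>
    (\<integral>\<^sup>+z. indicator D z * ennreal ((h z * Vd h z - g [] z * W z)\<^sup>2) \<partial>lborel) \<le> ennreal \<epsilon> \<and>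
    (\<integral>\<^sup>+x. indicator \<Omega> x * ennreal ((h (x, 0) - a x)\<^sup>2) \<partial>lborel) \<le> ennreal \<epsilon>"
proof -
  obtain ws M where ws: "\<And>k. test_function UNIV (ws k)" "jet_approx_on UNIV ws M"
    using global_approx by blast
  have E0: "(\<lambda>k. jet_error lborel D bjets g (ws k)) \<longlonglongrightarrow> 0" using ws(2) by (simp add: jet_approx_on_def)
  have e4: "\<epsilon> / 4 > 0" using \<epsilon> by simp
  obtain K1 where K1: "\<forall>k\<ge>K1. jet_error lborel D bjets g (ws k) \<le> ennreal (\<epsilon> / 4)"
    using tendsto_0_eventually_le[OF E0 e4] unfolding eventually_sequentially by (elim exE)
  obtain K2 where K2: "\<forall>k\<ge>K2.
    (\<integral>\<^sup>+z. indicator D z * ennreal ((ws k z * Vd (ws k) z - g [] z * W z)\<^sup>2) \<partial>lborel) \<le> ennreal (\<epsilon> / 4)"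
    using nonlinear_limit[OF ws(2) e4] by (elim exE)
  have "\<exists>K. \<forall>k\<ge>K. (\<integral>\<^sup>+x. indicator \<Omega> x * ennreal ((ws k (x, 0) - a x)\<^sup>2) \<partial>lborel) \<le> ennreal (\<epsilon> / 4)"
    by (rule initial_limit[OF ws(2) e4 a]) (rule init)
  then obtain K3 where K3: "\<forall>k\<ge>K3. (\<integral>\<^sup>+x. indicator \<Omega> x * ennreal ((ws k (x, 0) - a x)\<^sup>2) \<partial>lborel) \<le> ennreal (\<epsilon> / 4)"
    by (elim exE)
  define w where "w = ws (max K1 (max K2 K3))"
  have w1: "jet_error lborel D bjets g w \<le> ennreal (\<epsilon> / 4)"
    and w2: "(\<integral>\<^sup>+z. indicator D z * ennreal ((w z * Vd w z - g [] z * W z)\<^sup>2) \<partial>lborel) \<le> ennreal (\<epsilon> / 4)"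
    and w3: "(\<integral>\<^sup>+x. indicator \<Omega> x * ennreal ((w (x, 0) - a x)\<^sup>2) \<partial>lborel) \<le> ennreal (\<epsilon> / 4)"
    using K1 K2 K3 unfolding w_def by simp_all
  have test: "test_function UNIV w" unfolding w_def by (rule ws(1))
  have sm: "smooth w" by (rule test_function_smooth[OF test])
  \<comment> \<open>Time 0 is included because the initial values are compared there.\<close>
  define S where "S = \<Omega> \<times> {0..T}"
  have S: "bounded S" "D \<subseteq> S" "\<And>x. x \<in> \<Omega> \<Longrightarrow> (x, 0) \<in> S"
    unfolding S_def cylinder_def using \<Omega>(2) T by (auto intro: bounded_Times)
  obtain B1 where B1: "B1 \<ge> 0" "\<And>z. z \<in> S \<Longrightarrow> \<bar>w z\<bar> \<le> B1" using smooth_bounded_on[OF sm S(1)] by metis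
  obtain B2 where B2: "B2 \<ge> 0" "\<And>z. z \<in> S \<Longrightarrow> \<bar>Vd w z\<bar> \<le> B2" using smooth_bounded_on[OF smooth_Vd[OF sm] S(1)] by metis
  let ?n = "real (card (bjets :: ('b \<times> real) list set))" and ?d = "real DIM('b)"
  \<comment> \<open>A common factor for three perturbations: the jet sum has
    \<open>card bjets\<close> terms, the product changes by at most \<eta> times
    \<open>B2 + ?d + B1 * ?d\<close>, and the value by \<eta>.\<close>
  define Kc where "Kc = ?n + (B2 + ?d + B1 * ?d) + 1"
  have Kc: "Kc \<ge> 1" "Kc \<ge> ?n" "Kc \<ge> B2 + ?d + B1 * ?d" using B1(1) B2(1) by (auto simp: Kc_def)
  have fin: "emeasure lborel D < top" "emeasure lborel \<Omega> < top"
    using emeasure_bounded_finite[OF D_bounded] emeasure_bounded_finite[OF \<Omega>(2)] by simp_all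
  define V where "V = max (measure lborel D) (measure lborel \<Omega>)"
  have V: "V \<ge> 0" "emeasure lborel D \<le> ennreal V" "emeasure lborel \<Omega> \<le> ennreal V"
    using fin by (auto simp: V_def emeasure_eq_ennreal_measure le_max_iff_disj intro!: ennreal_leI)
  \<comment> \<open>Twice \<epsilon>/4 leaves \<epsilon>/2 for the uniform perturbation c over a set
    of measure at most V.\<close>
  define c where "c = sqrt (\<epsilon> / (4 * (V + 1)))"
  have c: "c > 0" "c\<^sup>2 = \<epsilon> / (4 * (V + 1))" using \<epsilon> V(1) by (auto simp: c_def)
  have cV: "2 * c\<^sup>2 * V \<le> \<epsilon> / 2" unfolding c(2) using \<epsilon> V(1) by (simp add: field_simps)
  define \<eta> where "\<eta> = min 1 (c / Kc)"
  have \<eta>: "\<eta> > 0" "\<eta> \<le> 1" using c Kc by (auto simp: \<eta>_def)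
  have "\<eta> * Kc \<le> (c / Kc) * Kc" using Kc by (intro mult_right_mono) (auto simp: \<eta>_def)
  then have \<eta>K: "\<eta> * Kc \<le> c" using Kc by simp
  obtain h where h: "h \<in> shallow \<sigma>" "Ck_close 2 S \<eta> h w"
    using shallow_Ck_approx[OF \<sigma> test S(1) \<eta>(1)] by metis
  have smh: "smooth h" by (rule shallow_smooth[OF h(1) \<sigma>(1)])
  note cl = Ck_close_bjets[OF h(2)]
  have jm: "jet_dist bjets g h \<in> borel_measurable borel" "jet_dist bjets g w \<in> borel_measurable borel"
    by (rule jet_dist_measurable[OF smh gl_meas] jet_dist_measurable[OF sm gl_meas], assumption)+
  have [measurable]: "\<Omega> \<in> sets borel" using \<Omega> by simp
  note [measurable] = smooth_borel[OF sm] smooth_borel[OF smh] smooth_borel[OF smooth_Vd[OF sm]] smooth_borel[OF smooth_Vd[OF smh]]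
  have fin4: "2 * x + ennreal (2 * c\<^sup>2) * y \<le> ennreal \<epsilon>" if "x \<le> ennreal (\<epsilon> / 4)" "y \<le> ennreal V" for x y
  proof -
    have "2 * x + ennreal (2 * c\<^sup>2) * y \<le> 2 * ennreal (\<epsilon> / 4) + ennreal (2 * c\<^sup>2) * ennreal V"
      using that by (intro add_mono mult_left_mono) auto
    also have "\<dots> = ennreal (2 * (\<epsilon> / 4) + 2 * c\<^sup>2 * V)"
      using \<epsilon> V(1) by (simp only: ennreal_plus ennreal_mult'' ennreal_numeral mult_nonneg_nonneg zero_le_numeral zero_le_power2 less_imp_le[OF e4])
    also have "\<dots> \<le> ennreal \<epsilon>" using cV by (intro ennreal_leI) simp
    finally show ?thesis .
  qed
  have 1: "jet_error lborel D bjets g h \<le> ennreal \<epsilon>"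
  proof -
    have "\<bar>jet_dist bjets g h z\<bar> \<le> \<bar>jet_dist bjets g w z\<bar> + c" if z: "z \<in> D" for z
    proof -
      have "jet_dist bjets g h z \<le> (\<Sum>l\<in>bjets. \<bar>Dl l w z - g l z\<bar> + \<eta>)"
        unfolding jet_dist_def
      proof (rule sum_mono)
        fix l :: "('b \<times> real) list" assume "l \<in> bjets"
        from cl[OF this, of z] z S(2) show "\<bar>Dl l h z - g l z\<bar> \<le> \<bar>Dl l w z - g l z\<bar> + \<eta>" by auto
      qed
      also have "\<dots> = jet_dist bjets g w z + \<eta> * ?n" by (simp add: sum.distrib jet_dist_def mult.commute)
      also have "\<eta> * ?n \<le> c" using Kc(2) \<eta>(1) \<eta>K mult_left_mono[of ?n Kc \<eta>] by linarith
      finally show ?thesis using jet_dist_nonneg[of bjets g h z] jet_dist_nonneg[of bjets g w z] by simp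
    qed
    from L2_perturb[OF D_borel jm this]
    have "jet_error lborel D bjets g h \<le> 2 * jet_error lborel D bjets g w + ennreal (2 * c\<^sup>2) * emeasure lborel D"
      unfolding jet_error_def .
    also have "\<dots> \<le> ennreal \<epsilon>" by (rule fin4[OF w1 V(2)])
    finally show ?thesis .
  qed
  have Vc: "\<bar>Vd h z - Vd w z\<bar> \<le> ?d * \<eta>" if z: "z \<in> S" for z
  proof -
    have "\<bar>Vd h z - Vd w z\<bar> \<le> (\<Sum>e\<in>Basis. \<bar>dirder (sp e) h z - dirder (sp e) w z\<bar>)"
      unfolding Vd_def sum_subtractf[symmetric] by (rule sum_abs)
    also have "\<dots> \<le> (\<Sum>e\<in>(Basis::'b set). \<eta>)"
      by (rule sum_mono) (use cl[OF bjets_memb(2) z] in simp)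
    finally show ?thesis by simp
  qed
  have wc: "\<bar>h z - w z\<bar> \<le> \<eta>" if "z \<in> S" for z using cl[OF bjets_memb(1) that] by simp
  have 2: "(\<integral>\<^sup>+z. indicator D z * ennreal ((h z * Vd h z - g [] z * W z)\<^sup>2) \<partial>lborel) \<le> ennreal \<epsilon>"
  proof -
    have "\<bar>h z * Vd h z - g [] z * W z\<bar> \<le> \<bar>w z * Vd w z - g [] z * W z\<bar> + c" if z: "z \<in> D" for z
    proof -
      have zS: "z \<in> S" using z S by blast
      have d\<eta>: "?d * \<eta> \<le> ?d * 1" using \<eta>(2) by (intro mult_left_mono) auto
      have Vh: "\<bar>Vd h z\<bar> \<le> B2 + ?d" using Vc[OF zS] B2(2)[OF zS] d\<eta> by linarith
      have "h z * Vd h z - w z * Vd w z = (h z - w z) * Vd h z + w z * (Vd h z - Vd w z)"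
        by (simp add: algebra_simps)
      then have "\<bar>h z * Vd h z - w z * Vd w z\<bar> \<le> \<bar>h z - w z\<bar> * \<bar>Vd h z\<bar> + \<bar>w z\<bar> * \<bar>Vd h z - Vd w z\<bar>"
        by (metis abs_mult abs_triangle_ineq)
      also have "\<dots> \<le> \<eta> * (B2 + ?d) + B1 * (?d * \<eta>)"
        using wc[OF zS] Vh B1 zS Vc[OF zS] \<eta> by (intro add_mono mult_mono) auto
      also have "\<dots> = \<eta> * (B2 + ?d + B1 * ?d)" by (simp add: algebra_simps)
      also have "\<dots> \<le> c" using Kc(3) \<eta>(1) \<eta>K mult_left_mono[of "B2 + ?d + B1 * ?d" Kc \<eta>] by linarith
      finally show ?thesis by linarith
    qed
    then have "(\<integral>\<^sup>+z. indicator D z * ennreal ((h z * Vd h z - g [] z * W z)\<^sup>2) \<partial>lborel)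
      \<le> 2 * (\<integral>\<^sup>+z. indicator D z * ennreal ((w z * Vd w z - g [] z * W z)\<^sup>2) \<partial>lborel)
        + ennreal (2 * c\<^sup>2) * emeasure lborel D"
      by (intro L2_perturb) auto
    also have "\<dots> \<le> ennreal \<epsilon>" by (rule fin4[OF w2 V(2)])
    finally show ?thesis .
  qed
  have 3: "(\<integral>\<^sup>+x. indicator \<Omega> x * ennreal ((h (x, 0) - a x)\<^sup>2) \<partial>lborel) \<le> ennreal \<epsilon>"
  proof -
    have "\<bar>h (x, 0) - a x\<bar> \<le> \<bar>w (x, 0) - a x\<bar> + c" if x: "x \<in> \<Omega>" for x
    proof -
      have "\<bar>h (x, 0) - w (x, 0)\<bar> \<le> \<eta> * 1" using wc[OF S(3)[OF x]] by simp
      also have "\<dots> \<le> \<eta> * Kc" using Kc(1) \<eta>(1) by (intro mult_left_mono) auto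
      finally show ?thesis using \<eta>K by linarith
    qed
    then have "(\<integral>\<^sup>+x. indicator \<Omega> x * ennreal ((h (x, 0) - a x)\<^sup>2) \<partial>lborel) \<le>
      2 * (\<integral>\<^sup>+x. indicator \<Omega> x * ennreal ((w (x, 0) - a x)\<^sup>2) \<partial>lborel) + ennreal (2 * c\<^sup>2) * emeasure lborel \<Omega>"
      by (intro L2_perturb) auto
    also have "\<dots> \<le> ennreal \<epsilon>" by (rule fin4[OF w3 V(3)])
    finally show ?thesis .
  qed
  show ?thesis using h(1) 1 2 3 by blast
qed

end

section \<open>Strong solutions\<close>

lemma AE_slices:
  fixes P :: "'b::euclidean_space \<times> real \<Rightarrow> bool"
  assumes "AE z in lborel. P z"
  shows "AE t in lborel. AE x in lborel. P (x, t)"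
proof -
  obtain N where N: "{z \<in> space lborel. \<not> P z} \<subseteq> N" "emeasure lborel N = 0" "N \<in> sets (lborel :: ('b \<times> real) measure)"
    using AE_E[OF assms] by metis
  have [measurable]: "N \<in> sets borel" using N(3) by simp
  have "(\<integral>\<^sup>+t. \<integral>\<^sup>+x. indicator N (x, t) \<partial>lborel \<partial>lborel) = (\<integral>\<^sup>+z. indicator N z \<partial>(lborel :: ('b \<times> real) measure))"
    by (rule nn_integral_swap_product[symmetric]) measurable
  also have "\<dots> = 0" using N(2) by simp
  finally have "AE t in lborel. (\<integral>\<^sup>+x. indicator N (x, t) \<partial>(lborel :: 'b measure)) = 0"
    by (subst (asm) nn_integral_0_iff_AE) auto
  then show ?thesis
  proof eventually_elim
    case (elim t)
    then have "AE x in lborel. (indicator N (x, t) :: ennreal) = 0"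
      by (subst (asm) nn_integral_0_iff_AE) auto
    then show ?case
      by eventually_elim (use N(1) in \<open>auto simp: indicator_def split: if_splits\<close>)
  qed
qed

text \<open>The converse of \<open>AE_slices\<close> rests on Tonelli for the exceptional set, which
  therefore has to be Borel.\<close>

lemma AE_from_slices:
  fixes P :: "'b::euclidean_space \<times> real \<Rightarrow> bool"
  assumes [measurable]: "{z. P z} \<in> sets borel" and ae: "AE t in lborel. AE x in lborel. P (x, t)"
  shows "AE z in lborel. P z"
proof -
  let ?N = "- {z. P z}"
  have "(\<integral>\<^sup>+z. indicator ?N z \<partial>lborel) = (\<integral>\<^sup>+t. \<integral>\<^sup>+x. indicator ?N (x, t) \<partial>lborel \<partial>lborel)"
    by (rule nn_integral_swap_product) measurable
  also have "\<dots> = (\<integral>\<^sup>+t. 0 \<partial>(lborel :: real measure))"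
  proof (rule nn_integral_cong_AE)
    show "AE t in lborel. (\<integral>\<^sup>+x. indicator ?N (x, t) \<partial>(lborel :: 'b measure)) = 0"
      using ae
    proof eventually_elim
      case (elim t)
      then have "AE x in lborel. (indicator ?N (x, t) :: ennreal) = 0" by eventually_elim simp
      then show ?case by (subst nn_integral_0_iff_AE) auto
    qed
  qed
  finally have "(\<integral>\<^sup>+z. indicator ?N z \<partial>(lborel :: ('b \<times> real) measure)) = 0" by simp
  then have "AE z in lborel. (indicator ?N z :: ennreal) = 0" by (subst (asm) nn_integral_0_iff_AE) auto
  then show ?thesis by eventually_elim (auto simp: indicator_def split: if_splits)
qed

lemma slice_rep:
  fixes \<Omega> :: "'b::euclidean_space set"
  assumes "is_rep (cylinder \<Omega> T) f f'"
  shows "AE t in lborel. t \<in> {0<..<T} \<longrightarrow> is_rep \<Omega> (slice f t) (slice f' t)"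
  using AE_slices[OF is_rep_AE[OF assms]]
proof eventually_elim
  case (elim t)
  have [measurable]: "f' \<in> borel_measurable borel" by (rule is_rep_meas[OF assms])
  show ?case
    unfolding is_rep_def
  proof (intro impI conjI allI)
    assume t: "t \<in> {0<..<T}"
    show "slice f' t \<in> borel_measurable borel" unfolding slice_def by measurable
    show "slice f' t x = 0" if "x \<notin> \<Omega>" for x
      using is_rep_zero[OF assms, of "(x, t)"] that by (simp add: slice_def cylinder_def)
    show "AE x in lborel. x \<in> \<Omega> \<longrightarrow> slice f t x = slice f' t x"
      using elim by eventually_elim (use t in \<open>auto simp: slice_def cylinder_def\<close>)
  qed
qed

lemma test_function_slice:
  fixes \<Omega> :: "'b::euclidean_space set"
  assumes "test_function (cylinder \<Omega> T) \<phi>"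
  shows "test_function \<Omega> (slice \<phi> t)"
proof -
  obtain K where K: "compact K" "K \<subseteq> cylinder \<Omega> T" "\<And>x. x \<notin> K \<Longrightarrow> \<phi> x = 0"
    using assms by (auto simp: test_function_def)
  let ?K = "fst ` (K \<inter> UNIV \<times> {t})"
  have cl: "closed (UNIV \<times> {t} :: ('b \<times> real) set)" by (intro closed_Times) auto
  have "compact ?K"
    by (intro compact_continuous_image compact_Int_closed K(1) cl continuous_intros)
  moreover have "?K \<subseteq> \<Omega>" using K(2) by (auto simp: cylinder_def)
  moreover have "slice \<phi> t x = 0" if "x \<notin> ?K" for x
    using K(3)[of "(x, t)"] that by (force simp: slice_def)
  ultimately show ?thesis
    unfolding test_function_def using smooth_slice[OF test_function_smooth[OF assms]] by blast
qed

text \<open>The regularity in space is given slice by slice. Slices of test functions are test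
  functions, so integrating the slice identities over time by Fubini yields a weak derivative on the
  cylinder, to which space-time mollification applies.\<close>

lemma slice_wd:
  fixes \<Omega> :: "'b::euclidean_space set"
  assumes \<Omega>: "open \<Omega>" "bounded \<Omega>" and r: "is_rep (cylinder \<Omega> T) f f'" "is_rep (cylinder \<Omega> T) k k'"
    and z: "L2z (cylinder \<Omega> T) f'" "L2z (cylinder \<Omega> T) k'"
    and ae: "AE t in lebesgue_on {0<..<T}. has_wderiv \<Omega> e (slice f t) (slice k t)"
  shows "wd (cylinder \<Omega> T) (sp e) f' k'"
  unfolding wd_def
proof (intro allI impI)
  fix \<phi> assume \<phi>: "test_function (cylinder \<Omega> T) \<phi>"
  let ?D = "cylinder \<Omega> T"
  have D: "bounded ?D" unfolding cylinder_def using \<Omega> by (intro bounded_Times) auto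
  have \<Omega>b: "\<Omega> \<in> sets borel" using \<Omega> by simp
  note t = test_function_UNIV[OF \<phi>]
  note t' = test_function_dirder[OF t, of "sp e"]
  note [measurable] = L2z_meas[OF z(1)] L2z_meas[OF z(2)] test_function_borel[OF t] test_function_borel[OF t']
  have I: "integrable (lborel \<Otimes>\<^sub>M lborel) (\<lambda>(x, s). f' (x, s) * dirder (sp e) \<phi> (x, s))"
    using L2z_test_integrable[OF D z(1) test_function_smooth[OF t'] t'] by (simp add: lborel_prod case_prod_beta')
  have I2: "integrable (lborel \<Otimes>\<^sub>M lborel) (\<lambda>(x, s). k' (x, s) * \<phi> (x, s))"
    using L2z_test_integrable[OF D z(2) test_function_smooth[OF t] t] by (simp add: lborel_prod case_prod_beta')
  have "(\<integral>z. f' z * dirder (sp e) \<phi> z \<partial>lborel) = (\<integral>s. \<integral>x. f' (x, s) * dirder (sp e) \<phi> (x, s) \<partial>lborel \<partial>lborel)"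
    using lborel_pair.integral_snd[OF I] by (simp add: lborel_prod case_prod_beta')
  also have "\<dots> = (\<integral>s. - (\<integral>x. k' (x, s) * \<phi> (x, s) \<partial>lborel) \<partial>lborel)"
  proof (rule integral_cong_AE)
    have "AE s in lborel. s \<in> {0<..<T} \<longrightarrow> has_wderiv \<Omega> e (slice f s) (slice k s)"
      using ae by (subst (asm) AE_lebesgue_on_iff) auto
    then show "AE s in lborel. (\<integral>x. f' (x, s) * dirder (sp e) \<phi> (x, s) \<partial>lborel) = - (\<integral>x. k' (x, s) * \<phi> (x, s) \<partial>lborel)"
      using slice_rep[OF r(1)] slice_rep[OF r(2)]
    proof eventually_elim
      case (elim s)
      show ?case
      proof (cases "s \<in> {0<..<T}")
        case True
        have "wd \<Omega> e (slice f' s) (slice k' s)" using has_wderiv_wd[OF \<Omega>b] elim True by blast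
        then have "(\<integral>x. slice f' s x * dirder e (slice \<phi> s) x \<partial>lborel) = - (\<integral>x. slice k' s x * slice \<phi> s x \<partial>lborel)"
          using test_function_slice[OF \<phi>] by (simp add: wd_def)
        then show ?thesis unfolding dirder_slice[OF test_function_smooth[OF t]] by (simp add: slice_def)
      next
        case False
        then have "f' (x, s) = 0" "k' (x, s) = 0" for x
          using L2z_zero[OF z(1)] L2z_zero[OF z(2)] by (auto simp: cylinder_def)
        then show ?thesis by simp
      qed
    qed
  qed measurable
  also have "\<dots> = - (\<integral>s. \<integral>x. k' (x, s) * \<phi> (x, s) \<partial>lborel \<partial>lborel)" by simp
  also have "(\<integral>s. \<integral>x. k' (x, s) * \<phi> (x, s) \<partial>lborel \<partial>lborel) = (\<integral>z. k' z * \<phi> z \<partial>lborel)"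
    using lborel_pair.integral_snd[OF I2] by (simp add: lborel_prod case_prod_beta')
  finally show "(\<integral>z. f' z * dirder (sp e) \<phi> z \<partial>lborel) = - (\<integral>z. k' z * \<phi> z \<partial>lborel)" .
qed

section \<open>Bounds from continuity in time\<close>

lemma L2_diff:
  assumes "D \<in> sets borel" "a \<in> L2 (lebesgue_on D)" "b \<in> L2 (lebesgue_on D)"
  shows "(\<lambda>x. a x - b x) \<in> L2 (lebesgue_on D)"
  using assms(2,3) L2_rep[OF assms(1)] is_rep_L2_iff[OF assms(1) is_rep_diff] L2z_diff by metis

lemma H1norm_quasi_triangle:
  assumes D: "open D" "bounded D" and f: "f \<in> H 1 D" and h: "h \<in> H 1 D"
  shows "ennreal ((H1norm D f)\<^sup>2) \<le> 2 * ennreal ((H1norm D (\<lambda>x. f x - h x))\<^sup>2) + 2 * ennreal ((H1norm D h)\<^sup>2)"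
proof -
  have Db: "D \<in> sets borel" using D by simp
  obtain fg where fg: "f \<in> L2 (lebesgue_on D)" "\<And>e. e \<in> Basis \<Longrightarrow> has_wderiv D e f (fg e)"
    using H1E[OF f] by metis
  obtain hg where hg: "h \<in> L2 (lebesgue_on D)" "\<And>e. e \<in> Basis \<Longrightarrow> has_wderiv D e h (hg e)"
    using H1E[OF h] by metis
  have q: "L2sq (lebesgue_on D) a \<le> 2 * L2sq (lebesgue_on D) (\<lambda>x. a x - b x) + 2 * L2sq (lebesgue_on D) b"
    if "a \<in> L2 (lebesgue_on D)" "b \<in> L2 (lebesgue_on D)" for a b
    using L2sq_add_le[of "\<lambda>x. a x - b x" "lebesgue_on D" b] that borel_measurable_diff[of a "lebesgue_on D" b]
    by (simp add: L2_def)
  have 1: "ennreal ((H1norm D f)\<^sup>2) = L2sq (lebesgue_on D) f + (\<Sum>e\<in>Basis. L2sq (lebesgue_on D) (fg e))"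
    by (rule H1norm_sq[OF D fg(2,1)])
  have 2: "ennreal ((H1norm D h)\<^sup>2) = L2sq (lebesgue_on D) h + (\<Sum>e\<in>Basis. L2sq (lebesgue_on D) (hg e))"
    by (rule H1norm_sq[OF D hg(2,1)])
  have 3: "ennreal ((H1norm D (\<lambda>x. f x - h x))\<^sup>2) = L2sq (lebesgue_on D) (\<lambda>x. f x - h x)
      + (\<Sum>e\<in>Basis. L2sq (lebesgue_on D) (\<lambda>x. fg e x - hg e x))"
    by (rule H1norm_sq[OF D has_wderiv_diff[OF Db D(2) fg(2) hg(2)] L2_diff[OF Db fg(1) hg(1)]])
  have "ennreal ((H1norm D f)\<^sup>2) \<le> (2 * L2sq (lebesgue_on D) (\<lambda>x. f x - h x) + 2 * L2sq (lebesgue_on D) h)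
      + (\<Sum>e\<in>Basis. 2 * L2sq (lebesgue_on D) (\<lambda>x. fg e x - hg e x) + 2 * L2sq (lebesgue_on D) (hg e))"
    unfolding 1
    by (intro add_mono sum_mono q fg(1) hg(1) has_wderiv_L2(2)[OF fg(2)] has_wderiv_L2(2)[OF hg(2)])
  also have "\<dots> = 2 * ennreal ((H1norm D (\<lambda>x. f x - h x))\<^sup>2) + 2 * ennreal ((H1norm D h)\<^sup>2)"
    unfolding 2 3 by (simp add: sum.distrib sum_distrib_left distrib_left ac_simps)
  finally show ?thesis .
qed

lemma C_H10_H1: "u \<in> C_H10 \<Omega> T \<Longrightarrow> t \<in> {0..T} \<Longrightarrow> slice u t \<in> H 1 \<Omega>"
  by (simp add: C_H10_def H10_def)

lemma C_H10_continuous: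
  assumes u: "u \<in> C_H10 \<Omega> T" and t: "t \<in> {0..T}" and e: "e > 0"
  shows "\<exists>d>0. \<forall>s\<in>{0..T}. s \<noteq> t \<longrightarrow> \<bar>s - t\<bar> < d \<longrightarrow> (H1norm \<Omega> (\<lambda>x. slice u s x - slice u t x))\<^sup>2 \<le> e"
proof -
  have "((\<lambda>s. H1norm \<Omega> (\<lambda>x. u (x, s) - u (x, t))) \<longlongrightarrow> 0) (at t within {0..T})"
    using u t by (simp add: C_H10_def)
  then have "((\<lambda>s. (H1norm \<Omega> (\<lambda>x. u (x, s) - u (x, t)))\<^sup>2) \<longlongrightarrow> 0\<^sup>2) (at t within {0..T})"
    by (rule tendsto_power)
  then have "\<forall>\<^sub>F s in at t within {0..T}. (H1norm \<Omega> (\<lambda>x. u (x, s) - u (x, t)))\<^sup>2 < e"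
    by (rule order_tendstoD(2)) (use e in simp)
  then show ?thesis
    unfolding eventually_at dist_real_def slice_def by (meson less_imp_le)
qed

text \<open>Near each t the squared norm is at most 2 + 2 times its value at t, by the quasi
  triangle inequality; finitely many such neighbourhoods cover the compact interval.\<close>

lemma C_H10_bounded:
  fixes \<Omega> :: "'b::euclidean_space set"
  assumes D: "open \<Omega>" "bounded \<Omega>" and u: "u \<in> C_H10 \<Omega> T"
  shows "\<exists>M\<ge>0. \<forall>t\<in>{0..T}. ennreal ((H1norm \<Omega> (slice u t))\<^sup>2) \<le> ennreal M"
proof -
  let ?n = "\<lambda>t. (H1norm \<Omega> (slice u t))\<^sup>2"
  have "\<forall>t\<in>{0..T}. \<exists>d>0. \<forall>s\<in>{0..T}. s \<noteq> t \<longrightarrow> \<bar>s - t\<bar> < d \<longrightarrow> (H1norm \<Omega> (\<lambda>x. slice u s x - slice u t x))\<^sup>2 \<le> 1"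
    using C_H10_continuous[OF u _ zero_less_one] by blast
  from bchoice[OF this] obtain d where d': "\<forall>t\<in>{0..T}. d t > 0 \<and>
      (\<forall>s\<in>{0..T}. s \<noteq> t \<longrightarrow> \<bar>s - t\<bar> < d t \<longrightarrow> (H1norm \<Omega> (\<lambda>x. slice u s x - slice u t x))\<^sup>2 \<le> 1)"
    by (elim exE)
  have d: "d t > 0" if "t \<in> {0..T}" for t using d' that by blast
  have d1: "(H1norm \<Omega> (\<lambda>x. slice u s x - slice u t x))\<^sup>2 \<le> 1"
    if "t \<in> {0..T}" "s \<in> {0..T}" "s \<noteq> t" "\<bar>s - t\<bar> < d t" for t s
    using d' that by blast
  have loc: "?n s \<le> 2 + 2 * ?n t" if "t \<in> {0..T}" "s \<in> {0..T}" "\<bar>s - t\<bar> < d t" for s t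
  proof (cases "s = t")
    case False
    have "ennreal (?n s) \<le> 2 * ennreal ((H1norm \<Omega> (\<lambda>x. slice u s x - slice u t x))\<^sup>2) + 2 * ennreal (?n t)"
      by (rule H1norm_quasi_triangle[OF D C_H10_H1[OF u that(2)] C_H10_H1[OF u that(1)]])
    also have "\<dots> \<le> 2 * ennreal 1 + 2 * ennreal (?n t)"
      using d1[OF that(1,2) False that(3)] by (intro add_mono mult_left_mono ennreal_leI) auto
    also have "\<dots> = ennreal (2 + 2 * ?n t)" by (simp add: ennreal_mult)
    finally show ?thesis by (subst (asm) ennreal_le_iff) (auto intro: add_nonneg_nonneg)
  qed (use zero_le_power2[of "H1norm \<Omega> (slice u t)"] in simp)
  have "compact {0..T}" by simp
  then obtain F where F: "F \<subseteq> {0..T}" "finite F" "{0..T} \<subseteq> (\<Union>t\<in>F. ball t (d t))"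
  proof (rule compactE_image)
    show "open (ball t (d t))" for t by simp
    show "{0..T} \<subseteq> (\<Union>t\<in>{0..T}. ball t (d t))" using d by force
  qed
  show ?thesis
  proof (intro exI[of _ "\<Sum>t\<in>F. 2 + 2 * ?n t"] conjI ballI ennreal_leI)
    show "0 \<le> (\<Sum>t\<in>F. 2 + 2 * ?n t)" by (intro sum_nonneg) auto
    fix s assume s: "s \<in> {0..T}"
    then obtain t where t: "t \<in> F" "s \<in> ball t (d t)" using F(3) by blast
    then have "?n s \<le> 2 + 2 * ?n t" using F(1) s by (intro loc) (auto simp: dist_real_def)
    also have "\<dots> \<le> (\<Sum>t\<in>F. 2 + 2 * ?n t)"
      by (rule member_le_sum[OF t(1) _ F(2)]) auto
    finally show "?n s \<le> (\<Sum>t\<in>F. 2 + 2 * ?n t)" .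
  qed
qed

lemma sum_squares_le_square_sum:
  fixes f :: "'i \<Rightarrow> real"
  assumes "finite I" "\<And>i. i \<in> I \<Longrightarrow> f i \<ge> 0"
  shows "(\<Sum>i\<in>I. (f i)\<^sup>2) \<le> (\<Sum>i\<in>I. f i)\<^sup>2"
  using assms
proof (induction I rule: finite_induct)
  case (insert i I)
  have "0 \<le> 2 * f i * (\<Sum>i\<in>I. f i)" using insert.prems by (intro mult_nonneg_nonneg sum_nonneg) auto
  then show ?case using insert by (simp add: power2_sum)
qed simp

text \<open>All choices hidden in the notion of a strong solution are made once: G and G2 are the
  spatial derivatives slice by slice, and names ending in r, with a further prime or index, are
  Borel representatives.\<close>

locale burgers_solution =
  fixes \<Omega> :: "'b::euclidean_space set" and T \<nu> :: real and u f u' :: "'b \<times> real \<Rightarrow> real"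
    and G :: "'b \<Rightarrow> 'b \<times> real \<Rightarrow> real" and G2 :: "'b \<Rightarrow> 'b \<Rightarrow> 'b \<times> real \<Rightarrow> real"
    and ur ur' fr :: "'b \<times> real \<Rightarrow> real"
    and Gr :: "'b \<Rightarrow> 'b \<times> real \<Rightarrow> real" and Gr2 :: "'b \<Rightarrow> 'b \<Rightarrow> 'b \<times> real \<Rightarrow> real"
  assumes dim: "DIM('b) \<le> 3" and \<Omega>: "open \<Omega>" "bounded \<Omega>" "\<And>p. p \<in> closure \<Omega> \<Longrightarrow> cone_at \<Omega> p"
    and T: "T > 0" and \<nu>: "\<nu> > 0"
    and u: "u \<in> C_H10 \<Omega> T" and u': "has_wderiv (cylinder \<Omega> T) (0, 1) u u'"
    and G: "\<And>e. e \<in> Basis \<Longrightarrow> AE t in lebesgue_on {0<..<T}. has_wderiv \<Omega> e (slice u t) (slice (G e) t)"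
    and G2: "\<And>e e'. e \<in> Basis \<Longrightarrow> e' \<in> Basis \<Longrightarrow>
      AE t in lebesgue_on {0<..<T}. has_wderiv \<Omega> e' (slice (G e) t) (slice (G2 e e') t)"
    and eq: "AE t in lebesgue_on {0<..<T}. AE x in lebesgue_on \<Omega>.
           u' (x, t) - \<nu> * (\<Sum>e\<in>Basis. wderiv \<Omega> e (wderiv \<Omega> e (slice u t)) x)
             + (\<Sum>e\<in>Basis. u (x, t) * wderiv \<Omega> e (slice u t) x) = f (x, t)"
    and ru: "is_rep (cylinder \<Omega> T) u ur" "L2z (cylinder \<Omega> T) ur"
    and ru': "is_rep (cylinder \<Omega> T) u' ur'" "L2z (cylinder \<Omega> T) ur'"
    and rf: "is_rep (cylinder \<Omega> T) f fr"
    and rG: "\<And>e. e \<in> Basis \<Longrightarrow> is_rep (cylinder \<Omega> T) (G e) (Gr e)" "\<And>e. e \<in> Basis \<Longrightarrow> L2z (cylinder \<Omega> T) (Gr e)"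
    and rG2: "\<And>e e'. e \<in> Basis \<Longrightarrow> e' \<in> Basis \<Longrightarrow> is_rep (cylinder \<Omega> T) (G2 e e') (Gr2 e e')"
      "\<And>e e'. e \<in> Basis \<Longrightarrow> e' \<in> Basis \<Longrightarrow> L2z (cylinder \<Omega> T) (Gr2 e e')"
begin

abbreviation "D \<equiv> cylinder \<Omega> T"

lemma D_borel [measurable]: "D \<in> sets borel"
  unfolding cylinder_def using \<Omega>(1) by (intro borel_open open_Times) auto

lemma \<Omega>_borel [measurable]: "\<Omega> \<in> sets borel"
  using \<Omega>(1) by simp

lemma AE_time: "(AE t in lebesgue_on {0<..<T}. P t) \<longleftrightarrow> (AE t in lborel. t \<in> {0<..<T} \<longrightarrow> P t)"
  by (rule AE_lebesgue_on_iff) simp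

text \<open>Spatial directions are stored in the first component and (0, 1) marks time. The head of
  a list is the outermost derivative, so the two indices of \<open>Gr2\<close> appear in
  reverse.\<close>

definition J :: "('b \<times> real) list \<Rightarrow> 'b \<times> real \<Rightarrow> real" where
  "J l = (case l of [] \<Rightarrow> ur
      | v # l' \<Rightarrow> (case l' of [] \<Rightarrow> if v = (0, 1) then ur' else Gr (fst v) | v' # _ \<Rightarrow> Gr2 (fst v') (fst v)))"

lemma J_simps: "J [] = ur" "J [(0, 1)] = ur'" "J [sp e] = Gr e" "J [sp e', sp e] = Gr2 e e'"
  by (simp_all add: J_def sp_def)

lemma bjets_cases:
  assumes "l \<in> bjets"
  obtains "l = []" | "l = [(0, 1)]" | e where "l = [sp e]" "e \<in> Basis"
    | e e' where "l = [sp e', sp e]" "e \<in> Basis" "e' \<in> Basis"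
  using assms by (auto simp: bjets_def jets2_def)

lemma wjet_J: "wjet D bjets J"
  unfolding wjet_def
proof (intro conjI ballI allI impI)
  fix l :: "('b \<times> real) list" assume "l \<in> bjets"
  then show "L2z D (J l)"
    by (cases rule: bjets_cases) (simp_all add: J_simps ru ru' rG rG2)
next
  fix v and l :: "('b \<times> real) list" assume "v # l \<in> bjets"
  then have "l \<in> bjets \<and> wd D v (J l) (J (v # l))"
  proof (cases rule: bjets_cases)
    case 2
    have "wd D (0, 1) ur ur'" by (rule has_wderiv_wd[OF D_borel u' ru(1) ru'(1)])
    then show ?thesis using 2 bjets_memb(1) by (simp add: J_simps)
  next
    case (3 e)
    have "wd D (sp e) ur (Gr e)"
      by (rule slice_wd[OF \<Omega>(1,2) ru(1) rG(1)[OF 3(2)] ru(2) rG(2)[OF 3(2)] G[OF 3(2)]])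
    then show ?thesis using 3 bjets_memb(1) by (simp add: J_simps)
  next
    case (4 e e')
    have "wd D (sp e') (Gr e) (Gr2 e e')"
      by (rule slice_wd[OF \<Omega>(1,2) rG(1)[OF 4(2)] rG2(1)[OF 4(2,3)] rG(2)[OF 4(2)] rG2(2)[OF 4(2,3)] G2[OF 4(2,3)]])
    then show ?thesis using 4 bjets_memb(2)[OF 4(2)] by (simp add: J_simps)
  qed simp
  then show "l \<in> bjets" "wd D v (J l) (J (v # l))" by blast+
qed

lemma slices_AE:
  "AE t in lborel. t \<in> {0<..<T} \<longrightarrow> is_rep \<Omega> (slice u t) (slice ur t) \<and>
    (\<forall>e\<in>Basis. has_wderiv \<Omega> e (slice u t) (slice (G e) t) \<and> is_rep \<Omega> (slice (G e) t) (slice (Gr e) t))"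
proof -
  have "AE t in lborel. \<forall>e\<in>Basis. t \<in> {0<..<T} \<longrightarrow>
      has_wderiv \<Omega> e (slice u t) (slice (G e) t) \<and> is_rep \<Omega> (slice (G e) t) (slice (Gr e) t)"
  proof (rule AE_finite_allI)
    fix e :: 'b assume e: "e \<in> Basis"
    show "AE t in lborel. t \<in> {0<..<T} \<longrightarrow>
      has_wderiv \<Omega> e (slice u t) (slice (G e) t) \<and> is_rep \<Omega> (slice (G e) t) (slice (Gr e) t)"
      using G[OF e, unfolded AE_time] slice_rep[OF rG(1)[OF e]] by eventually_elim simp
  qed simp
  with slice_rep[OF ru(1)] show ?thesis by eventually_elim simp
qed

lemma L2sq_slice_le_H1norm:
  assumes t: "t \<in> {0<..<T}" and w: "\<And>e. e \<in> Basis \<Longrightarrow> has_wderiv \<Omega> e (slice u t) (slice (G e) t)"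
  shows "L2sq (lebesgue_on \<Omega>) (slice u t) \<le> ennreal ((H1norm \<Omega> (slice u t))\<^sup>2)"
    and "e \<in> Basis \<Longrightarrow> L2sq (lebesgue_on \<Omega>) (slice (G e) t) \<le> ennreal ((H1norm \<Omega> (slice u t))\<^sup>2)"
proof -
  have "slice u t \<in> H 1 \<Omega>" by (rule C_H10_H1[OF u]) (use t in auto)
  then have sL: "slice u t \<in> L2 (lebesgue_on \<Omega>)" by (auto simp: One_nat_def)
  have n: "ennreal ((H1norm \<Omega> (slice u t))\<^sup>2)
      = L2sq (lebesgue_on \<Omega>) (slice u t) + (\<Sum>e\<in>Basis. L2sq (lebesgue_on \<Omega>) (slice (G e) t))"
    by (rule H1norm_sq[OF \<Omega>(1,2) w sL])
  show "L2sq (lebesgue_on \<Omega>) (slice u t) \<le> ennreal ((H1norm \<Omega> (slice u t))\<^sup>2)" unfolding n by simp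
  assume e: "e \<in> Basis"
  have "L2sq (lebesgue_on \<Omega>) (slice (G e) t) \<le> (\<Sum>e\<in>Basis. L2sq (lebesgue_on \<Omega>) (slice (G e) t))"
    by (rule member_le_sum[OF e]) auto
  also have "\<dots> \<le> L2sq (lebesgue_on \<Omega>) (slice u t) + (\<Sum>e\<in>Basis. L2sq (lebesgue_on \<Omega>) (slice (G e) t))"
    by simp
  finally show "L2sq (lebesgue_on \<Omega>) (slice (G e) t) \<le> ennreal ((H1norm \<Omega> (slice u t))\<^sup>2)" unfolding n .
qed

text \<open>The slice at almost every time represents u and its gradient, whose norms continuity in
  time bounds on all of [0, T].\<close>

lemma slice_bound_exists:
  "\<exists>M<\<infinity>. \<forall>l\<in>bjets1. AE \<tau> in lborel. (\<integral>\<^sup>+x. ennreal ((J l (x, \<tau>))\<^sup>2) \<partial>lborel) \<le> M"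
proof -
  obtain M where M: "M \<ge> 0" "\<forall>t\<in>{0..T}. ennreal ((H1norm \<Omega> (slice u t))\<^sup>2) \<le> ennreal M"
    using C_H10_bounded[OF \<Omega>(1,2) u] by (elim exE conjE)
  have "AE \<tau> in lborel. (\<integral>\<^sup>+x. ennreal ((J l (x, \<tau>))\<^sup>2) \<partial>lborel) \<le> ennreal M" if l: "l \<in> bjets1" for l
    using slices_AE
  proof eventually_elim
    case (elim t)
    show ?case
    proof (cases "t \<in> {0<..<T}")
      case True
      then have e: "is_rep \<Omega> (slice u t) (slice ur t)"
        and e2: "\<And>e. e \<in> Basis \<Longrightarrow> has_wderiv \<Omega> e (slice u t) (slice (G e) t)"
        and e3: "\<And>e. e \<in> Basis \<Longrightarrow> is_rep \<Omega> (slice (G e) t) (slice (Gr e) t)" using elim by blast+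
      have tM: "ennreal ((H1norm \<Omega> (slice u t))\<^sup>2) \<le> ennreal M" using M(2) True by auto
      have "L2sq lborel (slice (J l) t) \<le> ennreal M"
      proof -
        from l consider "l = []" | e where "l = [sp e]" "e \<in> Basis" by (auto simp: bjets1_def)
        then show ?thesis
        proof cases
          case 1
          show ?thesis using order_trans[OF L2sq_slice_le_H1norm(1)[OF True e2] tM]
            unfolding 1 J_simps is_rep_L2sq[OF \<Omega>_borel e] .
        next
          case (2 e)
          show ?thesis using order_trans[OF L2sq_slice_le_H1norm(2)[OF True e2 2(2)] tM]
            unfolding 2(1) J_simps is_rep_L2sq[OF \<Omega>_borel e3[OF 2(2)]] .
        qed
      qed
      then show ?thesis by (simp add: L2sq_def slice_def)
    next
      case False
      have "L2z D (J l)" using wjet_J l bjets1_subset by (auto simp: wjet_def)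
      then have "J l (x, t) = 0" for x using False by (auto simp: L2z_def cylinder_def)
      then show ?thesis by simp
    qed
  qed
  then show ?thesis by (intro exI[of _ "ennreal M"]) simp
qed

lemma burgers_jet_J:
  assumes "M < \<infinity>" "\<forall>l\<in>bjets1. AE \<tau> in lborel. (\<integral>\<^sup>+x. ennreal ((J l (x, \<tau>))\<^sup>2) \<partial>lborel) \<le> M"
  shows "burgers_jet \<Omega> T J M"
  by unfold_locales (use dim \<Omega> T wjet_J assms in auto)

text \<open>Continuity in \<open>H1norm\<close> at time 0 controls the mean square distance to the
  initial slice; the representative agrees with u on almost every slice.\<close>

lemma initial_J:
  assumes a: "is_rep \<Omega> (slice u 0) a" and e: "(e::real) > 0"
  shows "\<exists>\<tau>>0. AE t in lborel. t \<in> {0<..<\<tau>} \<longrightarrow>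
      (\<integral>\<^sup>+x. indicator \<Omega> x * ennreal ((J [] (x, t) - a x)\<^sup>2) \<partial>lborel) \<le> ennreal e"
proof -
  have T0: "0 \<in> {0..T}" using T by simp
  obtain d where d: "d > 0" "\<forall>s\<in>{0..T}. s \<noteq> 0 \<longrightarrow> \<bar>s - 0\<bar> < d \<longrightarrow>
      (H1norm \<Omega> (\<lambda>x. slice u s x - slice u 0 x))\<^sup>2 \<le> e"
    using C_H10_continuous[OF u T0 e] by (elim exE conjE)
  have "AE t in lborel. t \<in> {0<..<min d T} \<longrightarrow>
      (\<integral>\<^sup>+x. indicator \<Omega> x * ennreal ((J [] (x, t) - a x)\<^sup>2) \<partial>lborel) \<le> ennreal e"
    using slices_AE
  proof (eventually_elim, intro impI)
    fix t assume el: "t \<in> {0<..<T} \<longrightarrow> is_rep \<Omega> (slice u t) (slice ur t) \<and>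
    (\<forall>e\<in>Basis. has_wderiv \<Omega> e (slice u t) (slice (G e) t) \<and> is_rep \<Omega> (slice (G e) t) (slice (Gr e) t))"
      and t: "t \<in> {0<..<min d T}"
    then have r: "is_rep \<Omega> (slice u t) (slice ur t)" by simp
    have H: "slice u t \<in> H 1 \<Omega>" "slice u 0 \<in> H 1 \<Omega>"
      by (rule C_H10_H1[OF u], use t T0 in simp)+
    obtain g1 where g1: "slice u t \<in> L2 (lebesgue_on \<Omega>)" "\<And>e. e \<in> Basis \<Longrightarrow> has_wderiv \<Omega> e (slice u t) (g1 e)"
      using H1E[OF H(1)] by metis
    obtain g2 where g2: "slice u 0 \<in> L2 (lebesgue_on \<Omega>)" "\<And>e. e \<in> Basis \<Longrightarrow> has_wderiv \<Omega> e (slice u 0) (g2 e)"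
      using H1E[OF H(2)] by metis
    have n: "ennreal ((H1norm \<Omega> (\<lambda>x. slice u t x - slice u 0 x))\<^sup>2)
        = L2sq (lebesgue_on \<Omega>) (\<lambda>x. slice u t x - slice u 0 x) + (\<Sum>e\<in>Basis. L2sq (lebesgue_on \<Omega>) (\<lambda>x. g1 e x - g2 e x))"
      by (rule H1norm_sq[OF \<Omega>(1,2) has_wderiv_diff[OF \<Omega>_borel \<Omega>(2) g1(2) g2(2)] L2_diff[OF \<Omega>_borel g1(1) g2(1)]])
    have "(\<integral>\<^sup>+x. indicator \<Omega> x * ennreal ((J [] (x, t) - a x)\<^sup>2) \<partial>lborel) = L2sq lborel (\<lambda>x. slice ur t x - a x)"
      unfolding L2sq_def J_simps
    proof (rule nn_integral_cong)
      fix x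
      show "indicator \<Omega> x * ennreal ((ur (x, t) - a x)\<^sup>2) = ennreal ((slice ur t x - a x)\<^sup>2)"
        using is_rep_zero[OF is_rep_diff[OF r a], of x] by (cases "x \<in> \<Omega>") (auto simp: slice_def)
    qed
    also have "\<dots> = L2sq (lebesgue_on \<Omega>) (\<lambda>x. slice u t x - slice u 0 x)"
      by (rule is_rep_L2sq[OF \<Omega>_borel is_rep_diff[OF r a], symmetric])
    also have "\<dots> \<le> ennreal ((H1norm \<Omega> (\<lambda>x. slice u t x - slice u 0 x))\<^sup>2)" unfolding n by simp
    also have "\<dots> \<le> ennreal e" using d(2) t by (intro ennreal_leI) auto
    finally show "(\<integral>\<^sup>+x. indicator \<Omega> x * ennreal ((J [] (x, t) - a x)\<^sup>2) \<partial>lborel) \<le> ennreal e" .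
  qed
  then show ?thesis using d(1) T by (intro exI[of _ "min d T"]) simp
qed

text \<open>The source term as the equation computes it from the representatives; in this form it
  can be compared with the operator applied to a smooth function.\<close>

definition rhs :: "'b \<times> real \<Rightarrow> real" where
  "rhs z = ur' z - \<nu> * (\<Sum>e\<in>Basis. Gr2 e e z) + ur z * (\<Sum>e\<in>Basis. Gr e z)"

lemma rhs_meas [measurable]: "rhs \<in> borel_measurable borel"
proof -
  have [measurable]: "Gr e \<in> borel_measurable borel" "Gr2 e e \<in> borel_measurable borel" if "e \<in> Basis" for e
    using rG(2)[OF that] rG2(2)[OF that that] by (simp_all add: L2z_def)
  have [measurable]: "ur \<in> borel_measurable borel" "ur' \<in> borel_measurable borel"
    using ru(2) ru'(2) by (simp_all add: L2z_def)
  show ?thesis unfolding rhs_def[abs_def] by measurable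
qed

lemma rep_f_rhs: "AE z in lborel. z \<in> D \<longrightarrow> f z = rhs z"
proof -
  have frm: "fr \<in> borel_measurable borel" by (rule is_rep_meas[OF rf])
  \<comment> \<open>With \<open>fr\<close> in place of f the exceptional set is Borel, as the
    passage from slices to the cylinder requires.\<close>
  have "AE z in lborel. z \<in> D \<longrightarrow> fr z = rhs z"
  proof (rule AE_from_slices)
    have "Measurable.pred borel (\<lambda>z. z \<in> D \<longrightarrow> fr z = rhs z)"
      by (intro pred_intros_logic) (use frm in measurable)
    then show "{z. z \<in> D \<longrightarrow> fr z = rhs z} \<in> sets borel" by (simp add: pred_def)
    have G2e: "AE t in lborel. \<forall>e\<in>Basis. t \<in> {0<..<T} \<longrightarrow>
      has_wderiv \<Omega> e (slice (G e) t) (slice (G2 e e) t) \<and> is_rep \<Omega> (slice (G2 e e) t) (slice (Gr2 e e) t)"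
    proof (rule AE_finite_allI)
      fix e :: 'b assume e: "e \<in> Basis"
      show "AE t in lborel. t \<in> {0<..<T} \<longrightarrow>
        has_wderiv \<Omega> e (slice (G e) t) (slice (G2 e e) t) \<and> is_rep \<Omega> (slice (G2 e e) t) (slice (Gr2 e e) t)"
        using G2[OF e e, unfolded AE_time] slice_rep[OF rG2(1)[OF e e]] by eventually_elim simp
    qed simp
    show "AE t in lborel. AE x in lborel. (x, t) \<in> D \<longrightarrow> fr (x, t) = rhs (x, t)"
      using slices_AE G2e eq[unfolded AE_time] slice_rep[OF ru'(1)] slice_rep[OF rf]
    proof eventually_elim
      case (elim t)
      show ?case
      proof (cases "t \<in> {0<..<T}")
        case True
        have r0: "is_rep \<Omega> (slice u t) (slice ur t)" "is_rep \<Omega> (slice u' t) (slice ur' t)" "is_rep \<Omega> (slice f t) (slice fr t)"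
          using elim True by blast+
        have e2: "has_wderiv \<Omega> e (slice u t) (slice (G e) t)" "is_rep \<Omega> (slice (G e) t) (slice (Gr e) t)"
            "has_wderiv \<Omega> e (slice (G e) t) (slice (G2 e e) t)" "is_rep \<Omega> (slice (G2 e e) t) (slice (Gr2 e e) t)"
          if "e \<in> Basis" for e
          using elim True that by blast+
        have E: "AE x in lborel. x \<in> \<Omega> \<longrightarrow> u' (x, t) - \<nu> * (\<Sum>e\<in>Basis. wderiv \<Omega> e (wderiv \<Omega> e (slice u t)) x)
             + (\<Sum>e\<in>Basis. u (x, t) * wderiv \<Omega> e (slice u t) x) = f (x, t)"
          using elim(3) True by (simp add: AE_lebesgue_on_iff[OF \<Omega>_borel])
        have B: "AE x in lborel. \<forall>e\<in>Basis. x \<in> \<Omega> \<longrightarrow> wderiv \<Omega> e (slice u t) x = Gr e (x, t) \<and>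
            wderiv \<Omega> e (wderiv \<Omega> e (slice u t)) x = Gr2 e e (x, t)"
        proof (rule AE_finite_allI)
          fix e :: 'b assume e: "e \<in> Basis"
          note h = e2[OF e]
          have w1: "AE x in lebesgue_on \<Omega>. wderiv \<Omega> e (slice u t) x = slice (G e) t x"
            by (rule wderiv_AE[OF \<Omega>(1,2) h(1)])
          then have "AE x in lebesgue_on \<Omega>. slice (G e) t x = wderiv \<Omega> e (slice u t) x"
            by eventually_elim simp
          \<comment> \<open>The equation differentiates the arbitrarily chosen first derivative, so
            the known second derivative is transported to that representative.\<close>
          then have "has_wderiv \<Omega> e (wderiv \<Omega> e (slice u t)) (slice (G2 e e) t)"
            by (rule has_wderiv_cong_AE[OF \<Omega>_borel h(3) has_wderiv_L2(2)[OF has_wderiv_wderiv[OF h(1)]]])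
          from wderiv_AE[OF \<Omega>(1,2) this]
          have w2: "AE x in lborel. x \<in> \<Omega> \<longrightarrow> wderiv \<Omega> e (wderiv \<Omega> e (slice u t)) x = slice (G2 e e) t x"
            by (simp add: AE_lebesgue_on_iff[OF \<Omega>_borel])
          have w1': "AE x in lborel. x \<in> \<Omega> \<longrightarrow> wderiv \<Omega> e (slice u t) x = slice (G e) t x"
            using w1 by (simp add: AE_lebesgue_on_iff[OF \<Omega>_borel])
          show "AE x in lborel. x \<in> \<Omega> \<longrightarrow> wderiv \<Omega> e (slice u t) x = Gr e (x, t) \<and>
            wderiv \<Omega> e (wderiv \<Omega> e (slice u t)) x = Gr2 e e (x, t)"
            using w1' w2 is_rep_AE[OF h(2)] is_rep_AE[OF h(4)]
            by eventually_elim (simp add: slice_def)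
        qed simp
        show ?thesis
          using E B is_rep_AE[OF r0(1)] is_rep_AE[OF r0(2)] is_rep_AE[OF r0(3)]
        proof (eventually_elim, intro impI)
          fix x assume x: "(x, t) \<in> D"
            and a1: "x \<in> \<Omega> \<longrightarrow> u' (x, t) - \<nu> * (\<Sum>e\<in>Basis. wderiv \<Omega> e (wderiv \<Omega> e (slice u t)) x)
             + (\<Sum>e\<in>Basis. u (x, t) * wderiv \<Omega> e (slice u t) x) = f (x, t)"
            and a2: "\<forall>e\<in>Basis. x \<in> \<Omega> \<longrightarrow> wderiv \<Omega> e (slice u t) x = Gr e (x, t) \<and>
            wderiv \<Omega> e (wderiv \<Omega> e (slice u t)) x = Gr2 e e (x, t)"
            and a3: "x \<in> \<Omega> \<longrightarrow> slice u t x = slice ur t x" "x \<in> \<Omega> \<longrightarrow> slice u' t x = slice ur' t x"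
              "x \<in> \<Omega> \<longrightarrow> slice f t x = slice fr t x"
          have x\<Omega>: "x \<in> \<Omega>" using x by (simp add: cylinder_def)
          have s1: "(\<Sum>e\<in>Basis. wderiv \<Omega> e (wderiv \<Omega> e (slice u t)) x) = (\<Sum>e\<in>Basis. Gr2 e e (x, t))"
            using a2 x\<Omega> by (intro sum.cong) auto
          have s2: "(\<Sum>e\<in>Basis. u (x, t) * wderiv \<Omega> e (slice u t) x) = ur (x, t) * (\<Sum>e\<in>Basis. Gr e (x, t))"
            unfolding sum_distrib_left using a2 a3(1) x\<Omega> by (intro sum.cong) (auto simp: slice_def)
          show "fr (x, t) = rhs (x, t)"
            using a1 a3 x\<Omega> unfolding s1 s2 by (simp add: rhs_def slice_def)
        qed
      next
        case False
        then have "(x, t) \<notin> D" for x by (auto simp: cylinder_def)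
        then show ?thesis by simp
      qed
    qed
  qed
  with is_rep_AE[OF rf] show ?thesis by eventually_elim simp
qed

text \<open>The linear terms are part of the jet, with weight 1 for the time derivative and \<nu>
  for the Laplacian. The quadratic term is kept apart, since the jet error does not control
  it.\<close>

lemma residual_bound:
  assumes h: "smooth h"
  shows "L2sq (lebesgue_on D) (\<lambda>z. burgers_op \<nu> h z - f z) \<le> ennreal (2 * (1 + \<nu>)\<^sup>2) * jet_error lborel D bjets J h
    + 2 * (\<integral>\<^sup>+z. indicator D z * ennreal ((h z * Vd h z - J [] z * (\<Sum>e\<in>Basis. J [sp e] z))\<^sup>2) \<partial>lborel)"
proof -
  have Jm: "J l \<in> borel_measurable borel" if "l \<in> bjets" for l
    using wjet_J that by (auto simp: wjet_def L2z_def)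
  have [measurable]: "jet_dist bjets J h \<in> borel_measurable borel" by (rule jet_dist_measurable[OF h Jm])
  define N where "N z = h z * Vd h z - J [] z * (\<Sum>e\<in>Basis. J [sp e] z)" for z
  have [measurable]: "N \<in> borel_measurable borel"
  proof -
    have [measurable]: "J [] \<in> borel_measurable borel" "(\<lambda>z. \<Sum>e\<in>Basis. J [sp e] z) \<in> borel_measurable borel"
      using Jm[OF bjets_memb(1)] Jm[OF bjets_memb(2)] by (auto intro: borel_measurable_sum)
    note [measurable] = smooth_borel[OF h] smooth_borel[OF smooth_Vd[OF h]]
    show ?thesis unfolding N_def[abs_def] by measurable
  qed
  have pt: "\<bar>burgers_op \<nu> h z - rhs z\<bar> \<le> (1 + \<nu>) * jet_dist bjets J h z + \<bar>N z\<bar>" for z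
  proof -
    have fin: "finite (bjets :: ('b \<times> real) list set)" using jetset_bjets by (rule conjunct1[OF jetset_def[THEN iffD1]])
    have 1: "\<bar>dirder (0, 1) h z - ur' z\<bar> \<le> jet_dist bjets J h z"
      using jet_dist_ge[OF fin bjets_memb(4), of h z J] by (simp add: J_simps)
    have 2: "\<bar>(\<Sum>e\<in>Basis. dirder (sp e) (dirder (sp e) h) z) - (\<Sum>e\<in>Basis. Gr2 e e z)\<bar> \<le> jet_dist bjets J h z"
    proof -
      have "\<bar>(\<Sum>e\<in>Basis. dirder (sp e) (dirder (sp e) h) z) - (\<Sum>e\<in>Basis. Gr2 e e z)\<bar>
          \<le> (\<Sum>e\<in>Basis. \<bar>Dl [sp e, sp e] h z - J [sp e, sp e] z\<bar>)"
        unfolding sum_subtractf[symmetric] by (simp add: J_simps)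
      also have "\<dots> = (\<Sum>l\<in>(\<lambda>e. [sp e, sp e]) ` Basis. \<bar>Dl l h z - J l z\<bar>)"
        by (subst sum.reindex) (auto simp: inj_on_def inj_eq[OF inj_sp])
      also have "\<dots> \<le> jet_dist bjets J h z"
        unfolding jet_dist_def by (rule sum_mono2) (use fin bjets_memb(3) in auto)
      finally show ?thesis .
    qed
    have eqn: "burgers_op \<nu> h z - rhs z = (dirder (0, 1) h z - ur' z)
        - \<nu> * ((\<Sum>e\<in>Basis. dirder (sp e) (dirder (sp e) h) z) - (\<Sum>e\<in>Basis. Gr2 e e z)) + N z"
    proof -
      have "burgers_op \<nu> h z = dirder (0, 1) h z - \<nu> * (\<Sum>e\<in>Basis. dirder (sp e) (dirder (sp e) h) z) + h z * Vd h z"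
        by (simp add: burgers_op_def Vd_def sp_def sum_distrib_left)
      then show ?thesis by (simp add: rhs_def N_def J_simps algebra_simps)
    qed
    have "\<bar>\<nu> * ((\<Sum>e\<in>Basis. dirder (sp e) (dirder (sp e) h) z) - (\<Sum>e\<in>Basis. Gr2 e e z))\<bar> \<le> \<nu> * jet_dist bjets J h z"
      unfolding abs_mult using 2 \<nu> by (intro mult_mono) auto
    then show ?thesis unfolding eqn using 1 by (simp add: distrib_right)
  qed
  have "L2sq (lebesgue_on D) (\<lambda>z. burgers_op \<nu> h z - f z)
      = (\<integral>\<^sup>+z. ennreal ((burgers_op \<nu> h z - f z)\<^sup>2) * indicator D z \<partial>lborel)"
    unfolding L2sq_def by (rule nn_integral_lebesgue_on[OF D_borel])
  also have "\<dots> \<le> (\<integral>\<^sup>+z. ennreal (2 * (1 + \<nu>)\<^sup>2) * (indicator D z * ennreal ((jet_dist bjets J h z)\<^sup>2))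
      + 2 * (indicator D z * ennreal ((N z)\<^sup>2)) \<partial>lborel)"
  proof (rule nn_integral_mono_AE)
    show "AE z in lborel. ennreal ((burgers_op \<nu> h z - f z)\<^sup>2) * indicator D z
      \<le> ennreal (2 * (1 + \<nu>)\<^sup>2) * (indicator D z * ennreal ((jet_dist bjets J h z)\<^sup>2))
      + 2 * (indicator D z * ennreal ((N z)\<^sup>2))"
      using rep_f_rhs
    proof eventually_elim
      case (elim z)
      show ?case
      proof (cases "z \<in> D")
        case True
        then have "f z = rhs z" using elim by simp
        then have "(burgers_op \<nu> h z - f z)\<^sup>2 \<le> (1 * ((1 + \<nu>) * jet_dist bjets J h z + \<bar>N z\<bar>))\<^sup>2"
          using power_mono[OF pt[of z], of 2] by simp
        also have "\<dots> \<le> 2 * 1\<^sup>2 * (((1 + \<nu>) * jet_dist bjets J h z)\<^sup>2 + \<bar>N z\<bar>\<^sup>2)" by (rule square_add_bound)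
        finally have "ennreal ((burgers_op \<nu> h z - f z)\<^sup>2)
            \<le> ennreal (2 * (1 + \<nu>)\<^sup>2 * (jet_dist bjets J h z)\<^sup>2 + 2 * (N z)\<^sup>2)"
          by (intro ennreal_leI) (simp add: power_mult_distrib)
        also have "\<dots> = ennreal (2 * (1 + \<nu>)\<^sup>2) * ennreal ((jet_dist bjets J h z)\<^sup>2) + 2 * ennreal ((N z)\<^sup>2)"
          using \<nu> by (simp add: ennreal_mult ennreal_plus)
        finally show ?thesis using True by simp
      qed simp
    qed
  qed
  also have "\<dots> = ennreal (2 * (1 + \<nu>)\<^sup>2) * jet_error lborel D bjets J h
    + 2 * (\<integral>\<^sup>+z. indicator D z * ennreal ((N z)\<^sup>2) \<partial>lborel)"
    unfolding jet_error_def by (simp add: nn_integral_add nn_integral_cmult)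
  finally show ?thesis unfolding N_def .
qed

text \<open>At each time u belongs to \<open>H10\<close>, so the trace norm of the slice of h is at
  most the H1 norm of its distance to u. That distance involves only jet components of order at most
  one in space.\<close>

lemma trace_bound:
  assumes h: "smooth h"
  shows "(\<integral>\<^sup>+ t. (Hhalf_norm \<Omega> (slice h t))\<^sup>2 \<partial>lebesgue_on {0<..<T}) \<le> jet_error lborel D bjets J h"
proof -
  have Jm: "J l \<in> borel_measurable borel" if "l \<in> bjets" for l
    using wjet_J that by (auto simp: wjet_def L2z_def)
  have jm[measurable]: "jet_dist bjets J h \<in> borel_measurable borel" by (rule jet_dist_measurable[OF h Jm])
  have "(\<integral>\<^sup>+ t. (Hhalf_norm \<Omega> (slice h t))\<^sup>2 \<partial>lebesgue_on {0<..<T})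
      = (\<integral>\<^sup>+ t. (Hhalf_norm \<Omega> (slice h t))\<^sup>2 * indicator {0<..<T} t \<partial>lborel)"
    by (rule nn_integral_lebesgue_on) simp
  also have "\<dots> \<le> (\<integral>\<^sup>+t. \<integral>\<^sup>+x. indicator D (x, t) * ennreal ((jet_dist bjets J h (x, t))\<^sup>2) \<partial>lborel \<partial>lborel)"
  proof (rule nn_integral_mono_AE)
    show "AE t in lborel. (Hhalf_norm \<Omega> (slice h t))\<^sup>2 * indicator {0<..<T} t
        \<le> (\<integral>\<^sup>+x. indicator D (x, t) * ennreal ((jet_dist bjets J h (x, t))\<^sup>2) \<partial>lborel)"
      using slices_AE
    proof eventually_elim
      case (elim t)
      show ?case
      proof (cases "t \<in> {0<..<T}")
        case True
        have r: "is_rep \<Omega> (slice u t) (slice ur t)" using elim True by blast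
        have w: "has_wderiv \<Omega> e (slice u t) (slice (G e) t)" and rg: "is_rep \<Omega> (slice (G e) t) (slice (Gr e) t)"
          if "e \<in> Basis" for e using elim True that by blast+
        have v: "slice u t \<in> H10 \<Omega>" using u True by (simp add: C_H10_def)
        have sh: "smooth (slice h t)" by (rule smooth_slice[OF h])
        have shd: "smooth (dirder e (slice h t))" for e by (rule smooth_dirder[OF sh])
        have uL: "slice u t \<in> L2 (lebesgue_on \<Omega>)" using v by (auto simp: H10_def One_nat_def)
        let ?n = "H1norm \<Omega> (\<lambda>x. slice h t x - slice u t x)"
        let ?j = "\<lambda>x. jet_dist bjets J h (x, t)"
        have "(Hhalf_norm \<Omega> (slice h t))\<^sup>2 \<le> (ennreal ?n)\<^sup>2"
          by (rule power_mono[OF Hhalf_norm_le[OF \<Omega>(1,2) sh v]]) simp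
        also have "\<dots> = ennreal (?n\<^sup>2)" by (rule ennreal_power) (simp add: H1norm_def)
        also have "\<dots> = L2sq (lebesgue_on \<Omega>) (\<lambda>x. slice h t x - slice u t x)
            + (\<Sum>e\<in>Basis. L2sq (lebesgue_on \<Omega>) (\<lambda>x. dirder e (slice h t) x - slice (G e) t x))"
          by (rule H1norm_sq[OF \<Omega>(1,2) has_wderiv_diff[OF \<Omega>_borel \<Omega>(2) smooth_has_wderiv[OF \<Omega>(1,2) sh] w]
                L2_diff[OF \<Omega>_borel smooth_L2[OF \<Omega>(1,2) sh] uL]])
        also have "\<dots> = L2sq lborel (\<lambda>x. indicator \<Omega> x * slice h t x - slice ur t x)
            + (\<Sum>e\<in>Basis. L2sq lborel (\<lambda>x. indicator \<Omega> x * dirder e (slice h t) x - slice (Gr e) t x))"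
          using is_rep_L2sq[OF \<Omega>_borel is_rep_diff[OF smooth_is_rep[OF \<Omega>_borel sh] r]]
            is_rep_L2sq[OF \<Omega>_borel is_rep_diff[OF smooth_is_rep[OF \<Omega>_borel shd] rg]] by simp
        also have "\<dots> = (\<integral>\<^sup>+x. ennreal ((indicator \<Omega> x * slice h t x - slice ur t x)\<^sup>2)
            + (\<Sum>e\<in>Basis. ennreal ((indicator \<Omega> x * dirder e (slice h t) x - slice (Gr e) t x)\<^sup>2)) \<partial>lborel)"
        proof -
          note [measurable] = smooth_borel[OF sh] smooth_borel[OF shd] is_rep_meas[OF r] is_rep_meas[OF rg]
          show ?thesis unfolding L2sq_def
            by (subst nn_integral_add) (measurable, subst nn_integral_sum, measurable)
        qed
        also have "\<dots> \<le> (\<integral>\<^sup>+x. indicator D (x, t) * ennreal ((?j x)\<^sup>2) \<partial>lborel)"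
        proof (rule nn_integral_mono)
          fix x
          show "ennreal ((indicator \<Omega> x * slice h t x - slice ur t x)\<^sup>2)
            + (\<Sum>e\<in>Basis. ennreal ((indicator \<Omega> x * dirder e (slice h t) x - slice (Gr e) t x)\<^sup>2))
            \<le> indicator D (x, t) * ennreal ((?j x)\<^sup>2)"
          proof (cases "x \<in> \<Omega>")
            case x: True
            let ?a = "\<lambda>l. \<bar>Dl l h (x, t) - J l (x, t)\<bar>"
            have ds: "dirder e (slice h t) x = dirder (sp e) h (x, t)" for e
              using dirder_slice[OF h, of e t] by (simp add: slice_def)
            have ins: "[] \<notin> (\<lambda>e. [sp e]) ` (Basis :: 'b set)" by auto
            have "(slice h t x - slice ur t x)\<^sup>2 + (\<Sum>e\<in>Basis. (dirder e (slice h t) x - slice (Gr e) t x)\<^sup>2)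
                = (\<Sum>l\<in>bjets1. (?a l)\<^sup>2)"
              unfolding bjets1_def ds using ins
              by (subst sum.insert) (auto simp: sum.reindex inj_on_def inj_eq[OF inj_sp] J_simps slice_def)
            also have "\<dots> \<le> (\<Sum>l\<in>bjets1. ?a l)\<^sup>2"
              by (rule sum_squares_le_square_sum) (simp_all add: bjets1_def)
            also have "\<dots> \<le> (?j x)\<^sup>2"
            proof (rule power_mono)
              show "(\<Sum>l\<in>bjets1. ?a l) \<le> ?j x" unfolding jet_dist_def
                by (rule sum_mono2[OF conjunct1[OF jetset_bjets[unfolded jetset_def]] bjets1_subset]) simp
            qed (simp add: sum_nonneg)
            finally have "ennreal ((slice h t x - slice ur t x)\<^sup>2 + (\<Sum>e\<in>Basis. (dirder e (slice h t) x - slice (Gr e) t x)\<^sup>2))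
              \<le> ennreal ((?j x)\<^sup>2)" by (rule ennreal_leI)
            then show ?thesis using x True
              by (simp add: ennreal_plus sum_nonneg sum_ennreal cylinder_def)
          next
            case False
            then show ?thesis using is_rep_zero[OF r] is_rep_zero[OF rg] by simp
          qed
        qed
        finally show ?thesis using True by simp
      qed simp
    qed
  qed
  also have "\<dots> = jet_error lborel D bjets J h"
    unfolding jet_error_def by (rule nn_integral_swap_product[symmetric]) measurable
  finally show ?thesis .
qed

theorem network_exists:
  assumes \<sigma>: "smooth \<sigma>" "\<not> polynomial_fun \<sigma>" and \<epsilon>: "(\<epsilon>::real) > 0"
  shows "\<exists>h\<in>shallow \<sigma>. L2sq (lebesgue_on D) (\<lambda>z. burgers_op \<nu> h z - f z)
          + (\<integral>\<^sup>+ t. (Hhalf_norm \<Omega> (slice h t))\<^sup>2 \<partial>lebesgue_on {0<..<T})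
          + L2sq (lebesgue_on \<Omega>) (\<lambda>x. u (x, 0) - h (x, 0)) \<le> ennreal \<epsilon>"
proof -
  obtain M where M: "M < \<infinity>" "\<forall>l\<in>bjets1. AE \<tau> in lborel. (\<integral>\<^sup>+x. ennreal ((J l (x, \<tau>))\<^sup>2) \<partial>lborel) \<le> M"
    using slice_bound_exists by (elim exE conjE)
  interpret B: burgers_jet \<Omega> T J M by (rule burgers_jet_J[OF M])
  have "slice u 0 \<in> H 1 \<Omega>" by (rule C_H10_H1[OF u]) (use T in simp)
  then have "slice u 0 \<in> L2 (lebesgue_on \<Omega>)" by (auto simp: One_nat_def)
  then obtain a where a: "is_rep \<Omega> (slice u 0) a" using L2_rep[OF \<Omega>_borel] by metis
  \<comment> \<open>The residual uses \<open>2 * (1 + \<nu>)\<^sup>2 + 2\<close> shares, the trace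
    and the initial value one each.\<close>
  define \<delta> where "\<delta> = \<epsilon> / (2 * (1 + \<nu>)\<^sup>2 + 4)"
  have pos: "2 * (1 + \<nu>)\<^sup>2 + 4 > 0" by (simp add: add_nonneg_pos)
  have \<delta>: "\<delta> > 0" using \<epsilon> pos by (simp add: \<delta>_def)
  have "\<exists>h\<in>shallow \<sigma>. jet_error lborel D bjets J h \<le> ennreal \<delta> \<and>
    (\<integral>\<^sup>+z. indicator D z * ennreal ((h z * Vd h z - J [] z * B.W z)\<^sup>2) \<partial>lborel) \<le> ennreal \<delta> \<and>
    (\<integral>\<^sup>+x. indicator \<Omega> x * ennreal ((h (x, 0) - a x)\<^sup>2) \<partial>lborel) \<le> ennreal \<delta>"
    by (rule B.network_approx[OF \<sigma> \<delta> is_rep_meas[OF a]]) (rule initial_J[OF a])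
  then obtain h where h: "h \<in> shallow \<sigma>" "jet_error lborel D bjets J h \<le> ennreal \<delta>"
    "(\<integral>\<^sup>+z. indicator D z * ennreal ((h z * Vd h z - J [] z * B.W z)\<^sup>2) \<partial>lborel) \<le> ennreal \<delta>"
    "(\<integral>\<^sup>+x. indicator \<Omega> x * ennreal ((h (x, 0) - a x)\<^sup>2) \<partial>lborel) \<le> ennreal \<delta>"
    by (elim bexE conjE)
  have sm: "smooth h" by (rule shallow_smooth[OF h(1) \<sigma>(1)])
  have init: "L2sq (lebesgue_on \<Omega>) (\<lambda>x. u (x, 0) - h (x, 0))
      = (\<integral>\<^sup>+x. indicator \<Omega> x * ennreal ((h (x, 0) - a x)\<^sup>2) \<partial>lborel)"
  proof -
    have "is_rep \<Omega> (\<lambda>x. slice u 0 x - slice h 0 x) (\<lambda>x. a x - indicator \<Omega> x * slice h 0 x)"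
      by (rule is_rep_diff[OF a smooth_is_rep[OF \<Omega>_borel smooth_slice[OF sm]]])
    from is_rep_L2sq[OF \<Omega>_borel this]
    have "L2sq (lebesgue_on \<Omega>) (\<lambda>x. u (x, 0) - h (x, 0)) = L2sq lborel (\<lambda>x. a x - indicator \<Omega> x * slice h 0 x)"
      by (simp add: slice_def)
    also have "\<dots> = (\<integral>\<^sup>+x. indicator \<Omega> x * ennreal ((h (x, 0) - a x)\<^sup>2) \<partial>lborel)"
      unfolding L2sq_def
    proof (rule nn_integral_cong)
      fix x
      show "ennreal ((a x - indicator \<Omega> x * slice h 0 x)\<^sup>2) = indicator \<Omega> x * ennreal ((h (x, 0) - a x)\<^sup>2)"
        using is_rep_zero[OF a, of x] by (cases "x \<in> \<Omega>") (auto simp: slice_def power2_commute)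
    qed
    finally show ?thesis .
  qed
  have "L2sq (lebesgue_on D) (\<lambda>z. burgers_op \<nu> h z - f z)
          + (\<integral>\<^sup>+ t. (Hhalf_norm \<Omega> (slice h t))\<^sup>2 \<partial>lebesgue_on {0<..<T})
          + L2sq (lebesgue_on \<Omega>) (\<lambda>x. u (x, 0) - h (x, 0))
      \<le> (ennreal (2 * (1 + \<nu>)\<^sup>2) * ennreal \<delta> + 2 * ennreal \<delta>) + ennreal \<delta> + ennreal \<delta>"
  proof (intro add_mono)
    show "L2sq (lebesgue_on D) (\<lambda>z. burgers_op \<nu> h z - f z) \<le> ennreal (2 * (1 + \<nu>)\<^sup>2) * ennreal \<delta> + 2 * ennreal \<delta>"
      by (rule order_trans[OF residual_bound[OF sm]], intro add_mono mult_left_mono h(2))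
        (use h(3) in \<open>simp_all add: B.W_def\<close>)
    show "(\<integral>\<^sup>+ t. (Hhalf_norm \<Omega> (slice h t))\<^sup>2 \<partial>lebesgue_on {0<..<T}) \<le> ennreal \<delta>"
      by (rule order_trans[OF trace_bound[OF sm] h(2)])
    show "L2sq (lebesgue_on \<Omega>) (\<lambda>x. u (x, 0) - h (x, 0)) \<le> ennreal \<delta>" unfolding init by (rule h(4))
  qed
  also have "\<dots> = ennreal (2 * (1 + \<nu>)\<^sup>2 * \<delta> + 2 * \<delta> + \<delta> + \<delta>)"
    using \<delta> by (simp only: ennreal_plus ennreal_mult'' ennreal_numeral mult_nonneg_nonneg add_nonneg_nonneg
        zero_le_numeral zero_le_power2 less_imp_le)
  also have "2 * (1 + \<nu>)\<^sup>2 * \<delta> + 2 * \<delta> + \<delta> + \<delta> = \<delta> * (2 * (1 + \<nu>)\<^sup>2 + 4)" by (simp add: algebra_simps)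
  also have "\<dots> = \<epsilon>" using pos by (simp add: \<delta>_def)
  finally show ?thesis using h(1) by blast
qed

end

text \<open>The existential data in \<open>strong_solution\<close> and \<open>L2H\<close> are turned
  into functions of the basis vectors, so that the locale can be instantiated; second derivatives
  are indexed by pairs for a single use of choice.\<close>

theorem strong_solution_network:
  fixes \<Omega> :: "'b::euclidean_space set"
  assumes dim: "DIM('b) \<le> 3" and \<Omega>: "open \<Omega>" "bounded \<Omega>" "\<And>p. p \<in> closure \<Omega> \<Longrightarrow> cone_at \<Omega> p"
    and pos: "\<nu> > 0" "T > 0" and f: "f \<in> L2 (lebesgue_on (cylinder \<Omega> T))"
    and sol: "strong_solution \<Omega> T \<nu> f u0 u"
    and \<sigma>: "smooth \<sigma>" "\<not> polynomial_fun \<sigma>" and \<epsilon>: "(\<epsilon>::real) > 0"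
  shows "\<exists>h\<in>shallow \<sigma>. L2sq (lebesgue_on (cylinder \<Omega> T)) (\<lambda>z. burgers_op \<nu> h z - f z)
          + (\<integral>\<^sup>+ t. (Hhalf_norm \<Omega> (slice h t))\<^sup>2 \<partial>lebesgue_on {0<..<T})
          + L2sq (lebesgue_on \<Omega>) (\<lambda>x. u (x, 0) - h (x, 0)) \<le> ennreal \<epsilon>"
proof -
  let ?D = "cylinder \<Omega> T"
  have D: "?D \<in> sets borel" unfolding cylinder_def using \<Omega>(1) by (intro borel_open open_Times) auto
  have rep: "\<exists>k'. is_rep ?D k k' \<and> L2z ?D k'" if "k \<in> L2 (lebesgue_on ?D)" for k
    using L2_rep[OF D that] by metis
  have u: "u \<in> C_H10 \<Omega> T" "u \<in> L2H 2 \<Omega> T" using sol by (simp_all add: strong_solution_def)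
  have "\<exists>u'. has_wderiv ?D (0, 1) u u' \<and>
        (AE t in lebesgue_on {0<..<T}. AE x in lebesgue_on \<Omega>.
           u' (x, t) - \<nu> * (\<Sum>e\<in>Basis. wderiv \<Omega> e (wderiv \<Omega> e (slice u t)) x)
             + (\<Sum>e\<in>Basis. u (x, t) * wderiv \<Omega> e (slice u t) x) = f (x, t))"
    using sol unfolding strong_solution_def by blast
  then obtain u' where u': "has_wderiv ?D (0, 1) u u'"
    "AE t in lebesgue_on {0<..<T}. AE x in lebesgue_on \<Omega>.
           u' (x, t) - \<nu> * (\<Sum>e\<in>Basis. wderiv \<Omega> e (wderiv \<Omega> e (slice u t)) x)
             + (\<Sum>e\<in>Basis. u (x, t) * wderiv \<Omega> e (slice u t) x) = f (x, t)" by (elim exE conjE)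
  have L: "u \<in> L2H (Suc (Suc 0)) \<Omega> T" using u(2) by (simp only: numeral_2_eq_2)
  have uL: "u \<in> L2 (lebesgue_on ?D)" using L by simp
  have "\<forall>e\<in>Basis. \<exists>g. g \<in> L2H (Suc 0) \<Omega> T \<and> (AE t in lebesgue_on {0<..<T}. has_wderiv \<Omega> e (slice u t) (slice g t))"
    using L by (subst (asm) L2H.simps(2)) blast
  from bchoice[OF this] obtain G where G: "\<forall>e\<in>Basis. G e \<in> L2H (Suc 0) \<Omega> T \<and>
      (AE t in lebesgue_on {0<..<T}. has_wderiv \<Omega> e (slice u t) (slice (G e) t))" by (elim exE)
  have GL: "G e \<in> L2 (lebesgue_on ?D)" if "e \<in> Basis" for e using G that by simp
  have "\<forall>p\<in>Basis \<times> Basis. \<exists>k. k \<in> L2 (lebesgue_on ?D) \<and>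
      (AE t in lebesgue_on {0<..<T}. has_wderiv \<Omega> (snd p) (slice (G (fst p)) t) (slice k t))"
  proof
    fix p :: "'b \<times> 'b" assume p: "p \<in> Basis \<times> Basis"
    then have "G (fst p) \<in> L2H (Suc 0) \<Omega> T" using G by auto
    then show "\<exists>k. k \<in> L2 (lebesgue_on ?D) \<and>
      (AE t in lebesgue_on {0<..<T}. has_wderiv \<Omega> (snd p) (slice (G (fst p)) t) (slice k t))"
      using p by (simp add: mem_Times_iff) blast
  qed
  from bchoice[OF this] obtain G2 where G2: "\<forall>p\<in>Basis \<times> Basis. G2 p \<in> L2 (lebesgue_on ?D) \<and>
      (AE t in lebesgue_on {0<..<T}. has_wderiv \<Omega> (snd p) (slice (G (fst p)) t) (slice (G2 p) t))" by (elim exE)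
  obtain ur where ur: "is_rep ?D u ur" "L2z ?D ur" using rep[OF uL] by (elim exE conjE)
  obtain ur' where ur': "is_rep ?D u' ur'" "L2z ?D ur'" using rep[OF has_wderiv_L2(2)[OF u'(1)]] by (elim exE conjE)
  obtain fr where fr: "is_rep ?D f fr" using rep[OF f] by (elim exE conjE)
  have "\<forall>e\<in>Basis. \<exists>k. is_rep ?D (G e) k \<and> L2z ?D k" using rep GL by blast
  from bchoice[OF this] obtain Gr where Gr: "\<forall>e\<in>Basis. is_rep ?D (G e) (Gr e) \<and> L2z ?D (Gr e)" by (elim exE)
  have "\<forall>p\<in>Basis \<times> Basis. \<exists>k. is_rep ?D (G2 p) k \<and> L2z ?D k" using rep G2 by blast
  from bchoice[OF this] obtain Gr2 where Gr2: "\<forall>p\<in>Basis \<times> Basis. is_rep ?D (G2 p) (Gr2 p) \<and> L2z ?D (Gr2 p)" by (elim exE)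
  interpret burgers_solution \<Omega> T \<nu> u f u' G "\<lambda>e e'. G2 (e, e')" ur ur' fr Gr "\<lambda>e e'. Gr2 (e, e')"
  proof
    show "AE t in lebesgue_on {0<..<T}. has_wderiv \<Omega> e' (slice (G e) t) (slice (G2 (e, e')) t)"
      if "e \<in> Basis" "e' \<in> Basis" for e e' using bspec[OF G2, of "(e, e')"] that by simp
  qed (use dim \<Omega> pos u(1) u' G ur ur' fr Gr Gr2 in auto)
  show ?thesis by (rule network_exists[OF \<sigma> \<epsilon>])
qed

theorem theorem5p2:
  fixes \<Omega> :: "(real ^ 'n) set"
  assumes "CARD('n) \<in> {2, 3}"
    and "open \<Omega>" and "connected \<Omega>" and "\<Omega> \<noteq> {}" and "bounded \<Omega>"
    and "convex \<Omega> \<or> C2_boundary \<Omega>"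
  shows "\<exists>C :: real \<Rightarrow> real \<Rightarrow> real \<Rightarrow> real \<Rightarrow> real.
    (\<forall>a b c d. C a b c d > 0) \<and>
    (\<forall>(\<nu>::real) (T::real) (f :: (real ^ 'n) \<times> real \<Rightarrow> real) (u0 :: real ^ 'n \<Rightarrow> real)
        (u :: (real ^ 'n) \<times> real \<Rightarrow> real) (\<sigma> :: real \<Rightarrow> real) (\<epsilon>::real).
       \<nu> > 0 \<longrightarrow> T > 0 \<longrightarrow>
       f \<in> L2 (lebesgue_on (cylinder \<Omega> T)) \<longrightarrow>
       u0 \<in> H10 \<Omega> \<longrightarrow>
       strong_solution \<Omega> T \<nu> f u0 u \<longrightarrow>
       smooth \<sigma> \<longrightarrow> \<not> polynomial_fun \<sigma> \<longrightarrow>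
       \<epsilon> > 0 \<longrightarrow>
       (\<exists>N. \<exists>uN \<in> network_class \<sigma> N.
          L2sq (lebesgue_on (cylinder \<Omega> T)) (\<lambda>z. burgers_op \<nu> uN z - f z)
          + (\<integral>\<^sup>+ t. (Hhalf_norm \<Omega> (slice uN t))\<^sup>2 \<partial>lebesgue_on {0<..<T})
          + L2sq (lebesgue_on \<Omega>) (\<lambda>x. u (x, 0) - uN (x, 0))
          \<le> ennreal (C \<nu> T (grad_norm \<Omega> u0) (L2norm (lebesgue_on (cylinder \<Omega> T)) f) * \<epsilon>\<^sup>2)))"
proof (intro exI[of _ "\<lambda>_ _ _ _. 1"] conjI allI impI)
  fix \<nu> T :: real and f :: "(real ^ 'n) \<times> real \<Rightarrow> real" and u0 :: "real ^ 'n \<Rightarrow> real"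
    and u :: "(real ^ 'n) \<times> real \<Rightarrow> real" and \<sigma> :: "real \<Rightarrow> real" and \<epsilon> :: real
  assume pos: "\<nu> > 0" "T > 0" and f: "f \<in> L2 (lebesgue_on (cylinder \<Omega> T))"
    and sol: "strong_solution \<Omega> T \<nu> f u0 u" and \<sigma>: "smooth \<sigma>" "\<not> polynomial_fun \<sigma>" and \<epsilon>: "\<epsilon> > 0"
  have dim: "DIM(real ^ 'n) \<le> 3" using assms(1) by auto
  have cone: "cone_at \<Omega> p" if "p \<in> closure \<Omega>" for p
    by (rule cone_at_domain[OF assms(2,4,6) that])
  have \<epsilon>2: "\<epsilon>\<^sup>2 > 0" using \<epsilon> by simp
  have "\<exists>h\<in>shallow \<sigma>. L2sq (lebesgue_on (cylinder \<Omega> T)) (\<lambda>z. burgers_op \<nu> h z - f z)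
          + (\<integral>\<^sup>+ t. (Hhalf_norm \<Omega> (slice h t))\<^sup>2 \<partial>lebesgue_on {0<..<T})
          + L2sq (lebesgue_on \<Omega>) (\<lambda>x. u (x, 0) - h (x, 0)) \<le> ennreal (\<epsilon>\<^sup>2)"
    by (rule strong_solution_network[OF dim assms(2,5) cone pos f sol \<sigma> \<epsilon>2])
  then obtain h where h: "h \<in> shallow \<sigma>"
    "L2sq (lebesgue_on (cylinder \<Omega> T)) (\<lambda>z. burgers_op \<nu> h z - f z)
          + (\<integral>\<^sup>+ t. (Hhalf_norm \<Omega> (slice h t))\<^sup>2 \<partial>lebesgue_on {0<..<T})
          + L2sq (lebesgue_on \<Omega>) (\<lambda>x. u (x, 0) - h (x, 0)) \<le> ennreal (\<epsilon>\<^sup>2)" by (elim bexE)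
  obtain N where "h \<in> network_class \<sigma> N" using shallow_network[OF h(1)] by (elim exE)
  then show "\<exists>N. \<exists>uN \<in> network_class \<sigma> N.
          L2sq (lebesgue_on (cylinder \<Omega> T)) (\<lambda>z. burgers_op \<nu> uN z - f z)
          + (\<integral>\<^sup>+ t. (Hhalf_norm \<Omega> (slice uN t))\<^sup>2 \<partial>lebesgue_on {0<..<T})
          + L2sq (lebesgue_on \<Omega>) (\<lambda>x. u (x, 0) - uN (x, 0))
          \<le> ennreal (1 * \<epsilon>\<^sup>2)" using h(2) by (intro exI[of _ N] bexI[of _ h]) simp_all
qed simp

end
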